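(* Let $P$ and $G$ be unit disk graphs with $|V(P)|=k$, $|V(G)|=n$, given with embeddings of ply $p$. Then $|\mathrm{sub}(P,G)|$ can be computed in time $\sigma_0(P)^2\cdot n\cdot \mathrm{poly}(k)$ when given access to an oracle that computes $|\mathrm{sub}(P,H)|$ in constant time for host graphs $H$ of size $O(k^2p)$. In particular, there is a Turing kernel for computing $|\mathrm{sub}(P,G)|$ when $\sigma_0(P)$ and $p$ are polynomial in $k$.
   Context: A unit disk graph is a graph whose vertices can be represented by closed disks of equal (unit) size in the plane, two vertices being adjacent iff their disks intersect; such a representation is an embedding, and it has ply $p$ if every point of the plane lies in at most $p$ disks. $\mathrm{sub}(P,G)$ is the set of injective maps $f:V(P)\to V(G)$ with $uv\in E(P)\Rightarrow f(u)f(v)\in E(G)$. $\sigma_0(P)$ is the number of pairwise non-isomorphic separations of $P$ of order $0$, where a separation of order $0$ is a pair $(A,B)$ with $A\cup B=V(P)$, $A\cap B=\emptyset$, no edges between $A$ and $B$, and $(A,B),(C,D)$ are isomorphic if some automorphism $\phi$ of $P$ has $\phi(A)=C$, $\phi(B)=D$. A Turing kernel of size $f$ is a polynomial-time algorithm solving the problem given access to an oracle that solves instances of size at most $f(k)$ in a single step. *)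

theory Defs
  imports "HOL-Analysis.Analysis" "HOL-Computational_Algebra.Polynomial"
begin

section \<open>Unit disk graphs\<close>

type_synonym 'a graph = "'a set \<times> 'a set set"
type_synonym plane = "real \<times> real"

abbreviation verts :: "'a graph \<Rightarrow> 'a set" where "verts \<equiv> fst"
abbreviation edges :: "'a graph \<Rightarrow> 'a set set" where "edges \<equiv> snd"

definition simple_graph :: "'a graph \<Rightarrow> bool" where
  "simple_graph G \<longleftrightarrow> finite (verts G) \<and> (\<forall>e\<in>edges G. e \<subseteq> verts G \<and> card e = 2)"

text \<open>
  An embedding is given by the disk centres. The product metric on \<^typ>\<open>real \<times> real\<close> is
  the Euclidean one, so \<open>cball\<close> is a closed round disk. Distinct vertices may have the same disk.
\<close>

definition embedding :: "'a graph \<Rightarrow> ('a \<Rightarrow> plane) \<Rightarrow> bool" where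
  "embedding G f \<longleftrightarrow>
     (\<forall>u\<in>verts G. \<forall>v\<in>verts G. u \<noteq> v \<longrightarrow>
        ({u, v} \<in> edges G \<longleftrightarrow> cball (f u) 1 \<inter> cball (f v) 1 \<noteq> {}))"

definition ply_at_most :: "'a graph \<Rightarrow> ('a \<Rightarrow> plane) \<Rightarrow> nat \<Rightarrow> bool" where
  "ply_at_most G f p \<longleftrightarrow> (\<forall>z. card {v \<in> verts G. z \<in> cball (f v) 1} \<le> p)"

definition disk_graph :: "plane list \<Rightarrow> nat graph" where
  "disk_graph zs =
     ({..<length zs},
      {{i, j} | i j. i < length zs \<and> j < length zs \<and> i \<noteq> j \<and>
                     cball (zs ! i) 1 \<inter> cball (zs ! j) 1 \<noteq> {}})"

lemma simple_graph_disk_graph: "simple_graph (disk_graph zs)"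
  by (auto simp: simple_graph_def disk_graph_def card_insert_if)

lemma edges_disk_graph_iff:
  "{i, j} \<in> edges (disk_graph zs) \<longleftrightarrow>
     i < length zs \<and> j < length zs \<and> i \<noteq> j \<and> cball (zs ! i) 1 \<inter> cball (zs ! j) 1 \<noteq> {}"
    (is "_ \<longleftrightarrow> ?R i j")
proof
  assume "{i, j} \<in> edges (disk_graph zs)"
  then obtain a b where ab: "{i, j} = {a, b}" "?R a b"
    unfolding disk_graph_def snd_conv mem_Collect_eq by (elim exE conjE) (rule that; simp)
  then consider "i = a" "j = b" | "i = b" "j = a"
    unfolding doubleton_eq_iff by argo
  then show "?R i j"
    using ab(2) by cases (simp, simp add: Int_commute)
next
  assume "?R i j"
  then show "{i, j} \<in> edges (disk_graph zs)"
    unfolding disk_graph_def snd_conv mem_Collect_eq by (intro exI[of _ i] exI[of _ j] conjI) simp_all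
qed

lemma embedding_disk_graph: "embedding (disk_graph zs) ((!) zs)"
  unfolding embedding_def edges_disk_graph_iff by (simp add: disk_graph_def)

lemma disk_graph_unique:
  assumes "simple_graph G" "verts G = {..<n}" "embedding G f"
  shows "disk_graph (map f [0..<n]) = G"
proof -
  let ?D = "disk_graph (map f [0..<n])"
  have pair: "{i, j} \<in> edges ?D \<longleftrightarrow> {i, j} \<in> edges G" if "i < n" "j < n" "i \<noteq> j" for i j
    using assms(2,3) that unfolding edges_disk_graph_iff embedding_def by simp
  have D: "simple_graph ?D" "verts ?D = {..<n}"
    using simple_graph_disk_graph by (blast, simp add: disk_graph_def)
  have ends: "\<exists>i j. e = {i, j} \<and> i < n \<and> j < n \<and> i \<noteq> j"
    if H: "simple_graph H" "verts H = {..<n}" "e \<in> edges H" for H :: "nat graph" and e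
  proof -
    from H have "e \<subseteq> {..<n}" "card e = 2" by (auto simp: simple_graph_def)
    then show ?thesis unfolding card_2_iff by force
  qed
  have "edges ?D = edges G"
  proof (rule set_eqI)
    fix e
    show "e \<in> edges ?D \<longleftrightarrow> e \<in> edges G"
      using ends[OF D] ends[OF assms(1,2)] pair by metis
  qed
  then show ?thesis
    using assms(2) D(2) by (simp add: prod_eq_iff)
qed


section \<open>Subgraph maps and separations of order 0\<close>

text \<open>Maps \<open>V(P) \<rightarrow> V(G)\<close> are made extensional so that each of them is counted once.\<close>

definition sub :: "'a graph \<Rightarrow> 'b graph \<Rightarrow> ('a \<Rightarrow> 'b) set" where
  "sub P G = {f \<in> verts P \<rightarrow>\<^sub>E verts G. inj_on f (verts P) \<and>
     (\<forall>u v. {u, v} \<in> edges P \<longrightarrow> {f u, f v} \<in> edges G)}"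

definition automorphism :: "'a graph \<Rightarrow> ('a \<Rightarrow> 'a) \<Rightarrow> bool" where
  "automorphism P \<phi> \<longleftrightarrow> bij_betw \<phi> (verts P) (verts P) \<and>
     (\<forall>u\<in>verts P. \<forall>v\<in>verts P. {\<phi> u, \<phi> v} \<in> edges P \<longleftrightarrow> {u, v} \<in> edges P)"

definition separations0 :: "'a graph \<Rightarrow> ('a set \<times> 'a set) set" where
  "separations0 P = {(A, B). A \<union> B = verts P \<and> A \<inter> B = {} \<and>
     (\<forall>a\<in>A. \<forall>b\<in>B. {a, b} \<notin> edges P)}"

definition separation_iso :: "'a graph \<Rightarrow> (('a set \<times> 'a set) \<times> ('a set \<times> 'a set)) set" where
  "separation_iso P = {((A, B), (C, D)). (A, B) \<in> separations0 P \<and> (C, D) \<in> separations0 P \<and>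
     (\<exists>\<phi>. automorphism P \<phi> \<and> \<phi> ` A = C \<and> \<phi> ` B = D)}"

definition sigma0 :: "'a graph \<Rightarrow> nat" where
  "sigma0 P = card (separations0 P // separation_iso P)"


section \<open>Machine model\<close>

text \<open>
  The machine is a random access machine with two sorts of storage: machine words (bounded integers)
  and real numbers. Words have scalar variables and arrays, reals have arrays; the finitely many
  names that occur in a program play the role of its registers and memory segments.

  Real arithmetic is deliberately weak: addition, subtraction, the embedding of words, comparison,
  rounding down to a word, and the test \<open>a\<^sup>2 + b\<^sup>2 \<le> c\<^sup>2\<close>, which suffices to compare distances. There
  is no multiplication of stored reals, since unit-cost real multiplication together with rounding
  makes a machine unrealistically powerful.

  \<open>Query x a e b e'\<close> asks the oracle for the number of subgraph maps from the graph given by the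
  first \<open>e\<close> disk centres in the array \<open>a\<close> to the one given by the first \<open>e'\<close> disk
  centres in the array \<open>b\<close>, and stores the answer in \<open>x\<close>.
\<close>

datatype iexp =
    Lit int
  | Var string
  | Idx string iexp
  | Add iexp iexp
  | Sub iexp iexp
  | Mul iexp iexp
  | Div iexp iexp
  | Floor rexp
and rexp =
    RIdx string iexp
  | RAdd rexp rexp
  | RSub rexp rexp
  | OfInt iexp

datatype bexp =
    Less iexp iexp
  | RLess rexp rexp
  | NormLe rexp rexp rexp
  | Neg bexp
  | Conj bexp bexp

datatype com =
    Skip
  | Assign string iexp
  | Store string iexp iexp
  | RStore string iexp rexp
  | Seq com com
  | If bexp com com
  | While bexp com
  | Query string string iexp string iexp

record state =
  ivar :: "string \<Rightarrow> int"
  iarr :: "string \<Rightarrow> int \<Rightarrow> int"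
  rarr :: "string \<Rightarrow> int \<Rightarrow> real"

primrec ival :: "state \<Rightarrow> iexp \<Rightarrow> int" and rval :: "state \<Rightarrow> rexp \<Rightarrow> real" where
  "ival s (Lit i) = i"
| "ival s (Var x) = ivar s x"
| "ival s (Idx a e) = iarr s a (ival s e)"
| "ival s (Add e1 e2) = ival s e1 + ival s e2"
| "ival s (Sub e1 e2) = ival s e1 - ival s e2"
| "ival s (Mul e1 e2) = ival s e1 * ival s e2"
| "ival s (Div e1 e2) = ival s e1 div ival s e2"
| "ival s (Floor r) = \<lfloor>rval s r\<rfloor>"
| "rval s (RIdx a e) = rarr s a (ival s e)"
| "rval s (RAdd r1 r2) = rval s r1 + rval s r2"
| "rval s (RSub r1 r2) = rval s r1 - rval s r2"
| "rval s (OfInt e) = of_int (ival s e)"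

primrec bval :: "state \<Rightarrow> bexp \<Rightarrow> bool" where
  "bval s (Less e1 e2) = (ival s e1 < ival s e2)"
| "bval s (RLess r1 r2) = (rval s r1 < rval s r2)"
| "bval s (NormLe r1 r2 r3) = ((rval s r1)\<^sup>2 + (rval s r2)\<^sup>2 \<le> (rval s r3)\<^sup>2)"
| "bval s (Neg b) = (\<not> bval s b)"
| "bval s (Conj b1 b2) = (bval s b1 \<and> bval s b2)"

text \<open>
  A word holds the integers of absolute value at most \<open>W\<close>. The following predicates state that
  every word that arises in the evaluation of an expression is in this range.
\<close>

definition word :: "nat \<Rightarrow> int \<Rightarrow> bool" where
  "word W i \<longleftrightarrow> \<bar>i\<bar> \<le> int W"

primrec iok :: "nat \<Rightarrow> state \<Rightarrow> iexp \<Rightarrow> bool" and rok :: "nat \<Rightarrow> state \<Rightarrow> rexp \<Rightarrow> bool" where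
  "iok W s (Lit i) = word W i"
| "iok W s (Var x) = word W (ivar s x)"
| "iok W s (Idx a e) = (iok W s e \<and> word W (ival s (Idx a e)))"
| "iok W s (Add e1 e2) = (iok W s e1 \<and> iok W s e2 \<and> word W (ival s (Add e1 e2)))"
| "iok W s (Sub e1 e2) = (iok W s e1 \<and> iok W s e2 \<and> word W (ival s (Sub e1 e2)))"
| "iok W s (Mul e1 e2) = (iok W s e1 \<and> iok W s e2 \<and> word W (ival s (Mul e1 e2)))"
| "iok W s (Div e1 e2) = (iok W s e1 \<and> iok W s e2 \<and> word W (ival s (Div e1 e2)))"
| "iok W s (Floor r) = (rok W s r \<and> word W (ival s (Floor r)))"
| "rok W s (RIdx a e) = iok W s e"
| "rok W s (RAdd r1 r2) = (rok W s r1 \<and> rok W s r2)"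
| "rok W s (RSub r1 r2) = (rok W s r1 \<and> rok W s r2)"
| "rok W s (OfInt e) = iok W s e"

primrec bok :: "nat \<Rightarrow> state \<Rightarrow> bexp \<Rightarrow> bool" where
  "bok W s (Less e1 e2) = (iok W s e1 \<and> iok W s e2)"
| "bok W s (RLess r1 r2) = (rok W s r1 \<and> rok W s r2)"
| "bok W s (NormLe r1 r2 r3) = (rok W s r1 \<and> rok W s r2 \<and> rok W s r3)"
| "bok W s (Neg b) = bok W s b"
| "bok W s (Conj b1 b2) = (bok W s b1 \<and> bok W s b2)"

text \<open>An array stores the coordinates of its \<open>i\<close>-th disk centre at the indices \<open>2i\<close> and \<open>2i + 1\<close>.\<close>

definition centres :: "(int \<Rightarrow> real) \<Rightarrow> int \<Rightarrow> plane list" where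
  "centres a m = map (\<lambda>i. (a (2 * int i), a (2 * int i + 1))) [0..<nat m]"

definition store_centres :: "plane list \<Rightarrow> int \<Rightarrow> real" where
  "store_centres zs j =
     (if 0 \<le> j \<and> j < 2 * int (length zs)
      then (if even j then fst else snd) (zs ! nat (j div 2)) else 0)"

lemma centres_store_centres: "centres (store_centres zs) (int (length zs)) = zs"
  by (rule nth_equalityI) (auto simp: centres_def store_centres_def)

text \<open>
  An oracle maps a pattern and a host, both given by their disk centres, to its answer, or to
  \<open>None\<close> if the query is not admissible.

  \<open>exec \<Omega> W c s t s'\<close>: with oracle \<open>\<Omega>\<close> and words bounded by \<open>W\<close>, the program \<open>c\<close> started
  in \<open>s\<close> terminates in \<open>s'\<close> after \<open>t\<close> steps. Each assignment, test and query is one step;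
  the expressions in it have a size that is fixed by the program, so this is unit cost per
  operation up to a factor that depends on the program only. An execution is stuck, and hence has
  no derivation, as soon as a word overflows or an inadmissible query is made.
\<close>

type_synonym oracle_fun = "plane list \<Rightarrow> plane list \<Rightarrow> nat option"

inductive exec :: "oracle_fun \<Rightarrow> nat \<Rightarrow> com \<Rightarrow> state \<Rightarrow> nat \<Rightarrow> state \<Rightarrow> bool"
  for \<Omega> :: oracle_fun and W :: nat where
  Skip: "exec \<Omega> W Skip s 1 s"
| Assign: "iok W s e \<Longrightarrow>
    exec \<Omega> W (Assign x e) s 1 (s\<lparr>ivar := (ivar s)(x := ival s e)\<rparr>)"
| Store: "iok W s e \<Longrightarrow> iok W s e' \<Longrightarrow>
    exec \<Omega> W (Store a e e') s 1
      (s\<lparr>iarr := (iarr s)(a := (iarr s a)(ival s e := ival s e'))\<rparr>)"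
| RStore: "iok W s e \<Longrightarrow> rok W s r \<Longrightarrow>
    exec \<Omega> W (RStore a e r) s 1
      (s\<lparr>rarr := (rarr s)(a := (rarr s a)(ival s e := rval s r))\<rparr>)"
| Seq: "exec \<Omega> W c1 s t1 s' \<Longrightarrow> exec \<Omega> W c2 s' t2 s'' \<Longrightarrow>
    exec \<Omega> W (Seq c1 c2) s (t1 + t2) s''"
| IfTrue: "bok W s b \<Longrightarrow> bval s b \<Longrightarrow> exec \<Omega> W c1 s t s' \<Longrightarrow>
    exec \<Omega> W (If b c1 c2) s (t + 1) s'"
| IfFalse: "bok W s b \<Longrightarrow> \<not> bval s b \<Longrightarrow> exec \<Omega> W c2 s t s' \<Longrightarrow>
    exec \<Omega> W (If b c1 c2) s (t + 1) s'"
| WhileFalse: "bok W s b \<Longrightarrow> \<not> bval s b \<Longrightarrow> exec \<Omega> W (While b c) s 1 s"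
| WhileTrue: "bok W s b \<Longrightarrow> bval s b \<Longrightarrow> exec \<Omega> W c s t1 s' \<Longrightarrow>
    exec \<Omega> W (While b c) s' t2 s'' \<Longrightarrow>
    exec \<Omega> W (While b c) s (t1 + t2 + 1) s''"
| Query: "iok W s e \<Longrightarrow> iok W s e' \<Longrightarrow>
    \<Omega> (centres (rarr s a) (ival s e)) (centres (rarr s b) (ival s e')) = Some N \<Longrightarrow>
    word W (int N) \<Longrightarrow>
    exec \<Omega> W (Query x a e b e') s 1 (s\<lparr>ivar := (ivar s)(x := int N)\<rparr>)"

inductive_cases exec_elims:
  "exec \<Omega> W Skip s t s'"
  "exec \<Omega> W (Assign x e) s t s'"
  "exec \<Omega> W (Store a e e') s t s'"
  "exec \<Omega> W (RStore a e r) s t s'"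
  "exec \<Omega> W (Seq c1 c2) s t s'"
  "exec \<Omega> W (If b c1 c2) s t s'"
  "exec \<Omega> W (Query x a e d e') s t s'"

inductive_cases exec_WhileE: "exec \<Omega> W (While b c) s t s'"

lemma exec_deterministic:
  "exec \<Omega> W c s t s' \<Longrightarrow> exec \<Omega> W c s u s'' \<Longrightarrow> u = t \<and> s'' = s'"
proof (induction arbitrary: u s'' rule: exec.induct)
  case (Seq c1 s t1 s' c2 t2 s2)
  from Seq.prems obtain v1 v2 r
    where "u = v1 + v2" "exec \<Omega> W c1 s v1 r" "exec \<Omega> W c2 r v2 s''"
    by (rule exec_elims(5))
  then show ?case using Seq.IH by metis
next
  case (IfTrue s b c1 t s' c2)
  from IfTrue.prems IfTrue.hyps(1,2) obtain v where "u = v + 1" "exec \<Omega> W c1 s v s''"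
    by (elim exec_elims(6)) auto
  then show ?case using IfTrue.IH by metis
next
  case (IfFalse s b c2 t s' c1)
  from IfFalse.prems IfFalse.hyps(1,2) obtain v where "u = v + 1" "exec \<Omega> W c2 s v s''"
    by (elim exec_elims(6)) auto
  then show ?case using IfFalse.IH by metis
next
  case (WhileTrue s b c t1 s' t2 s2)
  from WhileTrue.prems obtain v1 v2 r
    where r: "u = v1 + v2 + 1" "exec \<Omega> W c s v1 r" "exec \<Omega> W (While b c) r v2 s''"
    by (rule exec_WhileE) (use WhileTrue.hyps in auto)
  have "v1 = t1 \<and> r = s'"
    using WhileTrue.IH(1)[OF r(2)] .
  moreover from this have "v2 = t2 \<and> s'' = s2"
    using WhileTrue.IH(2)[of v2 s''] r(3) by simp
  ultimately show ?case
    using r(1) by simp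
next
  case (WhileFalse s b c)
  from WhileFalse.prems show ?case
    by (rule exec_WhileE) (use WhileFalse.hyps in auto)
qed (elim exec_elims; simp)+

definition init_state :: "plane list \<Rightarrow> plane list \<Rightarrow> state" where
  "init_state xs ys = \<lparr>
     ivar = (\<lambda>_. 0)(''k'' := int (length xs), ''n'' := int (length ys)),
     iarr = (\<lambda>_ _. 0),
     rarr = (\<lambda>_ _. 0)(''P'' := store_centres xs, ''G'' := store_centres ys)\<rparr>"

definition computes_within ::
    "oracle_fun \<Rightarrow> nat \<Rightarrow> com \<Rightarrow> plane list \<Rightarrow> plane list \<Rightarrow> nat \<Rightarrow> nat \<Rightarrow> bool" where
  "computes_within \<Omega> W c xs ys T N \<longleftrightarrow>
     (\<exists>t s. exec \<Omega> W c (init_state xs ys) t s \<and> t \<le> T \<and> ivar s ''result'' = int N)"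

definition coords_at_most :: "plane list \<Rightarrow> nat \<Rightarrow> bool" where
  "coords_at_most zs M \<longleftrightarrow> (\<forall>(x, y)\<in>set zs. \<bar>x\<bar> \<le> real M \<and> \<bar>y\<bar> \<le> real M)"


section \<open>Oracles and Turing kernels\<close>

definition pattern_oracle :: "plane list \<Rightarrow> nat \<Rightarrow> oracle_fun" where
  "pattern_oracle xs h xs' zs =
     (if xs' = xs \<and> length zs \<le> h
      then Some (card (sub (disk_graph xs) (disk_graph zs))) else None)"

text \<open>
  Instances of the counting problem are pairs of lists of disk centres, for pattern and host. The
  parameter is the number of vertices of the pattern, and the size of an instance is the total
  number of vertices.
\<close>

type_synonym inst = "plane list \<times> plane list"

definition inst_size :: "inst \<Rightarrow> nat" where
  "inst_size I = length (fst I) + length (snd I)"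

definition inst_param :: "inst \<Rightarrow> nat" where
  "inst_param I = length (fst I)"

definition solution :: "inst \<Rightarrow> nat" where
  "solution I = card (sub (disk_graph (fst I)) (disk_graph (snd I)))"

definition instance_oracle :: "inst set \<Rightarrow> nat \<Rightarrow> oracle_fun" where
  "instance_oracle \<I> h xs zs =
     (if (xs, zs) \<in> \<I> \<and> inst_size (xs, zs) \<le> h then Some (solution (xs, zs)) else None)"

text \<open>
  Polynomial time is with respect to the size of the instance, with words of polynomially many
  times \<open>log (size + M)\<close> bits, where \<open>M\<close> bounds the coordinates. The latter is needed since
  the rounded coordinates have to fit into words.
\<close>

definition turing_kernel :: "inst set \<Rightarrow> (nat \<Rightarrow> nat) \<Rightarrow> bool" where
  "turing_kernel \<I> h \<longleftrightarrow>
     (\<exists>(c :: com) (T :: nat poly) (w :: nat poly). \<forall>I\<in>\<I>. \<forall>M.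
        coords_at_most (fst I @ snd I) M \<longrightarrow>
        computes_within (instance_oracle \<I> (h (inst_param I)))
          ((inst_size I + M + 2) ^ poly w (inst_size I))
          c (fst I) (snd I) (poly T (inst_size I)) (solution I))"

definition bounded_instances :: "nat poly \<Rightarrow> inst set" where
  "bounded_instances r = {(xs, ys).
     sigma0 (disk_graph xs) \<le> poly r (length xs) \<and>
     (\<exists>p \<le> poly r (length xs).
        ply_at_most (disk_graph xs) ((!) xs) p \<and> ply_at_most (disk_graph ys) ((!) ys) p)}"

end

theory Submission
  imports Defs
begin

text \<open>
  Call \<open>A \<subseteq> V(P)\<close> closed (\<open>sepset\<close>) if it is a union of components of \<open>P\<close>, and for a host \<open>X\<close> let \<open>s\<^sub>X(A)\<close> be the
  number of embeddings of \<open>P[A]\<close> into \<open>X\<close>, or \<open>0\<close> if \<open>A\<close> is not closed. A disjoint union of hosts becomes a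
  subset convolution of these functions. Modulo isomorphism there are at most \<open>\<sigma>\<^sub>0(P)\<close> closed sets, and
  \<open>s\<^sub>X\<close> is a unique combination \<open>\<Sum> x\<^sub>A s\<^sub>P\<^sub>[\<^sub>A\<^sub>]\<close> over representatives: the pairing of \<open>A\<close>, \<open>C\<close> by the number of
  maps from \<open>P\<close> to \<open>P[A] + P[V - C]\<close> is, up to the factor \<open>|Aut(P)|\<close>, unitriangular with respect to the
  number of vertices and edges.

  The algorithm maintains the vector \<open>x\<close> of \<open>s\<close> for the part \<open>U\<close> of \<open>G\<close> that lies in the cells processed so far
  of a grid of width \<open>2k\<close>. For a new cell \<open>Z\<close> with processed neighbours \<open>W\<close>, the hosts \<open>(U \<union> Z) + W\<close> and
  \<open>U + (W \<union> Z)\<close> admit equally many maps: superpose the two images and exchange the clusters that meet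
  \<open>Z\<close>. As \<open>s\<^sub>W\<close> is \<open>1\<close> at the empty set, it can be cancelled, so \<open>U \<union> Z\<close> is determined by hosts that
  consist of \<open>P[A]\<close>, a part of a block of nine cells, and \<open>P[V - C]\<close>. A square of area \<open>1\<close> contains at
  most \<open>p\<close> centres, hence these hosts have at most \<open>38k\<^sup>2p\<close> vertices and ply \<open>p\<close>, and every
  vertex of \<open>G\<close> occurs in at most nine blocks.
\<close>

subsection \<open>Embeddings of closed sets\<close>

text \<open>The obstacle is that \<open>U\<close> is too large to be queried, while the oracle
  counts maps of all of \<open>P\<close> only. Coordinates overcome both: the combination of small
  hosts \<open>P[A]\<close> stands in for \<open>U\<close> in every host \<open>U + X\<close>,
  because disjoint union is bilinear on these functions, and adding \<open>P[V - C]\<close> to a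
  host makes the count for \<open>P\<close> reveal values on smaller closed sets. All arithmetic
  stays integral. \<open>Aut(P)\<close> acts freely on the maps of \<open>P\<close> into a host, so
  every answer is divisible by \<open>alpha\<close>, and the divided matrix for the empty host is
  unitriangular. It is inverted by an iteration without fractions, and so is \<open>s_W\<close>, the
  unit of the convolution plus a nilpotent part. Coefficients might grow from cell to cell. They do
  not, being coordinates of a genuine host, whose numbers of maps bound them anew. A cluster of at
  most \<open>k\<close> vertices has diameter at most 2(k - 1), whence the width 2k. Nine cells form
  a square of side 6k, that is 36k^2 unit squares, and the two parts of \<open>P\<close> add at most
  2k <= 2k^2 p vertices, which gives 38.\<close>

definition conv :: "(nat set \<Rightarrow> int) \<Rightarrow> (nat set \<Rightarrow> int) \<Rightarrow> nat set \<Rightarrow> int" where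
  "conv s t A = (\<Sum>B\<in>Pow A. s B * t (A - B))"

lemma conv_diff_left: "conv (\<lambda>B. s B - s' B) t A = conv s t A - conv s' t A"
  unfolding conv_def by (simp add: left_diff_distrib sum_subtractf)

lemma conv_sum_left: "conv (\<lambda>B. \<Sum>i\<in>I. c i * s i B) t A = (\<Sum>i\<in>I. c i * conv (s i) t A)"
proof -
  have "conv (\<lambda>B. \<Sum>i\<in>I. c i * s i B) t A = (\<Sum>B\<in>Pow A. \<Sum>i\<in>I. c i * (s i B * t (A - B)))"
    unfolding conv_def by (simp add: sum_distrib_right mult.assoc)
  also have "\<dots> = (\<Sum>i\<in>I. \<Sum>B\<in>Pow A. c i * (s i B * t (A - B)))"
    by (rule sum.swap)
  finally show ?thesis
    unfolding conv_def by (simp add: sum_distrib_left)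
qed

lemma conv_cong:
  assumes "\<And>B. B \<subseteq> A \<Longrightarrow> s B = s' B" "\<And>B. B \<subseteq> A \<Longrightarrow> t B = t' B"
  shows "conv s t A = conv s' t' A"
  unfolding conv_def by (rule sum.cong) (auto simp: assms)

lemma conv_eq_single:
  assumes "finite A" "C \<subseteq> A" "\<And>B. B \<subseteq> A \<Longrightarrow> B \<noteq> C \<Longrightarrow> s B * t (A - B) = 0"
  shows "conv s t A = s C * t (A - C)"
proof -
  have "conv s t A = (\<Sum>B\<in>{C}. s B * t (A - B))"
    unfolding conv_def using assms by (intro sum.mono_neutral_right) auto
  then show ?thesis by simp
qed

lemma conv_nonneg: "(\<And>B. 0 \<le> s B) \<Longrightarrow> (\<And>B. 0 \<le> t B) \<Longrightarrow> 0 \<le> conv s t A"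
  unfolding conv_def by (intro sum_nonneg mult_nonneg_nonneg) auto

text \<open>Proper subsets of \<open>A\<close> have fewer than \<open>j\<close> elements, so only
  the term \<open>s A * t {}\<close> survives, and it equals \<open>s A\<close>. Passing from
  \<open>s\<close> to \<open>s - conv s t\<close> thus gains one more cardinality on which the
  function vanishes; this is the nilpotency behind the cancellation of a factor with value 1 at the
  empty set.\<close>

lemma conv_unit_step:
  assumes s: "\<And>A. finite A \<Longrightarrow> card A < j \<Longrightarrow> s A = 0" and t: "t {} = 1"
    and A: "finite A" "card A < Suc j"
  shows "s A - conv s t A = 0"
proof -
  have "conv s t A = s A * t (A - A)"
  proof (rule conv_eq_single)
    fix B assume B: "B \<subseteq> A" "B \<noteq> A"
    then have "card B < card A" "finite B"
      using A by (auto intro: psubset_card_mono finite_subset)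
    then show "s B * t (A - B) = 0" using s[of B] A by simp
  qed (use A in auto)
  then show ?thesis by (simp add: t)
qed

locale pattern =
  fixes k :: nat and E :: "nat \<Rightarrow> nat \<Rightarrow> bool"
  assumes E_sym: "E u v \<Longrightarrow> E v u" and E_irrefl: "\<not> E u u"
begin

abbreviation V :: "nat set" where "V \<equiv> {..<k}"

definition sepset :: "nat set \<Rightarrow> bool" where
  "sepset A \<longleftrightarrow> A \<subseteq> V \<and> (\<forall>u\<in>A. \<forall>v\<in>V. E u v \<longrightarrow> v \<in> A)"

definition emb :: "nat set \<Rightarrow> 'b set \<Rightarrow> ('b \<Rightarrow> 'b \<Rightarrow> bool) \<Rightarrow> (nat \<Rightarrow> 'b) set" where
  "emb A X R = {f \<in> A \<rightarrow>\<^sub>E X. inj_on f A \<and> (\<forall>u\<in>A. \<forall>v\<in>A. E u v \<longrightarrow> R (f u) (f v))}"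

text \<open>The value 0 off the closed sets turns the sum over all subsets in \<open>conv\<close>
  into a sum over separations: a term survives only if \<open>B\<close> and \<open>A - B\<close> are
  both closed.\<close>

definition S :: "'b set \<Rightarrow> ('b \<Rightarrow> 'b \<Rightarrow> bool) \<Rightarrow> nat set \<Rightarrow> int" where
  "S X R A = (if sepset A then int (card (emb A X R)) else 0)"

lemma sepset_empty [simp]: "sepset {}" and sepset_V [simp]: "sepset V"
  by (auto simp: sepset_def)

lemma sepset_finite: "sepset A \<Longrightarrow> finite A"
  unfolding sepset_def by (auto intro: finite_subset)

lemma sepset_subset: "sepset A \<Longrightarrow> A \<subseteq> V"
  by (simp add: sepset_def)

lemma sepset_Un: "sepset A \<Longrightarrow> sepset B \<Longrightarrow> sepset (A \<union> B)"
  by (auto simp: sepset_def)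

lemma sepset_Diff: "sepset A \<Longrightarrow> sepset B \<Longrightarrow> sepset (A - B)"
  using E_sym by (fastforce simp: sepset_def)

lemma sepset_edge: "sepset A \<Longrightarrow> u \<in> V \<Longrightarrow> v \<in> V \<Longrightarrow> E u v \<Longrightarrow> u \<in> A \<longleftrightarrow> v \<in> A"
  using E_sym by (auto simp: sepset_def)

lemma finite_emb: "finite A \<Longrightarrow> finite X \<Longrightarrow> finite (emb A X R)"
  unfolding emb_def by (rule finite_subset[OF _ finite_PiE[of A "\<lambda>_. X"]]) auto

lemma S_nonneg: "0 \<le> S X R A"
  by (simp add: S_def)

lemma emb_empty: "emb {} X R = {\<lambda>_. undefined}"
  by (auto simp: emb_def)

lemma S_empty [simp]: "S X R {} = 1"
  by (simp add: S_def emb_empty)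

lemma S_le:
  assumes "finite X" "sepset A" "card A \<le> m" "card X \<le> N" "1 \<le> N"
  shows "S X R A \<le> int N ^ m"
proof -
  have fA: "finite A" using assms sepset_finite by blast
  have "card (emb A X R) \<le> card (A \<rightarrow>\<^sub>E X)"
    using assms fA by (intro card_mono finite_PiE) (auto simp: emb_def)
  also have "\<dots> = card X ^ card A" using fA by (simp add: card_PiE)
  also have "\<dots> \<le> N ^ card A" using assms by (intro power_mono) auto
  also have "\<dots> \<le> N ^ m" using assms by (intro power_increasing) auto
  finally have "int (card (emb A X R)) \<le> int (N ^ m)" by (rule of_nat_mono)
  then show ?thesis using assms by (simp add: S_def)
qed

lemma emb_restrict:
  assumes "f \<in> emb A X R" "B \<subseteq> A" "\<And>u. u \<in> B \<Longrightarrow> f u \<in> Y"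
  shows "restrict f B \<in> emb B Y R"
  using assms unfolding emb_def by (auto simp: inj_on_def subset_iff)

text \<open>Host isomorphism; loops are irrelevant because embeddings are injective.\<close>

lemma emb_host_iso_le:
  assumes h: "bij_betw h X Y" and R: "\<And>u v. u \<in> X \<Longrightarrow> v \<in> X \<Longrightarrow> u \<noteq> v \<Longrightarrow> R u v \<Longrightarrow> R' (h u) (h v)"
    and fin: "finite X" "finite A"
  shows "card (emb A X R) \<le> card (emb A Y R')"
proof (rule card_inj_on_le)
  have hX: "inj_on h X" "h ` X = Y" using h by (auto simp: bij_betw_def)
  show "inj_on (\<lambda>f. restrict (h \<circ> f) A) (emb A X R)"
  proof (rule inj_onI)
    fix f g assume f: "f \<in> emb A X R" and g: "g \<in> emb A X R"
      and eq: "restrict (h \<circ> f) A = restrict (h \<circ> g) A"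
    have "f u = g u" if "u \<in> A" for u
    proof -
      have "h (f u) = h (g u)" using fun_cong[OF eq, of u] that by simp
      then show ?thesis using f g that hX by (auto simp: emb_def inj_on_def)
    qed
    then show "f = g" using f g unfolding emb_def by (auto intro: PiE_ext)
  qed
  show "(\<lambda>f. restrict (h \<circ> f) A) ` emb A X R \<subseteq> emb A Y R'"
  proof safe
    fix f assume f: "f \<in> emb A X R"
    then have fX: "\<And>u. u \<in> A \<Longrightarrow> f u \<in> X" and inj: "inj_on f A"
      and e: "\<And>u v. u \<in> A \<Longrightarrow> v \<in> A \<Longrightarrow> E u v \<Longrightarrow> R (f u) (f v)" by (auto simp: emb_def)
    have "inj_on (h \<circ> f) A" using inj hX fX by (auto simp: inj_on_def)
    moreover have "R' (h (f u)) (h (f v))" if "u \<in> A" "v \<in> A" "E u v" for u v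
    proof (rule R)
      show "f u \<noteq> f v" using that inj E_irrefl by (auto dest: inj_onD)
    qed (use that fX e in auto)
    ultimately show "restrict (h \<circ> f) A \<in> emb A Y R'"
      using fX hX by (auto simp: emb_def inj_on_def)
  qed
  have "finite Y" using fin h bij_betw_finite by blast
  then show "finite (emb A Y R')" using fin finite_emb by blast
qed

lemma S_host_iso:
  assumes h: "bij_betw h X Y" and R: "\<And>u v. u \<in> X \<Longrightarrow> v \<in> X \<Longrightarrow> u \<noteq> v \<Longrightarrow> R u v \<longleftrightarrow> R' (h u) (h v)"
    and fin: "finite X"
  shows "S X R A = S Y R' A"
proof (cases "sepset A")
  case True
  let ?h' = "inv_into X h"
  have h': "bij_betw ?h' Y X" using h bij_betw_inv_into by blast
  have "card (emb A X R) = card (emb A Y R')"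
  proof (rule antisym)
    show "card (emb A X R) \<le> card (emb A Y R')"
      by (rule emb_host_iso_le[OF h]) (use R fin True sepset_finite in auto)
    show "card (emb A Y R') \<le> card (emb A X R)"
    proof (rule emb_host_iso_le[OF h'])
      fix u v assume "u \<in> Y" "v \<in> Y" "u \<noteq> v" "R' u v"
      moreover from this have "h (?h' u) = u" "h (?h' v) = v" "?h' u \<in> X" "?h' v \<in> X"
        using h by (auto simp: bij_betw_def f_inv_into_f inv_into_into)
      ultimately show "R (?h' u) (?h' v)" using R[of "?h' u" "?h' v"] by metis
    qed (use fin h bij_betw_finite True sepset_finite in auto)
  qed
  then show ?thesis by (simp add: S_def)
qed (simp add: S_def)

text \<open>Pairs of embeddings of the two parts of a separation, presented as one map with a subset.\<close>

definition split_emb :: "nat set \<Rightarrow> 'b set \<Rightarrow> 'b set \<Rightarrow> ('b \<Rightarrow> 'b \<Rightarrow> bool) \<Rightarrow> (nat set \<times> (nat \<Rightarrow> 'b)) set" where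
  "split_emb A X Y R = {(B, e). B \<subseteq> A \<and> sepset B \<and> sepset (A - B) \<and> e \<in> extensional A \<and>
     restrict e B \<in> emb B X R \<and> restrict e (A - B) \<in> emb (A - B) Y R}"

lemma conv_S_eq_card_split_emb:
  assumes "finite X" "finite Y" "sepset A"
  shows "conv (S X R) (S Y R) A = int (card (split_emb A X Y R))"
proof -
  let ?I = "{B \<in> Pow A. sepset B \<and> sepset (A - B)}"
  let ?U = "SIGMA B:?I. emb B X R \<times> emb (A - B) Y R"
  have fA: "finite A" using assms sepset_finite by blast
  have "conv (S X R) (S Y R) A = (\<Sum>B\<in>?I. S X R B * S Y R (A - B))"
    unfolding conv_def by (rule sum.mono_neutral_right) (use fA in \<open>auto simp: S_def\<close>)
  also have "\<dots> = (\<Sum>B\<in>?I. int (card (emb B X R \<times> emb (A - B) Y R)))"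
    by (rule sum.cong) (auto simp: S_def card_cartesian_product)
  also have "\<dots> = int (card ?U)"
  proof -
    have "\<forall>B\<in>?I. finite (emb B X R \<times> emb (A - B) Y R)"
      using assms fA by (auto intro!: finite_emb intro: finite_subset)
    then show ?thesis using fA by simp
  qed
  also have "card ?U = card (split_emb A X Y R)"
  proof (rule bij_betw_same_card[of "\<lambda>(B, f, g). (B, \<lambda>u. if u \<in> B then f u else g u)"],
      rule bij_betw_byWitness[where f' = "\<lambda>(B, e). (B, restrict e B, restrict e (A - B))"])
    show "\<forall>a\<in>?U. (\<lambda>(B, e). (B, restrict e B, restrict e (A - B)))
       ((\<lambda>(B, f, g). (B, \<lambda>u. if u \<in> B then f u else g u)) a) = a"
      by (auto simp: emb_def fun_eq_iff restrict_def extensional_def PiE_def)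
    show "\<forall>a'\<in>split_emb A X Y R. (\<lambda>(B, f, g). (B, \<lambda>u. if u \<in> B then f u else g u))
       ((\<lambda>(B, e). (B, restrict e B, restrict e (A - B))) a') = a'"
      by (auto simp: split_emb_def fun_eq_iff restrict_def extensional_def)
    show "(\<lambda>(B, f, g). (B, \<lambda>u. if u \<in> B then f u else g u)) ` ?U \<subseteq> split_emb A X Y R"
    proof safe
      fix B f g assume *: "B \<subseteq> A" "sepset B" "sepset (A - B)" "f \<in> emb B X R" "g \<in> emb (A - B) Y R"
      let ?e = "\<lambda>u. if u \<in> B then f u else g u"
      have "restrict ?e B = f" "restrict ?e (A - B) = g"
        using *(4,5) by (auto simp: emb_def fun_eq_iff restrict_def PiE_def extensional_def)
      moreover have "?e \<in> extensional A"
        using *(1,5) by (auto simp: emb_def extensional_def PiE_def)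
      ultimately show "(B, ?e) \<in> split_emb A X Y R" using * by (auto simp: split_emb_def)
    qed
    show "(\<lambda>(B, e). (B, restrict e B, restrict e (A - B))) ` split_emb A X Y R \<subseteq> ?U"
      by (auto simp: split_emb_def)
  qed
  finally show ?thesis .
qed

text \<open>If \<open>B\<close> and \<open>A - B\<close> were both closed, so would be their union
  \<open>A\<close>; hence every term has a zero factor.\<close>

lemma conv_S_not_sepset:
  assumes "\<not> sepset A" shows "conv (S X R) (S Y R') A = 0"
  unfolding conv_def
proof (rule sum.neutral, safe)
  fix B assume "B \<subseteq> A"
  then have "A = B \<union> (A - B)" by auto
  then have "\<not> (sepset B \<and> sepset (A - B))" using assms sepset_Un by metis
  then show "S X R B * S Y R' (A - B) = 0" by (auto simp: S_def)
qed

text \<open>A component cannot be mapped partly into \<open>X\<close> and partly into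
  \<open>Y\<close>, since no edges join them, so the preimage of \<open>X\<close> is closed and
  determines the split. Conversely, maps of the two sides glue: disjointness gives injectivity, and
  no edge of \<open>P\<close> crosses the split.\<close>

lemma S_disjoint_union:
  assumes fin: "finite X" "finite Y" and disj: "X \<inter> Y = {}"
    and nR: "\<And>x y. x \<in> X \<Longrightarrow> y \<in> Y \<Longrightarrow> \<not> R x y \<and> \<not> R y x"
  shows "S (X \<union> Y) R A = conv (S X R) (S Y R) A"
proof (cases "sepset A")
  case True
  let ?Q = "split_emb A X Y R"
  have "card (emb A (X \<union> Y) R) = card ?Q"
  proof (rule bij_betw_same_card[of "\<lambda>e. ({u\<in>A. e u \<in> X}, e)"],
      rule bij_betw_byWitness[where f' = snd])
    show "\<forall>a'\<in>?Q. ({u \<in> A. (snd a') u \<in> X}, snd a') = a'"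
    proof
      fix a' assume "a' \<in> ?Q"
      moreover obtain B e where a': "a' = (B, e)" by (cases a')
      ultimately have q: "(B, e) \<in> ?Q" by simp
      have "e u \<in> X" if "u \<in> B" for u
        using q that by (auto simp: split_emb_def emb_def restrict_def PiE_def Pi_def split: if_splits)
      moreover have "e u \<in> Y" if "u \<in> A - B" for u
        using q that by (auto simp: split_emb_def emb_def restrict_def PiE_def Pi_def split: if_splits)
      ultimately have "{u \<in> A. e u \<in> X} = B"
        using disj q by (auto simp: split_emb_def)
      then show "({u \<in> A. (snd a') u \<in> X}, snd a') = a'" using a' by simp
    qed
    show "(\<lambda>e. ({u \<in> A. e u \<in> X}, e)) ` emb A (X \<union> Y) R \<subseteq> ?Q"
    proof safe
      fix e assume e: "e \<in> emb A (X \<union> Y) R"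
      let ?B = "{u \<in> A. e u \<in> X}"
      have eX: "e u \<in> X \<or> e u \<in> Y" if "u \<in> A" for u using e that by (auto simp: emb_def)
      have "sepset ?B" unfolding sepset_def
      proof safe
        fix u v assume u: "u \<in> A" "e u \<in> X" and v: "v < k" "E u v"
        show vA: "v \<in> A" using True u v by (auto simp: sepset_def)
        have "R (e u) (e v)" using e u v vA by (auto simp: emb_def)
        then show "e v \<in> X" using nR eX[OF vA] u by auto
      qed (use True in \<open>auto simp: sepset_def\<close>)
      moreover from this have "sepset (A - ?B)" using True sepset_Diff by blast
      moreover have "restrict e ?B \<in> emb ?B X R" by (rule emb_restrict[OF e]) auto
      moreover have "restrict e (A - ?B) \<in> emb (A - ?B) Y R"
        by (rule emb_restrict[OF e]) (use eX in auto)
      moreover have "e \<in> extensional A" using e by (auto simp: emb_def PiE_def)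
      ultimately show "(?B, e) \<in> ?Q" unfolding split_emb_def by blast
    qed
    show "snd ` ?Q \<subseteq> emb A (X \<union> Y) R"
    proof safe
      fix B e assume q: "(B, e) \<in> ?Q"
      then have B: "B \<subseteq> A" "sepset B" "e \<in> extensional A" and e1: "restrict e B \<in> emb B X R"
        and e2: "restrict e (A - B) \<in> emb (A - B) Y R" by (auto simp: split_emb_def)
      have X: "\<And>u. u \<in> B \<Longrightarrow> e u \<in> X" and Y: "\<And>u. u \<in> A \<Longrightarrow> u \<notin> B \<Longrightarrow> e u \<in> Y"
        and i1: "inj_on e B" and i2: "inj_on e (A - B)"
        and r1: "\<And>u v. u \<in> B \<Longrightarrow> v \<in> B \<Longrightarrow> E u v \<Longrightarrow> R (e u) (e v)"
        and r2: "\<And>u v. u \<in> A - B \<Longrightarrow> v \<in> A - B \<Longrightarrow> E u v \<Longrightarrow> R (e u) (e v)"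
        using e1 e2 by (auto simp: emb_def PiE_def Pi_def inj_on_def)
      have "inj_on e A"
      proof (rule inj_onI)
        fix u v assume uv: "u \<in> A" "v \<in> A" "e u = e v"
        then have "u \<in> B \<longleftrightarrow> v \<in> B" using X Y disj by (metis disjoint_iff)
        then show "u = v" using uv i1 i2 by (auto dest: inj_onD)
      qed
      moreover have "R (e u) (e v)" if "u \<in> A" "v \<in> A" "E u v" for u v
      proof -
        have "u \<in> B \<longleftrightarrow> v \<in> B" using sepset_edge[OF B(2)] that sepset_subset[OF True] by blast
        then show ?thesis using r1 r2 that by blast
      qed
      moreover have "e \<in> A \<rightarrow>\<^sub>E X \<union> Y" using B(1,3) X Y by (auto simp: PiE_def)
      ultimately show "snd (B, e) \<in> emb A (X \<union> Y) R" by (auto simp: emb_def)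
    qed
  qed auto
  then show ?thesis
    using conv_S_eq_card_split_emb[OF fin True] True by (simp add: S_def)
qed (simp add: S_def conv_S_not_sepset)

text \<open>Isomorphism of the induced subgraphs. It says nothing about the complements; that these
  are isomorphic as well follows for closed sets from \<open>giso_cancel\<close>.\<close>

definition giso :: "nat set \<Rightarrow> nat set \<Rightarrow> bool" where
  "giso A B \<longleftrightarrow> (\<exists>h. bij_betw h A B \<and> (\<forall>u\<in>A. \<forall>v\<in>A. E u v \<longleftrightarrow> E (h u) (h v)))"

lemma giso_refl: "giso A A"
  unfolding giso_def by (rule exI[of _ id]) (auto simp: bij_betw_def)

lemma giso_sym: assumes "giso A B" shows "giso B A"
proof -
  from assms obtain h where h: "bij_betw h A B" "\<And>u v. u \<in> A \<Longrightarrow> v \<in> A \<Longrightarrow> E u v \<longleftrightarrow> E (h u) (h v)"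
    by (auto simp: giso_def)
  have "bij_betw (inv_into A h) B A" using h(1) by (rule bij_betw_inv_into)
  moreover have "E u v \<longleftrightarrow> E (inv_into A h u) (inv_into A h v)" if "u \<in> B" "v \<in> B" for u v
    using h that by (metis bij_betw_def f_inv_into_f inv_into_into)
  ultimately show ?thesis by (auto simp: giso_def)
qed

lemma giso_trans: assumes "giso A B" "giso B C" shows "giso A C"
proof -
  from assms obtain h g where h: "bij_betw h A B" "\<forall>u\<in>A. \<forall>v\<in>A. E u v \<longleftrightarrow> E (h u) (h v)"
    and g: "bij_betw g B C" "\<forall>u\<in>B. \<forall>v\<in>B. E u v \<longleftrightarrow> E (g u) (g v)"
    by (auto simp: giso_def)
  have "bij_betw (g \<circ> h) A C" using h(1) g(1) bij_betw_trans by blast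
  moreover have "\<And>u. u \<in> A \<Longrightarrow> h u \<in> B" using h(1) by (auto simp: bij_betw_def)
  ultimately show ?thesis unfolding giso_def using h(2) g(2) by (intro exI[of _ "g \<circ> h"]) auto
qed

lemma giso_card: "giso A B \<Longrightarrow> card A = card B"
  unfolding giso_def using bij_betw_same_card by blast

lemma giso_Un:
  assumes "giso A B" "giso A' B'" "A \<inter> A' = {}" "B \<inter> B' = {}"
    and nA: "\<And>u v. u \<in> A \<Longrightarrow> v \<in> A' \<Longrightarrow> \<not> E u v" and nB: "\<And>u v. u \<in> B \<Longrightarrow> v \<in> B' \<Longrightarrow> \<not> E u v"
  shows "giso (A \<union> A') (B \<union> B')"
proof -
  from assms obtain h g where h: "bij_betw h A B" "\<And>u v. u \<in> A \<Longrightarrow> v \<in> A \<Longrightarrow> E u v \<longleftrightarrow> E (h u) (h v)"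
    and g: "bij_betw g A' B'" "\<And>u v. u \<in> A' \<Longrightarrow> v \<in> A' \<Longrightarrow> E u v \<longleftrightarrow> E (g u) (g v)"
    by (auto simp: giso_def)
  let ?f = "\<lambda>u. if u \<in> A then h u else g u"
  have "bij_betw ?f A B" using h(1) by (subst bij_betw_cong[of _ _ h]) auto
  moreover have "bij_betw ?f A' B'"
    using g(1) assms(3) by (subst bij_betw_cong[of _ _ g]) auto
  ultimately have "bij_betw ?f (A \<union> A') (B \<union> B')" using assms(4) by (rule bij_betw_combine)
  moreover have hB: "\<And>u. u \<in> A \<Longrightarrow> h u \<in> B" "\<And>u. u \<in> A' \<Longrightarrow> g u \<in> B'"
    using h(1) g(1) by (auto simp: bij_betw_def)
  have "E u v \<longleftrightarrow> E (?f u) (?f v)" if "u \<in> A \<union> A'" "v \<in> A \<union> A'" for u v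
  proof (cases "u \<in> A"; cases "v \<in> A")
    assume "u \<in> A" "v \<notin> A"
    then show ?thesis using nA[of u v] nB[of "h u" "g v"] hB that by simp
  next
    assume "u \<notin> A" "v \<in> A"
    then show ?thesis using nA[of v u] nB[of "h v" "g u"] hB that E_sym by (metis UnE)
  qed (use h(2) g(2) that in auto)
  ultimately show ?thesis unfolding giso_def by blast
qed

lemma giso_subset:
  assumes "bij_betw h A B" "\<And>u v. u \<in> A \<Longrightarrow> v \<in> A \<Longrightarrow> E u v \<longleftrightarrow> E (h u) (h v)" "C \<subseteq> A"
  shows "giso C (h ` C)"
  unfolding giso_def using assms by (intro exI[of _ h]) (auto simp: bij_betw_def inj_on_subset)

text \<open>
  Cancellation for disjoint unions. Inside \<open>D\<close> the induction hypothesis cancels \<open>D \<inter> F\<close> against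
  its preimage, so \<open>D - F\<close> and \<open>F - D\<close> are isomorphic and can be exchanged.
\<close>

lemma giso_cancel:
  assumes "finite X" "D \<subseteq> X" "F \<subseteq> X" "giso D F"
    and "\<And>u v. u \<in> D \<Longrightarrow> v \<in> X - D \<Longrightarrow> \<not> E u v" "\<And>u v. u \<in> F \<Longrightarrow> v \<in> X - F \<Longrightarrow> \<not> E u v"
  shows "giso (X - D) (X - F)"
  using assms
proof (induction "card X" arbitrary: X D F rule: less_induct)
  case less
  note sD = less.prems(5) and sF = less.prems(6)
  show ?case
  proof (cases "D = X")
    case True
    then have "card F = card X" using less.prems giso_card by metis
    then have "F = X" using less.prems card_subset_eq by blast
    then show ?thesis using True giso_refl by simp
  next
    case False
    then have "card D < card X" "finite D"
      using less.prems by (auto intro: psubset_card_mono finite_subset)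
    from less.prems obtain h where h: "bij_betw h D F"
        "\<And>u v. u \<in> D \<Longrightarrow> v \<in> D \<Longrightarrow> E u v \<longleftrightarrow> E (h u) (h v)"
      by (auto simp: giso_def)
    have hF: "\<And>u. u \<in> D \<Longrightarrow> h u \<in> F" and him: "h ` D = F" and hinj: "inj_on h D"
      using h(1) by (auto simp: bij_betw_def)
    define D2 where "D2 = {u\<in>D. h u \<in> D}"
    have im2: "h ` D2 = D \<inter> F" unfolding D2_def using him by auto
    have im3: "h ` (D - D2) = F - D" unfolding D2_def using him by auto
    have "giso D2 (D \<inter> F)" using giso_subset[OF h, of D2] im2 D2_def by auto
    then have "giso (D - D2) (D - (D \<inter> F))"
    proof (rule less.hyps[OF \<open>card D < card X\<close> \<open>finite D\<close>, rotated 2])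
      fix u v assume "u \<in> D2" "v \<in> D - D2"
      then show "\<not> E u v" using sD[of "h u" "h v"] hF[of v] h(2)[of u v] less.prems(3) by (auto simp: D2_def)
    next
      fix u v assume "u \<in> D \<inter> F" "v \<in> D - (D \<inter> F)"
      then show "\<not> E u v" using sF[of u v] less.prems by auto
    qed (auto simp: D2_def)
    moreover have "giso (D - D2) (F - D)" using giso_subset[OF h, of "D - D2"] im3 by auto
    ultimately have "giso (F - D) (D - F)"
      by (metis Diff_Int2 Diff_Int_distrib2 Int_absorb giso_sym giso_trans Diff_Int Diff_cancel Un_empty_left)
    then have "giso ((F - D) \<union> (X - D - F)) ((D - F) \<union> (X - D - F))"
      by (rule giso_Un) (use giso_refl sD sF in auto)
    moreover have "(F - D) \<union> (X - D - F) = X - D" "(D - F) \<union> (X - D - F) = X - F"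
      using less.prems by auto
    ultimately show ?thesis by simp
  qed
qed

lemma sepset_giso_compl:
  assumes "sepset A" "sepset B" "giso A B" shows "giso (V - A) (V - B)"
  by (rule giso_cancel) (use assms sepset_def in auto)

lemma sepset_giso_compl_iff:
  assumes "sepset A" "sepset B" shows "giso (V - A) (V - B) \<longleftrightarrow> giso A B"
proof -
  have "V - (V - A) = A" "V - (V - B) = B" using assms sepset_subset by auto
  then show ?thesis
    using sepset_giso_compl[OF assms] sepset_giso_compl[of "V - A" "V - B"] assms sepset_Diff sepset_V
    by metis
qed

text \<open>Functions on the isomorphism classes of closed sets, extended by zero. The vectors of
  the algorithm are coordinates in this space, whose dimension is the number of classes and not that
  of closed sets.\<close>

definition inv :: "(nat set \<Rightarrow> int) \<Rightarrow> bool" where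
  "inv s \<longleftrightarrow> (\<forall>A. \<not> sepset A \<longrightarrow> s A = 0) \<and>
     (\<forall>A B. sepset A \<longrightarrow> sepset B \<longrightarrow> giso A B \<longrightarrow> s A = s B)"

lemma emb_giso_le:
  assumes "giso A B" "finite X" "finite A" shows "card (emb B X R) \<le> card (emb A X R)"
proof -
  from assms(1) obtain h where h: "bij_betw h A B" "\<forall>u\<in>A. \<forall>v\<in>A. E u v \<longleftrightarrow> E (h u) (h v)"
    by (auto simp: giso_def)
  have hB: "\<And>u. u \<in> A \<Longrightarrow> h u \<in> B" "inj_on h A" "h ` A = B" using h(1) by (auto simp: bij_betw_def)
  show ?thesis
  proof (rule card_inj_on_le)
    show "inj_on (\<lambda>f. restrict (f \<circ> h) A) (emb B X R)"
    proof (rule inj_onI)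
      fix f g assume f: "f \<in> emb B X R" and g: "g \<in> emb B X R"
        and eq: "restrict (f \<circ> h) A = restrict (g \<circ> h) A"
      have "f v = g v" if "v \<in> B" for v
      proof -
        from that obtain u where "u \<in> A" "v = h u" using hB by auto
        then show ?thesis using fun_cong[OF eq, of u] by simp
      qed
      then show "f = g" using f g unfolding emb_def by (auto intro: PiE_ext)
    qed
    show "(\<lambda>f. restrict (f \<circ> h) A) ` emb B X R \<subseteq> emb A X R"
      using hB h(2) by (auto simp: emb_def inj_on_def)
    show "finite (emb A X R)" using assms finite_emb by blast
  qed
qed

lemma inv_S: "finite X \<Longrightarrow> inv (S X R)"
  unfolding inv_def S_def
  by (auto intro!: antisym emb_giso_le intro: giso_sym sepset_finite)

lemma inv_diff: "inv s \<Longrightarrow> inv t \<Longrightarrow> inv (\<lambda>A. s A - t A)"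
  unfolding inv_def by auto

lemma inv_sum: "(\<And>i. i \<in> I \<Longrightarrow> inv (s i)) \<Longrightarrow> inv (\<lambda>A. \<Sum>i\<in>I. c i * s i A)"
  unfolding inv_def by (auto intro!: sum.neutral sum.cong)


end

section \<open>Weights and the triangular pairing\<close>

context pattern
begin

definition arcs :: "nat set \<Rightarrow> (nat \<times> nat) set" where
  "arcs A = {(u, v). u \<in> A \<and> v \<in> A \<and> E u v}"

text \<open>Vertices alone would not do: a spanning subgraph has as many as the whole graph. With
  the arcs added (each edge counted in both directions), equality of weights turns an embedding into
  an isomorphism, and the weight is still additive over separations.\<close>

definition wt :: "nat set \<Rightarrow> nat" where
  "wt A = card A + card (arcs A)"

definition g :: "nat set \<Rightarrow> nat set \<Rightarrow> int" where
  "g B = S B E"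

lemma arcs_subset: "arcs A \<subseteq> A \<times> A"
  by (auto simp: arcs_def)

lemma finite_arcs: "finite A \<Longrightarrow> finite (arcs A)"
  using arcs_subset finite_cartesian_product finite_subset by metis

lemma wt_le: assumes "A \<subseteq> V" shows "wt A \<le> k + k * k"
proof -
  have fA: "finite A" using assms by (rule finite_subset) simp
  have cA: "card A \<le> k" using assms card_mono[of V A] by simp
  have "card (arcs A) \<le> card (A \<times> A)" using fA arcs_subset by (intro card_mono) auto
  also have "\<dots> \<le> k * k" using cA by (simp add: card_cartesian_product mult_le_mono)
  finally show ?thesis unfolding wt_def using cA by simp
qed

text \<open>No arc joins a closed set to its complement, so the arcs split along with the
  vertices.\<close>

lemma wt_sepset_compl:
  assumes "sepset B" shows "wt B + wt (V - B) = wt V"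
proof -
  have "arcs V = arcs B \<union> arcs (V - B)"
    using sepset_edge[OF assms] sepset_subset[OF assms] by (auto simp: arcs_def)
  moreover have "arcs B \<inter> arcs (V - B) = {}" by (auto simp: arcs_def)
  ultimately have "card (arcs V) = card (arcs B) + card (arcs (V - B))"
    using finite_arcs sepset_finite[OF assms] by (simp add: card_Un_disjoint)
  moreover have "card V = card B + card (V - B)"
    using sepset_subset[OF assms] by (metis card_Diff_subset card_mono finite_lessThan le_add_diff_inverse sepset_finite[OF assms])
  ultimately show ?thesis by (simp add: wt_def)
qed

lemma emb_arcs:
  assumes "f \<in> emb A B E"
  shows "inj_on (map_prod f f) (arcs A)" "map_prod f f ` arcs A \<subseteq> arcs B"
  using assms by (auto simp: emb_def arcs_def inj_on_def)

text \<open>An embedding is injective on vertices and on arcs. If both numbers agree, it is onto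
  both finite sets, so it reflects edges as well.\<close>

lemma emb_wt:
  assumes f: "f \<in> emb A B E" and fin: "finite A" "finite B"
  shows "card A \<le> card B" "card (arcs A) \<le> card (arcs B)"
    "card A = card B \<Longrightarrow> card (arcs A) = card (arcs B) \<Longrightarrow>
       bij_betw f A B \<and> (\<forall>u\<in>A. \<forall>v\<in>A. E u v \<longleftrightarrow> E (f u) (f v))"
proof -
  have fB: "f ` A \<subseteq> B" and inj: "inj_on f A"
    and e: "\<And>u v. u \<in> A \<Longrightarrow> v \<in> A \<Longrightarrow> E u v \<Longrightarrow> E (f u) (f v)" using f by (auto simp: emb_def)
  note arc = emb_arcs[OF f] and fa = finite_arcs[OF fin(2)]
  show "card A \<le> card B" using fB inj fin card_inj_on_le by blast
  show "card (arcs A) \<le> card (arcs B)" using arc fa card_inj_on_le by blast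
  assume c: "card A = card B" "card (arcs A) = card (arcs B)"
  have "f ` A = B" using c(1) fB inj fin by (metis card_image card_subset_eq)
  moreover have im: "map_prod f f ` arcs A = arcs B"
    using c(2) arc fa by (metis card_image card_subset_eq)
  have "E u v" if uv: "u \<in> A" "v \<in> A" "E (f u) (f v)" for u v
  proof -
    have "(f u, f v) \<in> arcs B" using uv fB by (auto simp: arcs_def)
    then obtain u' v' where "(u', v') \<in> arcs A" "f u = f u'" "f v = f v'" using im by force
    then show ?thesis using inj uv by (auto simp: arcs_def dest: inj_onD)
  qed
  ultimately show "bij_betw f A B \<and> (\<forall>u\<in>A. \<forall>v\<in>A. E u v \<longleftrightarrow> E (f u) (f v))"
    using e inj by (auto simp: bij_betw_def)
qed

lemma g_nonzero:
  assumes "g B A \<noteq> 0" "finite B"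
  shows "sepset A" "wt A \<le> wt B" "wt A = wt B \<Longrightarrow> giso A B"
proof -
  show sA: "sepset A" using assms by (auto simp: g_def S_def split: if_splits)
  then have "emb A B E \<noteq> {}" using assms by (auto simp: g_def S_def split: if_splits)
  then obtain f where f: "f \<in> emb A B E" by blast
  note w = emb_wt[OF f sepset_finite[OF sA] assms(2)]
  show "wt A \<le> wt B" using w by (simp add: wt_def)
  assume "wt A = wt B"
  then have "card A = card B" "card (arcs A) = card (arcs B)" using w(1,2) by (auto simp: wt_def)
  then show "giso A B" using w(3) by (auto simp: giso_def)
qed

lemma g_self_pos: assumes "sepset A" shows "0 < g A A"
proof -
  have "restrict id A \<in> emb A A E" by (auto simp: emb_def inj_on_def)
  then have "0 < card (emb A A E)"
    using finite_emb sepset_finite[OF assms] card_gt_0_iff by blast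
  then show ?thesis using assms by (simp add: g_def S_def)
qed

lemma g_nonneg: "0 \<le> g B A"
  by (simp add: g_def S_nonneg)

lemma inv_g: "finite B \<Longrightarrow> inv (g B)"
  unfolding g_def by (rule inv_S)

text \<open>In a nonzero term \<open>P[V - B]\<close> embeds into \<open>P[V - C]\<close>, so
  \<open>V - B\<close> weighs at most as much as \<open>V - C\<close>. Weights of complementary sets
  add up to \<open>wt V\<close>, which turns the inequality around to
  \<open>wt C \<le> wt B\<close>.\<close>

lemma conv_g_nonzero:
  assumes "conv s (g (V - C)) V \<noteq> 0" "sepset C" "\<And>B. s B \<noteq> 0 \<Longrightarrow> P B \<and> sepset B"
  shows "\<exists>B. P B \<and> sepset B \<and> wt C \<le> wt B \<and> (wt B = wt C \<longrightarrow> giso B C)"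
proof -
  obtain B where "s B * g (V - C) (V - B) \<noteq> 0"
    using assms(1) unfolding conv_def by (meson sum.not_neutral_contains_not_neutral)
  then have B: "s B \<noteq> 0" "g (V - C) (V - B) \<noteq> 0" by auto
  have sB: "P B" "sepset B" using assms(3) B(1) by auto
  have le: "wt (V - B) \<le> wt (V - C)" using g_nonzero(2)[OF B(2)] by simp
  have eq: "wt B + wt (V - B) = wt C + wt (V - C)"
    using wt_sepset_compl sB assms(2) by metis
  then have "wt B = wt C \<longrightarrow> giso (V - B) (V - C)"
    using g_nonzero(3)[OF B(2)] by simp
  then show ?thesis using sB le eq sepset_giso_compl_iff[OF sB(2) assms(2)] by auto
qed

text \<open>The pairing with the hosts \<open>P[V - C]\<close> is triangular in \<open>wt\<close>, hence it separates elements.\<close>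

lemma pairing_nondegenerate:
  assumes s: "inv s" and Rs: "\<And>A. sepset A \<Longrightarrow> \<exists>C\<in>Rs. sepset C \<and> giso A C"
    and zero: "\<And>C. C \<in> Rs \<Longrightarrow> sepset C \<Longrightarrow> conv s (g (V - C)) V = 0"
  shows "s A = 0"
proof (rule ccontr)
  assume "s A \<noteq> 0"
  then have ne: "{B \<in> Pow V. s B \<noteq> 0} \<noteq> {}" and sep: "\<And>B. s B \<noteq> 0 \<Longrightarrow> sepset B"
    using s sepset_subset unfolding inv_def by blast+
  have fin: "finite {B \<in> Pow V. s B \<noteq> 0}" by simp
  obtain A0 where A0: "s A0 \<noteq> 0" and max: "\<And>B. s B \<noteq> 0 \<Longrightarrow> wt B \<le> wt A0"
  proof -
    have "Max (wt ` {B \<in> Pow V. s B \<noteq> 0}) \<in> wt ` {B \<in> Pow V. s B \<noteq> 0}"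
      using ne fin by (intro Max_in) auto
    then obtain A0 where "s A0 \<noteq> 0" "wt A0 = Max (wt ` {B \<in> Pow V. s B \<noteq> 0})" by auto
    moreover have "wt B \<le> Max (wt ` {B \<in> Pow V. s B \<noteq> 0})" if "s B \<noteq> 0" for B
      using fin sepset_subset[OF sep[OF that]] that by (intro Max_ge) auto
    ultimately show ?thesis using that by metis
  qed
  obtain C where C: "C \<in> Rs" "sepset C" "giso A0 C" using Rs[OF sep[OF A0]] by blast
  have sC: "s C = s A0" using s C sep[OF A0] unfolding inv_def by metis
  have wtC: "wt B \<le> wt C" if "s B \<noteq> 0" for B
  proof -
    obtain h where "bij_betw h A0 C" "\<forall>u\<in>A0. \<forall>v\<in>A0. E u v \<longleftrightarrow> E (h u) (h v)"
      using C(3) by (auto simp: giso_def)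
    then have h: "restrict h A0 \<in> emb A0 C E" by (auto simp: emb_def bij_betw_def inj_on_def)
    have "wt A0 \<le> wt C"
      unfolding wt_def
      using emb_wt(1,2)[OF h sepset_finite[OF sep[OF A0]] sepset_finite[OF C(2)]] by (rule add_mono)
    then show ?thesis using max[OF that] by simp
  qed
  \<comment> \<open>Multiplying by \<open>s C\<close> removes the sign. A nonzero term needs
    \<open>wt C \<le> wt B\<close>, maximality forces equality, so \<open>B\<close> is isomorphic to
    \<open>C\<close> and the term is the square of \<open>s C\<close> times a count. The term for
    \<open>C\<close> itself is positive, hence the pairing with \<open>C\<close> cannot
    vanish.\<close>
  let ?t = "\<lambda>B. s C * (s B * g (V - C) (V - B))"
  have pos: "0 \<le> ?t B" if "B \<subseteq> V" for B
  proof (cases "s B * g (V - C) (V - B) = 0")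
    case False
    then have B: "s B \<noteq> 0" "g (V - C) (V - B) \<noteq> 0" by auto
    have "wt (V - B) \<le> wt (V - C)" using g_nonzero(2)[OF B(2)] by simp
    moreover have eq: "wt B + wt (V - B) = wt C + wt (V - C)"
      using wt_sepset_compl sep[OF B(1)] C(2) by metis
    ultimately have "wt (V - B) = wt (V - C)" using wtC[OF B(1)] by simp
    then have "giso (V - B) (V - C)" using g_nonzero(3)[OF B(2)] by simp
    then have "giso B C" using sepset_giso_compl_iff sep[OF B(1)] C(2) by blast
    then have "s B = s C" using s sep[OF B(1)] C(2) unfolding inv_def by blast
    then show ?thesis using g_nonneg[of "V - C" "V - B"] by (simp flip: mult.assoc)
  qed (simp only: mult_zero_right order_refl)
  have "0 < ?t C"
    using g_self_pos[of "V - C"] C(2) sepset_Diff sepset_V A0 sC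
    by (simp flip: mult.assoc add: zero_less_mult_iff) (metis linorder_neqE_linordered_idom)
  then have "0 < (\<Sum>B\<in>Pow V. ?t B)"
    using pos sepset_subset[OF C(2)] by (intro sum_pos2[of _ C]) auto
  then have "s C * conv s (g (V - C)) V \<noteq> 0"
    unfolding conv_def by (simp add: sum_distrib_left)
  then show False using zero C by simp
qed

text \<open>This is the order of Aut(P): an injective edge-preserving map of a finite graph into
  itself is an automorphism.\<close>

definition alpha :: int where "alpha = S V E V"

text \<open>\<open>P\<close> is the disjoint union of \<open>P[C]\<close> and
  \<open>P[V - C]\<close>, so the pairing of a closed set with itself counts the automorphisms of
  \<open>P\<close>. Division by \<open>alpha\<close> turns it into the diagonal entry 1.\<close>

lemma conv_g_self: assumes "sepset C" shows "conv (g C) (g (V - C)) V = alpha"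
proof -
  have "S (C \<union> (V - C)) E V = conv (S C E) (S (V - C) E) V"
    using sepset_edge[OF assms] sepset_subset[OF assms] sepset_finite[OF assms]
    by (intro S_disjoint_union) auto
  moreover have "C \<union> (V - C) = V" using sepset_subset[OF assms] by auto
  ultimately show ?thesis by (simp add: alpha_def g_def)
qed

lemma alpha_pos: "0 < alpha"
  using g_self_pos[OF sepset_V] by (simp add: alpha_def g_def)

lemma conv_g_g:
  assumes "conv (g A) (g (V - C)) V \<noteq> 0" "sepset A" "sepset C"
  shows "wt C \<le> wt A" "wt A = wt C \<Longrightarrow> giso A C"
proof -
  obtain B where B: "wt B \<le> wt A \<and> (wt B = wt A \<longrightarrow> giso B A)" "wt C \<le> wt B" "wt B = wt C \<longrightarrow> giso B C"
    using conv_g_nonzero[OF assms(1,3), of "\<lambda>B. wt B \<le> wt A \<and> (wt B = wt A \<longrightarrow> giso B A)"]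
      g_nonzero[of A] sepset_finite[OF assms(2)] by blast
  show "wt C \<le> wt A" using B by simp
  assume "wt A = wt C"
  then show "giso A C" using B giso_trans giso_sym by (metis le_antisym)
qed

text \<open>A positive pairing bounds \<open>wt C\<close> by \<open>wt A\<close>; two positive
  pairings make the weights equal, where triangularity leaves only isomorphic sets. Thus two oracle
  queries replace a search for an isomorphism.\<close>

lemma giso_iff_pairing:
  assumes "sepset A" "sepset C"
  shows "giso A C \<longleftrightarrow> 0 < conv (g A) (g (V - C)) V \<and> 0 < conv (g C) (g (V - A)) V"
proof
  assume iso: "giso A C"
  have g: "g A B = g C B" for B
  proof -
    obtain h where "bij_betw h A C" "\<forall>u\<in>A. \<forall>v\<in>A. E u v \<longleftrightarrow> E (h u) (h v)"
      using iso by (auto simp: giso_def)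
    then show ?thesis unfolding g_def using sepset_finite[OF assms(1)] by (intro S_host_iso) auto
  qed
  have "conv (g A) (g (V - C)) V = alpha" "conv (g C) (g (V - A)) V = alpha"
    using conv_g_self[OF assms(1)] conv_g_self[OF assms(2)] conv_cong[of V "g A" "g C"] g by metis+
  then show "0 < conv (g A) (g (V - C)) V \<and> 0 < conv (g C) (g (V - A)) V" using alpha_pos by simp
next
  assume "0 < conv (g A) (g (V - C)) V \<and> 0 < conv (g C) (g (V - A)) V"
  then show "giso A C" using conv_g_g assms by (metis less_irrefl le_antisym)
qed

text \<open>Precomposition with automorphisms permutes the embeddings with a given image freely.\<close>

lemma alpha_dvd: assumes "finite X" shows "alpha dvd S X R V"
proof -
  \<comment> \<open>The image is recorded as a subgraph, arcs included: the host may have further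
    edges among the same vertices, and then two maps with equal vertex images need not differ by an
    automorphism.\<close>
  define I where "I f = (f ` V, map_prod f f ` arcs V)" for f :: "nat \<Rightarrow> 'a"
  let ?A = "emb V X R"
  have fin: "finite ?A" using assms finite_emb by blast
  have fib: "card {f' \<in> ?A. I f' = I f} = card (emb V V E)" if f: "f \<in> ?A" for f
  proof (rule bij_betw_same_card[symmetric, of "\<lambda>\<phi>. restrict (f \<circ> \<phi>) V"],
      rule bij_betw_byWitness[where f' = "\<lambda>f'. restrict (inv_into V f \<circ> f') V"])
    have inj: "inj_on f V" and fX: "\<And>u. u \<in> V \<Longrightarrow> f u \<in> X"
      and fR: "\<And>u v. u \<in> V \<Longrightarrow> v \<in> V \<Longrightarrow> E u v \<Longrightarrow> R (f u) (f v)" using f by (auto simp: emb_def)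
    show "\<forall>\<phi>\<in>emb V V E. restrict (inv_into V f \<circ> restrict (f \<circ> \<phi>) V) V = \<phi>"
    proof
      fix \<phi> assume p: "\<phi> \<in> emb V V E"
      have "restrict (inv_into V f \<circ> restrict (f \<circ> \<phi>) V) V u = \<phi> u" for u
      proof (cases "u \<in> V")
        case True
        then have "\<phi> u \<in> V" using p by (auto simp: emb_def)
        then show ?thesis using True inv_into_f_f[OF inj] by simp
      next
        case False
        then show ?thesis using p by (auto simp: emb_def PiE_def extensional_def)
      qed
      then show "restrict (inv_into V f \<circ> restrict (f \<circ> \<phi>) V) V = \<phi>" ..
    qed
    show "\<forall>f'\<in>{f' \<in> ?A. I f' = I f}. restrict (f \<circ> restrict (inv_into V f \<circ> f') V) V = f'"
    proof
      fix f' assume f': "f' \<in> {f' \<in> ?A. I f' = I f}"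
      have "restrict (f \<circ> restrict (inv_into V f \<circ> f') V) V u = f' u" for u
      proof (cases "u \<in> V")
        case True
        then have "f' u \<in> f ` V" using f' by (auto simp: I_def)
        then show ?thesis using True by (simp add: f_inv_into_f)
      next
        case False
        then show ?thesis using f' by (auto simp: emb_def PiE_def extensional_def)
      qed
      then show "restrict (f \<circ> restrict (inv_into V f \<circ> f') V) V = f'" ..
    qed
    show "(\<lambda>\<phi>. restrict (f \<circ> \<phi>) V) ` emb V V E \<subseteq> {f' \<in> ?A. I f' = I f}"
    proof safe
      fix \<phi> assume p: "\<phi> \<in> emb V V E"
      have pV: "\<And>u. u \<in> V \<Longrightarrow> \<phi> u \<in> V" using p by (auto simp: emb_def)
      have pp: "bij_betw \<phi> V V" "\<And>u v. u \<in> V \<Longrightarrow> v \<in> V \<Longrightarrow> E u v \<longleftrightarrow> E (\<phi> u) (\<phi> v)"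
        using emb_wt(3)[OF p] by auto
      have pim: "\<phi> ` V = V" "map_prod \<phi> \<phi> ` arcs V = arcs V"
      proof -
        show "\<phi> ` V = V" using pp by (simp add: bij_betw_def)
        show "map_prod \<phi> \<phi> ` arcs V = arcs V"
          by (rule card_subset_eq) (use emb_arcs[OF p] finite_arcs in \<open>auto intro: card_image\<close>)
      qed
      show "restrict (f \<circ> \<phi>) V \<in> ?A"
        using p pV fX fR inj by (auto simp: emb_def inj_on_def)
      have "restrict (f \<circ> \<phi>) V ` V = f ` V" using pim(1) by (simp add: image_comp[symmetric] del: o_apply)
      moreover have "map_prod (restrict (f \<circ> \<phi>) V) (restrict (f \<circ> \<phi>) V) ` arcs V =
          map_prod f f ` (map_prod \<phi> \<phi> ` arcs V)"
        unfolding image_image by (rule image_cong) (auto simp: arcs_def)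
      ultimately show "I (restrict (f \<circ> \<phi>) V) = I f" using pim by (simp add: I_def)
    qed
    show "(\<lambda>f'. restrict (inv_into V f \<circ> f') V) ` {f' \<in> ?A. I f' = I f} \<subseteq> emb V V E"
    proof safe
      fix f' assume f': "f' \<in> ?A" "I f' = I f"
      have im: "f' ` V = f ` V" "map_prod f' f' ` arcs V = map_prod f f ` arcs V"
        using f'(2) by (auto simp: I_def)
      have inj': "inj_on f' V" using f'(1) by (simp add: emb_def)
      have fu: "f (inv_into V f (f' u)) = f' u" "inv_into V f (f' u) \<in> V" if "u \<in> V" for u
        using im(1) that by (metis f_inv_into_f imageI, metis imageI inv_into_into)
      have "inj_on (\<lambda>u. inv_into V f (f' u)) V"
        using inj' fu(1) by (intro inj_onI) (metis inj_onD)
      moreover have "E (inv_into V f (f' u)) (inv_into V f (f' v))" if "u \<in> V" "v \<in> V" "E u v" for u v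
      proof -
        have "(f' u, f' v) \<in> map_prod f f ` arcs V"
          using that im(2) by (force simp: arcs_def)
        then obtain a b where ab: "a \<in> V" "b \<in> V" "E a b" "f' u = f a" "f' v = f b"
          by (auto simp: arcs_def)
        then show ?thesis using inv_into_f_f[OF inj] by metis
      qed
      ultimately show "restrict (inv_into V f \<circ> f') V \<in> emb V V E"
        using fu(2) by (auto simp: emb_def inj_on_def)
    qed
  qed
  have "card ?A = (\<Sum>J\<in>I ` ?A. card {f' \<in> ?A. I f' = J})"
    using sum.image_gen[OF fin, of "\<lambda>_. 1::nat" I] by simp
  also have "\<dots> = (\<Sum>J\<in>I ` ?A. card (emb V V E))"
    by (rule sum.cong) (use fib in auto)
  finally show ?thesis unfolding alpha_def S_def by simp
qed

end

text \<open>A shortest walk visits no vertex twice, since the stretch between two visits could be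
  cut out; hence it has fewer steps than there are vertices.\<close>

lemma rtrancl_short:
  assumes "(x, y) \<in> r\<^sup>*" and r: "r \<subseteq> A \<times> A" and A: "finite A" "x \<in> A"
  shows "\<exists>j < card A. (x, y) \<in> r ^^ j"
proof -
  define j where "j = (LEAST j. (x, y) \<in> r ^^ j)"
  have "\<exists>j. (x, y) \<in> r ^^ j" using assms(1) by (simp add: rtrancl_power)
  then have j: "(x, y) \<in> r ^^ j" and least: "\<And>i. (x, y) \<in> r ^^ i \<Longrightarrow> j \<le> i"
    unfolding j_def by (auto intro: LeastI_ex Least_le)
  obtain f where f: "f 0 = x" "f j = y" "\<And>i. i < j \<Longrightarrow> (f i, f (Suc i)) \<in> r"
    using j by (auto simp: relpow_fun_conv)
  have path: "(f a, f b) \<in> r ^^ (b - a)" if "a \<le> b" "b \<le> j" for a b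
    unfolding relpow_fun_conv using that f(3) by (intro exI[of _ "\<lambda>i. f (a + i)"]) auto
  have ne: "f a \<noteq> f b" if "a < b" "b \<le> j" for a b
  proof
    assume "f a = f b"
    then have "(x, f a) \<in> r ^^ a" "(f a, y) \<in> r ^^ (j - b)"
      using path[of 0 a] path[of b j] that f(1,2) by auto
    then have "(x, y) \<in> r ^^ (a + (j - b))" unfolding relpow_add by (rule relcompI)
    then show False using least[of "a + (j - b)"] that by simp
  qed
  then have "inj_on f {..j}" by (metis atMost_iff linorder_inj_onI')
  moreover have "f ` {..j} \<subseteq> A"
  proof safe
    fix i assume "i \<le> j"
    then show "f i \<in> A" using f(1) A(2) f(3)[of "i - 1"] r by (cases i) auto
  qed
  ultimately have "card {..j} \<le> card A" using A(1) card_inj_on_le by blast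
  then show ?thesis using j by (auto simp: less_eq_Suc_le)
qed

section \<open>Exchanging clusters between two hosts\<close>

context pattern
begin

lemma restrict_embI:
  assumes "\<And>u. u \<in> C \<Longrightarrow> e u \<in> X" "inj_on e C" "\<And>u v. u \<in> C \<Longrightarrow> v \<in> C \<Longrightarrow> E u v \<Longrightarrow> R (e u) (e v)"
  shows "restrict e C \<in> emb C X R"
  using assms by (auto simp: emb_def inj_on_def)

text \<open>Both sides consist of a split \<open>B\<close> and a combined map \<open>e\<close>. The
  bijection keeps \<open>e\<close> and toggles the side of every vertex in \<open>T e\<close>; since
  \<open>T e\<close> does not depend on \<open>B\<close>, toggling twice is the identity, and the
  same map serves as inverse.\<close>

lemma split_emb_exchange:
  fixes R :: "'b \<Rightarrow> 'b \<Rightarrow> bool"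
  assumes A: "sepset A" and UZ: "U \<inter> Z = {}" and W: "W \<subseteq> U"
    and near: "\<And>z v j. z \<in> Z \<Longrightarrow> v \<in> U \<union> Z \<Longrightarrow> j < k \<Longrightarrow> (z, v) \<in> {(a, b). R a b \<or> a = b} ^^ j \<Longrightarrow> v \<in> W \<union> Z"
  shows "card (split_emb A (U \<union> Z) W R) = card (split_emb A U (W \<union> Z) R)"
proof -
  \<comment> \<open>The two maps may hit the same host vertex, because \<open>W\<close> lies inside
    \<open>U\<close>. Linking vertices with equal images makes such a pair change sides together,
    which keeps the map on each side injective.\<close>
  define rel where "rel e = {(u, v). u \<in> A \<and> v \<in> A \<and> (E u v \<or> e u = e v)}" for e :: "nat \<Rightarrow> 'b"
  define T where "T e = {u. \<exists>u0\<in>A. e u0 \<in> Z \<and> (u0, u) \<in> (rel e)\<^sup>*}" for e :: "nat \<Rightarrow> 'b"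
  define sw where "sw = (\<lambda>(B, e). (sym_diff B (T e), e))"
  have fA: "finite A" and AV: "A \<subseteq> V" using A sepset_finite sepset_subset by auto
  have relA: "rel e \<subseteq> A \<times> A" for e by (auto simp: rel_def)
  have TA: "T e \<subseteq> A" for e
  proof
    fix u assume "u \<in> T e"
    then obtain u0 where "u0 \<in> A" "(u0, u) \<in> (rel e)\<^sup>*" by (auto simp: T_def)
    then show "u \<in> A" using relA[of e] by (auto elim: rtranclE)
  qed
  have T_rel: "u \<in> T e \<longleftrightarrow> v \<in> T e" if "(u, v) \<in> rel e" for u v e
  proof -
    have "(v, u) \<in> rel e" using that E_sym by (auto simp: rel_def)
    then show ?thesis using that unfolding T_def by (auto intro: rtrancl.rtrancl_into_rtrancl)
  qed
  have T_Z: "u \<in> T e" if "u \<in> A" "e u \<in> Z" for u e using that by (auto simp: T_def)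
  have split: "B \<subseteq> A" "sepset B" "e \<in> extensional A" "\<And>u. u \<in> B \<Longrightarrow> e u \<in> X" "\<And>u. u \<in> A - B \<Longrightarrow> e u \<in> Y"
    "inj_on e B" "inj_on e (A - B)" "\<And>u v. u \<in> A \<Longrightarrow> v \<in> A \<Longrightarrow> E u v \<Longrightarrow> R (e u) (e v)"
    if q: "(B, e) \<in> split_emb A X Y R" for B e X Y
  proof -
    have e1: "restrict e B \<in> emb B X R" and e2: "restrict e (A - B) \<in> emb (A - B) Y R"
      using q by (auto simp: split_emb_def)
    show B: "B \<subseteq> A" "sepset B" "e \<in> extensional A" using q by (auto simp: split_emb_def)
    show "\<And>u. u \<in> B \<Longrightarrow> e u \<in> X" "\<And>u. u \<in> A - B \<Longrightarrow> e u \<in> Y" "inj_on e B" "inj_on e (A - B)"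
      using e1 e2 by (auto simp: emb_def PiE_def Pi_def inj_on_def)
    fix u v assume uv: "u \<in> A" "v \<in> A" "E u v"
    then have "u \<in> B \<longleftrightarrow> v \<in> B" using sepset_edge[OF B(2)] AV by blast
    then show "R (e u) (e v)" using uv e1 e2 by (auto simp: emb_def)
  qed
  \<comment> \<open>A link of \<open>rel e\<close> is sent to an edge of the host or to a single
    vertex, so the image of a vertex of \<open>T e\<close> is reached from \<open>Z\<close> by a
    walk with fewer than \<open>k\<close> steps, some of which may be pauses.\<close>
  have nearT: "e u \<in> W \<union> Z"
    if R: "\<And>u v. u \<in> A \<Longrightarrow> v \<in> A \<Longrightarrow> E u v \<Longrightarrow> R (e u) (e v)" and u: "u \<in> T e" "e u \<in> U \<union> Z" for e u
  proof -
    obtain u0 where u0: "u0 \<in> A" "e u0 \<in> Z" "(u0, u) \<in> (rel e)\<^sup>*" using u(1) by (auto simp: T_def)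
    obtain j where j: "j < card A" "(u0, u) \<in> rel e ^^ j"
      using rtrancl_short[OF u0(3) relA fA u0(1)] by blast
    have "(e u0, e u) \<in> {(a, b). R a b \<or> a = b} ^^ j"
    proof -
      obtain f where f: "f 0 = u0" "f j = u" "\<And>i. i < j \<Longrightarrow> (f i, f (Suc i)) \<in> rel e"
        using j(2) by (auto simp: relpow_fun_conv)
      have "R (e (f i)) (e (f (Suc i))) \<or> e (f i) = e (f (Suc i))" if "i < j" for i
        using f(3)[OF that] R by (auto simp: rel_def)
      then show ?thesis unfolding relpow_fun_conv using f by (intro exI[of _ "e \<circ> f"]) auto
    qed
    moreover have "j < k" using j(1) AV card_mono[of V A] by simp
    ultimately show ?thesis using near u0(2) u(2) by blast
  qed
  have sw: "sw (B, e) \<in> split_emb A X' Y' R"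
    if q: "(B, e) \<in> split_emb A X Y R"
      and c1: "\<And>u. u \<in> B \<Longrightarrow> u \<notin> T e \<Longrightarrow> e u \<in> X'" and c2: "\<And>u. u \<in> A \<Longrightarrow> u \<notin> B \<Longrightarrow> u \<in> T e \<Longrightarrow> e u \<in> X'"
      and c3: "\<And>u. u \<in> A \<Longrightarrow> u \<notin> B \<Longrightarrow> u \<notin> T e \<Longrightarrow> e u \<in> Y'" and c4: "\<And>u. u \<in> B \<Longrightarrow> u \<in> T e \<Longrightarrow> e u \<in> Y'"
    for B e X Y X' Y'
  proof -
    note s = split[OF q]
    let ?B = "sym_diff B (T e)"
    have BA: "?B \<subseteq> A" using s(1) TA by auto
    have sep: "sepset ?B" unfolding sepset_def
    proof (intro conjI ballI impI)
      fix u v assume u: "u \<in> ?B" and v: "v \<in> V" "E u v"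
      have uA: "u \<in> A" using u BA by blast
      then have vA: "v \<in> A" using v A by (auto simp: sepset_def)
      then have "(u, v) \<in> rel e" using uA v by (auto simp: rel_def)
      then have "u \<in> T e \<longleftrightarrow> v \<in> T e" by (rule T_rel)
      moreover have "u \<in> B \<longleftrightarrow> v \<in> B" using sepset_edge[OF s(2)] uA vA v AV by blast
      ultimately show "v \<in> ?B" using u by blast
    qed (use BA AV in auto)
    \<comment> \<open>Two vertices with equal images agree about membership in \<open>T e\<close>,
      so on a common new side they also had a common old side, where \<open>e\<close> is
      injective.\<close>
    have injB: "inj_on e C"
      if C: "C \<subseteq> A" "\<And>u v. u \<in> C \<Longrightarrow> v \<in> C \<Longrightarrow> u \<in> T e \<longleftrightarrow> v \<in> T e \<Longrightarrow> u \<in> B \<longleftrightarrow> v \<in> B" for C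
    proof (rule inj_onI)
      fix u v assume uv: "u \<in> C" "v \<in> C" "e u = e v"
      then have "(u, v) \<in> rel e" using C by (auto simp: rel_def)
      then have "u \<in> B \<longleftrightarrow> v \<in> B" using T_rel C uv by blast
      then show "u = v" using s(6,7) uv C(1) by (meson DiffI inj_onD subsetD)
    qed
    have "restrict e ?B \<in> emb ?B X' R"
    proof (rule restrict_embI)
      show "inj_on e ?B" using BA by (rule injB) blast
    qed (use c1 c2 s(8) BA TA in blast)+
    moreover have "restrict e (A - ?B) \<in> emb (A - ?B) Y' R"
    proof (rule restrict_embI)
      show "inj_on e (A - ?B)" by (rule injB) blast+
    qed (use c3 c4 s(8) in blast)+
    ultimately show ?thesis using BA sep sepset_Diff[OF A sep] s(3)
      unfolding split_emb_def sw_def by simp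
  qed
  have "bij_betw sw (split_emb A (U \<union> Z) W R) (split_emb A U (W \<union> Z) R)"
  proof (rule bij_betw_byWitness[where f' = sw])
    show "sw ` split_emb A (U \<union> Z) W R \<subseteq> split_emb A U (W \<union> Z) R"
    proof
      fix y assume "y \<in> sw ` split_emb A (U \<union> Z) W R"
      then obtain B e where y: "y = sw (B, e)" and q: "(B, e) \<in> split_emb A (U \<union> Z) W R" by auto
      note s = split[OF q]
      show "y \<in> split_emb A U (W \<union> Z) R" unfolding y
      proof (rule sw[OF q])
        fix u assume "u \<in> B" "u \<notin> T e" then show "e u \<in> U" using s(1,4) T_Z by blast
      next
        fix u assume "u \<in> B" "u \<in> T e" then show "e u \<in> W \<union> Z" using nearT s(4,8) by blast
      qed (use s(5) W in auto)
    qed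
    show "sw ` split_emb A U (W \<union> Z) R \<subseteq> split_emb A (U \<union> Z) W R"
    proof
      fix y assume "y \<in> sw ` split_emb A U (W \<union> Z) R"
      then obtain B e where y: "y = sw (B, e)" and q: "(B, e) \<in> split_emb A U (W \<union> Z) R" by auto
      note s = split[OF q]
      show "y \<in> split_emb A (U \<union> Z) W R" unfolding y
      proof (rule sw[OF q])
        fix u assume "u \<in> A" "u \<notin> B" "u \<in> T e" then show "e u \<in> U \<union> Z" using s(5) W by blast
      next
        fix u assume "u \<in> A" "u \<notin> B" "u \<notin> T e" then show "e u \<in> W" using s(5)[of u] T_Z by blast
      next
        fix u assume u: "u \<in> B" "u \<in> T e"
        then have "e u \<in> W \<union> Z" using nearT s(4,8) by blast
        then show "e u \<in> W" using s(4)[OF u(1)] UZ by blast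
      qed (use s(4) in auto)
    qed
  qed (auto simp: sw_def)
  then show ?thesis by (rule bij_betw_same_card)
qed

text \<open>
  Superposing the two maps on either side, exactly the clusters of overlapping components that meet
  \<open>Z\<close> are exchanged; such a cluster has at most \<open>k\<close> vertices, so it stays near \<open>Z\<close>.
\<close>

lemma S_exchange:
  fixes R :: "'b \<Rightarrow> 'b \<Rightarrow> bool"
  assumes "finite U" "finite Z" "U \<inter> Z = {}" "W \<subseteq> U"
    and "\<And>z v j. z \<in> Z \<Longrightarrow> v \<in> U \<union> Z \<Longrightarrow> j < k \<Longrightarrow> (z, v) \<in> {(a, b). R a b \<or> a = b} ^^ j \<Longrightarrow> v \<in> W \<union> Z"
  shows "conv (S (U \<union> Z) R) (S W R) A = conv (S U R) (S (W \<union> Z) R) A"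
proof (cases "sepset A")
  case True
  have "finite W" using assms finite_subset by blast
  moreover have "card (split_emb A (U \<union> Z) W R) = card (split_emb A U (W \<union> Z) R)"
    using True assms(3,4) by (rule split_emb_exchange) (rule assms(5))
  ultimately show ?thesis
    using conv_S_eq_card_split_emb[of "U \<union> Z" W A R] conv_S_eq_card_split_emb[of U "W \<union> Z" A R]
      True assms(1,2) by simp
qed (simp add: conv_S_not_sepset)

lemma S_empty_host: "S {} R A = (if A = {} then 1 else 0)"
  by (auto simp: S_def emb_empty) (auto simp: emb_def)

lemma conv_S_empty_host: assumes "finite A" shows "conv s (S {} R) A = s A"
proof -
  have "conv s (S {} R) A = s A * S {} R (A - A)"
    by (rule conv_eq_single) (use assms in \<open>auto simp: S_empty_host\<close>)
  then show ?thesis by simp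
qed

text \<open>The sum type keeps the two hosts apart, even if they live in different types. A
  convolution is therefore again counted by a host, so isomorphism invariance and divisibility by
  \<open>alpha\<close> carry over from \<open>S\<close> to products.\<close>

lemma conv_S_is_S:
  fixes X :: "'a set" and Y :: "'b set"
  assumes "finite X" "finite Y"
  obtains R :: "'a + 'b \<Rightarrow> 'a + 'b \<Rightarrow> bool"
  where "\<And>A. conv (S X RX) (S Y RY) A = S (X <+> Y) R A" "finite (X <+> Y)"
proof
  define R where "R p q = (case (p, q) of (Inl x, Inl x') \<Rightarrow> RX x x' | (Inr y, Inr y') \<Rightarrow> RY y y' | _ \<Rightarrow> False)"
    for p q
  fix A
  have "S X RX B = S (Inl ` X) R B" for B
    by (rule S_host_iso[of Inl]) (use assms in \<open>auto simp: bij_betw_def R_def\<close>)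
  moreover have "S Y RY B = S (Inr ` Y) R B" for B
    by (rule S_host_iso[of Inr]) (use assms in \<open>auto simp: bij_betw_def R_def\<close>)
  moreover have "S (Inl ` X \<union> Inr ` Y) R A = conv (S (Inl ` X) R) (S (Inr ` Y) R) A"
    by (rule S_disjoint_union) (use assms in \<open>auto simp: R_def\<close>)
  ultimately show "conv (S X RX) (S Y RY) A = S (X <+> Y) R A"
    unfolding Plus_def by (simp add: conv_def)
qed (use assms in simp)

lemma inv_conv_S:
  assumes "finite X" "finite Y" shows "inv (conv (S X RX) (S Y RY))"
proof -
  obtain R where "\<And>A. conv (S X RX) (S Y RY) A = S (X <+> Y) R A" "finite (X <+> Y)"
    by (rule conv_S_is_S[OF assms, of RX RY]) blast
  then show ?thesis using inv_S[of "X <+> Y" R] unfolding inv_def by metis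
qed

lemma alpha_dvd_conv:
  assumes "finite X" "finite Y" shows "alpha dvd conv (S X RX) (S Y RY) V"
proof -
  obtain R where R: "\<And>A. conv (S X RX) (S Y RY) A = S (X <+> Y) R A" "finite (X <+> Y)"
    by (rule conv_S_is_S[OF assms, of RX RY]) blast
  then show ?thesis using alpha_dvd[of "X <+> Y" R] by simp
qed

lemma alpha_dvd_conv3:
  assumes "finite X" "finite Y" "finite Z" shows "alpha dvd conv (conv (S X RX) (S Y RY)) (S Z RZ) V"
proof -
  obtain R where R: "\<And>A. conv (S X RX) (S Y RY) A = S (X <+> Y) R A" "finite (X <+> Y)"
    by (rule conv_S_is_S[OF assms(1,2), of RX RY]) blast
  then have "conv (conv (S X RX) (S Y RY)) (S Z RZ) V = conv (S (X <+> Y) R) (S Z RZ) V"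
    by (intro conv_cong) auto
  then show ?thesis using alpha_dvd_conv R(2) assms(3) by metis
qed

end

section \<open>Coordinates over representatives and their update\<close>

locale reps = pattern +
  fixes Rs :: "nat set list"
  assumes sep: "\<And>i. i < length Rs \<Longrightarrow> sepset (Rs ! i)"
    and complete: "\<And>A. sepset A \<Longrightarrow> \<exists>i < length Rs. giso A (Rs ! i)"
    and noniso: "\<And>i j. i < length Rs \<Longrightarrow> j < length Rs \<Longrightarrow> i \<noteq> j \<Longrightarrow> \<not> giso (Rs ! i) (Rs ! j)"
begin

abbreviation r :: nat where "r \<equiv> length Rs"

text \<open>For \<open>t = S X R\<close> the numerator counts the maps of \<open>P\<close> into
  \<open>P[A] + X + P[V - C]\<close>, where \<open>A\<close> and \<open>C\<close> are the rows
  \<open>a\<close> and \<open>c\<close>; this is the answer to one query. The division is exact by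
  \<open>alpha_Q\<close>.\<close>

definition Q :: "(nat set \<Rightarrow> int) \<Rightarrow> nat \<Rightarrow> nat \<Rightarrow> int" where
  "Q t a c = conv (conv (g (Rs ! a)) t) (g (V - Rs ! c)) V div alpha"

definition mv :: "(nat set \<Rightarrow> int) \<Rightarrow> (nat \<Rightarrow> int) \<Rightarrow> nat \<Rightarrow> int" where
  "mv t x c = (\<Sum>a<r. x a * Q t a c)"

definition xi :: "(nat \<Rightarrow> int) \<Rightarrow> nat set \<Rightarrow> int" where
  "xi x A = (\<Sum>a<r. x a * g (Rs ! a) A)"

lemma conv_xi: "conv (xi x) t A = (\<Sum>a<r. x a * conv (g (Rs ! a)) t A)"
proof -
  have "xi x = (\<lambda>B. \<Sum>a<r. x a * g (Rs ! a) B)" by (rule ext) (simp add: xi_def)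
  then show ?thesis by (simp only: conv_sum_left)
qed

lemma finite_rep: "i < r \<Longrightarrow> finite (Rs ! i)"
  using sep sepset_finite by blast

lemma alpha_Q:
  assumes "finite X" "a < r"
  shows "alpha * Q (S X R) a c = conv (conv (g (Rs ! a)) (S X R)) (g (V - Rs ! c)) V"
  unfolding Q_def g_def using assms finite_rep by (intro dvd_mult_div_cancel alpha_dvd_conv3) auto

text \<open>By bilinearity a matrix-vector product yields the pairings of
  \<open>conv (xi x) (S X R)\<close>. Adding a host \<open>X\<close> is thus carried out on the
  level of pairings, and \<open>xi_eqI\<close> leads back to coordinates.\<close>

lemma alpha_mv:
  assumes "finite X"
  shows "alpha * mv (S X R) x c = conv (conv (xi x) (S X R)) (g (V - Rs ! c)) V"
proof -
  have "alpha * mv (S X R) x c = (\<Sum>a<r. x a * (alpha * Q (S X R) a c))"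
    unfolding mv_def by (simp add: sum_distrib_left mult.left_commute)
  also have "\<dots> = (\<Sum>a<r. x a * conv (conv (g (Rs ! a)) (S X R)) (g (V - Rs ! c)) V)"
    using alpha_Q[OF assms] by simp
  also have "\<dots> = conv (\<lambda>A. \<Sum>a<r. x a * conv (g (Rs ! a)) (S X R) A) (g (V - Rs ! c)) V"
    by (simp only: conv_sum_left)
  also have "\<dots> = conv (conv (xi x) (S X R)) (g (V - Rs ! c)) V"
    by (rule conv_cong) (simp_all only: conv_xi)
  finally show ?thesis .
qed

lemma inv_xi: "inv (xi x)"
  unfolding xi_def using inv_g finite_rep by (intro inv_sum) auto

lemma inv_conv_xi: assumes "finite X" shows "inv (conv (xi x) (S X R))"
proof -
  have "conv (xi x) (S X R) = (\<lambda>A. \<Sum>a<r. x a * conv (g (Rs ! a)) (S X R) A)"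
    by (rule ext) (rule conv_xi)
  then show ?thesis
    using inv_conv_S[OF finite_rep assms, of _ E R] by (auto simp: g_def intro!: inv_sum)
qed

abbreviation H :: "nat \<Rightarrow> nat \<Rightarrow> int" where "H \<equiv> Q (S {} E)"

lemma H_eq: "H a c = conv (g (Rs ! a)) (g (V - Rs ! c)) V div alpha"
  unfolding Q_def by (intro arg_cong2[of _ _ _ _ "(div)"] conv_cong)
    (auto intro: conv_S_empty_host finite_subset)

lemma H_diag: "c < r \<Longrightarrow> H c c = 1"
  using conv_g_self[OF sep] alpha_pos by (simp add: H_eq)

lemma H_off_diag:
  assumes "a < r" "c < r" "a \<noteq> c" "H a c \<noteq> 0" shows "wt (Rs ! c) < wt (Rs ! a)"
proof -
  have ne: "conv (g (Rs ! a)) (g (V - Rs ! c)) V \<noteq> 0" using assms(4) by (auto simp: H_eq)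
  then show ?thesis
    using conv_g_g[OF ne sep sep] assms noniso by (metis le_neq_implies_less)
qed

lemma sum_H: assumes "c < r" shows "(\<Sum>a<r. x a * H a c) = x c + (\<Sum>a\<in>{..<r} - {c}. x a * H a c)"
  using assms H_diag by (simp add: sum.remove[of _ c])

lemma mv_H: "mv (S {} E) x c = (\<Sum>a<r. x a * H a c)"
  by (simp add: mv_def)

fun solve :: "(nat \<Rightarrow> int) \<Rightarrow> nat \<Rightarrow> nat \<Rightarrow> int" where
  "solve y 0 c = 0"
| "solve y (Suc j) c = solve y j c + y c - mv (S {} E) (solve y j) c"

text \<open>The diagonal entry 1 cancels the residual at \<open>c\<close> itself, so the new one
  involves only the residuals of strictly heavier classes. Exactness spreads from heavy to light
  classes, one unit of weight per round, and weights lie between 0 and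
  \<open>k + k * k\<close>.\<close>

lemma solve_residual:
  assumes "c < r" "k + k * k < wt (Rs ! c) + j"
  shows "mv (S {} E) (solve y j) c = y c"
  using assms
proof (induction j arbitrary: c)
  case 0
  then show ?case using wt_le[OF sepset_subset[OF sep[OF 0(1)]]] by simp
next
  case (Suc j)
  let ?res = "\<lambda>a. y a - mv (S {} E) (solve y j) a"
  have "mv (S {} E) (solve y (Suc j)) c = (\<Sum>a<r. (solve y j a + ?res a) * H a c)"
    unfolding mv_H[of "solve y (Suc j)"] by (intro sum.cong) (auto simp: algebra_simps)
  also have "\<dots> = mv (S {} E) (solve y j) c + (\<Sum>a<r. ?res a * H a c)"
    unfolding mv_H by (simp add: distrib_right sum.distrib)
  also have "(\<Sum>a<r. ?res a * H a c) = ?res c + (\<Sum>a\<in>{..<r} - {c}. ?res a * H a c)"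
    by (rule sum_H[OF Suc.prems(1)])
  also have "(\<Sum>a\<in>{..<r} - {c}. ?res a * H a c) = 0"
  proof (rule sum.neutral, rule ballI)
    fix a assume "a \<in> {..<r} - {c}"
    then have a: "a < r" "a \<noteq> c" by auto
    show "?res a * H a c = 0"
    proof (cases "H a c = 0")
      case False
      then have "wt (Rs ! c) < wt (Rs ! a)" using H_off_diag a Suc.prems(1) by blast
      then have "mv (S {} E) (solve y j) a = y a" using Suc.prems a(1) by (intro Suc.IH) auto
      then show ?thesis by simp
    qed simp
  qed
  finally show ?case by simp
qed

lemma mv_solve: "c < r \<Longrightarrow> mv (S {} E) (solve y (k * k + k + 1)) c = y c"
  by (rule solve_residual) auto

lemma xi_eqI:
  assumes s: "inv s" and eq: "\<And>c. c < r \<Longrightarrow> alpha * mv (S {} E) x c = conv s (g (V - Rs ! c)) V"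
  shows "xi x = s"
proof
  fix A
  have "s A - xi x A = 0"
  proof (rule pairing_nondegenerate[where Rs = "set Rs"])
    show "inv (\<lambda>A. s A - xi x A)" using s inv_xi by (rule inv_diff)
    show "\<exists>C\<in>set Rs. sepset C \<and> giso A C" if "sepset A" for A
      using complete[OF that] sep by (metis nth_mem)
    fix C assume "C \<in> set Rs"
    then obtain c where c: "c < r" "C = Rs ! c" by (auto simp: in_set_conv_nth)
    have "conv (xi x) (g (V - C)) V = conv (conv (xi x) (S {} E)) (g (V - C)) V"
      by (intro conv_cong conv_S_empty_host[symmetric]) (auto intro: finite_subset)
    also have "\<dots> = conv s (g (V - C)) V"
      using eq[OF c(1)] alpha_mv[of "{}" E x c] c(2) by simp
    finally show "conv (\<lambda>A. s A - xi x A) (g (V - C)) V = 0"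
      unfolding conv_diff_left by simp
  qed
  then show "xi x A = s A" by simp
qed

lemma xi_add: "xi (\<lambda>c. x c + y c) A = xi x A + xi y A"
  by (simp add: xi_def distrib_right sum.distrib)

fun update :: "(nat set \<Rightarrow> int) \<Rightarrow> (nat \<Rightarrow> int) \<Rightarrow> (nat \<Rightarrow> int) \<Rightarrow> nat \<Rightarrow> nat \<Rightarrow> int" where
  "update t y x 0 c = x c"
| "update t y x (Suc j) c = update t y x j c +
     solve (\<lambda>c. y c - mv t (update t y x j) c) (k * k + k + 1) c"

text \<open>One step replaces the error \<open>e\<close> by \<open>e - e * t\<close>, which is nilpotent since \<open>t {} = 1\<close>.\<close>

lemma xi_update:
  assumes fin: "finite X" "finite Y" and s: "inv s"
    and eq: "\<And>A. conv s (S X R) A = conv (xi x) (S Y R') A"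
  shows "xi (update (S X R) (mv (S Y R') x) x (Suc k)) = s"
proof -
  let ?u = "\<lambda>j. update (S X R) (mv (S Y R') x) x j"
  let ?\<tau> = "conv (xi x) (S Y R')"
  have step: "xi (?u (Suc j)) A = xi (?u j) A + (conv s (S X R) A - conv (xi (?u j)) (S X R) A)" for j A
  proof -
    let ?y = "\<lambda>c. mv (S Y R') x c - mv (S X R) (?u j) c"
    \<comment> \<open>The target \<open>s\<close> is unknown, but its product with
      \<open>S X R\<close> is known by \<open>eq\<close>. The solver turns the pairings of the
      difference between this product and the current one into coordinates of the
      correction.\<close>
    have "xi (solve ?y (k * k + k + 1)) = (\<lambda>A. ?\<tau> A - conv (xi (?u j)) (S X R) A)"
    proof (rule xi_eqI)
      show "inv (\<lambda>A. ?\<tau> A - conv (xi (?u j)) (S X R) A)"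
        using fin by (intro inv_diff inv_conv_xi)
      fix c assume "c < r"
      then have "mv (S {} E) (solve ?y (k * k + k + 1)) c = ?y c" by (rule mv_solve)
      then have "alpha * mv (S {} E) (solve ?y (k * k + k + 1)) c =
          alpha * mv (S Y R') x c - alpha * mv (S X R) (?u j) c"
        by (simp add: right_diff_distrib)
      also have "\<dots> = conv (\<lambda>A. ?\<tau> A - conv (xi (?u j)) (S X R) A) (g (V - Rs ! c)) V"
        unfolding conv_diff_left alpha_mv[OF fin(1)] alpha_mv[OF fin(2)] ..
      finally show "alpha * mv (S {} E) (solve ?y (k * k + k + 1)) c =
          conv (\<lambda>A. ?\<tau> A - conv (xi (?u j)) (S X R) A) (g (V - Rs ! c)) V" .
    qed
    moreover have "xi (?u (Suc j)) A = xi (?u j) A + xi (solve ?y (k * k + k + 1)) A"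
    proof -
      have "?u (Suc j) = (\<lambda>c. ?u j c + solve ?y (k * k + k + 1) c)"
        by (rule ext) (rule update.simps(2))
      then show ?thesis by (simp only: xi_add)
    qed
    ultimately show ?thesis using eq by simp
  qed
  \<comment> \<open>Each step gains one cardinality, so the sets with \<open>k\<close> elements are
    reached after \<open>Suc k\<close> steps and not after \<open>k\<close>.\<close>
  have "s A - xi (?u j) A = 0" if "finite A" "card A < j" for A j
    using that
  proof (induction j arbitrary: A)
    case (Suc j)
    have "(\<lambda>A. s A - xi (?u j) A) A - conv (\<lambda>A. s A - xi (?u j) A) (S X R) A = 0"
      by (rule conv_unit_step[where j = j]) (use Suc in auto)
    then show ?case unfolding step conv_diff_left by simp
  qed simp
  moreover have "s A = 0 \<and> xi (?u (Suc k)) A = 0" if "\<not> sepset A" for A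
    using that s inv_xi by (simp add: inv_def)
  moreover have "finite A" "card A < Suc k" if "sepset A" for A
    using that sepset_subset sepset_finite card_mono[of V A] by auto
  ultimately show ?thesis by (metis eq_iff_diff_eq_0 ext)
qed

text \<open>Back substitution from the heaviest classes: \<open>l c\<close> is the distance of the
  weight of \<open>c\<close> from \<open>k + k * k\<close>, and each level multiplies the bound by
  at most \<open>1 + r * B\<close>. Only pairings enter, so coefficients do not inherit the growth
  of earlier updates.\<close>

lemma x_bound:
  assumes y: "\<And>c. c < r \<Longrightarrow> \<bar>mv (S {} E) x c\<bar> \<le> Y" and B: "\<And>a c. a < r \<Longrightarrow> c < r \<Longrightarrow> \<bar>H a c\<bar> \<le> B"
    and c: "c < r"
  shows "\<bar>x c\<bar> \<le> Y * (1 + int r * B) ^ (k + k * k)"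
proof -
  let ?\<beta> = "1 + int r * B"
  define l where "l c = k + k * k - wt (Rs ! c)" for c
  have Y0: "0 \<le> Y" using y[OF c] by linarith
  have B0: "0 \<le> B" using B[OF c c] by linarith
  have \<beta>: "1 \<le> ?\<beta>" using B0 by simp
  have "\<bar>x c\<bar> \<le> Y * ?\<beta> ^ l c"
    using c
  proof (induction "l c" arbitrary: c rule: less_induct)
    case less
    have lt: "l a < l c" if "a < r" "a \<noteq> c" "H a c \<noteq> 0" for a
    proof -
      have "wt (Rs ! c) < wt (Rs ! a)" using H_off_diag that less.prems by blast
      moreover have "wt (Rs ! a) \<le> k + k * k" using wt_le sepset_subset sep that(1) by blast
      ultimately show ?thesis unfolding l_def by linarith
    qed
    have "x c = mv (S {} E) x c - (\<Sum>a\<in>{..<r} - {c}. x a * H a c)"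
      using sum_H[OF less.prems] by (simp add: mv_H)
    then have xc: "\<bar>x c\<bar> \<le> Y + (\<Sum>a\<in>{..<r} - {c}. \<bar>x a * H a c\<bar>)"
      using y[OF less.prems] sum_abs[of "\<lambda>a. x a * H a c" "{..<r} - {c}"] by linarith
    show ?case
    proof (cases "l c")
      case 0
      then have "(\<Sum>a\<in>{..<r} - {c}. \<bar>x a * H a c\<bar>) = 0"
        using lt by (intro sum.neutral) auto
      then show ?thesis using xc 0 by simp
    next
      case (Suc m)
      have "\<bar>x a * H a c\<bar> \<le> Y * ?\<beta> ^ m * B" if a: "a \<in> {..<r} - {c}" for a
      proof (cases "H a c = 0")
        case False
        then have la: "l a < l c" using lt a by auto
        then have "\<bar>x a\<bar> \<le> Y * ?\<beta> ^ l a" using less.hyps a by auto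
        also have "\<dots> \<le> Y * ?\<beta> ^ m"
          using la Suc Y0 \<beta> by (intro mult_left_mono power_increasing) auto
        finally show ?thesis unfolding abs_mult using B[of a c] a less.prems B0 Y0 \<beta>
          by (intro mult_mono) auto
      qed (use Y0 B0 \<beta> in simp)
      then have "(\<Sum>a\<in>{..<r} - {c}. \<bar>x a * H a c\<bar>) \<le> (\<Sum>a\<in>{..<r} - {c}. Y * ?\<beta> ^ m * B)"
        by (rule sum_mono)
      also have "\<dots> \<le> int r * (Y * ?\<beta> ^ m * B)"
      proof -
        have "card ({..<r} - {c}) \<le> r" using card_mono[of "{..<r}" "{..<r} - {c}"] by auto
        then show ?thesis using Y0 B0 \<beta> by (simp only: sum_constant) (intro mult_right_mono mult_nonneg_nonneg; simp)
      qed
      finally have "\<bar>x c\<bar> \<le> Y + int r * (Y * ?\<beta> ^ m * B)" using xc by linarith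
      moreover have "Y \<le> Y * ?\<beta> ^ m"
        using Y0 one_le_power[OF \<beta>, of m] by (metis mult.right_neutral mult_left_mono)
      ultimately have "\<bar>x c\<bar> \<le> Y * ?\<beta> ^ m + int r * (Y * ?\<beta> ^ m * B)" by linarith
      also have "\<dots> = Y * ?\<beta> ^ l c" unfolding Suc by (simp add: algebra_simps)
      finally show ?thesis .
    qed
  qed
  also have "\<dots> \<le> Y * ?\<beta> ^ (k + k * k)"
    using Y0 \<beta> unfolding l_def by (intro mult_left_mono power_increasing) auto
  finally show ?thesis .
qed

end

subsection \<open>Program logic and oracle queries\<close>

primrec modi :: "com \<Rightarrow> string set" where
  "modi Skip = {}"
| "modi (Assign x e) = {x}"
| "modi (Store a e e') = {}"
| "modi (RStore a e r) = {}"
| "modi (Seq c1 c2) = modi c1 \<union> modi c2"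
| "modi (If b c1 c2) = modi c1 \<union> modi c2"
| "modi (While b c) = modi c"
| "modi (Query x a e b e') = {x}"

primrec moda :: "com \<Rightarrow> string set" where
  "moda Skip = {}"
| "moda (Assign x e) = {}"
| "moda (Store a e e') = {a}"
| "moda (RStore a e r) = {}"
| "moda (Seq c1 c2) = moda c1 \<union> moda c2"
| "moda (If b c1 c2) = moda c1 \<union> moda c2"
| "moda (While b c) = moda c"
| "moda (Query x a e b e') = {}"

primrec modr :: "com \<Rightarrow> string set" where
  "modr Skip = {}"
| "modr (Assign x e) = {}"
| "modr (Store a e e') = {}"
| "modr (RStore a e r) = {a}"
| "modr (Seq c1 c2) = modr c1 \<union> modr c2"
| "modr (If b c1 c2) = modr c1 \<union> modr c2"
| "modr (While b c) = modr c"
| "modr (Query x a e b e') = {}"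

text \<open>The frame of a program: what it never assigns keeps its contents. The rules for
  sequences and loops hand this fact to the continuation, so that assertions need to speak only of
  what changes.\<close>

definition same :: "com \<Rightarrow> state \<Rightarrow> state \<Rightarrow> bool" where
  "same c s s' \<longleftrightarrow> (\<forall>x. x \<notin> modi c \<longrightarrow> ivar s' x = ivar s x) \<and>
     (\<forall>a. a \<notin> moda c \<longrightarrow> iarr s' a = iarr s a) \<and> (\<forall>a. a \<notin> modr c \<longrightarrow> rarr s' a = rarr s a)"

lemma sameD:
  assumes "same c s s'"
  shows "x \<notin> modi c \<Longrightarrow> ivar s' x = ivar s x" "a \<notin> moda c \<Longrightarrow> iarr s' a = iarr s a"
    "b \<notin> modr c \<Longrightarrow> rarr s' b = rarr s b"
  using assms by (auto simp: same_def)

lemma exec_same: "exec \<Omega> W c s t s' \<Longrightarrow> same c s s'"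
  by (induction rule: exec.induct) (auto simp: same_def)

lemma word_mono: "word W i \<Longrightarrow> W \<le> W' \<Longrightarrow> word W' i"
  by (auto simp: word_def)

lemma ok_mono:
  assumes "W \<le> W'"
  shows "iok W s e \<Longrightarrow> iok W' s e" "rok W s r \<Longrightarrow> rok W' s r"
  by (induction e and r) (use word_mono[OF _ assms] in auto)

lemma bok_mono: "W \<le> W' \<Longrightarrow> bok W s b \<Longrightarrow> bok W' s b"
  by (induction b) (auto intro: ok_mono)

text \<open>Larger words only remove overflows. The word size of a kernel is expressed in the size
  of the instance, while the program is analysed with an exponent that depends on
  \<open>k\<close>.\<close>

lemma exec_mono: "exec \<Omega> W c s t s' \<Longrightarrow> W \<le> W' \<Longrightarrow> exec \<Omega> W' c s t s'"
  by (induction rule: exec.induct) (blast intro: exec.intros ok_mono bok_mono word_mono)+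

text \<open>The bound is a variable that is read again in every round, so constant bounds such as
  nine are first stored in a variable.\<close>

definition For :: "string \<Rightarrow> string \<Rightarrow> com \<Rightarrow> com" where
  "For x y c = Seq (Assign x (Lit 0))
     (While (Less (Var x) (Var y)) (Seq c (Assign x (Add (Var x) (Lit 1)))))"

lemma mod_For [simp]: "modi (For x y c) = insert x (modi c)" "moda (For x y c) = moda c" "modr (For x y c) = modr c"
  by (auto simp: For_def)

locale machine =
  fixes \<Omega> :: oracle_fun and W :: nat
  assumes W1: "1 \<le> W"
begin

text \<open>Total correctness with a time bound. An execution that overflows a word or makes an
  inadmissible query has no derivation, so the existence of a run also certifies word sizes and
  queries.\<close>

definition runs :: "com \<Rightarrow> state \<Rightarrow> nat \<Rightarrow> (state \<Rightarrow> bool) \<Rightarrow> bool" where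
  "runs c s T Q \<longleftrightarrow> (\<exists>t s'. exec \<Omega> W c s t s' \<and> t \<le> T \<and> Q s')"

lemma runs_mono: "runs c s T Q \<Longrightarrow> T \<le> T' \<Longrightarrow> (\<And>s'. same c s s' \<Longrightarrow> Q s' \<Longrightarrow> Q' s') \<Longrightarrow> runs c s T' Q'"
  unfolding runs_def using exec_same by (meson order_trans)

lemma runs_time: "runs c s T Q \<Longrightarrow> T \<le> T' \<Longrightarrow> runs c s T' Q"
  by (rule runs_mono)

lemma runs_imp: "runs c s T Q \<Longrightarrow> runs c s T (\<lambda>s'. P s' \<longrightarrow> Q s')"
  by (erule runs_mono[OF _ order_refl]) simp

lemma runs_Skip: "Q s \<Longrightarrow> runs Skip s 1 Q"
  unfolding runs_def using exec.Skip by blast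

lemma runs_Assign: "iok W s e \<Longrightarrow> Q (s\<lparr>ivar := (ivar s)(x := ival s e)\<rparr>) \<Longrightarrow> runs (Assign x e) s 1 Q"
  unfolding runs_def using exec.Assign by blast

lemma runs_Store:
  "iok W s e \<Longrightarrow> iok W s e' \<Longrightarrow> Q (s\<lparr>iarr := (iarr s)(a := (iarr s a)(ival s e := ival s e'))\<rparr>) \<Longrightarrow>
   runs (Store a e e') s 1 Q"
  unfolding runs_def using exec.Store by blast

lemma runs_RStore:
  "iok W s e \<Longrightarrow> rok W s r \<Longrightarrow> Q (s\<lparr>rarr := (rarr s)(a := (rarr s a)(ival s e := rval s r))\<rparr>) \<Longrightarrow>
   runs (RStore a e r) s 1 Q"
  unfolding runs_def using exec.RStore by blast

lemma runs_Query:
  "iok W s e \<Longrightarrow> iok W s e' \<Longrightarrow> \<Omega> (centres (rarr s a) (ival s e)) (centres (rarr s b) (ival s e')) = Some N \<Longrightarrow>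
   word W (int N) \<Longrightarrow> Q (s\<lparr>ivar := (ivar s)(x := int N)\<rparr>) \<Longrightarrow> runs (Query x a e b e') s 1 Q"
  unfolding runs_def using exec.Query by blast

lemma runs_Seq: "runs c1 s T1 (\<lambda>s'. same c1 s s' \<longrightarrow> runs c2 s' T2 Q) \<Longrightarrow> runs (Seq c1 c2) s (T1 + T2) Q"
  unfolding runs_def using exec.Seq exec_same by (meson add_mono)

lemma runs_SeqI:
  assumes "runs c1 s T1 Q1" "\<And>s'. same c1 s s' \<Longrightarrow> Q1 s' \<Longrightarrow> runs c2 s' T2 Q"
  shows "runs (Seq c1 c2) s (T1 + T2) Q"
  by (rule runs_Seq, rule runs_mono[OF assms(1) order_refl]) (use assms(2) in blast)

lemma runs_If:
  "bok W s b \<Longrightarrow> (bval s b \<Longrightarrow> runs c1 s T Q) \<Longrightarrow> (\<not> bval s b \<Longrightarrow> runs c2 s T Q) \<Longrightarrow> runs (If b c1 c2) s (T + 1) Q"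
  unfolding runs_def using exec.IfTrue exec.IfFalse by (metis add_le_mono1)

text \<open>Besides the body each round costs a test and an increment, and the loop adds the initial
  assignment and the last test. The cost \<open>T i\<close> may depend on the round, which the
  amortised analysis of the sweep exploits.\<close>

lemma runs_For:
  assumes y: "ivar s y = int N" "x \<noteq> y" "x \<notin> modi c" "y \<notin> modi c" "N \<le> W"
    and init: "I 0 (s\<lparr>ivar := (ivar s)(x := 0)\<rparr>)"
    and step: "\<And>i s'. i < N \<Longrightarrow> ivar s' x = int i \<Longrightarrow> same (For x y c) s s' \<Longrightarrow> I i s' \<Longrightarrow>
      runs c s' (T i) (\<lambda>s''. same c s' s'' \<longrightarrow> I (Suc i) (s''\<lparr>ivar := (ivar s'')(x := int i + 1)\<rparr>))"
    and post: "\<And>s'. same (For x y c) s s' \<Longrightarrow> ivar s' x = int N \<Longrightarrow> I N s' \<Longrightarrow> Q s'"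
  shows "runs (For x y c) s ((\<Sum>i<N. T i) + 2 * N + 2) Q"
proof -
  let ?b = "Less (Var x) (Var y)" and ?d = "Seq c (Assign x (Add (Var x) (Lit 1)))"
  have w: "word W 0" "word W 1" "\<And>i. i \<le> N \<Longrightarrow> word W (int i)" using W1 y(5) by (auto simp: word_def)
  have loop: "\<exists>t s''. exec \<Omega> W (While ?b ?d) s' t s'' \<and> t \<le> (\<Sum>i\<in>{i..<N}. T i) + 2 * (N - i) + 1 \<and> Q s''"
    if "i \<le> N" "ivar s' x = int i" "same (For x y c) s s'" "I i s'" for i s'
    using that
  proof (induction "N - i" arbitrary: i s')
    case 0
    then have "i = N" by simp
    moreover have "ivar s' y = int N" using sameD(1)[OF 0(4), of y] y by simp
    ultimately have "exec \<Omega> W (While ?b ?d) s' 1 s'" using 0 w by (intro exec.WhileFalse) auto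
    then show ?case using post 0 \<open>i = N\<close> by fastforce
  next
    case (Suc m)
    then have i: "i < N" and m: "m = N - Suc i" by simp_all
    have sy: "ivar s' y = int N" using sameD(1)[OF Suc.prems(3), of y] y by simp
    obtain t1 s1 where c: "exec \<Omega> W c s' t1 s1" "t1 \<le> T i"
      and I: "I (Suc i) (s1\<lparr>ivar := (ivar s1)(x := int i + 1)\<rparr>)"
      using step[OF i Suc.prems(2-4)] exec_same unfolding runs_def by blast
    have sm: "same c s' s1" using c exec_same by blast
    have x1: "ivar s1 x = int i" using sameD(1)[OF sm y(3)] Suc.prems(2) by simp
    let ?s2 = "s1\<lparr>ivar := (ivar s1)(x := int i + 1)\<rparr>"
    have w': "word W (int i)" "word W (int i + 1)" using w(3)[of i] w(3)[of "Suc i"] i by (auto simp: add.commute)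
    have a: "exec \<Omega> W (Assign x (Add (Var x) (Lit 1))) s1 1 (s1\<lparr>ivar := (ivar s1)(x := ival s1 (Add (Var x) (Lit 1)))\<rparr>)"
      using x1 w w' by (intro exec.Assign) auto
    then have d: "exec \<Omega> W ?d s' (t1 + 1) ?s2" using exec.Seq[OF c(1) a] x1 by simp
    have "same (For x y c) s ?s2"
      using Suc.prems(3) sm by (auto simp: same_def)
    then obtain t s'' where r: "exec \<Omega> W (While ?b ?d) ?s2 t s''"
        "t \<le> (\<Sum>i\<in>{Suc i..<N}. T i) + 2 * (N - Suc i) + 1" "Q s''"
      using Suc.hyps(1)[of "Suc i" ?s2] m i I by auto
    have "exec \<Omega> W (While ?b ?d) s' ((t1 + 1) + t + 1) s''"
      using d r(1) sy Suc.prems(2) i w w' by (intro exec.WhileTrue) auto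
    moreover have "(\<Sum>i\<in>{i..<N}. T i) = T i + (\<Sum>i\<in>{Suc i..<N}. T i)"
      using i by (rule sum.atLeast_Suc_lessThan)
    ultimately show ?case using r c(2) i by (intro exI[of _ "(t1 + 1) + t + 1"] exI[of _ s'']) auto
  qed
  let ?s0 = "s\<lparr>ivar := (ivar s)(x := 0)\<rparr>"
  have "same (For x y c) s ?s0" by (auto simp: same_def)
  then obtain t s'' where "exec \<Omega> W (While ?b ?d) ?s0 t s''" "t \<le> (\<Sum>i\<in>{0..<N}. T i) + 2 * N + 1" "Q s''"
    using loop[of 0 ?s0] init by auto
  moreover have "exec \<Omega> W (Assign x (Lit 0)) s 1 (s\<lparr>ivar := (ivar s)(x := ival s (Lit 0))\<rparr>)"
    using w by (intro exec.Assign) auto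
  ultimately show ?thesis unfolding runs_def For_def
    by (intro exI[of _ "1 + t"] exI[of _ s''] conjI exec.Seq) (auto simp: atLeast0LessThan)
qed

lemma runs_For_const:
  assumes "ivar s y = int N" "x \<noteq> y" "x \<notin> modi c" "y \<notin> modi c" "N \<le> W"
    and "I 0 (s\<lparr>ivar := (ivar s)(x := 0)\<rparr>)"
    and "\<And>i s'. i < N \<Longrightarrow> ivar s' x = int i \<Longrightarrow> same (For x y c) s s' \<Longrightarrow> I i s' \<Longrightarrow>
      runs c s' T (\<lambda>s''. same c s' s'' \<longrightarrow> I (Suc i) (s''\<lparr>ivar := (ivar s'')(x := int i + 1)\<rparr>))"
    and "\<And>s'. same (For x y c) s s' \<Longrightarrow> ivar s' x = int N \<Longrightarrow> I N s' \<Longrightarrow> Q s'"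
  shows "runs (For x y c) s (N * (T + 2) + 2) Q"
proof -
  have "runs (For x y c) s ((\<Sum>i<N. T) + 2 * N + 2) Q"
    by (rule runs_For[where I = I]) (fact assms)+
  then show ?thesis by (rule runs_time) (simp add: algebra_simps)
qed

end

definition app :: "rexp \<Rightarrow> rexp \<Rightarrow> com" where
  "app rx ry = Seq (RStore ''H'' (Mul (Lit 2) (Var ''h'')) rx)
     (Seq (RStore ''H'' (Add (Mul (Lit 2) (Var ''h'')) (Lit 1)) ry)
       (Assign ''h'' (Add (Var ''h'') (Lit 1))))"

lemma mod_app [simp]: "modi (app rx ry) = {''h''}" "moda (app rx ry) = {}" "modr (app rx ry) = {''H''}"
  by (auto simp: app_def)

abbreviation px :: "string \<Rightarrow> iexp \<Rightarrow> rexp" where "px a e \<equiv> RIdx a (Mul (Lit 2) e)"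
abbreviation py :: "string \<Rightarrow> iexp \<Rightarrow> rexp" where "py a e \<equiv> RIdx a (Add (Mul (Lit 2) e) (Lit 1))"

lemma store_centres_nth:
  assumes "i < length zs"
  shows "store_centres zs (2 * int i) = fst (zs ! i)" "store_centres zs (2 * int i + 1) = snd (zs ! i)"
  using assms by (auto simp: store_centres_def)

lemma centres_snoc:
  "centres (b(2 * int m := x, 2 * int m + 1 := y)) (int m + 1) = centres b (int m) @ [(x, y)]"
proof -
  have "nat (int m + 1) = Suc m" by simp
  then show ?thesis by (auto simp: centres_def)
qed

text \<open>Closed sets are stored as 0/1 rows of length \<open>k\<close> in the flat array
  \<open>m\<close>; the test asks whether the vertex \<open>u\<close> belongs to the set in row
  \<open>x\<close>.\<close>

definition sel :: "string \<Rightarrow> com \<Rightarrow> com \<Rightarrow> com" where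
  "sel x c1 c2 = If (Less (Lit 0) (Idx ''m'' (Add (Mul (Var x) (Var ''k'')) (Var ''u'')))) c1 c2"

definition app_P :: "int \<Rightarrow> int \<Rightarrow> com" where
  "app_P d d' = app (RAdd (px ''P'' (Var ''u'')) (OfInt (Add (Mul (Lit d) (Var ''S'')) (Lit d')))) (py ''P'' (Var ''u''))"

definition app_G :: com where
  "app_G = app (px ''G'' (Idx ''wl'' (Var ''u''))) (py ''G'' (Idx ''wl'' (Var ''u'')))"

lemma mod_sel [simp]: "modi (sel x c1 c2) = modi c1 \<union> modi c2" "moda (sel x c1 c2) = moda c1 \<union> moda c2"
    "modr (sel x c1 c2) = modr c1 \<union> modr c2"
  by (auto simp: sel_def)

lemma mod_app_PG [simp]: "modi (app_P d d') = {''h''}" "moda (app_P d d') = {}" "modr (app_P d d') = {''H''}"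
    "modi app_G = {''h''}" "moda app_G = {}" "modr app_G = {''H''}"
  by (auto simp: app_P_def app_G_def)

text \<open>
  The number of maps into the host consisting of \<open>P[A]\<close>, the vertices \<open>wl\<close> of \<open>G\<close>, and \<open>P[V - C]\<close>, where
  \<open>A\<close> and \<open>C\<close> are the rows \<open>a\<close> and \<open>c\<close> of the table \<open>m\<close>. Translations keep the three parts apart.
\<close>

definition ask :: com where
  "ask = Seq (Assign ''h'' (Lit 0))
    (Seq (For ''u'' ''k'' (sel ''a'' (app_P 2 3) Skip))
    (Seq (For ''u'' ''w'' app_G)
    (Seq (For ''u'' ''k'' (sel ''c'' Skip (app_P 4 6)))
    (Query ''q'' ''P'' (Var ''k'') ''H'' (Var ''h'')))))"

lemma mod_ask [simp]: "modi ask = {''h'', ''u'', ''q''}" "moda ask = {}" "modr ask = {''H''}"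
  by (auto simp: ask_def)

text \<open>There are two scales of integers: \<open>Bd\<close> bounds counters, row numbers and
  cell keys, and the last inequality lets a product of two such numbers plus a third fit into a
  word. With \<open>9 \<le> Bd\<close> multiples up to \<open>9 * Bd\<close> fit as well.\<close>

locale bounded_machine = machine +
  fixes xs ys :: "plane list" and Sb Bd :: nat
  assumes Bd: "9 \<le> Bd" "length xs \<le> Bd" "length ys \<le> Bd" "4 * Sb + 6 \<le> Bd" and BW: "Bd * Bd + Bd \<le> W"
begin

abbreviation k where "k \<equiv> length xs"
abbreviation n where "n \<equiv> length ys"

lemma word_lin: "\<bar>i\<bar> \<le> 9 * int Bd \<Longrightarrow> word W i"
proof -
  assume "\<bar>i\<bar> \<le> 9 * int Bd"
  also have "\<dots> \<le> int (Bd * Bd)" using Bd(1) by simp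
  also have "\<dots> \<le> int W" using BW by linarith
  finally show ?thesis by (simp add: word_def)
qed

lemma word_mult_add: assumes "\<bar>a\<bar> \<le> int Bd" "\<bar>b\<bar> \<le> int Bd" "\<bar>c\<bar> \<le> int Bd"
  shows "word W (a * b + c)"
proof -
  have "\<bar>a * b + c\<bar> \<le> \<bar>a\<bar> * \<bar>b\<bar> + \<bar>c\<bar>" using abs_triangle_ineq[of "a * b" c] by (simp add: abs_mult)
  also have "\<dots> \<le> int Bd * int Bd + int Bd" using assms by (intro add_mono mult_mono) auto
  also have "\<dots> \<le> int W" using BW by (metis of_nat_add of_nat_le_iff of_nat_mult)
  finally show ?thesis by (simp add: word_def)
qed

lemma word_mult: "\<bar>a\<bar> \<le> int Bd \<Longrightarrow> \<bar>b\<bar> \<le> int Bd \<Longrightarrow> word W (a * b)"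
  using word_mult_add[of a b 0] by simp

definition base :: "state \<Rightarrow> bool" where
  "base s \<longleftrightarrow> ivar s ''k'' = int k \<and> ivar s ''n'' = int n \<and> ivar s ''S'' = int Sb \<and>
     rarr s ''P'' = store_centres xs \<and> rarr s ''G'' = store_centres ys"

definition shift :: "real \<Rightarrow> plane \<Rightarrow> plane" where "shift d z = (fst z + d, snd z)"

text \<open>If all first coordinates are at most \<open>Sb\<close> in absolute value, the three
  parts lie in the vertical strips from \<open>Sb + 3\<close> to \<open>3 * Sb + 3\<close>, from
  \<open>- Sb\<close> to \<open>Sb\<close>, and from \<open>3 * Sb + 6\<close> on. The gaps of width
  3 exceed the distance 2 at which unit disks still touch.\<close>

definition host :: "nat set \<Rightarrow> nat list \<Rightarrow> nat set \<Rightarrow> plane list" where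
  "host A L C = map (\<lambda>u. shift (2 * real Sb + 3) (xs ! u)) (filter (\<lambda>u. u \<in> A) [0..<k]) @ map ((!) ys) L @
     map (\<lambda>u. shift (4 * real Sb + 6) (xs ! u)) (filter (\<lambda>u. u \<notin> C) [0..<k])"

definition row :: "state \<Rightarrow> nat \<Rightarrow> nat set" where
  "row s i = {u. u < k \<and> 0 < iarr s ''m'' (int i * int k + int u)}"

lemma row_subset: "row s i \<subseteq> {..<k}"
  by (auto simp: row_def)

definition m_ok :: "state \<Rightarrow> bool" where "m_ok s \<longleftrightarrow> (\<forall>j. iarr s ''m'' j \<in> {0, 1})"

definition wl_is :: "state \<Rightarrow> nat list \<Rightarrow> bool" where
  "wl_is s L \<longleftrightarrow> (\<forall>i<length L. iarr s ''wl'' (int i) = int (L ! i)) \<and> set L \<subseteq> {..<n}"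

definition buf :: "state \<Rightarrow> plane list \<Rightarrow> bool" where
  "buf s l \<longleftrightarrow> centres (rarr s ''H'') (ivar s ''h'') = l \<and> ivar s ''h'' = int (length l)"

lemma buf_upd [simp]: "v \<noteq> ''h'' \<Longrightarrow> buf (s\<lparr>ivar := (ivar s)(v := z)\<rparr>) l \<longleftrightarrow> buf s l"
  by (simp add: buf_def)

lemma runs_app:
  assumes b: "buf s l" "length l \<le> 4 * Bd" and ok: "rok W s rx"
    "\<And>z. rok W (s\<lparr>rarr := (rarr s)(''H'' := z)\<rparr>) ry"
    and v: "rval s rx = x" "\<And>z. rval (s\<lparr>rarr := (rarr s)(''H'' := z)\<rparr>) ry = y"
  shows "runs (app rx ry) s 3 (\<lambda>s'. buf s' (l @ [(x, y)]))"
proof -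
  have h: "ivar s ''h'' = int (length l)" and l: "centres (rarr s ''H'') (int (length l)) = l"
    using b(1) by (auto simp: buf_def)
  have "runs (app rx ry) s (1 + (1 + 1)) (\<lambda>s'. buf s' (l @ [(x, y)]))"
    unfolding app_def
    apply (rule runs_Seq, rule runs_RStore)
      apply (use h b(2) Bd in \<open>auto intro!: word_lin\<close>)[1]
     apply (rule ok(1))
    apply (rule impI, rule runs_Seq, rule runs_RStore)
      apply (use h b(2) Bd in \<open>auto intro!: word_lin\<close>)[1]
     apply (rule ok(2))
    apply (rule impI, rule runs_Assign)
     apply (use h b(2) Bd in \<open>auto intro!: word_lin\<close>)[1]
    using centres_snoc[of "rarr s ''H''" "length l" x y]
    apply (simp add: buf_def h l v)
    done
  then show ?thesis by (simp add: numeral_3_eq_3)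
qed

lemma length_filter_upt_le: "length (filter P [0..<i]) \<le> i"
  by (metis length_filter_le length_upt diff_zero)

lemma runs_app_P:
  assumes "base s" "buf s l" "length l \<le> 4 * Bd" "ivar s ''u'' = int i" "i < k"
    and d: "0 \<le> d" "d \<le> 4" "0 \<le> d'" "d' \<le> 6"
  shows "runs (app_P d d') s 3 (\<lambda>s'. buf s' (l @ [shift (of_int d * real Sb + of_int d') (xs ! i)]))"
proof -
  have dS: "0 \<le> d * int Sb" "d * int Sb \<le> 4 * int Sb" using d by (auto intro: mult_right_mono)
  have w: "word W (2 * int i)" "word W (int i)" "word W (2 * int i + 1)" "word W 1" "word W 2"
    "word W (int Sb)" "word W d" "word W d'" "word W (d * int Sb)" "word W (d * int Sb + d')"
    using assms(5) Bd d dS by (auto intro!: word_lin)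
  have s: "ivar s ''S'' = int Sb" "rarr s ''P'' = store_centres xs" using assms(1) by (auto simp: base_def)
  show ?thesis
    using runs_app[OF assms(2,3), of "RAdd (px ''P'' (Var ''u'')) (OfInt (Add (Mul (Lit d) (Var ''S'')) (Lit d')))"
        "py ''P'' (Var ''u'')" "fst (shift (of_int d * real Sb + of_int d') (xs ! i))" "snd (xs ! i)"]
      s w assms(4) store_centres_nth[OF assms(5)]
    by (simp add: app_P_def shift_def)
qed

lemma runs_app_G:
  assumes "base s" "buf s l" "length l \<le> 4 * Bd" "ivar s ''u'' = int i" "wl_is s L" "i < length L" "length L \<le> n"
  shows "runs app_G s 3 (\<lambda>s'. buf s' (l @ [ys ! (L ! i)]))"
proof -
  have "L ! i \<in> {..<n}" using assms(5) nth_mem[OF assms(6)] unfolding wl_is_def by blast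
  then have wl: "iarr s ''wl'' (int i) = int (L ! i)" "L ! i < n" using assms(5,6) by (auto simp: wl_is_def)
  have w: "word W (2 * int (L ! i))" "word W (int i)" "word W (2 * int (L ! i) + 1)" "word W 1" "word W 2" "word W (int (L ! i))"
    using assms(6,7) wl(2) Bd by (auto intro!: word_lin)
  have s: "rarr s ''G'' = store_centres ys" using assms(1) by (auto simp: base_def)
  show ?thesis
    using runs_app[OF assms(2,3), of "px ''G'' (Idx ''wl'' (Var ''u''))" "py ''G'' (Idx ''wl'' (Var ''u''))"
        "fst (ys ! (L ! i))" "snd (ys ! (L ! i))"] s w assms(4) wl store_centres_nth[OF wl(2)]
    by (simp add: app_G_def)
qed

lemma runs_sel:
  assumes "base s" "m_ok s" "ivar s x = int e" "e \<le> Bd" "ivar s ''u'' = int i" "i < k"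
    and "i \<in> row s e \<Longrightarrow> runs c1 s T Q" "i \<notin> row s e \<Longrightarrow> runs c2 s T Q"
  shows "runs (sel x c1 c2) s (T + 1) Q"
proof -
  let ?j = "int e * int k + int i"
  have k: "ivar s ''k'' = int k" using assms(1) by (simp add: base_def)
  have "iarr s ''m'' ?j \<in> {0, 1}" using assms(2) by (simp add: m_ok_def)
  then have w: "word W (iarr s ''m'' ?j)" using Bd(1) by (intro word_lin) auto
  have ix: "word W ?j" "word W (int e * int k)"
    by (rule word_mult_add word_mult; use assms(4,6) Bd in simp)+
  have ix': "word W (int e)" "word W (int k)" "word W (int i)" "word W 0"
    by (rule word_lin; use assms(4,6) Bd in simp)+
  show ?thesis unfolding sel_def
  proof (rule runs_If)
    show "bok W s (Less (Lit 0) (Idx ''m'' (Add (Mul (Var x) (Var ''k'')) (Var ''u''))))"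
      using w ix ix' assms(3,5) k by simp
  qed (use assms k in \<open>auto simp: row_def\<close>)
qed

lemma runs_loop_P:
  assumes "base s" "m_ok s" "ivar s x = int e" "e \<le> Bd" "x \<notin> {''h'', ''u''}" "buf s l" "length l + k \<le> 4 * Bd"
    and d: "0 \<le> d" "d \<le> 4" "0 \<le> d'" "d' \<le> 6"
    and c: "c = (if pos then sel x (app_P d d') Skip else sel x Skip (app_P d d'))"
  shows "runs (For ''u'' ''k'' c) s (6 * k + 2) (\<lambda>s'.
     buf s' (l @ map (\<lambda>u. shift (of_int d * real Sb + of_int d') (xs ! u)) (filter (\<lambda>u. (u \<in> row s e) = pos) [0..<k])))"
proof -
  let ?l = "\<lambda>i. l @ map (\<lambda>u. shift (of_int d * real Sb + of_int d') (xs ! u)) (filter (\<lambda>u. (u \<in> row s e) = pos) [0..<i])"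
  have c': "modi c = {''h''}" "moda c = {}" "modr c = {''H''}" unfolding c by auto
  have "runs (For ''u'' ''k'' c) s (k * (3 + 1 + 2) + 2) (\<lambda>s'. buf s' (?l k))"
  proof (rule runs_For_const[where I = "\<lambda>i s'. buf s' (?l i)"])
    show "ivar s ''k'' = int k" using assms(1) by (simp add: base_def)
    show "k \<le> W" using Bd BW by linarith
    show "buf (s\<lparr>ivar := (ivar s)(''u'' := 0)\<rparr>) (?l 0)" using assms(6) by simp
    fix i s' assume i: "i < k" "ivar s' ''u'' = int i" and same: "same (For ''u'' ''k'' c) s s'" and I: "buf s' (?l i)"
    note fr = sameD[OF same]
    have b: "base s'" using assms(1) fr unfolding base_def by (simp add: c')
    have m: "m_ok s'" "row s' e = row s e" using assms(2) fr(2)[of "''m''"] by (auto simp: m_ok_def row_def c')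
    have x: "ivar s' x = int e" using assms(3,5) fr(1)[of x] by (simp add: c')
    have len: "length (?l i) \<le> 4 * Bd"
      using length_filter_upt_le[of "\<lambda>u. (u \<in> row s e) = pos" i] assms(7) i(1)
      unfolding length_append length_map by linarith
    have app: "runs (app_P d d') s' 3 (\<lambda>s''. buf (s''\<lparr>ivar := (ivar s'')(''u'' := int i + 1)\<rparr>) (?l (Suc i)))"
      if "(i \<in> row s e) = pos"
      by (rule runs_mono[OF runs_app_P[OF b I len i(2,1) d] order_refl]) (use that in simp)
    have skip: "runs Skip s' 3 (\<lambda>s''. buf (s''\<lparr>ivar := (ivar s'')(''u'' := int i + 1)\<rparr>) (?l (Suc i)))"
      if "(i \<in> row s e) \<noteq> pos"
      by (rule runs_time[OF runs_Skip]) (use that I in simp_all)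
    have "runs c s' (3 + 1) (\<lambda>s''. buf (s''\<lparr>ivar := (ivar s'')(''u'' := int i + 1)\<rparr>) (?l (Suc i)))"
    proof (cases pos)
      case True
      then show ?thesis unfolding c using app skip m(2)
        by (simp only: if_True) (rule runs_sel[OF b m(1) x assms(4) i(2,1)]; blast)
    next
      case False
      then show ?thesis unfolding c using app skip m(2)
        by (simp only: if_False) (rule runs_sel[OF b m(1) x assms(4) i(2,1)]; blast)
    qed
    then show "runs c s' (3 + 1) (\<lambda>s''. same c s' s'' \<longrightarrow> buf (s''\<lparr>ivar := (ivar s'')(''u'' := int i + 1)\<rparr>) (?l (Suc i)))"
      by (rule runs_imp)
  qed (simp_all add: c')
  then show ?thesis by (simp add: mult.commute)
qed

lemma runs_loop_G:
  assumes "base s" "ivar s ''w'' = int (length L)" "wl_is s L" "length L \<le> n" "buf s l" "length l + n \<le> 4 * Bd"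
  shows "runs (For ''u'' ''w'' app_G) s (5 * length L + 2) (\<lambda>s'. buf s' (l @ map ((!) ys) L))"
proof -
  let ?l = "\<lambda>i. l @ map ((!) ys) (take i L)"
  have "runs (For ''u'' ''w'' app_G) s (length L * (3 + 2) + 2) (\<lambda>s'. buf s' (?l (length L)))"
  proof (rule runs_For_const[where I = "\<lambda>i s'. buf s' (?l i)"])
    show "ivar s ''w'' = int (length L)" by fact
    show "length L \<le> W" using Bd BW assms(4) by linarith
    show "buf (s\<lparr>ivar := (ivar s)(''u'' := 0)\<rparr>) (?l 0)" using assms(5) by simp
    fix i s' assume i: "i < length L" "ivar s' ''u'' = int i" and same: "same (For ''u'' ''w'' app_G) s s'" and I: "buf s' (?l i)"
    note fr = sameD[OF same]
    have b: "base s'" using assms(1) fr unfolding base_def by simp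
    have wl: "wl_is s' L" using assms(3) fr unfolding wl_is_def by simp
    have len: "length (?l i) \<le> 4 * Bd" using assms(4,6) i(1) by simp
    show "runs app_G s' 3 (\<lambda>s''. same app_G s' s'' \<longrightarrow> buf (s''\<lparr>ivar := (ivar s'')(''u'' := int i + 1)\<rparr>) (?l (Suc i)))"
      by (rule runs_mono[OF runs_app_G[OF b I len i(2) wl i(1) assms(4)] order_refl])
        (use i(1) in \<open>simp add: take_Suc_conv_app_nth\<close>)
  qed simp_all
  then show ?thesis by (simp add: mult.commute)
qed

end

context bounded_machine
begin

lemma runs_ask:
  assumes s: "base s" "m_ok s" and a: "ivar s ''a'' = int a" "a \<le> Bd" and c: "ivar s ''c'' = int c" "c \<le> Bd"
    and w: "ivar s ''w'' = int (length L)" "wl_is s L" "length L \<le> n"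
    and \<Omega>: "\<Omega> xs (host (row s a) L (row s c)) = Some N" "N \<le> W"
  shows "runs ask s (12 * (k + length L) + 8) (\<lambda>s'. ivar s' ''q'' = int N)"
proof -
  let ?l1 = "map (\<lambda>u. shift (of_int 2 * real Sb + of_int 3) (xs ! u)) (filter (\<lambda>u. (u \<in> row s a) = True) [0..<k])"
  let ?l2 = "?l1 @ map ((!) ys) L"
  let ?l3 = "?l2 @ map (\<lambda>u. shift (of_int 4 * real Sb + of_int 6) (xs ! u)) (filter (\<lambda>u. (u \<in> row s c) = False) [0..<k])"
  have host: "?l3 = host (row s a) L (row s c)" by (simp add: host_def)
  have len: "length ?l1 \<le> k" "length ?l2 \<le> k + n" "length ?l3 \<le> 2 * k + n"
    using w(3) length_filter_upt_le[of "\<lambda>u. (u \<in> row s a) = True" k] length_filter_upt_le[of "\<lambda>u. (u \<in> row s c) = False" k]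
    unfolding length_append length_map by linarith+
  define ok where "ok s' \<longleftrightarrow> base s' \<and> iarr s' = iarr s \<and> ivar s' ''a'' = int a \<and> ivar s' ''c'' = int c \<and>
    ivar s' ''w'' = int (length L)" for s' :: state
  have okD: "m_ok s'" "wl_is s' L" "row s' e = row s e" if "ok s'" for s' e
    using that s w by (auto simp: ok_def m_ok_def wl_is_def row_def)
  have ok_same: "ok s2" if "ok s1" "same (For ''u'' y d) s1 s2" "modi d = {''h''}" "moda d = {}" "modr d = {''H''}" for s1 s2 y d
    using that(1) unfolding ok_def base_def by (simp add: sameD[OF that(2)] that(3-5) fun_eq_iff)
  have q: "runs (Query ''q'' ''P'' (Var ''k'') ''H'' (Var ''h'')) s3 1 (\<lambda>s'. ivar s' ''q'' = int N)"
    if ok3: "ok s3" and b3: "buf s3 ?l3" for s3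
  proof (rule runs_Query[where N = N])
    have h: "ivar s3 ''h'' = int (length ?l3)" and k: "ivar s3 ''k'' = int k" and P: "rarr s3 ''P'' = store_centres xs"
      using b3 ok3 unfolding buf_def ok_def base_def by blast+
    show "iok W s3 (Var ''k'')" using k Bd by (simp add: word_lin)
    show "iok W s3 (Var ''h'')" unfolding iok.simps h using len(3) Bd by (intro word_lin) linarith
    have "centres (rarr s3 ''H'') (ival s3 (Var ''h'')) = host (row s a) L (row s c)"
      using b3 unfolding buf_def host ival.simps by (rule conjunct1)
    moreover have "centres (rarr s3 ''P'') (ival s3 (Var ''k'')) = xs"
      using k P by (simp add: centres_store_centres)
    ultimately show "\<Omega> (centres (rarr s3 ''P'') (ival s3 (Var ''k''))) (centres (rarr s3 ''H'') (ival s3 (Var ''h''))) = Some N"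
      using \<Omega>(1) by simp
    show "word W (int N)" using \<Omega>(2) by (simp add: word_def)
  qed simp
  have p3: "runs (Seq (For ''u'' ''k'' (sel ''c'' Skip (app_P 4 6))) (Query ''q'' ''P'' (Var ''k'') ''H'' (Var ''h''))) s2
      ((6 * k + 2) + 1) (\<lambda>s'. ivar s' ''q'' = int N)" if ok2: "ok s2" and b2: "buf s2 ?l2" for s2
  proof (rule runs_SeqI)
    show "runs (For ''u'' ''k'' (sel ''c'' Skip (app_P 4 6))) s2 (6 * k + 2) (\<lambda>s'. buf s' ?l3)"
      unfolding okD(3)[OF ok2, symmetric]
    proof (rule runs_loop_P)
      show "buf s2 (map (\<lambda>u. shift (of_int 2 * real Sb + of_int 3) (xs ! u)) (filter (\<lambda>u. (u \<in> row s2 a) = True) [0..<k]) @ map ((!) ys) L)"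
        using b2 unfolding okD(3)[OF ok2] .
      show "length (map (\<lambda>u. shift (of_int 2 * real Sb + of_int 3) (xs ! u)) (filter (\<lambda>u. (u \<in> row s2 a) = True) [0..<k]) @ map ((!) ys) L) + k \<le> 4 * Bd"
        using len(2) Bd unfolding okD(3)[OF ok2] by linarith
    qed (use ok2 okD[OF ok2] c in \<open>auto simp: ok_def\<close>)
    show "runs (Query ''q'' ''P'' (Var ''k'') ''H'' (Var ''h'')) s3 1 (\<lambda>s'. ivar s' ''q'' = int N)"
      if "same (For ''u'' ''k'' (sel ''c'' Skip (app_P 4 6))) s2 s3" "buf s3 ?l3" for s3
      using ok_same[OF ok2 that(1)] that(2) by (intro q) simp_all
  qed
  have p2: "runs (Seq (For ''u'' ''w'' app_G) (Seq (For ''u'' ''k'' (sel ''c'' Skip (app_P 4 6)))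
      (Query ''q'' ''P'' (Var ''k'') ''H'' (Var ''h'')))) s1 ((5 * length L + 2) + ((6 * k + 2) + 1)) (\<lambda>s'. ivar s' ''q'' = int N)"
    if ok1: "ok s1" and b1: "buf s1 ?l1" for s1
  proof (rule runs_SeqI)
    show "runs (For ''u'' ''w'' app_G) s1 (5 * length L + 2) (\<lambda>s'. buf s' ?l2)"
    proof (rule runs_loop_G)
      show "length ?l1 + n \<le> 4 * Bd" using len(1) Bd by linarith
    qed (use ok1 okD[OF ok1] b1 w in \<open>auto simp: ok_def\<close>)
  qed (use ok_same[OF ok1] p3 in simp)
  have "runs ask s (1 + ((6 * k + 2) + ((5 * length L + 2) + ((6 * k + 2) + 1)))) (\<lambda>s'. ivar s' ''q'' = int N)"
    unfolding ask_def
  proof (rule runs_SeqI)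
    show "runs (Assign ''h'' (Lit 0)) s 1 (\<lambda>s'. ok s' \<and> buf s' [])"
      by (rule runs_Assign) (use s a c w in \<open>simp_all add: ok_def base_def buf_def centres_def word_def\<close>)
    fix s0 assume "ok s0 \<and> buf s0 []"
    then have ok0: "ok s0" and b0: "buf s0 []" by auto
    show "runs (Seq (For ''u'' ''k'' (sel ''a'' (app_P 2 3) Skip)) (Seq (For ''u'' ''w'' app_G)
        (Seq (For ''u'' ''k'' (sel ''c'' Skip (app_P 4 6))) (Query ''q'' ''P'' (Var ''k'') ''H'' (Var ''h'')))))
      s0 ((6 * k + 2) + ((5 * length L + 2) + ((6 * k + 2) + 1))) (\<lambda>s'. ivar s' ''q'' = int N)"
    proof (rule runs_SeqI)
      have "runs (For ''u'' ''k'' (sel ''a'' (app_P 2 3) Skip)) s0 (6 * k + 2) (\<lambda>s'. buf s' ([] @ ?l1))"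
        unfolding okD(3)[OF ok0, symmetric]
        by (rule runs_loop_P) (use ok0 okD[OF ok0] a b0 Bd in \<open>auto simp: ok_def\<close>)
      then show "runs (For ''u'' ''k'' (sel ''a'' (app_P 2 3) Skip)) s0 (6 * k + 2) (\<lambda>s'. buf s' ?l1)"
        unfolding append_Nil .
    qed (use ok_same[OF ok0] p2 in simp)
  qed
  then show ?thesis by (rule runs_time) simp
qed

end

subsection \<open>Disk graphs, grid cells and classes of separations\<close>

lemma cball_inter_iff: fixes a b :: plane
  shows "cball a 1 \<inter> cball b 1 \<noteq> {} \<longleftrightarrow> dist a b \<le> 2"
proof
  assume "cball a 1 \<inter> cball b 1 \<noteq> {}"
  then obtain z where "dist a z \<le> 1" "dist b z \<le> 1" by auto
  then show "dist a b \<le> 2" using dist_triangle2[of a b z] by linarith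
next
  assume "dist a b \<le> 2"
  then have "midpoint a b \<in> cball a 1 \<inter> cball b 1" by (simp add: dist_midpoint)
  then show "cball a 1 \<inter> cball b 1 \<noteq> {}" by blast
qed

lemma dist_plane: fixes a b :: plane
  shows "dist a b = sqrt ((fst a - fst b)\<^sup>2 + (snd a - snd b)\<^sup>2)"
  by (simp add: dist_prod_def dist_real_def)

lemma dist_fst_snd_le: fixes a b :: plane
  shows "\<bar>fst a - fst b\<bar> \<le> dist a b" "\<bar>snd a - snd b\<bar> \<le> dist a b"
  using dist_fst_le[of a b] dist_snd_le[of a b] by (simp_all add: dist_real_def)

definition close :: "plane list \<Rightarrow> nat \<Rightarrow> nat \<Rightarrow> bool" where
  "close zs i j \<longleftrightarrow> dist (zs ! i) (zs ! j) \<le> 2"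

definition far :: "plane list \<Rightarrow> plane list \<Rightarrow> bool" where
  "far l l' \<longleftrightarrow> (\<forall>z\<in>set l. \<forall>z'\<in>set l'. 2 < dist z z')"

definition has_ply :: "plane list \<Rightarrow> nat \<Rightarrow> bool" where
  "has_ply zs p \<longleftrightarrow> (\<forall>z. card {i. i < length zs \<and> dist (zs ! i) z \<le> 1} \<le> p)"

lemma ply_disk_graph: "ply_at_most (disk_graph zs) ((!) zs) p \<longleftrightarrow> has_ply zs p"
  by (simp add: ply_at_most_def has_ply_def disk_graph_def)

text \<open>A point covered by a disk from each list would bring two centres within distance 2. So
  every point meets the disks of one list only and the bounds do not add up; composed hosts keep the
  ply \<open>p\<close>.\<close>

lemma has_ply_append:
  assumes "has_ply l p" "has_ply l' p" "far l l'"
  shows "has_ply (l @ l') p"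
  unfolding has_ply_def
proof
  fix z
  let ?I = "{i. i < length (l @ l') \<and> dist ((l @ l') ! i) z \<le> 1}"
  let ?A = "{i. i < length l \<and> dist (l ! i) z \<le> 1}" and ?B = "{i. i < length l' \<and> dist (l' ! i) z \<le> 1}"
  have I: "?I = ?A \<union> (\<lambda>i. length l + i) ` ?B"
  proof (rule set_eqI, rule iffI)
    fix i assume i: "i \<in> ?I"
    show "i \<in> ?A \<union> (\<lambda>i. length l + i) ` ?B"
    proof (cases "i < length l")
      case False
      then have "i = length l + (i - length l)" "i - length l \<in> ?B" using i by (auto simp: nth_append)
      then show ?thesis by blast
    qed (use i in \<open>auto simp: nth_append\<close>)
  qed (auto simp: nth_append)
  have "?A = {} \<or> ?B = {}"
  proof (rule ccontr)
    assume "\<not> (?A = {} \<or> ?B = {})"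
    then obtain i j where ij: "i < length l" "dist (l ! i) z \<le> 1" "j < length l'" "dist (l' ! j) z \<le> 1" by auto
    then have "2 < dist (l ! i) (l' ! j)" using assms(3) by (auto simp: far_def)
    then show False using ij dist_triangle2[of "l ! i" "l' ! j" z] by linarith
  qed
  moreover have "card ((\<lambda>i. length l + i) ` ?B) = card ?B" by (rule card_image) (auto simp: inj_on_def)
  moreover have "card ?A \<le> p" "card ?B \<le> p" using assms(1,2) unfolding has_ply_def by blast+
  ultimately show "card ?I \<le> p" unfolding I by (elim disjE) (simp_all only: Un_empty_left Un_empty_right image_empty)
qed

lemma has_ply_map:
  assumes "distinct is" "\<And>z. card {u \<in> set is. dist (f u) z \<le> 1} \<le> p"
  shows "has_ply (map f is) p"
  unfolding has_ply_def
proof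
  fix z
  have "bij_betw (\<lambda>i. is ! i) {i. i < length (map f is) \<and> dist (map f is ! i) z \<le> 1} {u \<in> set is. dist (f u) z \<le> 1}"
    using assms(1) by (auto simp: bij_betw_def inj_on_def nth_eq_iff_index_eq in_set_conv_nth)
  then have "card {i. i < length (map f is) \<and> dist (map f is ! i) z \<le> 1} = card {u \<in> set is. dist (f u) z \<le> 1}"
    by (rule bij_betw_same_card)
  then show "card {i. i < length (map f is) \<and> dist (map f is ! i) z \<le> 1} \<le> p"
    using assms(2) by metis
qed

context pattern
begin

definition Sl :: "plane list \<Rightarrow> nat set \<Rightarrow> int" where
  "Sl zs = S {..<length zs} (close zs)"

lemma Sl_append:
  assumes "far l l'" shows "Sl (l @ l') A = conv (Sl l) (Sl l') A"
proof -
  let ?R = "close (l @ l')" and ?X = "{..<length l}" and ?Y = "(\<lambda>i. length l + i) ` {..<length l'}"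
  have V: "{..<length (l @ l')} = ?X \<union> ?Y"
  proof -
    have "?Y = {length l..<length l + length l'}" by (simp add: lessThan_atLeast0 add.commute)
    then show ?thesis by auto
  qed
  have "S ?X ?R B = Sl l B" for B
    unfolding Sl_def by (rule S_host_iso[of id]) (auto simp: bij_betw_def close_def nth_append)
  moreover have "Sl l' B = S ?Y ?R B" for B
    unfolding Sl_def by (rule S_host_iso[of "\<lambda>i. length l + i"]) (auto simp: bij_betw_def inj_on_def close_def)
  moreover have "S (?X \<union> ?Y) ?R A = conv (S ?X ?R) (S ?Y ?R) A"
  proof (rule S_disjoint_union)
    fix x y assume x: "x \<in> ?X" and "y \<in> ?Y"
    then obtain j where j: "y = length l + j" "j < length l'" by auto
    then have "2 < dist (l ! x) (l' ! j)" using assms x by (auto simp: far_def)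
    then show "\<not> ?R x y \<and> \<not> ?R y x" using x j by (simp add: close_def nth_append dist_commute)
  qed auto
  ultimately show ?thesis unfolding Sl_def[of "l @ l'"] V by (simp add: conv_def)
qed

lemma Sl_map:
  assumes "distinct is" "\<And>u v. u \<in> set is \<Longrightarrow> v \<in> set is \<Longrightarrow> u \<noteq> v \<Longrightarrow> dist (f u) (f v) \<le> 2 \<longleftrightarrow> R u v"
  shows "Sl (map f is) A = S (set is) R A"
  unfolding Sl_def
proof (rule S_host_iso[of "\<lambda>i. is ! i"])
  show "bij_betw (\<lambda>i. is ! i) {..<length (map f is)} (set is)"
    using assms(1) by (auto simp: bij_betw_def inj_on_def nth_eq_iff_index_eq in_set_conv_nth)
qed (use assms in \<open>auto simp: close_def nth_eq_iff_index_eq\<close>)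

end

text \<open>Answers are assumed only for the fixed pattern and small hosts of ply at most
  \<open>p\<close>. Both \<open>pattern_oracle\<close> and \<open>instance_oracle\<close> can supply
  them, so one analysis of the program serves both halves of the result.\<close>

locale disk_instance = bounded_machine +
  fixes p :: nat
  assumes kpos: "1 \<le> k" and plyP: "has_ply xs p" and plyG: "has_ply ys p"
    and Sb: "\<And>z. z \<in> set xs \<union> set ys \<Longrightarrow> \<bar>fst z\<bar> \<le> real Sb \<and> \<bar>snd z\<bar> \<le> real Sb"
    and answers: "\<And>zs. length zs \<le> 38 * k\<^sup>2 * p \<Longrightarrow> has_ply zs p \<Longrightarrow>
      \<Omega> xs zs = Some (card (sub (disk_graph xs) (disk_graph zs)))"
begin

definition adj :: "nat \<Rightarrow> nat \<Rightarrow> bool" where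
  "adj u v \<longleftrightarrow> u < k \<and> v < k \<and> u \<noteq> v \<and> close xs u v"

sublocale pattern k adj
  by standard (auto simp: adj_def close_def dist_commute)

lemma edges_iff_adj: "{u, v} \<in> edges (disk_graph xs) \<longleftrightarrow> adj u v"
  by (auto simp: edges_disk_graph_iff cball_inter_iff adj_def close_def)

lemma card_sub: "int (card (sub (disk_graph xs) (disk_graph zs))) = Sl zs V"
proof -
  have "sub (disk_graph xs) (disk_graph zs) = emb V {..<length zs} (close zs)"
  proof (rule set_eqI)
    fix f
    have "(\<forall>u v. adj u v \<longrightarrow> {f u, f v} \<in> edges (disk_graph zs)) \<longleftrightarrow>
        (\<forall>u\<in>V. \<forall>v\<in>V. adj u v \<longrightarrow> close zs (f u) (f v))" if "f \<in> V \<rightarrow>\<^sub>E {..<length zs}" "inj_on f V"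
    proof -
      have "{f u, f v} \<in> edges (disk_graph zs) \<longleftrightarrow> close zs (f u) (f v)" if uv: "adj u v" for u v
      proof -
        have "f u < length zs" "f v < length zs" "f u \<noteq> f v"
          using uv \<open>f \<in> V \<rightarrow>\<^sub>E {..<length zs}\<close> \<open>inj_on f V\<close> by (auto simp: adj_def inj_on_def)
        then show ?thesis by (simp add: edges_disk_graph_iff cball_inter_iff close_def)
      qed
      then show ?thesis by (auto simp: adj_def)
    qed
    then show "f \<in> sub (disk_graph xs) (disk_graph zs) \<longleftrightarrow> f \<in> emb V {..<length zs} (close zs)"
      unfolding sub_def emb_def edges_iff_adj by (auto simp: disk_graph_def)
  qed
  then show ?thesis by (simp add: Sl_def S_def)
qed

text \<open>The centre of the first disk lies in that disk. This allows the 2k vertices from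
  \<open>P\<close> to be absorbed into a multiple of k^2 p.\<close>

lemma p_pos: "1 \<le> p"
proof -
  have "{i. i < length xs \<and> dist (xs ! i) (xs ! 0) \<le> 1} \<noteq> {}" using kpos by (auto intro: exI[of _ 0])
  then have "0 < card {i. i < length xs \<and> dist (xs ! i) (xs ! 0) \<le> 1}" by (simp add: card_gt_0_iff)
  then show ?thesis using plyP unfolding has_ply_def by (metis le_trans less_eq_Suc_le One_nat_def)
qed

lemma dist_shift: "dist (shift d a) (shift d b) = dist a b"
  by (simp add: dist_plane shift_def)

lemma ply_subset:
  assumes "has_ply zs p" "A \<subseteq> {..<length zs}"
  shows "card {u \<in> A. dist (zs ! u) z \<le> 1} \<le> p"
proof -
  have "card {u \<in> A. dist (zs ! u) z \<le> 1} \<le> card {i. i < length zs \<and> dist (zs ! i) z \<le> 1}"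
    using assms(2) by (intro card_mono) auto
  then show ?thesis using assms(1) unfolding has_ply_def by (meson le_trans)
qed

lemma host_parts:
  assumes L: "distinct L" "set L \<subseteq> {..<n}"
  shows "Sl (host A L C) V = conv (conv (g (A \<inter> V)) (S (set L) (close ys))) (g (V - C)) V" (is ?T1)
    and "has_ply (host A L C) p" (is ?T2)
proof -
  let ?d1 = "2 * real Sb + 3" and ?d3 = "4 * real Sb + 6"
  let ?i1 = "filter (\<lambda>u. u \<in> A) [0..<k]" and ?i3 = "filter (\<lambda>u. u \<notin> C) [0..<k]"
  let ?l1 = "map (\<lambda>u. shift ?d1 (xs ! u)) ?i1" and ?l2 = "map ((!) ys) L" and ?l3 = "map (\<lambda>u. shift ?d3 (xs ! u)) ?i3"
  have far_fst: "far l l'" if "\<And>z z'. z \<in> set l \<Longrightarrow> z' \<in> set l' \<Longrightarrow> 2 < \<bar>fst z - fst z'\<bar>" for l l'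
    unfolding far_def using that dist_fst_snd_le(1) by (meson less_le_trans)
  have b1: "real Sb + 3 \<le> fst z \<and> fst z \<le> 3 * real Sb + 3" if z: "z \<in> set ?l1" for z
  proof -
    obtain u where "u < k" "z = shift ?d1 (xs ! u)" using z by auto
    then show ?thesis using Sb[of "xs ! u"] by (auto simp: shift_def abs_le_iff)
  qed
  have b2: "\<bar>fst z\<bar> \<le> real Sb" if z: "z \<in> set ?l2" for z
  proof -
    obtain u where "u \<in> set L" "z = ys ! u" using z by auto
    then show ?thesis using Sb[of "ys ! u"] L(2) by auto
  qed
  have b3: "3 * real Sb + 6 \<le> fst z" if z: "z \<in> set ?l3" for z
  proof -
    obtain u where "u < k" "z = shift ?d3 (xs ! u)" using z by auto
    then show ?thesis using Sb[of "xs ! u"] by (auto simp: shift_def abs_le_iff)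
  qed
  have far12: "far ?l1 ?l2" using b1 b2 by (intro far_fst) (smt (verit))
  have far3: "far (?l1 @ ?l2) ?l3" using b1 b2 b3 by (intro far_fst) (simp only: set_append Un_iff, smt (verit))
  have s1: "Sl ?l1 B = g (A \<inter> V) B" for B
  proof -
    have "Sl ?l1 B = S (set ?i1) adj B"
      by (rule Sl_map) (auto simp: dist_shift adj_def close_def)
    moreover have "set ?i1 = A \<inter> V" by auto
    ultimately show ?thesis by (simp add: g_def)
  qed
  have s2: "Sl ?l2 B = S (set L) (close ys) B" for B
    by (rule Sl_map) (use L in \<open>auto simp: close_def\<close>)
  have s3: "Sl ?l3 B = g (V - C) B" for B
  proof -
    have "Sl ?l3 B = S (set ?i3) adj B"
      by (rule Sl_map) (auto simp: dist_shift adj_def close_def)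
    moreover have "set ?i3 = V - C" by auto
    ultimately show ?thesis by (simp add: g_def)
  qed
  have "Sl ((?l1 @ ?l2) @ ?l3) V = conv (Sl (?l1 @ ?l2)) (Sl ?l3) V" by (rule Sl_append[OF far3])
  also have "\<dots> = conv (conv (g (A \<inter> V)) (S (set L) (close ys))) (g (V - C)) V"
    by (rule conv_cong) (simp_all only: Sl_append[OF far12] s3 conv_def s1 s2)
  finally show ?T1 by (simp add: host_def)
  have pm: "has_ply (map (\<lambda>u. shift d (xs ! u)) (filter P [0..<k])) p" for d P
  proof (rule has_ply_map)
    fix z
    have "{u \<in> set (filter P [0..<k]). dist (shift d (xs ! u)) z \<le> 1} =
        {u \<in> {u \<in> V. P u}. dist (xs ! u) (shift (- d) z) \<le> 1}"
      by (auto simp: dist_plane shift_def algebra_simps)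
    also have "card \<dots> \<le> p" by (rule ply_subset[OF plyP]) auto
    finally show "card {u \<in> set (filter P [0..<k]). dist (shift d (xs ! u)) z \<le> 1} \<le> p" .
  qed simp
  have "has_ply ?l2 p" using L ply_subset[OF plyG L(2)] by (intro has_ply_map) auto
  then have "has_ply ((?l1 @ ?l2) @ ?l3) p" using pm far12 far3 by (intro has_ply_append)
  then show ?T2 by (simp add: host_def)
qed

text \<open>Rounding precedes the division because the machine can round reals down to words but not
  divide them.\<close>

definition cell :: "nat \<Rightarrow> int \<times> int" where
  "cell u = (\<lfloor>fst (ys ! u)\<rfloor> div (2 * int k), \<lfloor>snd (ys ! u)\<rfloor> div (2 * int k))"

definition nbr :: "int \<times> int \<Rightarrow> int \<times> int \<Rightarrow> bool" where
  "nbr a b \<longleftrightarrow> \<bar>fst a - fst b\<bar> \<le> 1 \<and> \<bar>snd a - snd b\<bar> \<le> 1"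

text \<open>A difference of at most \<open>2 * (k - 1)\<close> leaves room for the rounding error:
  the floors differ by at most \<open>2 * k\<close>, and adding \<open>2 * k\<close> raises the
  quotient by exactly 1.\<close>

lemma floor_div_near:
  fixes x y :: real
  assumes "\<bar>x - y\<bar> \<le> 2 * real j" "j < k"
  shows "\<bar>\<lfloor>x\<rfloor> div (2 * int k) - \<lfloor>y\<rfloor> div (2 * int k)\<bar> \<le> 1"
proof -
  have d: "0 < 2 * int k" using kpos by linarith
  have le: "a div (2 * int k) \<le> b div (2 * int k) + 1" if "a \<le> b + 2 * int k" for a b
  proof -
    have "a div (2 * int k) \<le> (b + 2 * int k) div (2 * int k)" using that d by (rule zdiv_mono1)
    also have "\<dots> = b div (2 * int k) + 1" using d by simp
    finally show ?thesis .
  qed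
  have jk: "real j + 1 \<le> real k" using assms(2) by linarith
  have "\<lfloor>x\<rfloor> \<le> \<lfloor>y\<rfloor> + 2 * int k" "\<lfloor>y\<rfloor> \<le> \<lfloor>x\<rfloor> + 2 * int k"
    using assms(1) jk by linarith+
  then show ?thesis using le[of "\<lfloor>x\<rfloor>" "\<lfloor>y\<rfloor>"] le[of "\<lfloor>y\<rfloor>" "\<lfloor>x\<rfloor>"] by linarith
qed

text \<open>Each step covers a distance of at most 2 and pauses cover none, so the walk ends within
  distance \<open>2 * j\<close> of its start.\<close>

lemma walk_nbr:
  assumes "(z, v) \<in> {(a, b). close ys a b \<or> a = b} ^^ j" "j < k"
  shows "nbr (cell v) (cell z)"
proof -
  have "dist (ys ! z) (ys ! v) \<le> 2 * real j"
    using assms(1)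
  proof (induction j arbitrary: v)
    case (Suc j)
    then obtain w where w: "(z, w) \<in> {(a, b). close ys a b \<or> a = b} ^^ j" "close ys w v \<or> w = v" by auto
    then show ?case using Suc.IH[OF w(1)] dist_triangle[of "ys ! z" "ys ! v" "ys ! w"]
      by (auto simp: close_def)
  qed simp
  then have "\<bar>fst (ys ! v) - fst (ys ! z)\<bar> \<le> 2 * real j" "\<bar>snd (ys ! v) - snd (ys ! z)\<bar> \<le> 2 * real j"
    using dist_fst_snd_le[of "ys ! v" "ys ! z"] by (auto simp: dist_commute)
  then show ?thesis using floor_div_near assms(2) by (simp add: nbr_def cell_def)
qed

text \<open>The centre of a unit square is at distance less than 1 from all its points, so it lies
  in every disk centred in the square.\<close>

lemma unit_square_ply: "card {u \<in> {..<n}. \<lfloor>fst (ys ! u)\<rfloor> = a \<and> \<lfloor>snd (ys ! u)\<rfloor> = b} \<le> p"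
proof -
  let ?z = "(of_int a + 1/2, of_int b + 1/2) :: plane"
  have "{u \<in> {..<n}. \<lfloor>fst (ys ! u)\<rfloor> = a \<and> \<lfloor>snd (ys ! u)\<rfloor> = b} \<subseteq> {u \<in> {..<n}. dist (ys ! u) ?z \<le> 1}"
  proof safe
    fix u
    have h: "(x - (of_int \<lfloor>x\<rfloor> + 1/2))\<^sup>2 \<le> 1/4" for x :: real
    proof -
      have "\<bar>x - (of_int \<lfloor>x\<rfloor> + 1/2)\<bar> \<le> 1/2" by linarith
      then have "\<bar>x - (of_int \<lfloor>x\<rfloor> + 1/2)\<bar>\<^sup>2 \<le> (1/2)\<^sup>2" by (rule power_mono) simp
      then show ?thesis by (simp add: power2_eq_square)
    qed
    show "dist (ys ! u) (of_int \<lfloor>fst (ys ! u)\<rfloor> + 1 / 2, of_int \<lfloor>snd (ys ! u)\<rfloor> + 1 / 2) \<le> 1"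
      unfolding dist_plane fst_conv snd_conv using h[of "fst (ys ! u)"] h[of "snd (ys ! u)"]
      by (intro real_le_lsqrt) auto
  qed
  then have "card {u \<in> {..<n}. \<lfloor>fst (ys ! u)\<rfloor> = a \<and> \<lfloor>snd (ys ! u)\<rfloor> = b} \<le> card {u \<in> {..<n}. dist (ys ! u) ?z \<le> 1}"
    by (intro card_mono) auto
  also have "\<dots> \<le> p" by (rule ply_subset[OF plyG]) simp
  finally show ?thesis .
qed

text \<open>As cells are cut out by integer parts, the nine cells of a block are a union of
  half-open unit squares, 6k in each direction.\<close>

lemma card_block: "card {u \<in> {..<n}. nbr (cell u) Z} \<le> 36 * k\<^sup>2 * p"
proof -
  let ?I = "\<lambda>z. {(z - 1) * (2 * int k) ..< (z + 2) * (2 * int k)}"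
  let ?G = "?I (fst Z) \<times> ?I (snd Z)"
  have cI: "card (?I z) = 6 * k" for z
  proof -
    have "(z + 2) * (2 * int k) - (z - 1) * (2 * int k) = int (6 * k)" by (simp add: algebra_simps)
    then show ?thesis by simp
  qed
  have div: "x \<in> ?I z" if "\<bar>x div (2 * int k) - z\<bar> \<le> 1" for x z
  proof -
    have d: "0 < 2 * int k" using kpos by linarith
    have "(z - 1) * (2 * int k) \<le> (x div (2 * int k)) * (2 * int k)" using that d by (intro mult_right_mono) auto
    moreover have "(x div (2 * int k) + 1) * (2 * int k) \<le> (z + 2) * (2 * int k)" using that d by (intro mult_right_mono) auto
    moreover have "x = (x div (2 * int k)) * (2 * int k) + x mod (2 * int k)" by (rule div_mult_mod_eq[symmetric])
    moreover have "0 \<le> x mod (2 * int k)" "x mod (2 * int k) < 2 * int k" using d by auto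
    ultimately show ?thesis unfolding atLeastLessThan_iff distrib_right by linarith
  qed
  have "{u \<in> {..<n}. nbr (cell u) Z} \<subseteq> (\<Union>(a, b)\<in>?G. {u \<in> {..<n}. \<lfloor>fst (ys ! u)\<rfloor> = a \<and> \<lfloor>snd (ys ! u)\<rfloor> = b})"
  proof
    fix u assume "u \<in> {u \<in> {..<n}. nbr (cell u) Z}"
    then have "u < n" "\<lfloor>fst (ys ! u)\<rfloor> \<in> ?I (fst Z)" "\<lfloor>snd (ys ! u)\<rfloor> \<in> ?I (snd Z)"
      using div by (auto simp only: nbr_def cell_def mem_Collect_eq fst_conv snd_conv lessThan_iff)
    then show "u \<in> (\<Union>(a, b)\<in>?G. {u \<in> {..<n}. \<lfloor>fst (ys ! u)\<rfloor> = a \<and> \<lfloor>snd (ys ! u)\<rfloor> = b})" by blast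
  qed
  then have "card {u \<in> {..<n}. nbr (cell u) Z} \<le>
      card (\<Union>(a, b)\<in>?G. {u \<in> {..<n}. \<lfloor>fst (ys ! u)\<rfloor> = a \<and> \<lfloor>snd (ys ! u)\<rfloor> = b})"
    by (intro card_mono) auto
  also have "\<dots> \<le> (\<Sum>(a, b)\<in>?G. card {u \<in> {..<n}. \<lfloor>fst (ys ! u)\<rfloor> = a \<and> \<lfloor>snd (ys ! u)\<rfloor> = b})"
    unfolding case_prod_unfold by (rule card_UN_le) simp
  also have "\<dots> \<le> (\<Sum>ab\<in>?G. p)" by (intro sum_mono) (use unit_square_ply in auto)
  also have "\<dots> = 36 * k\<^sup>2 * p" by (simp only: sum_constant card_cartesian_product cI) (simp add: power2_eq_square)
  finally show ?thesis .
qed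

lemma oracle_host:
  assumes L: "distinct L" "set L \<subseteq> {..<n}" "length L \<le> 36 * k\<^sup>2 * p"
  obtains N where "\<Omega> xs (host A L C) = Some N"
    "int N = conv (conv (g (A \<inter> V)) (S (set L) (close ys))) (g (V - C)) V"
proof
  have "length (host A L C) \<le> k + 36 * k\<^sup>2 * p + k"
    using length_filter_upt_le[of "\<lambda>u. u \<in> A" k] length_filter_upt_le[of "\<lambda>u. u \<notin> C" k] L(3)
    unfolding host_def length_append length_map by linarith
  also have "\<dots> \<le> 38 * k\<^sup>2 * p"
  proof -
    have "k \<le> k * k * p" using kpos p_pos by simp
    then show ?thesis by (simp add: power2_eq_square)
  qed
  finally show "\<Omega> xs (host A L C) = Some (card (sub (disk_graph xs) (disk_graph (host A L C))))"
    using answers host_parts(2)[OF L(1,2)] by blast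
  show "int (card (sub (disk_graph xs) (disk_graph (host A L C)))) =
      conv (conv (g (A \<inter> V)) (S (set L) (close ys))) (g (V - C)) V"
    unfolding card_sub host_parts(1)[OF L(1,2)] ..
qed

text \<open>Isomorphism classes of separations are detected by the isomorphism type of one side.\<close>

lemma card_reps_le_sigma0:
  assumes "\<And>i. i < length Rs \<Longrightarrow> sepset (Rs ! i)"
    and "\<And>i j. i < length Rs \<Longrightarrow> j < length Rs \<Longrightarrow> i \<noteq> j \<Longrightarrow> \<not> giso (Rs ! i) (Rs ! j)"
  shows "length Rs \<le> sigma0 (disk_graph xs)"
proof -
  let ?P = "disk_graph xs"
  have vP: "verts ?P = V" by (simp add: disk_graph_def)
  have sep: "(A, V - A) \<in> separations0 ?P" if "sepset A" for A
    using that sepset_edge[OF that] unfolding separations0_def edges_iff_adj vP by (auto simp: sepset_def)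
  have id: "automorphism ?P id" by (auto simp: automorphism_def)
  let ?f = "\<lambda>i. separation_iso ?P `` {(Rs ! i, V - Rs ! i)}"
  have "card {..<length Rs} \<le> card (separations0 ?P // separation_iso ?P)"
  proof (rule card_inj_on_le)
    show "inj_on ?f {..<length Rs}"
    proof (rule inj_onI, rule ccontr)
      fix i j assume ij: "i \<in> {..<length Rs}" "j \<in> {..<length Rs}" "?f i = ?f j" "i \<noteq> j"
      have "(Rs ! j, V - Rs ! j) \<in> ?f j"
        using sep[of "Rs ! j"] assms(1) ij id unfolding separation_iso_def by (auto intro!: exI[of _ id])
      then have "(Rs ! j, V - Rs ! j) \<in> ?f i" using ij(3) by simp
      then obtain \<phi> where \<phi>: "automorphism ?P \<phi>" "\<phi> ` (Rs ! i) = Rs ! j" by (auto simp: separation_iso_def)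
      have sub: "Rs ! i \<subseteq> V" using assms(1) ij sepset_subset by auto
      have "bij_betw \<phi> (Rs ! i) (Rs ! j)"
        using \<phi> sub unfolding automorphism_def vP bij_betw_def by (auto intro: inj_on_subset)
      moreover have "\<forall>u\<in>Rs ! i. \<forall>v\<in>Rs ! i. adj u v \<longleftrightarrow> adj (\<phi> u) (\<phi> v)"
        using \<phi>(1) sub unfolding automorphism_def vP edges_iff_adj by blast
      ultimately have "giso (Rs ! i) (Rs ! j)" unfolding giso_def by blast
      then show False using assms(2) ij by auto
    qed
    show "?f ` {..<length Rs} \<subseteq> separations0 ?P // separation_iso ?P"
      using sep assms(1) by (auto simp: quotient_def)
    have "separations0 ?P \<subseteq> Pow V \<times> Pow V" unfolding separations0_def vP by auto
    then have "finite (separations0 ?P)" by (rule finite_subset) simp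
    moreover have "separation_iso ?P \<subseteq> separations0 ?P \<times> separations0 ?P" by (auto simp: separation_iso_def)
    ultimately show "finite (separations0 ?P // separation_iso ?P)" by (rule finite_quotient)
  qed
  then show ?thesis by (simp add: sigma0_def)
qed

end

subsection \<open>Computing the representatives\<close>

definition EqE :: "iexp \<Rightarrow> iexp \<Rightarrow> bexp" where
  "EqE e e' = Conj (Neg (Less e e')) (Neg (Less e' e))"

lemma EqE [simp]: "bval s (EqE e e') \<longleftrightarrow> ival s e = ival s e'" "bok W s (EqE e e') \<longleftrightarrow> iok W s e \<and> iok W s e'"
  by (auto simp: EqE_def)

text \<open>A naive union of classes by relabelling. Called for every pair of touching disks, it
  yields the components of \<open>P\<close> in cubic time without a graph search.\<close>

definition merge :: com where
  "merge = Seq (Assign ''l'' (Idx ''lab'' (Var ''v''))) (Seq (Assign ''l2'' (Idx ''lab'' (Var ''u'')))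
     (For ''t'' ''k'' (If (EqE (Idx ''lab'' (Var ''t'')) (Var ''l'')) (Store ''lab'' (Var ''t'') (Var ''l2'')) Skip)))"

definition labels :: com where
  "labels = Seq (For ''u'' ''k'' (Store ''lab'' (Var ''u'') (Var ''u'')))
     (For ''u'' ''k'' (For ''v'' ''k''
       (If (NormLe (RSub (px ''P'' (Var ''u'')) (px ''P'' (Var ''v''))) (RSub (py ''P'' (Var ''u'')) (py ''P'' (Var ''v''))) (OfInt (Lit 2)))
         merge Skip)))"

text \<open>Two rows \<open>A\<close>, \<open>C\<close> are isomorphic iff \<open>P\<close> maps both to \<open>P[A] + P[V - C]\<close> and to \<open>P[C] + P[V - A]\<close>.\<close>

definition test :: com where
  "test = Seq (Assign ''a'' (Var ''t'')) (Seq (Assign ''c'' (Var ''r'')) (Seq ask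
     (If (Less (Lit 0) (Var ''q''))
       (Seq (Assign ''a'' (Var ''r'')) (Seq (Assign ''c'' (Var ''t'')) (Seq ask
         (If (Less (Lit 0) (Var ''q'')) (Assign ''new'' (Lit 0)) Skip))))
       Skip)))"

definition fill :: com where
  "fill = If (EqE (Idx ''lab'' (Var ''u'')) (Idx ''lab'' (Var ''v'')))
     (Store ''m'' (Add (Mul (Var ''r'') (Var ''k'')) (Var ''u'')) (Lit 1))
     (Store ''m'' (Add (Mul (Var ''r'') (Var ''k'')) (Var ''u'')) (Idx ''m'' (Add (Mul (Var ''i'') (Var ''k'')) (Var ''u''))))"

definition candidate :: com where
  "candidate = Seq (For ''u'' ''k'' fill)
     (Seq (Assign ''new'' (Lit 1)) (Seq (For ''t'' ''r'' test) (Assign ''r'' (Add (Var ''r'') (Var ''new'')))))"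

text \<open>
  The union of a representative and a component is a candidate for a new one, which is written to the
  row \<open>r\<close> of the table and stays there only if it is new. The rows agree with those of \<open>outer\<close> below.
\<close>

definition enum :: com where
  "enum = Seq (Assign ''r'' (Lit 1)) (Seq (Assign ''w'' (Lit 0))
     (For ''v'' ''k'' (Seq (Assign ''r0'' (Var ''r'')) (For ''i'' ''r0'' candidate))))"

lemma mods [simp]:
  "modi merge = {''l'', ''l2'', ''t''}" "moda merge = {''lab''}" "modr merge = {}"
  "modi test = {''a'', ''c'', ''h'', ''u'', ''q'', ''new''}" "moda test = {}" "modr test = {''H''}"
  "modi fill = {}" "moda fill = {''m''}" "modr fill = {}"
  "modi candidate = {''u'', ''new'', ''t'', ''a'', ''c'', ''h'', ''q'', ''r''}" "moda candidate = {''m''}" "modr candidate = {''H''}"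
  by (auto simp: merge_def test_def fill_def candidate_def)

context disk_instance
begin

text \<open>
  \<open>Qb\<close> bounds the answers of the oracle, \<open>2 + Be\<close> the growth in a step of the iterative solver,
  \<open>X0\<close> the coefficients between two cells, and \<open>Gam\<close> their growth in a step of the update of a cell.
\<close>

definition Qb :: nat where "Qb = (2 * k + n) ^ k"

definition Be :: int where "Be = 2 + 2 ^ k * int Qb"
definition Gam :: int where "Gam = (2 + Be) ^ (k * k + k + 3)"
definition X0 :: int where "X0 = int Qb * (1 + 2 ^ k * int Qb) ^ (k + k * k)"

text \<open>The estimate uses the numbers of vertices of \<open>P\<close> and \<open>G\<close>
  instead of \<open>38 * k^2 * p\<close>, because the word size is to depend on \<open>k\<close>,
  \<open>n\<close> and the coordinates but not on \<open>p\<close>.\<close>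

lemma query_bound:
  assumes L: "distinct L" "set L \<subseteq> {..<n}"
  shows "card (sub (disk_graph xs) (disk_graph (host A L C))) \<le> Qb"
proof -
  have "length L \<le> n" using L by (metis card_lessThan card_mono distinct_card finite_lessThan)
  then have "length (host A L C) \<le> 2 * k + n"
    using length_filter_upt_le[of "\<lambda>u. u \<in> A" k] length_filter_upt_le[of "\<lambda>u. u \<notin> C" k]
    unfolding host_def length_append length_map by linarith
  then have "Sl (host A L C) V \<le> int (2 * k + n) ^ k"
    unfolding Sl_def using kpos by (intro S_le) auto
  then show ?thesis unfolding Qb_def card_sub[symmetric] by (simp only: of_nat_power[symmetric] of_nat_le_iff)
qed

end

text \<open>The demands on the two scales: row numbers (at most \<open>2 ^ k\<close>) and cell keys
  stay below \<open>Bd\<close>, while a word holds coefficients after \<open>k + 1\<close> update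
  steps from \<open>X0\<close>, with room for intermediate values. \<open>Sb_eq\<close> is the value
  that the program computes.\<close>

locale disk_program = disk_instance +
  assumes QW: "Qb \<le> W" and pow: "2 ^ length xs + 1 \<le> Bd" and XW: "X0 * Gam ^ (length xs + 4) \<le> int W"
    and key_Bd: "(Sb + 1) * (2 * Sb + 6) \<le> Bd" and K_Bd: "length xs * length xs + length xs + 1 \<le> Bd"
    and Sb_eq: "int Sb = 3 + (\<Sum>z\<leftarrow>xs @ ys. \<lfloor>fst z\<rfloor> * \<lfloor>fst z\<rfloor> + \<lfloor>snd z\<rfloor> * \<lfloor>snd z\<rfloor>)"
begin

definition pairing :: "nat set \<Rightarrow> nat list \<Rightarrow> nat set \<Rightarrow> int" where
  "pairing A L C = conv (conv (g A) (S (set L) (close ys))) (g (V - C)) V"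

lemma pairing_Nil: "pairing A [] C = conv (g A) (g (V - C)) V"
  unfolding pairing_def by (rule conv_cong) (auto intro!: conv_S_empty_host intro: finite_subset)

lemma runs_pairing:
  assumes s: "base s" "m_ok s" and a: "ivar s ''a'' = int a" "a \<le> Bd" and c: "ivar s ''c'' = int c" "c \<le> Bd"
    and w: "ivar s ''w'' = int (length L)" "wl_is s L" "distinct L" "length L \<le> 36 * k\<^sup>2 * p"
  shows "runs ask s (12 * (k + length L) + 8)
     (\<lambda>s'. ivar s' ''q'' = pairing (row s a) L (row s c) \<and> 0 \<le> ivar s' ''q'' \<and> ivar s' ''q'' \<le> int Qb)"
proof -
  have L: "set L \<subseteq> {..<n}" using w(2) by (simp add: wl_is_def)
  then have Ln: "length L \<le> n" using w(3) by (metis card_lessThan card_mono distinct_card finite_lessThan)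
  let ?N = "card (sub (disk_graph xs) (disk_graph (host (row s a) L (row s c))))"
  have N: "?N \<le> Qb" by (rule query_bound[OF w(3) L])
  have \<Omega>: "\<Omega> xs (host (row s a) L (row s c)) = Some ?N" and v: "int ?N = pairing (row s a) L (row s c)"
  proof -
    have "row s a \<inter> V = row s a" by (auto simp: row_def)
    then show v: "int ?N = pairing (row s a) L (row s c)"
      unfolding card_sub host_parts(1)[OF w(3) L] pairing_def by simp
    obtain N where "\<Omega> xs (host (row s a) L (row s c)) = Some N" "int N = pairing (row s a) L (row s c)"
      using oracle_host[OF w(3) L w(4)] \<open>row s a \<inter> V = row s a\<close> unfolding pairing_def by metis
    then show "\<Omega> xs (host (row s a) L (row s c)) = Some ?N" using v by (metis of_nat_eq_iff)
  qed
  show ?thesis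
  proof (rule runs_mono[OF runs_ask[OF s a c w(1,2) Ln \<Omega>] order_refl])
    show "?N \<le> W" using N QW by simp
  qed (use N v in simp)
qed

text \<open>One half of the statement that label classes are components: no closed set separates
  vertices with equal labels. Phrased with closed sets it needs no paths; \<open>good_lab\<close>
  adds the other half, that edges do not leave a class.\<close>

definition sound :: "(nat \<Rightarrow> int) \<Rightarrow> bool" where
  "sound l \<longleftrightarrow> (\<forall>u<k. 0 \<le> l u \<and> l u < int k) \<and>
     (\<forall>A u v. sepset A \<longrightarrow> u < k \<longrightarrow> v < k \<longrightarrow> l u = l v \<longrightarrow> (u \<in> A \<longleftrightarrow> v \<in> A))"

definition merged :: "(nat \<Rightarrow> int) \<Rightarrow> nat \<Rightarrow> nat \<Rightarrow> nat \<Rightarrow> int" where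
  "merged l u v t = (if l t = l v then l u else l t)"

lemma sound_merged:
  assumes "sound l" "close xs u v" "u < k" "v < k" shows "sound (merged l u v)"
proof -
  have uv: "u \<in> A \<longleftrightarrow> v \<in> A" if "sepset A" for A
  proof (cases "u = v")
    case False
    then show ?thesis using sepset_edge[OF that] assms(2-4) by (auto simp: adj_def)
  qed simp
  have "a \<in> A \<longleftrightarrow> b \<in> A" if A: "sepset A" and ab: "a < k" "b < k" "merged l u v a = merged l u v b" for A a b
  proof -
    have s: "x \<in> A \<longleftrightarrow> y \<in> A" if "x < k" "y < k" "l x = l y" for x y
      using assms(1) A that unfolding sound_def by blast
    \<comment> \<open>Merging amounts to reading the old label at \<open>u\<close> for all vertices
      labelled like \<open>v\<close>; as \<open>u\<close> and \<open>v\<close> touch, no closed set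
      tells them apart.\<close>
    define rep where "rep x = (if l x = l v then u else x)" for x
    have "merged l u v x = l (rep x)" "rep x < k" "x \<in> A \<longleftrightarrow> rep x \<in> A" if "x < k" for x
      using s[of x v] uv[OF A] assms(3,4) that by (auto simp: merged_def rep_def)
    then show ?thesis using s[of "rep a" "rep b"] ab by simp
  qed
  moreover have "0 \<le> merged l u v t \<and> merged l u v t < int k" if "t < k" for t
    using assms(1,3) that unfolding sound_def merged_def by simp
  ultimately show ?thesis unfolding sound_def by blast
qed

definition lab_is :: "state \<Rightarrow> (nat \<Rightarrow> int) \<Rightarrow> bool" where
  "lab_is s l \<longleftrightarrow> (\<forall>u<k. iarr s ''lab'' (int u) = l u)"

lemma kW: "k \<le> W" "n \<le> W"
  using Bd BW by linarith+

lemma base_same: "base s \<Longrightarrow> same c s s' \<Longrightarrow> {''k'', ''n'', ''S''} \<inter> modi c = {} \<Longrightarrow> {''P'', ''G''} \<inter> modr c = {} \<Longrightarrow> base s'"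
  unfolding base_def same_def by auto

lemma runs_merge:
  assumes s: "base s" "lab_is s l" "sound l" and u: "ivar s ''u'' = int u" "u < k" and v: "ivar s ''v'' = int v" "v < k"
  shows "runs merge s (4 * k + 4) (\<lambda>s'. lab_is s' (merged l u v))"
proof -
  have lw: "word W (l t)" if "t < k" for t
    using s(3) that Bd by (intro word_lin) (auto simp: sound_def dest!: spec[of _ t])
  have w: "word W (int t)" if "t < k" for t using that Bd by (intro word_lin) auto
  have k: "ivar s ''k'' = int k" using s(1) by (simp add: base_def)
  have lu: "iarr s ''lab'' (int t) = l t" if "t < k" for t using s(2) that by (simp add: lab_is_def)
  let ?s1 = "s\<lparr>ivar := (ivar s)(''l'' := l v)\<rparr>"
  let ?s2 = "s\<lparr>ivar := (ivar s)(''l'' := l v, ''l2'' := l u)\<rparr>"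
  let ?b = "If (EqE (Idx ''lab'' (Var ''t'')) (Var ''l'')) (Store ''lab'' (Var ''t'') (Var ''l2'')) Skip"
  have "runs (For ''t'' ''k'' ?b) ?s2 (k * (1 + 1 + 2) + 2) (\<lambda>s'. lab_is s' (merged l u v))"
  proof (rule runs_For_const[where N = k and I = "\<lambda>i s'. \<forall>t<k. iarr s' ''lab'' (int t) = (if t < i then merged l u v t else l t)"])
    fix i s' assume i: "i < k" "ivar s' ''t'' = int i" and same: "same (For ''t'' ''k'' ?b) ?s2 s'"
      and I: "\<forall>t<k. iarr s' ''lab'' (int t) = (if t < i then merged l u v t else l t)"
    have f: "ivar s' ''l'' = l v" "ivar s' ''l2'' = l u" using sameD(1)[OF same] by simp_all
    have li: "iarr s' ''lab'' (int i) = l i" using I i by simp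
    show "runs ?b s' (1 + 1) (\<lambda>s''. same ?b s' s'' \<longrightarrow>
        (\<forall>t<k. iarr (s''\<lparr>ivar := (ivar s'')(''t'' := int i + 1)\<rparr>) ''lab'' (int t) = (if t < Suc i then merged l u v t else l t)))"
    proof (rule runs_If)
      show "bok W s' (EqE (Idx ''lab'' (Var ''t'')) (Var ''l''))"
        using i f li lw[OF i(1)] lw[OF v(2)] w[OF i(1)] by simp
      show "runs (Store ''lab'' (Var ''t'') (Var ''l2'')) s' 1 (\<lambda>s''. same ?b s' s'' \<longrightarrow>
        (\<forall>t<k. iarr (s''\<lparr>ivar := (ivar s'')(''t'' := int i + 1)\<rparr>) ''lab'' (int t) = (if t < Suc i then merged l u v t else l t)))"
        if "bval s' (EqE (Idx ''lab'' (Var ''t'')) (Var ''l''))"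
        by (rule runs_Store) (use that I i f li lw[OF u(2)] w[OF i(1)] in \<open>auto simp: merged_def less_Suc_eq\<close>)
      show "runs Skip s' 1 (\<lambda>s''. same ?b s' s'' \<longrightarrow>
        (\<forall>t<k. iarr (s''\<lparr>ivar := (ivar s'')(''t'' := int i + 1)\<rparr>) ''lab'' (int t) = (if t < Suc i then merged l u v t else l t)))"
        if "\<not> bval s' (EqE (Idx ''lab'' (Var ''t'')) (Var ''l''))"
        by (rule runs_Skip) (use that I i f li in \<open>auto simp: merged_def less_Suc_eq\<close>)
    qed
  qed (use k kW lu in \<open>auto simp: lab_is_def\<close>)
  then have 2: "runs (For ''t'' ''k'' ?b) ?s2 (4 * k + 2) (\<lambda>s'. lab_is s' (merged l u v))"
    by (rule runs_time) simp
  have "runs merge s (1 + (1 + (4 * k + 2))) (\<lambda>s'. lab_is s' (merged l u v))"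
    unfolding merge_def
  proof (rule runs_SeqI[where ?Q1.0 = "\<lambda>s'. s' = ?s1"], rule runs_Assign)
    fix s1 assume "s1 = ?s1"
    then show "runs (Seq (Assign ''l2'' (Idx ''lab'' (Var ''u''))) (For ''t'' ''k'' ?b)) s1 (1 + (4 * k + 2)) (\<lambda>s'. lab_is s' (merged l u v))"
      using u lu lw w 2
      by (intro runs_SeqI[where ?Q1.0 = "\<lambda>s'. s' = ?s2"] runs_Assign) (auto simp: fun_upd_twist)
  qed (use v lu lw w in auto)
  then show ?thesis by (rule runs_time) simp
qed

definition good_lab :: "state \<Rightarrow> (nat \<Rightarrow> int) \<Rightarrow> bool" where
  "good_lab s l \<longleftrightarrow> lab_is s l \<and> sound l \<and> (\<forall>u<k. \<forall>v<k. close xs u v \<longrightarrow> l u = l v)"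

text \<open>A merged labelling is a function of the old one, so equalities obtained for earlier
  pairs persist. The invariant \<open>I i j\<close> covers the pairs that precede
  \<open>(i, j)\<close> lexicographically.\<close>

lemma runs_labels:
  assumes s: "base s"
  shows "runs labels s (k * (k * (4 * k + 7) + 4) + 3 * k + 4) (\<lambda>s'. \<exists>l. good_lab s' l)"
proof -
  have w: "word W (int u)" "word W (2 * int u)" "word W (2 * int u + 1)" "word W 1" "word W 2" if "u < k" for u
    by (rule word_lin; use that Bd in simp)+
  have k: "ivar s ''k'' = int k" and P: "rarr s ''P'' = store_centres xs" using s by (auto simp: base_def)
  let ?c = "If (NormLe (RSub (px ''P'' (Var ''u'')) (px ''P'' (Var ''v''))) (RSub (py ''P'' (Var ''u'')) (py ''P'' (Var ''v''))) (OfInt (Lit 2))) merge Skip"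
  let ?d = "For ''v'' ''k'' ?c"
  define I where "I i j s' \<longleftrightarrow> (\<exists>l. lab_is s' l \<and> sound l \<and> (\<forall>u<k. \<forall>v<k. (u < i \<or> u = i \<and> v < j) \<longrightarrow> close xs u v \<longrightarrow> l u = l v))"
    for i j and s' :: state
  have inner: "runs ?c s' (4 * k + 4 + 1) (I i (Suc j))"
    if s': "base s'" "ivar s' ''u'' = int i" "i < k" "ivar s' ''v'' = int j" "j < k" "I i j s'" for s' i j
  proof -
    from s'(6) obtain l where l: "lab_is s' l" "sound l"
        "\<And>u v. u < k \<Longrightarrow> v < k \<Longrightarrow> (u < i \<or> u = i \<and> v < j) \<Longrightarrow> close xs u v \<Longrightarrow> l u = l v"
      unfolding I_def by blast
    have P': "rarr s' ''P'' = store_centres xs" using s'(1) by (simp add: base_def)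
    have close: "bval s' (NormLe (RSub (px ''P'' (Var ''u'')) (px ''P'' (Var ''v''))) (RSub (py ''P'' (Var ''u'')) (py ''P'' (Var ''v''))) (OfInt (Lit 2)))
        \<longleftrightarrow> close xs i j"
      using s'(2-5) P' store_centres_nth[OF s'(3)] store_centres_nth[OF s'(5)] unfolding close_def dist_plane
      by (simp add: real_sqrt_le_iff flip: real_sqrt_le_iff[of _ "4"])
    show ?thesis
    proof (rule runs_If)
      show "bok W s' (NormLe (RSub (px ''P'' (Var ''u'')) (px ''P'' (Var ''v''))) (RSub (py ''P'' (Var ''u'')) (py ''P'' (Var ''v''))) (OfInt (Lit 2)))"
        using w[OF s'(3)] w[OF s'(5)] s'(2,4) by simp
    next
      assume "bval s' (NormLe (RSub (px ''P'' (Var ''u'')) (px ''P'' (Var ''v''))) (RSub (py ''P'' (Var ''u'')) (py ''P'' (Var ''v''))) (OfInt (Lit 2)))"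
      then have c: "close xs i j" using close by blast
      show "runs merge s' (4 * k + 4) (I i (Suc j))"
      proof (rule runs_mono[OF runs_merge[OF s'(1) l(1,2) s'(2,3,4,5)] order_refl])
        fix s'' assume "lab_is s'' (merged l i j)"
        moreover have "merged l i j u = merged l i j v" if "u < k" "v < k" "u < i \<or> u = i \<and> v < Suc j" "close xs u v" for u v
          using that l(3)[of u v] by (cases "u = i \<and> v = j") (auto simp: merged_def)
        ultimately show "I i (Suc j) s''" using sound_merged[OF l(2) c s'(3,5)] unfolding I_def by blast
      qed
    next
      assume "\<not> bval s' (NormLe (RSub (px ''P'' (Var ''u'')) (px ''P'' (Var ''v''))) (RSub (py ''P'' (Var ''u'')) (py ''P'' (Var ''v''))) (OfInt (Lit 2)))"
      then have "\<not> close xs i j" using close by blast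
      then have "I i (Suc j) s'" using l unfolding I_def by (metis less_Suc_eq)
      then show "runs Skip s' (4 * k + 4) (I i (Suc j))" by (intro runs_time[OF runs_Skip]) auto
    qed
  qed
  have I_upd: "I i j (s'\<lparr>ivar := z\<rparr>) \<longleftrightarrow> I i j s'" for i j s' z by (simp add: I_def lab_is_def)
  have row: "runs ?d s' (k * (4 * k + 4 + 1 + 2) + 2) (I (Suc i) 0)"
    if s': "base s'" "ivar s' ''u'' = int i" "i < k" "I i 0 s'" for s' i
  proof (rule runs_For_const[where I = "\<lambda>j s''. I i j s''"])
    show "ivar s' ''k'' = int k" using s'(1) by (simp add: base_def)
    fix j s'' assume j: "j < k" "ivar s'' ''v'' = int j" and same: "same ?d s' s''" and Ij: "I i j s''"
    have "base s''" using base_same[OF s'(1) same] by simp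
    moreover have "ivar s'' ''u'' = int i" using sameD(1)[OF same, of "''u''"] s'(2) by simp
    ultimately have "runs ?c s'' (4 * k + 4 + 1) (I i (Suc j))" using s'(3) j Ij by (intro inner)
    then show "runs ?c s'' (4 * k + 4 + 1) (\<lambda>s3. same ?c s'' s3 \<longrightarrow> I i (Suc j) (s3\<lparr>ivar := (ivar s3)(''v'' := int j + 1)\<rparr>))"
      unfolding I_upd by (rule runs_imp)
  next
    fix s'' assume "I i k s''"
    then show "I (Suc i) 0 s''" unfolding I_def by (metis less_Suc_eq not_less_zero)
  qed (use kW s' in \<open>auto simp: I_upd\<close>)
  have all: "runs (For ''u'' ''k'' ?d) s' (k * (k * (4 * k + 4 + 1 + 2) + 2 + 2) + 2) (\<lambda>s'. \<exists>l. good_lab s' l)"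
    if s': "base s'" "I 0 0 s'" for s'
  proof (rule runs_For_const[where I = "\<lambda>i s''. I i 0 s''"])
    show "ivar s' ''k'' = int k" using s'(1) by (simp add: base_def)
    fix i s'' assume i: "i < k" "ivar s'' ''u'' = int i" and same: "same (For ''u'' ''k'' ?d) s' s''" and Ii: "I i 0 s''"
    have "base s''" using base_same[OF s'(1) same] by simp
    then have "runs ?d s'' (k * (4 * k + 4 + 1 + 2) + 2) (I (Suc i) 0)" using i Ii by (intro row)
    then show "runs ?d s'' (k * (4 * k + 4 + 1 + 2) + 2) (\<lambda>s3. same ?d s'' s3 \<longrightarrow> I (Suc i) 0 (s3\<lparr>ivar := (ivar s3)(''u'' := int i + 1)\<rparr>))"
      unfolding I_upd by (rule runs_imp)
  next
    fix s'' assume "I k 0 s''"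
    then show "\<exists>l. good_lab s'' l" unfolding I_def good_lab_def by blast
  qed (use kW s' in \<open>auto simp: I_upd\<close>)
  have init: "runs (For ''u'' ''k'' (Store ''lab'' (Var ''u'') (Var ''u''))) s (k * (1 + 2) + 2) (I 0 0)"
  proof (rule runs_For_const[where I = "\<lambda>i s'. \<forall>u<i. iarr s' ''lab'' (int u) = int u"])
    fix i and s' :: state assume i: "i < k" "ivar s' ''u'' = int i" and I: "\<forall>u<i. iarr s' ''lab'' (int u) = int u"
    show "runs (Store ''lab'' (Var ''u'') (Var ''u'')) s' 1 (\<lambda>s''. same (Store ''lab'' (Var ''u'') (Var ''u'')) s' s'' \<longrightarrow>
      (\<forall>u<Suc i. iarr (s''\<lparr>ivar := (ivar s'')(''u'' := int i + 1)\<rparr>) ''lab'' (int u) = int u))"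
      by (rule runs_Store) (use i I w[OF i(1)] in \<open>auto simp: less_Suc_eq\<close>)
  next
    fix s' :: state assume "\<forall>u<k. iarr s' ''lab'' (int u) = int u"
    then have "lab_is s' int" by (simp add: lab_is_def)
    moreover have "sound int" by (simp add: sound_def)
    ultimately show "I 0 0 s'" unfolding I_def by (intro exI[of _ int]) auto
  qed (use kW k in auto)
  have "runs labels s ((k * (1 + 2) + 2) + (k * (k * (4 * k + 4 + 1 + 2) + 2 + 2) + 2)) (\<lambda>s'. \<exists>l. good_lab s' l)"
    unfolding labels_def
  proof (rule runs_SeqI[OF init])
    fix s' assume same: "same (For ''u'' ''k'' (Store ''lab'' (Var ''u'') (Var ''u''))) s s'" and "I 0 0 s'"
    then show "runs (For ''u'' ''k'' ?d) s' (k * (k * (4 * k + 4 + 1 + 2) + 2 + 2) + 2) (\<lambda>s'. \<exists>l. good_lab s' l)"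
      using base_same[OF s same] by (intro all) auto
  qed
  then show ?thesis by (rule runs_time) (simp add: algebra_simps)
qed

end

section \<open>Enumerating closed sets up to isomorphism\<close>

context disk_program
begin

definition comp :: "(nat \<Rightarrow> int) \<Rightarrow> nat \<Rightarrow> nat set" where
  "comp l v = {u. u < k \<and> l u = l v}"

definition add_rep :: "nat set list \<Rightarrow> nat set \<Rightarrow> nat set list" where
  "add_rep Rs B = (if \<exists>R\<in>set Rs. giso R B then Rs else Rs @ [B])"

text \<open>One pass joins the component of \<open>v\<close> to the rows present at its start. The
  list grows at its end meanwhile, which leaves these rows in place (\<open>inner_prefix\<close>),
  so a fixed \<open>Rs\<close> may be read.\<close>

fun inner :: "(nat \<Rightarrow> int) \<Rightarrow> nat \<Rightarrow> nat set list \<Rightarrow> nat \<Rightarrow> nat set list" where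
  "inner l v Rs 0 = Rs"
| "inner l v Rs (Suc i) = add_rep (inner l v Rs i) (Rs ! i \<union> comp l v)"

fun outer :: "(nat \<Rightarrow> int) \<Rightarrow> nat \<Rightarrow> nat set list" where
  "outer l 0 = [{}]"
| "outer l (Suc v) = inner l v (outer l v) (length (outer l v))"

text \<open>Row 0 is kept empty on purpose: it makes the host of the query for \<open>alpha\<close>
  equal to \<open>P\<close>, and it represents the empty host at the start of the sweep.\<close>

definition irredundant :: "nat set list \<Rightarrow> nat set \<Rightarrow> bool" where
  "irredundant Rs U \<longleftrightarrow> (\<forall>R\<in>set Rs. sepset R \<and> R \<subseteq> U) \<and>
     (\<forall>i<length Rs. \<forall>j<length Rs. i \<noteq> j \<longrightarrow> \<not> giso (Rs ! i) (Rs ! j)) \<and> Rs \<noteq> [] \<and> Rs ! 0 = {}"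

lemma irredundantD:
  assumes "irredundant Rs U"
  shows "length Rs \<le> sigma0 (disk_graph xs)" "length Rs + 1 \<le> Bd" "i < length Rs \<Longrightarrow> sepset (Rs ! i)"
    "i < length Rs \<Longrightarrow> Rs ! i \<subseteq> U" "i < length Rs \<Longrightarrow> j < length Rs \<Longrightarrow> i \<noteq> j \<Longrightarrow> \<not> giso (Rs ! i) (Rs ! j)"
    "Rs \<noteq> []" "Rs ! 0 = {}" "length Rs \<le> 2 ^ k"
proof -
  have sep: "\<And>i. i < length Rs \<Longrightarrow> sepset (Rs ! i)"
    and iso: "\<And>i j. i < length Rs \<Longrightarrow> j < length Rs \<Longrightarrow> i \<noteq> j \<Longrightarrow> \<not> giso (Rs ! i) (Rs ! j)"
    using assms unfolding irredundant_def by auto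
  show "length Rs \<le> sigma0 (disk_graph xs)" using card_reps_le_sigma0[OF sep iso] by blast
  have "distinct Rs" unfolding distinct_conv_nth using iso giso_refl by metis
  then have "length Rs = card (set Rs)" by (simp add: distinct_card)
  also have "\<dots> \<le> card (Pow V)"
  proof (rule card_mono)
    show "set Rs \<subseteq> Pow V" using sep sepset_subset by (metis PowI in_set_conv_nth subsetI)
  qed simp
  finally show "length Rs \<le> 2 ^ k" by (simp add: card_Pow)
  then show "length Rs + 1 \<le> Bd" using pow by linarith
  show "i < length Rs \<Longrightarrow> sepset (Rs ! i)" "i < length Rs \<Longrightarrow> j < length Rs \<Longrightarrow> i \<noteq> j \<Longrightarrow> \<not> giso (Rs ! i) (Rs ! j)"
    by (fact sep iso)+
  show "i < length Rs \<Longrightarrow> Rs ! i \<subseteq> U" "Rs \<noteq> []" "Rs ! 0 = {}" using assms unfolding irredundant_def by auto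
qed

lemma irredundant_add_rep:
  assumes "irredundant Rs U" "sepset B" "B \<subseteq> U" shows "irredundant (add_rep Rs B) U"
proof (cases "\<exists>R\<in>set Rs. giso R B")
  case False
  have "\<not> giso ((Rs @ [B]) ! i) ((Rs @ [B]) ! j)" if ij: "i < length (Rs @ [B])" "j < length (Rs @ [B])" "i \<noteq> j" for i j
  proof -
    have nB: "\<not> giso (Rs ! m) B" "\<not> giso B (Rs ! m)" if "m < length Rs" for m
      using False that nth_mem giso_sym by blast+
    consider "i < length Rs" "j < length Rs" | "i < length Rs" "j = length Rs" | "i = length Rs" "j < length Rs"
      using ij by fastforce
    then show ?thesis
      using irredundantD(5)[OF assms(1)] nB \<open>i \<noteq> j\<close> by cases (simp_all add: nth_append)
  qed
  moreover have "(Rs @ [B]) ! 0 = {}" using irredundantD(6,7)[OF assms(1)] by (simp add: nth_append)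
  moreover have "\<forall>R\<in>set (Rs @ [B]). sepset R \<and> R \<subseteq> U" using assms unfolding irredundant_def by auto
  ultimately show ?thesis using False unfolding add_rep_def irredundant_def by simp
qed (use assms in \<open>simp add: add_rep_def\<close>)

lemma add_rep_prefix: "i < length Rs \<Longrightarrow> add_rep Rs B ! i = Rs ! i" "length Rs \<le> length (add_rep Rs B)"
    "set Rs \<subseteq> set (add_rep Rs B)"
  by (auto simp: add_rep_def nth_append)

lemma add_rep_covers: "\<exists>R\<in>set (add_rep Rs B). giso R B"
  by (auto simp: add_rep_def giso_refl)

lemma inner_prefix: "i < length Rs \<Longrightarrow> inner l v Rs j ! i = Rs ! i" "length Rs \<le> length (inner l v Rs j)"
proof -
  have *: "length Rs \<le> length (inner l v Rs j) \<and> (\<forall>i<length Rs. inner l v Rs j ! i = Rs ! i)"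
    by (induction j) (use add_rep_prefix in \<open>auto intro: order_trans simp: less_le_trans\<close>)
  then show "i < length Rs \<Longrightarrow> inner l v Rs j ! i = Rs ! i" "length Rs \<le> length (inner l v Rs j)" by auto
qed

lemma sepset_comp:
  assumes "\<forall>u<k. \<forall>v<k. close xs u v \<longrightarrow> l u = l v" shows "sepset (comp l v)"
  using assms unfolding sepset_def comp_def adj_def by fastforce

lemma comp_cases: assumes "sound l" "v < k" "sepset A" shows "comp l v \<subseteq> A \<or> comp l v \<inter> A = {}"
proof -
  have "u \<in> A \<longleftrightarrow> v \<in> A" if "u \<in> comp l v" for u
    using assms that unfolding sound_def comp_def by blast
  then show ?thesis by blast
qed

lemma irredundant_inner:
  assumes "irredundant Rs U" "\<forall>u<k. \<forall>v<k. close xs u v \<longrightarrow> l u = l v" "i \<le> length Rs"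
  shows "irredundant (inner l v Rs i) (U \<union> comp l v)"
  using assms(3)
proof (induction i)
  case 0
  then show ?case using assms(1) unfolding irredundant_def by auto
next
  case (Suc i)
  then have "irredundant (inner l v Rs i) (U \<union> comp l v)" by simp
  moreover have "sepset (Rs ! i \<union> comp l v)" "Rs ! i \<union> comp l v \<subseteq> U \<union> comp l v"
    using irredundantD(3,4)[OF assms(1), of i] Suc.prems sepset_comp[OF assms(2)] sepset_Un by auto
  ultimately show ?case by (simp add: irredundant_add_rep)
qed

lemma inner_covers: "j < i \<Longrightarrow> \<exists>R\<in>set (inner l v Rs i). giso R (Rs ! j \<union> comp l v)"
proof (induction i)
  case (Suc i)
  then show ?case using add_rep_covers[of "inner l v Rs i"] add_rep_prefix(3)[of "inner l v Rs i"]
    by (cases "j = i") auto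
qed simp

definition covers :: "nat set list \<Rightarrow> nat set \<Rightarrow> bool" where
  "covers Rs U \<longleftrightarrow> (\<forall>A. sepset A \<longrightarrow> A \<subseteq> U \<longrightarrow> (\<exists>R\<in>set Rs. giso A R))"

text \<open>A closed set not inside \<open>U\<close> contains the component of \<open>v\<close>,
  which is then disjoint from \<open>U\<close>. Removing it leaves a closed subset of
  \<open>U\<close>, represented by some row; putting the component back on both sides extends the
  isomorphism, as no edges leave it.\<close>

lemma covers_inner:
  assumes l: "sound l" "\<forall>u<k. \<forall>v<k. close xs u v \<longrightarrow> l u = l v" "v < k"
    and Rs: "irredundant Rs U" "covers Rs U" "sepset U"
  shows "covers (inner l v Rs (length Rs)) (U \<union> comp l v)"
  unfolding covers_def
proof (intro allI impI)
  let ?C = "comp l v" and ?I = "inner l v Rs (length Rs)"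
  fix A assume A: "sepset A" "A \<subseteq> U \<union> ?C"
  note sC = sepset_comp[OF l(2), of v]
  have old: "\<exists>R\<in>set ?I. giso B R" if B: "sepset B" "B \<subseteq> U" for B
  proof -
    obtain R where "R \<in> set Rs" "giso B R" using Rs(2) B unfolding covers_def by blast
    then show ?thesis using inner_prefix by (metis in_set_conv_nth less_le_trans)
  qed
  show "\<exists>R\<in>set ?I. giso A R"
  proof (cases "A \<subseteq> U")
    case False
    have "\<not> ?C \<subseteq> U" using A(2) False by blast
    then have CU: "?C \<inter> U = {}" using comp_cases[OF l(1,3) Rs(3)] by blast
    have CA: "?C \<subseteq> A" using comp_cases[OF l(1,3) A(1)] A(2) False by blast
    have "sepset (A - ?C)" using A(1) sC sepset_Diff by blast
    moreover have "A - ?C \<subseteq> U" using A(2) by blast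
    ultimately obtain R where R: "R \<in> set Rs" "giso (A - ?C) R" using Rs(2) unfolding covers_def by blast
    obtain j where j: "j < length Rs" "R = Rs ! j" using R(1) by (auto simp: in_set_conv_nth)
    have sR: "sepset R" "R \<subseteq> U" using irredundantD(3,4)[OF Rs(1) j(1)] j(2) by auto
    have nE: "\<not> adj a b" if "a \<in> B" "b \<in> ?C" "sepset B" "B \<inter> ?C = {}" for a b B
      using that sepset_edge[OF that(3), of a b] sepset_subset[OF sC] sepset_subset[OF that(3)] by blast
    have "giso ((A - ?C) \<union> ?C) (R \<union> ?C)"
      by (rule giso_Un[OF R(2) giso_refl]) (use CU sR nE \<open>sepset (A - ?C)\<close> in blast)+
    moreover have "(A - ?C) \<union> ?C = A" using CA by blast
    moreover obtain R' where "R' \<in> set ?I" "giso R' (R \<union> ?C)" using inner_covers[OF j(1)] j(2) by blast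
    ultimately show ?thesis using giso_trans giso_sym by metis
  qed (use old A in blast)
qed

lemma outer_ok:
  assumes l: "sound l" "\<forall>u<k. \<forall>v<k. close xs u v \<longrightarrow> l u = l v"
  shows "v \<le> k \<Longrightarrow> irredundant (outer l v) (\<Union>u<v. comp l u) \<and> covers (outer l v) (\<Union>u<v. comp l u)"
proof (induction v)
  case 0
  have "irredundant [{}] {}" by (simp add: irredundant_def)
  moreover have "covers [{}] {}" by (simp add: covers_def giso_refl)
  ultimately show ?case by simp
next
  case (Suc v)
  let ?U = "\<Union>u<v. comp l u"
  have "sepset ?U"
  proof -
    have "sepset (\<Union>u<w. comp l u)" for w
      by (induction w) (use sepset_comp[OF l(2)] sepset_Un in \<open>auto simp: lessThan_Suc\<close>)
    then show ?thesis .
  qed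
  moreover have "(\<Union>u<Suc v. comp l u) = ?U \<union> comp l v" by (auto simp: lessThan_Suc)
  ultimately show ?case
    using Suc irredundant_inner[OF _ l(2) order_refl] covers_inner[OF l, of v] by simp
qed

lemma outer_reps:
  assumes "good_lab s l"
  shows "irredundant (outer l k) V" "reps k adj (outer l k)"
proof -
  have l: "sound l" "\<forall>u<k. \<forall>v<k. close xs u v \<longrightarrow> l u = l v" using assms by (auto simp: good_lab_def)
  have "(\<Union>u<k. comp l u) = V" by (auto simp: comp_def)
  then have o: "irredundant (outer l k) V" "covers (outer l k) V" using outer_ok[OF l, of k] by auto
  show "irredundant (outer l k) V" by (fact o)
  show "reps k adj (outer l k)"
  proof
    fix A assume "sepset A"
    then show "\<exists>i<length (outer l k). giso A (outer l k ! i)"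
      using o(2) sepset_subset unfolding covers_def by (metis in_set_conv_nth)
  qed (use irredundantD(3,5)[OF o(1)] in auto)
qed

definition table :: "state \<Rightarrow> nat set list \<Rightarrow> bool" where
  "table s Rs \<longleftrightarrow> ivar s ''r'' = int (length Rs) \<and> (\<forall>i<length Rs. row s i = Rs ! i)"

lemma runs_test:
  assumes s: "base s" "m_ok s" "ivar s ''w'' = 0" and t: "ivar s ''t'' = int t" "t \<le> Bd"
    and r: "ivar s ''r'' = int r" "r \<le> Bd" and sep: "sepset (row s t)" "sepset (row s r)"
  shows "runs test s (24 * k + 24) (\<lambda>s'. ivar s' ''new'' = (if giso (row s t) (row s r) then 0 else ivar s ''new''))"
    (is "runs _ _ _ ?Q")
proof -
  define ok where "ok s' \<longleftrightarrow> base s' \<and> iarr s' = iarr s \<and> ivar s' ''t'' = int t \<and> ivar s' ''r'' = int r \<and>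
     ivar s' ''w'' = 0 \<and> ivar s' ''new'' = ivar s ''new''" for s' :: state
  have okD: "m_ok s'" "wl_is s' []" "row s' e = row s e" "base s'" if "ok s'" for s' e
    using that s by (auto simp: ok_def m_ok_def wl_is_def row_def)
  have ok_ask: "ok s2" if "ok s1" "same ask s1 s2" for s1 s2
    using that(1) unfolding ok_def base_def by (simp add: sameD[OF that(2)] fun_eq_iff)
  have w: "word W (int t)" "word W (int r)" "word W 0" by (rule word_lin; use t r Bd in simp)+
  have qw: "word W q" if "0 \<le> q" "q \<le> int Qb" for q using that QW by (simp add: word_def)
  have asks: "runs ask s' (12 * k + 8) (\<lambda>s''. ivar s'' ''q'' = conv (g (row s a)) (g (V - row s c)) V \<and> word W (ivar s'' ''q''))"
    if "ok s'" "ivar s' ''a'' = int a" "ivar s' ''c'' = int c" "a \<le> Bd" "c \<le> Bd" for s' a c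
  proof -
    have "runs ask s' (12 * (k + length ([] :: nat list)) + 8) (\<lambda>s''. ivar s'' ''q'' = pairing (row s' a) [] (row s' c) \<and>
       0 \<le> ivar s'' ''q'' \<and> ivar s'' ''q'' \<le> int Qb)"
      by (rule runs_pairing) (use that okD[OF that(1)] in \<open>auto simp: ok_def\<close>)
    then show ?thesis unfolding pairing_Nil okD(3)[OF that(1)] by (rule runs_mono) (auto intro: qw)
  qed
  let ?if2 = "If (Less (Lit 0) (Var ''q'')) (Assign ''new'' (Lit 0)) Skip"
  let ?p1 = "conv (g (row s t)) (g (V - row s r)) V" and ?p2 = "conv (g (row s r)) (g (V - row s t)) V"
  have iff: "giso (row s t) (row s r) \<longleftrightarrow> 0 < ?p1 \<and> 0 < ?p2" by (rule giso_iff_pairing[OF sep])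
  have if2: "runs ?if2 s' (1 + 1) ?Q" if "ok s'" "ivar s' ''q'' = ?p2" "word W ?p2" "0 < ?p1" for s'
  proof (rule runs_If)
    show "bok W s' (Less (Lit 0) (Var ''q''))" using that w by simp
    show "runs (Assign ''new'' (Lit 0)) s' 1 ?Q" if "bval s' (Less (Lit 0) (Var ''q''))"
      by (rule runs_Assign) (use that w \<open>0 < ?p1\<close> \<open>ivar s' ''q'' = ?p2\<close> iff in auto)
    show "runs Skip s' 1 ?Q" if "\<not> bval s' (Less (Lit 0) (Var ''q''))"
      by (rule runs_Skip) (use that \<open>ok s'\<close> \<open>ivar s' ''q'' = ?p2\<close> iff in \<open>auto simp: ok_def\<close>)
  qed
  let ?T2 = "1 + (1 + ((12 * k + 8) + (1 + 1)))"
  let ?c2 = "Seq (Assign ''a'' (Var ''r'')) (Seq (Assign ''c'' (Var ''t'')) (Seq ask ?if2))"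
  have c2: "runs ?c2 s' ?T2 ?Q" if ok: "ok s'" and p1: "0 < ?p1" for s'
  proof (rule runs_SeqI)
    show "runs (Assign ''a'' (Var ''r'')) s' 1 (\<lambda>s1. ok s1 \<and> ivar s1 ''a'' = int r)"
      by (rule runs_Assign) (use ok w in \<open>auto simp: ok_def base_def\<close>)
    fix s1 assume s1: "ok s1 \<and> ivar s1 ''a'' = int r"
    show "runs (Seq (Assign ''c'' (Var ''t'')) (Seq ask ?if2)) s1 (1 + ((12 * k + 8) + (1 + 1))) ?Q"
    proof (rule runs_SeqI)
      show "runs (Assign ''c'' (Var ''t'')) s1 1 (\<lambda>s2. ok s2 \<and> ivar s2 ''a'' = int r \<and> ivar s2 ''c'' = int t)"
        by (rule runs_Assign) (use s1 w in \<open>auto simp: ok_def base_def\<close>)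
      fix s2 assume s2: "ok s2 \<and> ivar s2 ''a'' = int r \<and> ivar s2 ''c'' = int t"
      show "runs (Seq ask ?if2) s2 ((12 * k + 8) + (1 + 1)) ?Q"
        by (rule runs_SeqI[OF asks[of s2 r t]]) (use s2 t r if2 ok_ask p1 in auto)
    qed
  qed
  let ?if1 = "If (Less (Lit 0) (Var ''q'')) ?c2 Skip"
  have if1: "runs ?if1 s' (?T2 + 1) ?Q" if "ok s'" "ivar s' ''q'' = ?p1" "word W ?p1" for s'
  proof (rule runs_If)
    show "bok W s' (Less (Lit 0) (Var ''q''))" using that w by simp
    show "runs ?c2 s' ?T2 ?Q" if "bval s' (Less (Lit 0) (Var ''q''))"
      using that \<open>ok s'\<close> \<open>ivar s' ''q'' = ?p1\<close> by (intro c2) auto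
    show "runs Skip s' ?T2 ?Q" if "\<not> bval s' (Less (Lit 0) (Var ''q''))"
      by (rule runs_time[OF runs_Skip]) (use that \<open>ok s'\<close> \<open>ivar s' ''q'' = ?p1\<close> iff in \<open>auto simp: ok_def\<close>)
  qed
  have "runs test s (1 + (1 + ((12 * k + 8) + (?T2 + 1)))) ?Q"
    unfolding test_def
  proof (rule runs_SeqI)
    show "runs (Assign ''a'' (Var ''t'')) s 1 (\<lambda>s1. ok s1 \<and> ivar s1 ''a'' = int t)"
      by (rule runs_Assign) (use s t r w in \<open>auto simp: ok_def base_def\<close>)
    fix s1 assume s1: "ok s1 \<and> ivar s1 ''a'' = int t"
    show "runs (Seq (Assign ''c'' (Var ''r'')) (Seq ask ?if1)) s1 (1 + ((12 * k + 8) + (?T2 + 1))) ?Q"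
    proof (rule runs_SeqI)
      show "runs (Assign ''c'' (Var ''r'')) s1 1 (\<lambda>s2. ok s2 \<and> ivar s2 ''a'' = int t \<and> ivar s2 ''c'' = int r)"
        by (rule runs_Assign) (use s1 w in \<open>auto simp: ok_def base_def\<close>)
      fix s2 assume s2: "ok s2 \<and> ivar s2 ''a'' = int t \<and> ivar s2 ''c'' = int r"
      show "runs (Seq ask ?if1) s2 ((12 * k + 8) + (?T2 + 1)) ?Q"
        by (rule runs_SeqI[OF asks[of s2 t r]]) (use s2 t r if1 ok_ask in auto)
    qed
  qed
  then show ?thesis by (rule runs_time) simp
qed

definition enum_state :: "state \<Rightarrow> (nat \<Rightarrow> int) \<Rightarrow> bool" where
  "enum_state s l \<longleftrightarrow> base s \<and> m_ok s \<and> good_lab s l \<and> ivar s ''w'' = 0"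

lemma good_lab_same: "good_lab s l \<Longrightarrow> iarr s' ''lab'' = iarr s ''lab'' \<Longrightarrow> good_lab s' l"
  by (simp add: good_lab_def lab_is_def)

lemma row_upd: "row (s\<lparr>ivar := z\<rparr>) i = row s i" "m_ok (s\<lparr>ivar := z\<rparr>) = m_ok s" "base (s\<lparr>iarr := z'\<rparr>) = base s"
  by (simp_all add: row_def m_ok_def base_def)

lemma m_index: "int i * int k + int u = int j * int k + int v \<Longrightarrow> u < k \<Longrightarrow> v < k \<Longrightarrow> i = j \<and> u = v"
proof -
  assume a: "int i * int k + int u = int j * int k + int v" "u < k" "v < k"
  then have e: "i * k + u = j * k + v" by (metis of_nat_add of_nat_eq_iff of_nat_mult)
  have "xs \<noteq> []" using a(2) by auto
  then have "(i * k + u) div k = i" "(j * k + v) div k = j" using a(2,3) by simp_all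
  then show ?thesis using e by auto
qed

lemma runs_fill:
  assumes s: "base s" "m_ok s" "good_lab s l" and v: "ivar s ''v'' = int v" "v < k" and u: "ivar s ''u'' = int u" "u < k"
    and r: "ivar s ''r'' = int r" "r \<le> Bd" and i: "ivar s ''i'' = int i" "i \<le> Bd"
  shows "runs fill s 2 (\<lambda>s'. m_ok s' \<and> (\<forall>j a. a < k \<longrightarrow> (j, a) \<noteq> (r, u) \<longrightarrow> (a \<in> row s' j \<longleftrightarrow> a \<in> row s j)) \<and>
     (u \<in> row s' r \<longleftrightarrow> u \<in> row s i \<or> u \<in> comp l v))" (is "runs _ _ _ ?Q")
proof -
  have lab: "iarr s ''lab'' (int a) = l a" "word W (l a)" if "a < k" for a
    using s(3) that Bd by (auto simp: good_lab_def lab_is_def sound_def intro!: word_lin)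
  have k: "ivar s ''k'' = int k" using s(1) by (simp add: base_def)
  have m: "iarr s ''m'' j \<in> {0, 1}" for j using s(2) unfolding m_ok_def by blast
  have mw: "word W (iarr s ''m'' j)" for j using m[of j] Bd by (intro word_lin) auto
  have w: "word W (int a * int k + int u)" "word W (int a * int k)" "word W (int a)" if "a \<le> Bd" for a
    by (rule word_mult_add word_mult word_lin; use that u(2) Bd in simp)+
  have w': "word W (int u)" "word W (int v)" "word W (int k)" "word W 1" by (rule word_lin; use u(2) v(2) Bd in simp)+
  have Q: "?Q (s\<lparr>iarr := (iarr s)(''m'' := (iarr s ''m'')(int r * int k + int u := x))\<rparr>)"
    if "x \<in> {0, 1}" "0 < x \<longleftrightarrow> u \<in> row s i \<or> u \<in> comp l v" for x
    using that m m_index[of _ _ r u] u(2) unfolding m_ok_def row_def by auto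
  have "runs fill s (1 + 1) ?Q" unfolding fill_def
  proof (rule runs_If)
    show "bok W s (EqE (Idx ''lab'' (Var ''u'')) (Idx ''lab'' (Var ''v'')))"
      using lab u v w' by simp
    let ?x = "iarr s ''m'' (int i * int k + int u)"
    show "runs (Store ''m'' (Add (Mul (Var ''r'') (Var ''k'')) (Var ''u'')) (Lit 1)) s 1 ?Q"
      if "bval s (EqE (Idx ''lab'' (Var ''u'')) (Idx ''lab'' (Var ''v'')))"
    proof (rule runs_Store)
      show "?Q (s\<lparr>iarr := (iarr s)(''m'' := (iarr s ''m'')(ival s (Add (Mul (Var ''r'') (Var ''k'')) (Var ''u'')) := ival s (Lit 1)))\<rparr>)"
        using Q[of 1] that lab u v r k by (simp add: comp_def)
    qed (use w[OF r(2)] w' u r k in simp_all)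
    show "runs (Store ''m'' (Add (Mul (Var ''r'') (Var ''k'')) (Var ''u'')) (Idx ''m'' (Add (Mul (Var ''i'') (Var ''k'')) (Var ''u'')))) s 1 ?Q"
      if "\<not> bval s (EqE (Idx ''lab'' (Var ''u'')) (Idx ''lab'' (Var ''v'')))"
    proof (rule runs_Store)
      have "0 < ?x \<longleftrightarrow> u \<in> row s i \<or> u \<in> comp l v" using that lab u v by (auto simp: comp_def row_def)
      then show "?Q (s\<lparr>iarr := (iarr s)(''m'' := (iarr s ''m'')(ival s (Add (Mul (Var ''r'') (Var ''k'')) (Var ''u'')) :=
          ival s (Idx ''m'' (Add (Mul (Var ''i'') (Var ''k'')) (Var ''u'')))))\<rparr>)"
        using Q[of ?x] m u i r k by simp
    qed (use w[OF r(2)] w[OF i(2)] mw w' u r i k in simp_all)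
  qed
  then show ?thesis by (simp add: numeral_2_eq_2)
qed

text \<open>A rejected candidate remains in row \<open>r\<close> and is overwritten by the next one;
  \<open>table\<close> therefore constrains only the rows before \<open>r\<close>.\<close>

lemma runs_candidate:
  assumes s: "enum_state s l" and tab: "table s Rs" and irr: "irredundant Rs U" "length Rs \<le> R"
    and v: "ivar s ''v'' = int v" "v < k" and i: "ivar s ''i'' = int i" "i < length Rs"
  shows "runs candidate s (R * (24 * k + 26) + 4 * k + 6) (\<lambda>s'. enum_state s' l \<and> table s' (add_rep Rs (Rs ! i \<union> comp l v)))"
proof -
  let ?r = "length Rs" and ?B = "Rs ! i \<union> comp l v"
  note irrD = irredundantD[OF irr(1)]
  have rB: "?r + 1 \<le> Bd" by (fact irrD(2))
  have good: "good_lab s l" "base s" "m_ok s" "ivar s ''w'' = 0" using s by (auto simp: enum_state_def)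
  have l: "\<forall>u<k. \<forall>v<k. close xs u v \<longrightarrow> l u = l v" using good(1) by (simp add: good_lab_def)
  have sB: "sepset ?B" using irrD(3)[OF i(2)] sepset_comp[OF l] sepset_Un by blast
  have riv: "ivar s ''r'' = int ?r" and rows: "\<And>j. j < ?r \<Longrightarrow> row s j = Rs ! j" using tab by (auto simp: table_def)
  define st where "st s' \<longleftrightarrow> base s' \<and> m_ok s' \<and> good_lab s' l \<and> ivar s' ''w'' = 0 \<and> ivar s' ''r'' = int ?r \<and>
     (\<forall>j<?r. row s' j = Rs ! j)" for s' :: state
  have st0: "st s" using good riv rows by (simp add: st_def)
  have 1: "runs (For ''u'' ''k'' fill) s (k * (2 + 2) + 2) (\<lambda>s'. st s' \<and> row s' ?r = ?B)"
  proof (rule runs_For_const[where N = k and I = "\<lambda>u s'. m_ok s' \<and> (\<forall>j<?r. row s' j = Rs ! j) \<and> (\<forall>a<u. a \<in> row s' ?r \<longleftrightarrow> a \<in> ?B)"])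
    fix u s' assume u: "u < k" "ivar s' ''u'' = int u" and same: "same (For ''u'' ''k'' fill) s s'"
      and I: "m_ok s' \<and> (\<forall>j<?r. row s' j = Rs ! j) \<and> (\<forall>a<u. a \<in> row s' ?r \<longleftrightarrow> a \<in> ?B)"
    note fr = sameD[OF same, simplified]
    have b: "base s'" using base_same[OF good(2) same] by simp
    have g: "good_lab s' l" using good_lab_same[OF good(1)] fr(2)[of "''lab''"] by simp
    show "runs fill s' 2 (\<lambda>s''. same fill s' s'' \<longrightarrow> m_ok (s''\<lparr>ivar := (ivar s'')(''u'' := int u + 1)\<rparr>) \<and>
       (\<forall>j<?r. row (s''\<lparr>ivar := (ivar s'')(''u'' := int u + 1)\<rparr>) j = Rs ! j) \<and>
       (\<forall>a<Suc u. a \<in> row (s''\<lparr>ivar := (ivar s'')(''u'' := int u + 1)\<rparr>) ?r \<longleftrightarrow> a \<in> ?B))"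
      unfolding row_upd
    proof (rule runs_mono[OF runs_fill[where v = v and u = u and r = ?r and i = i and l = l] order_refl])
      fix s'' assume q: "m_ok s'' \<and> (\<forall>j a. a < k \<longrightarrow> (j, a) \<noteq> (?r, u) \<longrightarrow> (a \<in> row s'' j \<longleftrightarrow> a \<in> row s' j)) \<and>
         (u \<in> row s'' ?r \<longleftrightarrow> u \<in> row s' i \<or> u \<in> comp l v)"
      have "row s'' j = Rs ! j" if "j < ?r" for j
      proof -
        have "a \<in> row s'' j \<longleftrightarrow> a \<in> row s' j" for a
          using q that row_subset[of s'' j] row_subset[of s' j] by (cases "a < k") auto
        then show ?thesis using I that by blast
      qed
      moreover have "a \<in> row s'' ?r \<longleftrightarrow> a \<in> ?B" if "a < Suc u" for a
        using q I i(2) that u(1) by (cases "a = u") auto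
      ultimately show "same fill s' s'' \<longrightarrow> m_ok s'' \<and> (\<forall>j<?r. row s'' j = Rs ! j) \<and> (\<forall>a<Suc u. a \<in> row s'' ?r \<longleftrightarrow> a \<in> ?B)"
        using q by blast
    qed (use b g I u v i rB riv fr in auto)
  next
    fix s' assume same: "same (For ''u'' ''k'' fill) s s'" and I: "m_ok s' \<and> (\<forall>j<?r. row s' j = Rs ! j) \<and> (\<forall>a<k. a \<in> row s' ?r \<longleftrightarrow> a \<in> ?B)"
    note fr = sameD[OF same, simplified]
    have "row s' ?r = ?B" using I row_subset[of s' ?r] sepset_subset[OF sB] by blast
    then show "st s' \<and> row s' ?r = ?B"
      using I base_same[OF good(2) same] good_lab_same[OF good(1), of s'] fr good(4) riv by (auto simp: st_def)
  qed (use good kW rows v in \<open>auto simp: base_def row_upd\<close>)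
  have 3: "runs (For ''t'' ''r'' test) s' (?r * (24 * k + 24 + 2) + 2)
      (\<lambda>s''. st s'' \<and> row s'' ?r = ?B \<and> ivar s'' ''new'' = (if \<exists>j<?r. giso (Rs ! j) ?B then 0 else 1))"
    if s': "st s' \<and> row s' ?r = ?B \<and> ivar s' ''new'' = 1" for s'
  proof (rule runs_For_const[where N = ?r and I = "\<lambda>t s''. ivar s'' ''new'' = (if \<exists>j<t. giso (Rs ! j) ?B then 0 else 1)"])
    have keep: "st s'' \<and> row s'' ?r = ?B" if "same (For ''t'' ''r'' test) s' s''" for s''
    proof -
      note fr = sameD[OF that, simplified]
      have "row s'' j = row s' j" for j unfolding row_def using fr(2) by simp
      moreover have "m_ok s''" using s' unfolding st_def m_ok_def using fr(2) by simp
      ultimately show ?thesis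
        using s' base_same[OF _ that] good_lab_same[of s' l s''] fr(2)[of "''lab''"] fr(1)[of "''w''"] fr(1)[of "''r''"]
        unfolding st_def by simp
    qed
    show "ivar s' ''r'' = int ?r" using s' by (simp add: st_def)
    show "?r \<le> W" using rB Bd BW by linarith
    show "st s'' \<and> row s'' ?r = ?B \<and> ivar s'' ''new'' = (if \<exists>j<?r. giso (Rs ! j) ?B then 0 else 1)"
      if "same (For ''t'' ''r'' test) s' s''" "ivar s'' ''new'' = (if \<exists>j<?r. giso (Rs ! j) ?B then 0 else 1)" for s''
      using keep that by blast
    fix t s'' assume t: "t < ?r" "ivar s'' ''t'' = int t" and same: "same (For ''t'' ''r'' test) s' s''"
      and I: "ivar s'' ''new'' = (if \<exists>j<t. giso (Rs ! j) ?B then 0 else 1)"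
    note ks = keep[OF same]
    have rt: "row s'' t = Rs ! t" using ks t(1) by (simp add: st_def)
    show "runs test s'' (24 * k + 24) (\<lambda>s3. same test s'' s3 \<longrightarrow>
        ivar (s3\<lparr>ivar := (ivar s3)(''t'' := int t + 1)\<rparr>) ''new'' = (if \<exists>j<Suc t. giso (Rs ! j) ?B then 0 else 1))"
    proof (rule runs_mono[OF runs_test[where t = t and r = ?r] order_refl])
      fix s3 :: state assume "ivar s3 ''new'' = (if giso (row s'' t) (row s'' ?r) then 0 else ivar s'' ''new'')"
      then show "same test s'' s3 \<longrightarrow>
        ivar (s3\<lparr>ivar := (ivar s3)(''t'' := int t + 1)\<rparr>) ''new'' = (if \<exists>j<Suc t. giso (Rs ! j) ?B then 0 else 1)"
        using I rt ks by (auto simp: less_Suc_eq)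
    qed (use ks t rt rB irrD(3)[OF t(1)] sB in \<open>auto simp: st_def\<close>)
  qed (use s' in simp_all)
  have 4: "runs (Assign ''r'' (Add (Var ''r'') (Var ''new''))) s' 1 (\<lambda>s''. enum_state s'' l \<and> table s'' (add_rep Rs ?B))"
    if s': "st s' \<and> row s' ?r = ?B \<and> ivar s' ''new'' = (if \<exists>j<?r. giso (Rs ! j) ?B then 0 else 1)" for s'
  proof (rule runs_Assign)
    have w: "word W (int ?r)" "word W (int ?r + 1)" "word W 0" "word W 1" by (rule word_lin; use rB in simp)+
    show "iok W s' (Add (Var ''r'') (Var ''new''))" using s' w by (auto simp: st_def)
    have ex: "(\<exists>j<?r. giso (Rs ! j) ?B) \<longleftrightarrow> (\<exists>R\<in>set Rs. giso R ?B)" by (metis in_set_conv_nth)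
    let ?s = "s'\<lparr>ivar := (ivar s')(''r'' := ival s' (Add (Var ''r'') (Var ''new'')))\<rparr>"
    have "table ?s (add_rep Rs ?B)"
    proof (cases "\<exists>R\<in>set Rs. giso R ?B")
      case True
      then show ?thesis using s' ex unfolding table_def add_rep_def row_upd st_def by simp
    next
      case False
      then show ?thesis using s' ex unfolding table_def add_rep_def row_upd st_def by (simp add: nth_append less_Suc_eq)
    qed
    moreover have "enum_state ?s l" using s' unfolding st_def enum_state_def row_upd by (simp add: base_def good_lab_def lab_is_def)
    ultimately show "enum_state ?s l \<and> table ?s (add_rep Rs ?B)" by blast
  qed
  have "runs candidate s ((k * (2 + 2) + 2) + (1 + ((?r * (24 * k + 24 + 2) + 2) + 1))) (\<lambda>s'. enum_state s' l \<and> table s' (add_rep Rs ?B))"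
    unfolding candidate_def
  proof (rule runs_SeqI[OF 1])
    fix s1 assume s1: "st s1 \<and> row s1 ?r = ?B"
    show "runs (Seq (Assign ''new'' (Lit 1)) (Seq (For ''t'' ''r'' test) (Assign ''r'' (Add (Var ''r'') (Var ''new''))))) s1
      (1 + ((?r * (24 * k + 24 + 2) + 2) + 1)) (\<lambda>s'. enum_state s' l \<and> table s' (add_rep Rs ?B))"
    proof (rule runs_SeqI)
      have "word W 1" by (rule word_lin) (use Bd in simp)
      then show "runs (Assign ''new'' (Lit 1)) s1 1 (\<lambda>s2. st s2 \<and> row s2 ?r = ?B \<and> ivar s2 ''new'' = 1)"
        using s1 by (intro runs_Assign) (simp_all add: st_def base_def row_upd good_lab_def lab_is_def)
      fix s2 assume "st s2 \<and> row s2 ?r = ?B \<and> ivar s2 ''new'' = 1"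
      then show "runs (Seq (For ''t'' ''r'' test) (Assign ''r'' (Add (Var ''r'') (Var ''new'')))) s2 ((?r * (24 * k + 24 + 2) + 2) + 1)
         (\<lambda>s'. enum_state s' l \<and> table s' (add_rep Rs ?B))"
        by (intro runs_SeqI[OF 3]) (use 4 in blast)+
    qed
  qed
  then show ?thesis
  proof (rule runs_time)
    have "?r * (24 * k + 26) \<le> R * (24 * k + 26)" using irr(2) by (rule mult_le_mono1)
    then show "(k * (2 + 2) + 2) + (1 + ((?r * (24 * k + 24 + 2) + 2) + 1)) \<le> R * (24 * k + 26) + 4 * k + 6"
      by (simp add: algebra_simps)
  qed
qed

text \<open>There are \<open>k\<close> passes over at most \<open>R\<close> rows, and a candidate is
  compared with at most \<open>R\<close> rows by at most two queries each. The list is irredundant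
  throughout, so \<open>R\<close> bounds the intermediate lists too, and the time is quadratic in
  \<open>R\<close>.\<close>

lemma runs_enum:
  assumes s: "base s" "good_lab s l" "\<And>j. iarr s ''m'' j = 0"
  defines "R \<equiv> sigma0 (disk_graph xs)"
  shows "runs enum s (k * (R * (R * (24 * k + 26) + 4 * k + 8) + 5) + 4) (\<lambda>s'. enum_state s' l \<and> table s' (outer l k))"
proof -
  have sound: "sound l" and l: "\<forall>u<k. \<forall>v<k. close xs u v \<longrightarrow> l u = l v" using s(2) by (auto simp: good_lab_def)
  let ?Tc = "R * (24 * k + 26) + 4 * k + 6"
  have upd: "enum_state (s'\<lparr>ivar := (ivar s')(x := z)\<rparr>) l = enum_state s' l" "table (s'\<lparr>ivar := (ivar s')(x := z)\<rparr>) Rs = table s' Rs"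
    if "x \<in> {''i'', ''v'', ''r0''}" for s' x z Rs
    using that by (auto simp: enum_state_def table_def row_upd base_def good_lab_def lab_is_def)
  let ?in = "For ''i'' ''r0'' candidate" and ?body = "Seq (Assign ''r0'' (Var ''r'')) (For ''i'' ''r0'' candidate)"
  have body: "runs ?body s' (1 + (R * (?Tc + 2) + 2)) (\<lambda>s''. enum_state s'' l \<and> table s'' (outer l (Suc v)))"
    if s': "enum_state s' l" "table s' (outer l v)" "ivar s' ''v'' = int v" "v < k" for s' v
  proof (rule runs_SeqI)
    let ?O = "outer l v"
    have irr: "irredundant ?O (\<Union>u<v. comp l u)" using outer_ok[OF sound l, of v] s'(4) by simp
    note irrD = irredundantD[OF irr]
    have OR: "length ?O \<le> R" using irrD(1) by (simp add: R_def)
    have OB: "length ?O \<le> Bd" using irrD(2) by simp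
    show "runs (Assign ''r0'' (Var ''r'')) s' 1 (\<lambda>s1. enum_state s1 l \<and> table s1 ?O \<and> ivar s1 ''v'' = int v \<and> ivar s1 ''r0'' = int (length ?O))"
    proof (rule runs_Assign)
      have r: "ivar s' ''r'' = int (length ?O)" using s'(2) by (simp add: table_def)
      have "word W (int (length ?O))" by (rule word_lin) (use OB in simp)
      then show "iok W s' (Var ''r'')" using r by simp
      show "enum_state (s'\<lparr>ivar := (ivar s')(''r0'' := ival s' (Var ''r''))\<rparr>) l \<and>
          table (s'\<lparr>ivar := (ivar s')(''r0'' := ival s' (Var ''r''))\<rparr>) ?O \<and>
          ivar (s'\<lparr>ivar := (ivar s')(''r0'' := ival s' (Var ''r''))\<rparr>) ''v'' = int v \<and>
          ivar (s'\<lparr>ivar := (ivar s')(''r0'' := ival s' (Var ''r''))\<rparr>) ''r0'' = int (length ?O)"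
        using s' r by (simp add: upd)
    qed
    fix s1 assume s1: "enum_state s1 l \<and> table s1 ?O \<and> ivar s1 ''v'' = int v \<and> ivar s1 ''r0'' = int (length ?O)"
    have "runs ?in s1 (length ?O * (?Tc + 2) + 2) (\<lambda>s''. enum_state s'' l \<and> table s'' (outer l (Suc v)))"
    proof (rule runs_For_const[where N = "length ?O" and I = "\<lambda>i s2. enum_state s2 l \<and> table s2 (inner l v ?O i)"])
      show "length ?O \<le> W" using OB BW by linarith
      fix i s2 assume i: "i < length ?O" "ivar s2 ''i'' = int i" and same: "same ?in s1 s2"
        and I: "enum_state s2 l \<and> table s2 (inner l v ?O i)"
      have irr': "irredundant (inner l v ?O i) ((\<Union>u<v. comp l u) \<union> comp l v)"
        by (rule irredundant_inner[OF irr l]) (use i in simp)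
      have "ivar s2 ''v'' = int v" using sameD(1)[OF same, of "''v''"] s1 by simp
      then have "runs candidate s2 ?Tc (\<lambda>s'. enum_state s' l \<and> table s' (add_rep (inner l v ?O i) (inner l v ?O i ! i \<union> comp l v)))"
        using I irredundantD(1)[OF irr'] i s'(4) inner_prefix(2)[of ?O l v i]
        by (intro runs_candidate[OF _ _ irr']) (auto simp: R_def)
      then have "runs candidate s2 ?Tc (\<lambda>s'. enum_state s' l \<and> table s' (inner l v ?O (Suc i)))"
        using inner_prefix(1)[OF i(1), of l v i] by simp
      then show "runs candidate s2 ?Tc (\<lambda>s3. same candidate s2 s3 \<longrightarrow> enum_state (s3\<lparr>ivar := (ivar s3)(''i'' := int i + 1)\<rparr>) l \<and>
          table (s3\<lparr>ivar := (ivar s3)(''i'' := int i + 1)\<rparr>) (inner l v ?O (Suc i)))"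
        by (rule runs_mono[OF _ order_refl]) (use upd in simp)
    qed (use s1 upd in auto)
    then show "runs ?in s1 (R * (?Tc + 2) + 2) (\<lambda>s''. enum_state s'' l \<and> table s'' (outer l (Suc v)))"
      by (rule runs_time) (use OR in simp)
  qed
  let ?loop = "For ''v'' ''k'' ?body"
  have loop: "runs ?loop s' (k * ((1 + (R * (?Tc + 2) + 2)) + 2) + 2) (\<lambda>s''. enum_state s'' l \<and> table s'' (outer l k))"
    if s': "enum_state s' l" "table s' [{}]" for s'
  proof (rule runs_For_const[where N = k and I = "\<lambda>v s2. enum_state s2 l \<and> table s2 (outer l v)"])
    show "ivar s' ''k'' = int k" using s'(1) by (simp add: enum_state_def base_def)
    fix v s2 assume v: "v < k" "ivar s2 ''v'' = int v" and I: "enum_state s2 l \<and> table s2 (outer l v)"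
    show "runs ?body s2 (1 + (R * (?Tc + 2) + 2)) (\<lambda>s3. same ?body s2 s3 \<longrightarrow> enum_state (s3\<lparr>ivar := (ivar s3)(''v'' := int v + 1)\<rparr>) l \<and>
        table (s3\<lparr>ivar := (ivar s3)(''v'' := int v + 1)\<rparr>) (outer l (Suc v)))"
      by (rule runs_mono[OF body order_refl]) (use v I upd in \<open>auto simp del: outer.simps\<close>)
  qed (use kW s' upd in auto)
  have "runs enum s (1 + (1 + (k * ((1 + (R * (?Tc + 2) + 2)) + 2) + 2))) (\<lambda>s'. enum_state s' l \<and> table s' (outer l k))"
    unfolding enum_def
  proof (rule runs_SeqI)
    have w: "word W 0" "word W 1" by (rule word_lin; use Bd in simp)+
    show "runs (Assign ''r'' (Lit 1)) s 1 (\<lambda>s1. base s1 \<and> m_ok s1 \<and> good_lab s1 l \<and> table s1 [{}])"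
      using s w by (intro runs_Assign) (auto simp: base_def m_ok_def good_lab_def lab_is_def table_def row_def)
    fix s1 assume s1: "base s1 \<and> m_ok s1 \<and> good_lab s1 l \<and> table s1 [{}]"
    show "runs (Seq (Assign ''w'' (Lit 0)) ?loop) s1 (1 + (k * ((1 + (R * (?Tc + 2) + 2)) + 2) + 2)) (\<lambda>s'. enum_state s' l \<and> table s' (outer l k))"
    proof (rule runs_SeqI)
      show "runs (Assign ''w'' (Lit 0)) s1 1 (\<lambda>s2. enum_state s2 l \<and> table s2 [{}])"
        using s1 w by (intro runs_Assign) (auto simp: enum_state_def base_def row_upd good_lab_def lab_is_def table_def)
    qed (use loop in blast)
  qed
  then show ?thesis by (rule runs_time) (simp add: algebra_simps)
qed

end

subsection \<open>The linear update\<close>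

text \<open>The middle part of the queried host is the prefix of length \<open>w\<close> of the
  array \<open>wl\<close>, which holds first the processed neighbours and then the new cell. Setting
  \<open>w\<close> to \<open>w1\<close>, \<open>w2\<close> or 0 selects the three matrices that an
  update needs; none is stored, each entry is queried when it is used.\<close>

definition mv_prog :: "string \<Rightarrow> string \<Rightarrow> com" where
  "mv_prog x y = For ''c'' ''r'' (Seq (Store y (Var ''c'') (Lit 0))
     (For ''a'' ''r'' (Seq ask (Store y (Var ''c'')
       (Add (Idx y (Var ''c'')) (Mul (Idx x (Var ''a'')) (Div (Var ''q'') (Var ''al''))))))))"

definition vec :: "string \<Rightarrow> iexp \<Rightarrow> com" where
  "vec y e = For ''c'' ''r'' (Store y (Var ''c'') e)"

abbreviation col :: "string \<Rightarrow> iexp" where "col x \<equiv> Idx x (Var ''c'')"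

text \<open>
  As the system is unitriangular, \<open>d := d + b - H d\<close> started with \<open>d = 0\<close> is exact after
  \<open>K0 = k\<^sup>2 + k + 1\<close> rounds.
\<close>

definition solve_prog :: com where
  "solve_prog = For ''i'' ''K0'' (Seq (mv_prog ''d'' ''e'') (vec ''d'' (Sub (Add (col ''d'') (col ''b'')) (col ''e''))))"

definition update_step :: com where
  "update_step = Seq (Assign ''w'' (Var ''w1'')) (Seq (mv_prog ''x'' ''e'') (Seq (vec ''b'' (Sub (col ''y'') (col ''e'')))
     (Seq (Assign ''w'' (Lit 0)) (Seq (vec ''d'' (Lit 0)) (Seq solve_prog (vec ''x'' (Add (col ''x'') (col ''d''))))))))"

definition update_prog :: com where
  "update_prog = Seq (Assign ''w'' (Var ''w2'')) (Seq (mv_prog ''x'' ''y'') (For ''j'' ''k1'' update_step))"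

lemma mods_mv [simp]:
  "modi (mv_prog x y) = {''c'', ''a'', ''h'', ''u'', ''q''}" "moda (mv_prog x y) = {y}" "modr (mv_prog x y) = {''H''}"
  "modi (vec y e) = {''c''}" "moda (vec y e) = {y}" "modr (vec y e) = {}"
  "modi solve_prog = {''i'', ''c'', ''a'', ''h'', ''u'', ''q''}" "moda solve_prog = {''d'', ''e''}" "modr solve_prog = {''H''}"
  by (auto simp: mv_prog_def vec_def solve_prog_def)

lemma mods_update [simp]:
  "modi update_step = {''w'', ''i'', ''c'', ''a'', ''h'', ''u'', ''q''}" "moda update_step = {''b'', ''d'', ''e'', ''x''}"
  "modr update_step = {''H''}"
  by (auto simp: update_step_def)

lemma mods_update_prog [simp]:
  "modi update_prog = {''w'', ''j'', ''i'', ''c'', ''a'', ''h'', ''u'', ''q''}"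
  "moda update_prog = {''y'', ''b'', ''d'', ''e'', ''x''}" "modr update_prog = {''H''}"
  by (auto simp: update_prog_def)

locale disk_reps = disk_program +
  fixes Rs :: "nat set list"
  assumes irr: "irredundant Rs {..<length xs}" and reps: "reps (length xs) adj Rs"
begin

sublocale reps "length xs" adj Rs
  by (fact reps)

abbreviation host_series :: "nat list \<Rightarrow> nat set \<Rightarrow> int" where "host_series L \<equiv> S (set L) (close ys)"

abbreviation valid :: "nat list \<Rightarrow> bool" where "valid L \<equiv> distinct L \<and> set L \<subseteq> {..<n}"

lemma Qb_pos: "1 \<le> Qb"
  unfolding Qb_def using kpos by simp

lemma Be_ge: "3 \<le> Be"
proof -
  have "1 * 1 \<le> 2 ^ k * int Qb" using Qb_pos by (intro mult_mono) auto
  then show ?thesis by (simp add: Be_def)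
qed

lemma r_le: "int r \<le> 2 ^ k"
  using irredundantD(8)[OF irr] by (metis of_nat_le_iff of_nat_numeral of_nat_power)

lemma r_Bd: "r + 1 \<le> Bd"
  by (rule irredundantD(2)[OF irr])

lemma alpha_le: "alpha \<le> int Qb"
proof -
  have "S V adj V \<le> int (2 * k + n) ^ k" using kpos by (intro S_le) auto
  then show ?thesis by (simp add: alpha_def Qb_def)
qed

lemma pairing_le: assumes "valid L" shows "0 \<le> pairing A L C" "A \<subseteq> V \<Longrightarrow> pairing A L C \<le> int Qb"
proof -
  show "0 \<le> pairing A L C"
    unfolding pairing_def by (intro conv_nonneg) (auto simp: g_nonneg S_nonneg intro: conv_nonneg)
  assume "A \<subseteq> V"
  then have "int (card (sub (disk_graph xs) (disk_graph (host A L C)))) = pairing A L C"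
    using assms unfolding card_sub pairing_def by (subst host_parts(1)) (auto simp: Int_absorb2)
  then show "pairing A L C \<le> int Qb" using query_bound[of L A C] assms by linarith
qed

lemma Q_bound: assumes "valid L" "a < r" shows "\<bar>Q (host_series L) a c\<bar> \<le> int Qb"
proof -
  have sub: "Rs ! a \<subseteq> V" using sep[OF assms(2)] sepset_subset by blast
  have Q: "Q (host_series L) a c = pairing (Rs ! a) L (Rs ! c) div alpha" by (simp add: Q_def pairing_def)
  have "0 \<le> pairing (Rs ! a) L (Rs ! c) div alpha"
    using pairing_le(1)[OF assms(1)] alpha_pos by (simp add: pos_imp_zdiv_nonneg_iff)
  moreover have "pairing (Rs ! a) L (Rs ! c) div alpha \<le> pairing (Rs ! a) L (Rs ! c)"
    using pairing_le(1)[OF assms(1)] alpha_pos by (metis div_by_1 int_one_le_iff_zero_less zdiv_mono2 zero_less_one)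
  ultimately show ?thesis using pairing_le(2)[OF assms(1) sub, of "Rs ! c"] unfolding Q by linarith
qed

text \<open>Partial sums are included because they are held in words while an entry is
  accumulated.\<close>

lemma partial_mv_bound:
  assumes "valid L" "\<And>a. a < r \<Longrightarrow> \<bar>x a\<bar> \<le> X" "i \<le> r" "0 \<le> X"
  shows "\<bar>\<Sum>a<i. x a * Q (host_series L) a c\<bar> \<le> X * (Be - 2)"
proof -
  have "\<bar>\<Sum>a<i. x a * Q (host_series L) a c\<bar> \<le> (\<Sum>a<i. \<bar>x a * Q (host_series L) a c\<bar>)" by (rule sum_abs)
  also have "\<dots> \<le> (\<Sum>a<i. X * int Qb)"
    using assms Q_bound[OF assms(1)] by (intro sum_mono) (auto simp: abs_mult intro!: mult_mono)
  also have "\<dots> = int i * (X * int Qb)" by simp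
  also have "\<dots> \<le> 2 ^ k * (X * int Qb)" using assms(3,4) r_le by (intro mult_right_mono) auto
  finally show ?thesis by (simp add: Be_def mult.left_commute)
qed

lemma mv_bound:
  assumes "valid L" "\<And>a. a < r \<Longrightarrow> \<bar>x a\<bar> \<le> X" "0 \<le> X"
  shows "\<bar>mv (host_series L) x c\<bar> \<le> X * (Be - 2)"
  unfolding mv_def using partial_mv_bound[OF assms(1,2) order_refl assms(3)] .

lemma empty_series: "host_series [] = S {} adj"
  by (rule ext) (simp add: S_empty_host)

lemma mv_empty_bound:
  assumes "\<And>a. a < r \<Longrightarrow> \<bar>x a\<bar> \<le> X" "0 \<le> X" shows "\<bar>mv (S {} adj) x c\<bar> \<le> X * (Be - 2)"
  using mv_bound[of "[]", OF _ assms, where c = c] unfolding empty_series by simp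

text \<open>A round adds \<open>Y\<close> and a matrix product to the current bound
  \<open>?D\<close>, which gives at most \<open>?D * Be\<close>. Growth alone is estimated, without
  the cancellation that makes the result exact; this still keeps the number of bits
  polynomial.\<close>

lemma solve_bound:
  assumes "\<And>c. c < r \<Longrightarrow> \<bar>y c\<bar> \<le> Y" "0 \<le> Y" "c < r"
  shows "\<bar>solve y j c\<bar> \<le> Y * (2 + Be) ^ j"
  using assms(3)
proof (induction j arbitrary: c)
  case (Suc j)
  let ?D = "Y * (2 + Be) ^ j"
  have D: "Y \<le> ?D" using assms(2) Be_ge one_le_power[of "2 + Be" j] by (metis add_increasing mult.right_neutral mult_left_mono one_le_numeral order_trans zero_le_numeral)
  have "\<bar>mv (S {} adj) (solve y j) c\<bar> \<le> ?D * (Be - 2)"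
    by (rule mv_empty_bound[OF Suc.IH]) (use D assms(2) in auto)
  then have "\<bar>solve y (Suc j) c\<bar> \<le> ?D + Y + ?D * (Be - 2)" using Suc.IH[OF Suc.prems] assms(1)[OF Suc.prems] by simp
  also have "\<dots> \<le> ?D + ?D + ?D * (Be - 2)" using D by simp
  also have "\<dots> = ?D * Be" by (simp add: algebra_simps)
  also have "\<dots> \<le> ?D * (2 + Be)" using D assms(2) by (intro mult_left_mono) auto
  finally show ?case by (simp add: ac_simps)
qed (use assms in simp)

lemma update_bound:
  assumes L: "valid L" and x: "\<And>c. c < r \<Longrightarrow> \<bar>x c\<bar> \<le> X" "0 \<le> X" and y: "\<And>c. c < r \<Longrightarrow> \<bar>y c\<bar> \<le> X * Be"
    and "c < r"
  shows "\<bar>update (host_series L) y x j c\<bar> \<le> X * Gam ^ j" (is ?T1)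
    and "\<bar>y c - mv (host_series L) (update (host_series L) y x j) c\<bar> \<le> 2 * (X * Gam ^ j) * Be" (is ?T2)
proof -
  have G1: "1 \<le> Gam" unfolding Gam_def using Be_ge by (intro one_le_power) auto
  have T2: "\<bar>y c - mv (host_series L) (update (host_series L) y x j) c\<bar> \<le> 2 * (X * Gam ^ j) * Be"
    if u: "\<And>c. c < r \<Longrightarrow> \<bar>update (host_series L) y x j c\<bar> \<le> X * Gam ^ j" and c: "c < r" for c j
  proof -
    let ?U = "X * Gam ^ j"
    have U: "X \<le> ?U" using x(2) one_le_power[OF G1, of j] by (metis mult.right_neutral mult_left_mono)
    have "\<bar>mv (host_series L) (update (host_series L) y x j) c\<bar> \<le> ?U * (Be - 2)"
      using U x(2) by (intro mv_bound[OF L] u) auto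
    also have "\<dots> \<le> ?U * Be" using U x(2) by (intro mult_left_mono) auto
    finally have "\<bar>y c - mv (host_series L) (update (host_series L) y x j) c\<bar> \<le> X * Be + ?U * Be"
      using y[OF c] by linarith
    also have "X * Be \<le> ?U * Be" using U Be_ge by (intro mult_right_mono) auto
    finally show ?thesis by (simp add: ac_simps)
  qed
  have T1: "\<bar>update (host_series L) y x j c\<bar> \<le> X * Gam ^ j" if "c < r" for c j
    using that
  proof (induction j arbitrary: c)
    case (Suc j)
    let ?U = "X * Gam ^ j" and ?K = "k * k + k + 1"
    have U0: "0 \<le> ?U" using x(2) G1 by simp
    let ?G = "(2 + Be) ^ ?K"
    have G: "1 \<le> ?G" using Be_ge by (intro one_le_power) auto
    have "\<bar>solve (\<lambda>c. y c - mv (host_series L) (update (host_series L) y x j) c) ?K c\<bar> \<le> 2 * ?U * Be * ?G"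
      by (rule solve_bound) (use T2[OF Suc.IH] Suc.prems U0 Be_ge in auto)
    then have "\<bar>update (host_series L) y x (Suc j) c\<bar> \<le> ?U + 2 * ?U * Be * ?G"
      using Suc.IH[OF Suc.prems] unfolding update.simps by linarith
    also have "\<dots> \<le> ?U * ?G + 2 * ?U * Be * ?G"
      using U0 G by (metis add_le_cancel_right mult.right_neutral mult_left_mono)
    also have "\<dots> = ?U * ?G * (1 + 2 * Be)" by (simp add: algebra_simps)
    \<comment> \<open>The origin of the exponent of \<open>Gam\<close>: \<open>k * k + k + 1\<close>
      rounds of the solver, and two more factors for the size of the residual and for the old
      value.\<close>
    also have "\<dots> \<le> ?U * ?G * ((2 + Be) * (2 + Be))"
    proof (rule mult_left_mono)
      have "0 \<le> Be * Be" by simp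
      then show "1 + 2 * Be \<le> (2 + Be) * (2 + Be)" using Be_ge unfolding distrib_left distrib_right by linarith
      show "0 \<le> ?U * ?G" using G by (intro mult_nonneg_nonneg[OF U0]) linarith
    qed
    also have "\<dots> = ?U * Gam"
    proof -
      have "k * k + k + 3 = ?K + 2" by simp
      then have "Gam = ?G * ((2 + Be) * (2 + Be))" unfolding Gam_def by (simp only: power_add power2_eq_square)
      then show ?thesis by (simp add: ac_simps)
    qed
    finally show ?case by (simp add: ac_simps)
  qed (use x in simp)
  show ?T1 by (rule T1) fact
  show ?T2 by (rule T2) (use T1 \<open>c < r\<close> in auto)
qed

definition mst :: "state \<Rightarrow> bool" where
  "mst s \<longleftrightarrow> base s \<and> m_ok s \<and> table s Rs \<and> ivar s ''al'' = alpha"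

lemma mst_same:
  assumes "mst s" "same c s s'" "{''k'', ''n'', ''S'', ''r'', ''al''} \<inter> modi c = {}" "''m'' \<notin> moda c" "{''P'', ''G''} \<inter> modr c = {}"
  shows "mst s'"
proof -
  have "base s'" using base_same[OF _ assms(2)] assms by (auto simp: mst_def)
  moreover have "iarr s' ''m'' = iarr s ''m''" using sameD(2)[OF assms(2,4)] .
  moreover have "ivar s' ''r'' = ivar s ''r''" "ivar s' ''al'' = ivar s ''al''"
    using sameD(1)[OF assms(2)] assms(3) by auto
  ultimately show ?thesis using assms(1) unfolding mst_def m_ok_def table_def row_def by simp
qed

lemma mst_r: "mst s \<Longrightarrow> ivar s ''r'' = int r" "mst s \<Longrightarrow> i < r \<Longrightarrow> row s i = Rs ! i"
  by (auto simp: mst_def table_def)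

lemma rW: "r \<le> W" "c < r \<Longrightarrow> word W (int c)"
proof -
  show "r \<le> W" using r_Bd Bd BW by linarith
  show "word W (int c)" if "c < r" by (rule word_lin) (use r_Bd that in simp)
qed

abbreviation mv_time :: "nat \<Rightarrow> nat" where
  "mv_time m \<equiv> r * (r * (12 * (k + m) + 11) + 5) + 2"

lemma runs_mv:
  assumes s: "mst s" and w: "ivar s ''w'' = int (length L)" "wl_is s L" "distinct L" "length L \<le> 36 * k\<^sup>2 * p"
    and xy: "x \<noteq> y" "x \<notin> {''m'', ''wl''}" "y \<notin> {''m'', ''wl''}"
    and xv: "\<And>a. a < r \<Longrightarrow> iarr s x (int a) = v a" "\<And>a. a < r \<Longrightarrow> \<bar>v a\<bar> \<le> X"
    and X: "1 \<le> X" "X * Be \<le> int W"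
  shows "runs (mv_prog x y) s (mv_time (length L)) (\<lambda>s'. \<forall>c<r. iarr s' y (int c) = mv (host_series L) v c)"
proof -
  have L: "valid L" using w by (simp add: wl_is_def)
  define st where "st s' \<longleftrightarrow> mst s' \<and> ivar s' ''w'' = int (length L) \<and> wl_is s' L \<and> iarr s' x = iarr s x" for s' :: state
  have st_same: "st s2" if "st s1" "same c s1 s2" "modi c \<subseteq> {''c'', ''a'', ''h'', ''u'', ''q''}" "moda c \<subseteq> {y}" "modr c \<subseteq> {''H''}" for s1 s2 c
  proof -
    have "mst s2" by (rule mst_same[OF _ that(2)]) (use that xy in \<open>auto simp: st_def\<close>)
    moreover have "ivar s2 ''w'' = ivar s1 ''w''" by (rule sameD(1)[OF that(2)]) (use that(3) in auto)
    moreover have "iarr s2 ''wl'' = iarr s1 ''wl''" "iarr s2 x = iarr s1 x"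
      by (rule sameD(2)[OF that(2)]; use that(4) xy in auto)+
    ultimately show ?thesis using that(1) unfolding st_def wl_is_def by simp
  qed
  let ?q = "\<lambda>a c. Q (host_series L) a c"
  let ?P = "\<lambda>i c. \<Sum>a<i. v a * ?q a c"
  let ?T = "12 * (k + length L) + 8"
  have le_W: "word W z" if "\<bar>z\<bar> \<le> X * Be" for z using that X(2) by (simp add: word_def)
  have XBe: "X \<le> X * Be" "X * int Qb \<le> X * Be" "int Qb \<le> X * Be"
  proof -
    show "X \<le> X * Be" using X(1) Be_ge by (simp add: mult_le_cancel_left1)
    have "int Qb \<le> Be"
    proof -
      have "1 * int Qb \<le> 2 ^ k * int Qb" by (intro mult_right_mono) auto
      then show ?thesis by (simp add: Be_def)
    qed
    then show "X * int Qb \<le> X * Be" using X(1) by (intro mult_left_mono) auto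
    moreover have "1 * int Qb \<le> X * int Qb" using X(1) by (intro mult_right_mono) auto
    ultimately show "int Qb \<le> X * Be" by linarith
  qed
  let ?ic = "Seq ask (Store y (Var ''c'') (Add (Idx y (Var ''c'')) (Mul (Idx x (Var ''a'')) (Div (Var ''q'') (Var ''al'')))))"
  have ic: "runs ?ic s' (?T + 1) (\<lambda>s''. iarr s'' y = (iarr s' y)(int c := ?P (Suc a) c))"
    if s': "st s'" "ivar s' ''c'' = int c" "c < r" "ivar s' ''a'' = int a" "a < r" "iarr s' y (int c) = ?P a c" for s' a c
  proof (rule runs_SeqI)
    show "runs ask s' ?T (\<lambda>s1. ivar s1 ''q'' = pairing (Rs ! a) L (Rs ! c))"
      by (rule runs_mono[OF runs_pairing[where a = a and c = c and L = L] order_refl])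
        (use s' r_Bd w mst_r[of s'] in \<open>auto simp: st_def mst_def\<close>)
    fix s1 assume sm: "same ask s' s1" and q: "ivar s1 ''q'' = pairing (Rs ! a) L (Rs ! c)"
    have st1: "st s1" by (rule st_same[OF s'(1) sm]) auto
    have f: "ivar s1 ''c'' = int c" "ivar s1 ''a'' = int a" "iarr s1 y = iarr s' y"
      using sameD[OF sm] s' by auto
    have al: "ivar s1 ''al'' = alpha" using st1 by (simp add: st_def mst_def)
    have qd: "ivar s1 ''q'' div alpha = ?q a c" unfolding q by (simp add: Q_def pairing_def)
    have xa: "iarr s1 x (int a) = v a" using st1 xv(1)[OF s'(5)] by (simp add: st_def)
    have sub: "Rs ! a \<subseteq> V" using sep[OF s'(5)] sepset_subset by blast
    have bq: "\<bar>?q a c\<bar> \<le> int Qb" by (rule Q_bound[OF L s'(5)])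
    have bP: "\<bar>?P i c\<bar> \<le> X * Be" if "i \<le> r" for i
    proof -
      have "\<bar>?P i c\<bar> \<le> X * (Be - 2)" by (rule partial_mv_bound[OF L xv(2) that]) (use X in auto)
      also have "\<dots> \<le> X * Be" using X(1) by (intro mult_left_mono) auto
      finally show ?thesis .
    qed
    have bm: "\<bar>v a * ?q a c\<bar> \<le> X * Be"
    proof -
      have "\<bar>v a * ?q a c\<bar> \<le> X * int Qb" unfolding abs_mult using bq xv(2)[OF s'(5)] X(1) by (intro mult_mono) auto
      then show ?thesis using XBe by linarith
    qed
    show "runs (Store y (Var ''c'') (Add (Idx y (Var ''c'')) (Mul (Idx x (Var ''a'')) (Div (Var ''q'') (Var ''al''))))) s1 1
       (\<lambda>s''. iarr s'' y = (iarr s' y)(int c := ?P (Suc a) c))"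
    proof (rule runs_Store)
      show "iok W s1 (Var ''c'')" using f rW(2)[OF s'(3)] by simp
      have "word W (?P a c)" "word W (?P (Suc a) c)" using bP[of a] bP[of "Suc a"] s'(5) by (auto intro!: le_W simp del: sum.lessThan_Suc)
      moreover have "word W (v a)" using xv(2)[OF s'(5)] XBe by (intro le_W) linarith
      moreover have "word W (ivar s1 ''q'')" using pairing_le(1)[OF L] pairing_le(2)[OF L sub] XBe unfolding q
        by (intro le_W) (smt (verit))
      moreover have "word W alpha" using alpha_le alpha_pos XBe by (intro le_W) linarith
      moreover have "word W (?q a c)" using bq XBe by (intro le_W) linarith
      moreover have "word W (v a * ?q a c)" using bm by (rule le_W)
      ultimately show "iok W s1 (Add (Idx y (Var ''c'')) (Mul (Idx x (Var ''a'')) (Div (Var ''q'') (Var ''al''))))"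
        using f xa qd al s'(6) rW(2)[OF s'(3)] rW(2)[OF s'(5)] by simp
    qed (use f xa qd al s'(6) in simp)
  qed
  let ?oc = "Seq (Store y (Var ''c'') (Lit 0)) (For ''a'' ''r'' ?ic)"
  have mic: "modi ?ic = {''h'', ''u'', ''q''}" "moda ?ic = {y}" "modr ?ic = {''H''}" by auto
  have oc: "runs ?oc s' (1 + (r * (?T + 1 + 2) + 2)) (\<lambda>s''. iarr s'' y = (iarr s' y)(int c := ?P r c))"
    if s': "st s'" "ivar s' ''c'' = int c" "c < r" for s' c
  proof (rule runs_SeqI)
    have "word W 0" by (rule word_lin) simp
    then show "runs (Store y (Var ''c'') (Lit 0)) s' 1 (\<lambda>s1. iarr s1 y = (iarr s' y)(int c := 0))"
      using rW(2)[OF s'(3)] s'(2) by (intro runs_Store) auto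
    fix s1 assume sm: "same (Store y (Var ''c'') (Lit 0)) s' s1" and y0: "iarr s1 y = (iarr s' y)(int c := 0)"
    have st1: "st s1" by (rule st_same[OF s'(1) sm]) auto
    have c1: "ivar s1 ''c'' = int c" using sameD(1)[OF sm] s'(2) by simp
    show "runs (For ''a'' ''r'' ?ic) s1 (r * (?T + 1 + 2) + 2) (\<lambda>s''. iarr s'' y = (iarr s' y)(int c := ?P r c))"
    proof (rule runs_For_const[where N = r and I = "\<lambda>a s''. iarr s'' y = (iarr s' y)(int c := ?P a c)"])
      show "ivar s1 ''r'' = int r" using st1 by (simp add: st_def mst_r)
      fix a s2 assume a: "a < r" "ivar s2 ''a'' = int a" and sm2: "same (For ''a'' ''r'' ?ic) s1 s2"
        and I: "iarr s2 y = (iarr s' y)(int c := ?P a c)"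
      have st2: "st s2" by (rule st_same[OF st1 sm2]) auto
      have c2: "ivar s2 ''c'' = int c" using sameD(1)[OF sm2] c1 by simp
      have "runs ?ic s2 (?T + 1) (\<lambda>s''. iarr s'' y = (iarr s2 y)(int c := ?P (Suc a) c))"
        by (rule ic[OF st2 c2 s'(3) a(2,1)]) (simp add: I)
      then show "runs ?ic s2 (?T + 1) (\<lambda>s3. same ?ic s2 s3 \<longrightarrow>
          iarr (s3\<lparr>ivar := (ivar s3)(''a'' := int a + 1)\<rparr>) y = (iarr s' y)(int c := ?P (Suc a) c))"
        by (rule runs_mono[OF _ order_refl]) (simp add: I)
    qed (use rW y0 in auto)
  qed
  have "runs (For ''c'' ''r'' ?oc) s (r * ((1 + (r * (?T + 1 + 2) + 2)) + 2) + 2) (\<lambda>s'. \<forall>c<r. iarr s' y (int c) = mv (host_series L) v c)"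
  proof (rule runs_For_const[where N = r and I = "\<lambda>i s'. \<forall>c<i. iarr s' y (int c) = ?P r c"])
    have st0: "st s" using s w by (simp add: st_def)
    show "ivar s ''r'' = int r" using s by (simp add: mst_r)
    fix c s' assume c: "c < r" "ivar s' ''c'' = int c" and sm: "same (For ''c'' ''r'' ?oc) s s'" and I: "\<forall>c'<c. iarr s' y (int c') = ?P r c'"
    have st1: "st s'" by (rule st_same[OF st0 sm]) auto
    show "runs ?oc s' (1 + (r * (?T + 1 + 2) + 2)) (\<lambda>s''. same ?oc s' s'' \<longrightarrow>
        (\<forall>c'<Suc c. iarr (s''\<lparr>ivar := (ivar s'')(''c'' := int c + 1)\<rparr>) y (int c') = ?P r c'))"
      by (rule runs_mono[OF oc[OF st1 c(2,1)] order_refl]) (use I in \<open>auto simp: less_Suc_eq\<close>)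
  qed (use rW in \<open>auto simp: mv_def\<close>)
  then show ?thesis unfolding mv_prog_def by (rule runs_time) (simp add: algebra_simps)
qed

lemma runs_vec:
  assumes r: "ivar s ''r'' = int r"
    and e: "\<And>c s'. c < r \<Longrightarrow> ivar s' ''c'' = int c \<Longrightarrow> iarr s' y (int c) = iarr s y (int c) \<Longrightarrow> same (vec y e) s s' \<Longrightarrow>
      iok W s' e \<and> ival s' e = f c"
  shows "runs (vec y e) s (3 * r + 2) (\<lambda>s'. \<forall>c<r. iarr s' y (int c) = f c)"
proof -
  have "runs (For ''c'' ''r'' (Store y (Var ''c'') e)) s (r * (1 + 2) + 2) (\<lambda>s'. \<forall>c<r. iarr s' y (int c) = f c)"
  proof (rule runs_For_const[where N = r and I = "\<lambda>i s'. (\<forall>c<i. iarr s' y (int c) = f c) \<and> (\<forall>c\<ge>i. iarr s' y (int c) = iarr s y (int c))"])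
    fix i s' assume i: "i < r" "ivar s' ''c'' = int i" and same: "same (For ''c'' ''r'' (Store y (Var ''c'') e)) s s'"
      and I: "(\<forall>c<i. iarr s' y (int c) = f c) \<and> (\<forall>c\<ge>i. iarr s' y (int c) = iarr s y (int c))"
    have "iok W s' e \<and> ival s' e = f i" using e[OF i] I same by (simp add: vec_def)
    then show "runs (Store y (Var ''c'') e) s' 1 (\<lambda>s''. same (Store y (Var ''c'') e) s' s'' \<longrightarrow>
        (\<forall>c<Suc i. iarr (s''\<lparr>ivar := (ivar s'')(''c'' := int i + 1)\<rparr>) y (int c) = f c) \<and>
        (\<forall>c\<ge>Suc i. iarr (s''\<lparr>ivar := (ivar s'')(''c'' := int i + 1)\<rparr>) y (int c) = iarr s y (int c)))"
      using i rW(2)[OF i(1)] I by (intro runs_Store) (auto simp: less_Suc_eq)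
  qed (use r rW in auto)
  then show ?thesis unfolding vec_def by (rule runs_time) simp
qed

lemma runs_solve:
  assumes s: "mst s" "ivar s ''w'' = 0" "ivar s ''K0'' = int (k * k + k + 1)"
    and d: "\<And>c. c < r \<Longrightarrow> iarr s ''d'' (int c) = 0" and b: "\<And>c. c < r \<Longrightarrow> iarr s ''b'' (int c) = b c"
    and Y: "\<And>c. c < r \<Longrightarrow> \<bar>b c\<bar> \<le> Y" "1 \<le> Y" "Y * (2 + Be) ^ (k * k + k + 2) \<le> int W" and K: "k * k + k + 1 \<le> Bd"
  shows "runs solve_prog s ((k * k + k + 1) * (mv_time 0 + 3 * r + 4) + 2)
     (\<lambda>s'. \<forall>c<r. iarr s' ''d'' (int c) = solve b (k * k + k + 1) c)"
proof -
  let ?K = "k * k + k + 1" and ?c1 = "mv_prog ''d'' ''e''" and ?c2 = "vec ''d'' (Sub (Add (col ''d'') (col ''b'')) (col ''e''))"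
  have W: "Y * (2 + Be) ^ j * (2 + Be) \<le> int W" if "j \<le> ?K" for j
  proof -
    have "Y * (2 + Be) ^ j * (2 + Be) = Y * (2 + Be) ^ (j + 1)" by simp
    also have "\<dots> \<le> Y * (2 + Be) ^ (k * k + k + 2)"
      using Y(2) Be_ge that by (intro mult_left_mono power_increasing) auto
    finally show ?thesis using Y(3) by linarith
  qed
  have D1: "1 \<le> Y * (2 + Be) ^ j" for j
    using mult_mono[OF Y(2) one_le_power[of "2 + Be" j]] Y(2) Be_ge by simp
  have loop: "runs (For ''i'' ''K0'' (Seq ?c1 ?c2)) s (?K * ((mv_time 0 + (3 * r + 2)) + 2) + 2)
     (\<lambda>s'. \<forall>c<r. iarr s' ''d'' (int c) = solve b ?K c)"
  proof (rule runs_For_const[where N = ?K and I = "\<lambda>j s'. \<forall>c<r. iarr s' ''d'' (int c) = solve b j c"])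
    show "ivar s ''K0'' = int ?K" by fact
    show "?K \<le> W" using K Bd BW by linarith
    fix j s' assume j: "j < ?K" "ivar s' ''i'' = int j" and sm: "same (For ''i'' ''K0'' (Seq ?c1 ?c2)) s s'"
      and I: "\<forall>c<r. iarr s' ''d'' (int c) = solve b j c"
    have m: "mst s'" by (rule mst_same[OF s(1) sm]) auto
    have w: "ivar s' ''w'' = 0" and bs: "iarr s' ''b'' = iarr s ''b''" using sameD[OF sm] s(2) by auto
    let ?D = "Y * (2 + Be) ^ j"
    have sb: "\<bar>solve b j c\<bar> \<le> ?D" if "c < r" for c by (rule solve_bound) (use Y that in auto)
    have DW: "?D * (2 + Be) \<le> int W" by (rule W) (use j in simp)
    have DB: "?D * Be \<le> ?D * (2 + Be)" using D1[of j] by (intro mult_left_mono) auto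
    have "runs (Seq ?c1 ?c2) s' (mv_time 0 + (3 * r + 2)) (\<lambda>s''. \<forall>c<r. iarr s'' ''d'' (int c) = solve b (Suc j) c)"
    proof (rule runs_SeqI)
      have "runs ?c1 s' (mv_time (length ([]::nat list))) (\<lambda>s1. \<forall>c<r. iarr s1 ''e'' (int c) = mv (host_series []) (solve b j) c)"
        by (rule runs_mv[where X = ?D and v = "solve b j", OF m]) (use w I sb D1[of j] DW DB in \<open>auto simp: wl_is_def\<close>)
      then show "runs ?c1 s' (mv_time 0) (\<lambda>s1. \<forall>c<r. iarr s1 ''e'' (int c) = mv (S {} adj) (solve b j) c)"
        by (simp only: empty_series list.size)
      fix s1 assume sm1: "same ?c1 s' s1" and e: "\<forall>c<r. iarr s1 ''e'' (int c) = mv (S {} adj) (solve b j) c"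
      have m1: "mst s1" by (rule mst_same[OF m sm1]) auto
      show "runs ?c2 s1 (3 * r + 2) (\<lambda>s''. \<forall>c<r. iarr s'' ''d'' (int c) = solve b (Suc j) c)"
      proof (rule runs_vec[OF mst_r(1)[OF m1]])
        fix c s2 assume c: "c < r" "ivar s2 ''c'' = int c" and d2: "iarr s2 ''d'' (int c) = iarr s1 ''d'' (int c)"
          and sm2: "same ?c2 s1 s2"
        have v: "iarr s2 ''d'' (int c) = solve b j c" "iarr s2 ''b'' (int c) = b c" "iarr s2 ''e'' (int c) = mv (S {} adj) (solve b j) c"
          using d2 sameD(2)[OF sm1] sameD(2)[OF sm2] I bs b[OF c(1)] e c(1) by simp_all
        have mb: "\<bar>mv (S {} adj) (solve b j) c\<bar> \<le> ?D * (Be - 2)"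
          by (rule mv_empty_bound[OF sb]) (use D1[of j] in auto)
        have bD: "\<bar>b c\<bar> \<le> ?D"
        proof -
          have "Y * 1 \<le> ?D" using Y(2) Be_ge by (intro mult_left_mono one_le_power) auto
          then show ?thesis using Y(1)[OF c(1)] by linarith
        qed
        have ex: "?D * (2 + Be) = ?D * (Be - 2) + 4 * ?D" by (simp add: algebra_simps)
        have "0 \<le> ?D * (Be - 2)" using D1[of j] Be_ge by (rule_tac mult_nonneg_nonneg; linarith)
        then have "word W (solve b j c)" "word W (b c)" "word W (mv (S {} adj) (solve b j) c)" "word W (solve b j c + b c)"
          "word W (solve b j c + b c - mv (S {} adj) (solve b j) c)"
          using sb[OF c(1)] bD mb DW ex D1[of j] unfolding word_def by linarith+
        then show "iok W s2 (Sub (Add (col ''d'') (col ''b'')) (col ''e'')) \<and> ival s2 (Sub (Add (col ''d'') (col ''b'')) (col ''e'')) = solve b (Suc j) c"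
          using v c rW(2)[OF c(1)] by simp
      qed
    qed
    then show "runs (Seq ?c1 ?c2) s' (mv_time 0 + (3 * r + 2)) (\<lambda>s''. same (Seq ?c1 ?c2) s' s'' \<longrightarrow>
        (\<forall>c<r. iarr (s''\<lparr>ivar := (ivar s'')(''i'' := int j + 1)\<rparr>) ''d'' (int c) = solve b (Suc j) c))"
      by (rule runs_mono[OF _ order_refl]) simp
  qed (use d in auto)
  then show ?thesis unfolding solve_prog_def by (rule runs_time) (simp add: algebra_simps)
qed

abbreviation step_time :: "nat \<Rightarrow> nat" where
  "step_time m \<equiv> mv_time m + ((k * k + k + 1) * (mv_time 0 + 3 * r + 4) + 2) + 9 * r + 8"

text \<open>Within one update step the residual and all iterates of the solver exceed the current
  bound by a factor of at most \<open>Gam * Gam\<close>, which the exponent \<open>k + 4\<close> in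
  the assumption on \<open>W\<close> covers.\<close>

lemma Gam_facts: "1 \<le> Gam" "2 * Be * (2 + Be) ^ (k * k + k + 2) \<le> Gam * Gam" "2 * Be + (2 * Be) * (2 + Be) ^ (k * k + k + 1) \<le> Gam * Gam"
proof -
  let ?G = "2 + Be"
  have G: "5 \<le> ?G" using Be_ge by simp
  show G1: "1 \<le> Gam" unfolding Gam_def using G by (intro one_le_power) linarith
  have "2 * Be \<le> ?G * ?G" using mult_mono[of 2 ?G Be ?G] Be_ge by simp
  then have "2 * Be * ?G ^ (k * k + k + 2) \<le> ?G * ?G * ?G ^ (k * k + k + 2)" using G by (intro mult_right_mono) auto
  also have "\<dots> = ?G * Gam" by (simp add: Gam_def numeral_eq_Suc)
  also have "\<dots> \<le> Gam * Gam"
  proof (rule mult_right_mono)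
    show "?G \<le> Gam" unfolding Gam_def using power_increasing[of 1 "k * k + k + 3" ?G] G by simp
  qed (use G1 in linarith)
  finally show 2: "2 * Be * ?G ^ (k * k + k + 2) \<le> Gam * Gam" .
  have p: "1 \<le> ?G ^ (k * k + k + 1)" using G by (intro one_le_power) linarith
  have "2 * Be + (2 * Be) * ?G ^ (k * k + k + 1) \<le> 2 * Be * ?G ^ (k * k + k + 1) + (2 * Be) * ?G ^ (k * k + k + 1)"
    using mult_left_mono[OF p, of "2 * Be"] Be_ge by simp
  also have "\<dots> = 2 * Be * (?G ^ (k * k + k + 1) * 2)" by simp
  also have "\<dots> \<le> 2 * Be * (?G ^ (k * k + k + 1) * ?G)" using Be_ge p by (intro mult_left_mono) auto
  also have "\<dots> = 2 * Be * ?G ^ (k * k + k + 2)" by simp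
  finally show "2 * Be + (2 * Be) * ?G ^ (k * k + k + 1) \<le> Gam * Gam" using 2 by linarith
qed

lemma runs_update_step:
  assumes s: "mst s" and w: "ivar s ''w1'' = int (length L)" "wl_is s L" "distinct L" "length L \<le> 36 * k\<^sup>2 * p"
    and K: "ivar s ''K0'' = int (k * k + k + 1)" "k * k + k + 1 \<le> Bd"
    and x: "\<And>c. c < r \<Longrightarrow> iarr s ''x'' (int c) = x c" "\<And>c. c < r \<Longrightarrow> \<bar>x c\<bar> \<le> U"
    and y: "\<And>c. c < r \<Longrightarrow> iarr s ''y'' (int c) = y c" "\<And>c. c < r \<Longrightarrow> \<bar>y c\<bar> \<le> U * Be"
    and r: "\<And>c. c < r \<Longrightarrow> \<bar>y c - mv (host_series L) x c\<bar> \<le> 2 * U * Be"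
    and U: "1 \<le> U" "U * (Gam * Gam) \<le> int W"
  shows "runs update_step s (step_time (length L))
     (\<lambda>s'. \<forall>c<r. iarr s' ''x'' (int c) = x c + solve (\<lambda>c. y c - mv (host_series L) x c) (k * k + k + 1) c)"
proof -
  let ?K = "k * k + k + 1" and ?b = "\<lambda>c. y c - mv (host_series L) x c"
  let ?Q = "\<lambda>s'. \<forall>c<r. iarr s' ''x'' (int c) = x c + solve ?b ?K c"
  have L: "valid L" using w by (simp add: wl_is_def)
  have Y1: "1 \<le> 2 * U * Be" using mult_mono[of 1 "2 * U" 1 Be] U(1) Be_ge by simp
  have YW: "2 * U * Be * (2 + Be) ^ (k * k + k + 2) \<le> int W"
  proof -
    have "2 * U * Be * (2 + Be) ^ (k * k + k + 2) = U * (2 * Be * (2 + Be) ^ (k * k + k + 2))" by simp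
    also have "\<dots> \<le> U * (Gam * Gam)" using Gam_facts(2) U(1) by (intro mult_left_mono) auto
    finally show ?thesis using U(2) by linarith
  qed
  have UBe: "2 * U * Be + 2 * U * Be * (2 + Be) ^ ?K \<le> int W"
  proof -
    have "2 * U * Be + 2 * U * Be * (2 + Be) ^ ?K = U * (2 * Be + 2 * Be * (2 + Be) ^ ?K)" by (simp add: algebra_simps)
    also have "\<dots> \<le> U * (Gam * Gam)" using Gam_facts(3) U(1) by (intro mult_left_mono) auto
    finally show ?thesis using U(2) by linarith
  qed
  have Gp: "0 \<le> 2 * U * Be * (2 + Be) ^ ?K" using Y1 Be_ge U(1) by (intro mult_nonneg_nonneg) auto
  then have UB: "2 * U * Be \<le> int W" using UBe by linarith
  have UU: "U \<le> U * Be" "U * Be \<le> 2 * U * Be" "U * (Be - 2) \<le> U * Be"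
    using U(1) Be_ge by (auto simp: mult_le_cancel_left1)
  have ww: "word W (int (length L))" "word W 0"
  proof -
    have "length L \<le> n" using L by (metis card_lessThan card_mono distinct_card finite_lessThan)
    then show "word W (int (length L))" using Bd by (intro word_lin) auto
    show "word W 0" by (rule word_lin) simp
  qed
  have p7: "runs (vec ''x'' (Add (col ''x'') (col ''d''))) s' (3 * r + 2) ?Q"
    if m: "mst s'" and xs': "iarr s' ''x'' = iarr s ''x''" and d: "\<forall>c<r. iarr s' ''d'' (int c) = solve ?b ?K c" for s'
  proof (rule runs_vec[OF mst_r(1)[OF m]])
    fix c s2 assume c: "c < r" "ivar s2 ''c'' = int c" and x2: "iarr s2 ''x'' (int c) = iarr s' ''x'' (int c)"
      and sm: "same (vec ''x'' (Add (col ''x'') (col ''d''))) s' s2"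
    have v: "iarr s2 ''x'' (int c) = x c" "iarr s2 ''d'' (int c) = solve ?b ?K c"
      using x2 sameD(2)[OF sm] xs' x(1) d c(1) by simp_all
    have "\<bar>solve ?b ?K c\<bar> \<le> 2 * U * Be * (2 + Be) ^ ?K" by (rule solve_bound) (use r Y1 c(1) in auto)
    then have "word W (x c)" "word W (solve ?b ?K c)" "word W (x c + solve ?b ?K c)"
      using x(2)[OF c(1)] UU UBe Gp unfolding word_def by linarith+
    then show "iok W s2 (Add (col ''x'') (col ''d'')) \<and> ival s2 (Add (col ''x'') (col ''d'')) = x c + solve ?b ?K c"
      using v c rW(2)[OF c(1)] by simp
  qed
  define st where "st s' \<longleftrightarrow> mst s' \<and> ivar s' ''K0'' = int ?K \<and> iarr s' ''x'' = iarr s ''x'' \<and> iarr s' ''y'' = iarr s ''y'' \<and> wl_is s' L" for s' :: state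
  have st_same: "st s2" if "st s1" "same c s1 s2" "modi c \<subseteq> {''w'', ''i'', ''c'', ''a'', ''h'', ''u'', ''q''}"
    "moda c \<subseteq> {''b'', ''d'', ''e''}" "modr c \<subseteq> {''H''}" for s1 s2 c
  proof -
    have "mst s2" by (rule mst_same[OF _ that(2)]) (use that in \<open>auto simp: st_def\<close>)
    moreover have "ivar s2 ''K0'' = ivar s1 ''K0''" by (rule sameD(1)[OF that(2)]) (use that(3) in auto)
    moreover have "iarr s2 ''wl'' = iarr s1 ''wl''" "iarr s2 ''x'' = iarr s1 ''x''" "iarr s2 ''y'' = iarr s1 ''y''"
      by (rule sameD(2)[OF that(2)]; use that(4) in auto)+
    ultimately show ?thesis using that(1) unfolding st_def wl_is_def by simp
  qed
  have p6: "runs (Seq solve_prog (vec ''x'' (Add (col ''x'') (col ''d'')))) s' ((?K * (mv_time 0 + 3 * r + 4) + 2) + (3 * r + 2)) ?Q"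
    if st: "st s'" and w0: "ivar s' ''w'' = 0" and d: "\<forall>c<r. iarr s' ''d'' (int c) = 0" and b: "\<forall>c<r. iarr s' ''b'' (int c) = ?b c" for s'
  proof (rule runs_SeqI)
    show "runs solve_prog s' (?K * (mv_time 0 + 3 * r + 4) + 2) (\<lambda>s1. \<forall>c<r. iarr s1 ''d'' (int c) = solve ?b ?K c)"
      by (rule runs_solve[where Y = "2 * U * Be"]) (use st w0 d b r Y1 YW K(2) in \<open>auto simp: st_def\<close>)
    fix s1 assume sm: "same solve_prog s' s1" and d1: "\<forall>c<r. iarr s1 ''d'' (int c) = solve ?b ?K c"
    have "st s1" by (rule st_same[OF st sm]) auto
    then show "runs (vec ''x'' (Add (col ''x'') (col ''d''))) s1 (3 * r + 2) ?Q" using d1 by (intro p7) (auto simp: st_def)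
  qed
  let ?r6 = "Seq solve_prog (vec ''x'' (Add (col ''x'') (col ''d'')))"
  let ?T6 = "(?K * (mv_time 0 + 3 * r + 4) + 2) + (3 * r + 2)"
  have p5: "runs (Seq (vec ''d'' (Lit 0)) ?r6) s' ((3 * r + 2) + ?T6) ?Q"
    if st: "st s'" and w0: "ivar s' ''w'' = 0" and b: "\<forall>c<r. iarr s' ''b'' (int c) = ?b c" for s'
  proof (rule runs_SeqI)
    show "runs (vec ''d'' (Lit 0)) s' (3 * r + 2) (\<lambda>s1. \<forall>c<r. iarr s1 ''d'' (int c) = 0)"
      by (rule runs_vec) (use st ww in \<open>auto simp: st_def mst_r\<close>)
    fix s1 assume sm: "same (vec ''d'' (Lit 0)) s' s1" and d: "\<forall>c<r. iarr s1 ''d'' (int c) = 0"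
    have "st s1" by (rule st_same[OF st sm]) auto
    then show "runs ?r6 s1 ?T6 ?Q" using w0 b d sameD[OF sm] by (intro p6) auto
  qed
  let ?r4 = "Seq (Assign ''w'' (Lit 0)) (Seq (vec ''d'' (Lit 0)) ?r6)"
  have p4: "runs ?r4 s' (1 + ((3 * r + 2) + ?T6)) ?Q"
    if st: "st s'" and b: "\<forall>c<r. iarr s' ''b'' (int c) = ?b c" for s'
  proof (rule runs_SeqI)
    show "runs (Assign ''w'' (Lit 0)) s' 1 (\<lambda>s1. ivar s1 ''w'' = 0)" by (rule runs_Assign) (use ww in auto)
    fix s1 assume sm: "same (Assign ''w'' (Lit 0)) s' s1" and w0: "ivar s1 ''w'' = 0"
    have "st s1" by (rule st_same[OF st sm]) auto
    then show "runs (Seq (vec ''d'' (Lit 0)) ?r6) s1 ((3 * r + 2) + ?T6) ?Q" using w0 b sameD[OF sm] by (intro p5) auto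
  qed
  let ?v3 = "vec ''b'' (Sub (col ''y'') (col ''e''))"
  have p3: "runs (Seq ?v3 ?r4) s' ((3 * r + 2) + (1 + ((3 * r + 2) + ?T6))) ?Q"
    if st: "st s'" and e: "\<forall>c<r. iarr s' ''e'' (int c) = mv (host_series L) x c" for s'
  proof (rule runs_SeqI)
    have m: "mst s'" using st by (simp add: st_def)
    show "runs ?v3 s' (3 * r + 2) (\<lambda>s1. \<forall>c<r. iarr s1 ''b'' (int c) = ?b c)"
    proof (rule runs_vec[OF mst_r(1)[OF m]])
      fix c s2 assume c: "c < r" "ivar s2 ''c'' = int c" and sm: "same ?v3 s' s2"
      have v: "iarr s2 ''y'' (int c) = y c" "iarr s2 ''e'' (int c) = mv (host_series L) x c"
        using sameD(2)[OF sm] st y(1) e c(1) by (simp_all add: st_def)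
      have "\<bar>mv (host_series L) x c\<bar> \<le> U * (Be - 2)" by (rule mv_bound[OF L]) (use x(2) U in auto)
      then have "word W (y c)" "word W (mv (host_series L) x c)" "word W (?b c)"
        using y(2)[OF c(1)] r[OF c(1)] UB UU unfolding word_def by linarith+
      then show "iok W s2 (Sub (col ''y'') (col ''e'')) \<and> ival s2 (Sub (col ''y'') (col ''e'')) = ?b c"
        using v c rW(2)[OF c(1)] by simp
    qed
    fix s1 assume sm: "same ?v3 s' s1" and b: "\<forall>c<r. iarr s1 ''b'' (int c) = ?b c"
    have "st s1" by (rule st_same[OF st sm]) auto
    then show "runs ?r4 s1 (1 + ((3 * r + 2) + ?T6)) ?Q" using b by (rule p4)
  qed
  have p2: "runs (Seq (mv_prog ''x'' ''e'') (Seq ?v3 ?r4)) s' (mv_time (length L) + ((3 * r + 2) + (1 + ((3 * r + 2) + ?T6)))) ?Q"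
    if st: "st s'" and w1: "ivar s' ''w'' = int (length L)" for s'
  proof (rule runs_SeqI)
    show "runs (mv_prog ''x'' ''e'') s' (mv_time (length L)) (\<lambda>s1. \<forall>c<r. iarr s1 ''e'' (int c) = mv (host_series L) x c)"
    proof (rule runs_mv[where X = U])
      have "U * Be \<le> 2 * U * Be" by (rule UU)
      then show "U * Be \<le> int W" using UB by linarith
    qed (use st w1 w x U in \<open>auto simp: st_def\<close>)
    fix s1 assume sm: "same (mv_prog ''x'' ''e'') s' s1" and e: "\<forall>c<r. iarr s1 ''e'' (int c) = mv (host_series L) x c"
    have "st s1" by (rule st_same[OF st sm]) auto
    then show "runs (Seq ?v3 ?r4) s1 ((3 * r + 2) + (1 + ((3 * r + 2) + ?T6))) ?Q" using e by (rule p3)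
  qed
  have "runs update_step s (1 + (mv_time (length L) + ((3 * r + 2) + (1 + ((3 * r + 2) + ?T6))))) ?Q"
    unfolding update_step_def
  proof (rule runs_SeqI)
    show "runs (Assign ''w'' (Var ''w1'')) s 1 (\<lambda>s1. ivar s1 ''w'' = int (length L))"
      by (rule runs_Assign) (use w ww in auto)
    have st0: "st s" using s K w by (simp add: st_def)
    fix s1 assume sm: "same (Assign ''w'' (Var ''w1'')) s s1" and w1: "ivar s1 ''w'' = int (length L)"
    have "st s1" by (rule st_same[OF st0 sm]) auto
    then show "runs (Seq (mv_prog ''x'' ''e'') (Seq ?v3 ?r4)) s1 (mv_time (length L) + ((3 * r + 2) + (1 + ((3 * r + 2) + ?T6)))) ?Q"
      using w1 by (rule p2)
  qed
  then show ?thesis by (rule runs_time) simp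
qed

text \<open>The array \<open>y\<close> receives the pairings of the old vector multiplied by the
  whole block and is computed once; the \<open>k + 1\<close> rounds query the block without the new
  cell. That \<open>L\<close> is a prefix of \<open>L2\<close> lets one array \<open>wl\<close>
  serve both.\<close>

lemma runs_update:
  assumes s: "mst s" and w: "ivar s ''w1'' = int (length L)" "ivar s ''w2'' = int (length L2)" "wl_is s L2" "distinct L2"
      "length L2 \<le> 36 * k\<^sup>2 * p" "L2 = L @ L'"
    and K: "ivar s ''K0'' = int (k * k + k + 1)" "ivar s ''k1'' = int (k + 1)" "k * k + k + 1 \<le> Bd"
    and x: "\<And>c. c < r \<Longrightarrow> iarr s ''x'' (int c) = x c" "\<And>c. c < r \<Longrightarrow> \<bar>x c\<bar> \<le> X"
    and X: "1 \<le> X" "X * Gam ^ (k + 4) \<le> int W"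
  shows "runs update_prog s (mv_time (length L2) + (k + 1) * (step_time (length L2) + 2) + 3)
     (\<lambda>s'. \<forall>c<r. iarr s' ''x'' (int c) = update (host_series L) (mv (host_series L2) x) x (Suc k) c)"
proof -
  let ?y = "mv (host_series L2) x" and ?u = "update (host_series L) (mv (host_series L2) x) x"
  have L2: "valid L2" using w by (simp add: wl_is_def)
  then have L: "valid L" "length L \<le> length L2" using w(6) by auto
  have wl: "wl_is s L" using w(3,6) unfolding wl_is_def by (auto simp: nth_append)
  have len: "length L \<le> 36 * k\<^sup>2 * p" using L(2) w(5) by linarith
  have y: "\<bar>?y c\<bar> \<le> X * Be" if "c < r" for c
  proof -
    have "\<bar>?y c\<bar> \<le> X * (Be - 2)" by (rule mv_bound[OF L2]) (use x(2) X in auto)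
    also have "\<dots> \<le> X * Be" using X(1) by (intro mult_left_mono) auto
    finally show ?thesis .
  qed
  have ub: "\<bar>?u j c\<bar> \<le> X * Gam ^ j" "\<bar>?y c - mv (host_series L) (?u j) c\<bar> \<le> 2 * (X * Gam ^ j) * Be" if "c < r" for c j
    using that x(2) X(1) y by (intro update_bound[OF L(1)]; simp)+
  have G1: "1 \<le> Gam" by (rule Gam_facts)
  have U: "1 \<le> X * Gam ^ j" "X \<le> X * Gam ^ j" for j
  proof -
    show "X \<le> X * Gam ^ j" using X(1) one_le_power[OF G1, of j] by (simp add: mult_le_cancel_left1)
    then show "1 \<le> X * Gam ^ j" using X(1) by linarith
  qed
  have UW: "X * Gam ^ j * (Gam * Gam) \<le> int W" if "j \<le> k" for j
  proof -
    have "X * Gam ^ j * (Gam * Gam) = X * Gam ^ (j + 2)" by (simp add: ac_simps)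
    also have "\<dots> \<le> X * Gam ^ (k + 4)" using X(1) G1 that by (intro mult_left_mono power_increasing) auto
    finally show ?thesis using X(2) by linarith
  qed
  have lenW: "length L2 \<le> Bd"
  proof -
    have "length L2 \<le> n" using L2 by (metis card_lessThan card_mono distinct_card finite_lessThan)
    then show ?thesis using Bd by simp
  qed
  let ?step = update_step
  have loop: "runs (For ''j'' ''k1'' ?step) s' ((k + 1) * (step_time (length L) + 2) + 2)
      (\<lambda>s''. \<forall>c<r. iarr s'' ''x'' (int c) = ?u (Suc k) c)"
    if m: "mst s'" and s': "iarr s' ''x'' = iarr s ''x''" "iarr s' ''wl'' = iarr s ''wl''" "ivar s' ''w1'' = ivar s ''w1''"
      "ivar s' ''K0'' = ivar s ''K0''" "ivar s' ''k1'' = ivar s ''k1''" and yv: "\<forall>c<r. iarr s' ''y'' (int c) = ?y c" for s'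
  proof (rule runs_For_const[where N = "k + 1" and I = "\<lambda>j s''. \<forall>c<r. iarr s'' ''x'' (int c) = ?u j c"])
    show "k + 1 \<le> W" using K(3) Bd BW by simp
    fix j s2 assume j: "j < k + 1" "ivar s2 ''j'' = int j" and sm: "same (For ''j'' ''k1'' ?step) s' s2" and I: "\<forall>c<r. iarr s2 ''x'' (int c) = ?u j c"
    have m2: "mst s2" by (rule mst_same[OF m sm]) auto
    note fr = sameD[OF sm, simplified]
    have XU: "X * Be \<le> X * Gam ^ j * Be" using U(2)[of j] Be_ge by (intro mult_right_mono) auto
    have "runs ?step s2 (step_time (length L)) (\<lambda>s''. \<forall>c<r. iarr s'' ''x'' (int c) =
        ?u j c + solve (\<lambda>c. ?y c - mv (host_series L) (?u j) c) (k * k + k + 1) c)"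
    proof (rule runs_update_step[where U = "X * Gam ^ j"])
      show "wl_is s2 L" using wl fr(2)[of "''wl''"] s'(2) by (simp add: wl_is_def)
      show "\<bar>?y c\<bar> \<le> X * Gam ^ j * Be" if "c < r" for c using y[OF that] XU by linarith
      show "\<bar>?y c - mv (host_series L) (?u j) c\<bar> \<le> 2 * (X * Gam ^ j) * Be" if "c < r" for c
        using ub(2)[OF that] .
      show "\<bar>?u j c\<bar> \<le> X * Gam ^ j" if "c < r" for c using ub(1)[OF that] .
    qed (use m2 fr s' w K I yv len U UW j L in auto)
    then show "runs ?step s2 (step_time (length L)) (\<lambda>s3. same ?step s2 s3 \<longrightarrow>
        (\<forall>c<r. iarr (s3\<lparr>ivar := (ivar s3)(''j'' := int j + 1)\<rparr>) ''x'' (int c) = ?u (Suc j) c))"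
      by (rule runs_mono[OF _ order_refl]) simp
  qed (use s' K x in auto)
  have "runs update_prog s (1 + (mv_time (length L2) + ((k + 1) * (step_time (length L) + 2) + 2))) (\<lambda>s''. \<forall>c<r. iarr s'' ''x'' (int c) = ?u (Suc k) c)"
    unfolding update_prog_def
  proof (rule runs_SeqI)
    show "runs (Assign ''w'' (Var ''w2'')) s 1 (\<lambda>s1. ivar s1 ''w'' = int (length L2))"
      by (rule runs_Assign) (use w lenW in \<open>auto intro!: word_lin\<close>)
    fix s1 assume sm: "same (Assign ''w'' (Var ''w2'')) s s1" and w1: "ivar s1 ''w'' = int (length L2)"
    have m1: "mst s1" by (rule mst_same[OF s sm]) auto
    note fr = sameD[OF sm, simplified]
    show "runs (Seq (mv_prog ''x'' ''y'') (For ''j'' ''k1'' ?step)) s1 (mv_time (length L2) + ((k + 1) * (step_time (length L) + 2) + 2))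
       (\<lambda>s''. \<forall>c<r. iarr s'' ''x'' (int c) = ?u (Suc k) c)"
    proof (rule runs_SeqI)
      show "runs (mv_prog ''x'' ''y'') s1 (mv_time (length L2)) (\<lambda>s2. \<forall>c<r. iarr s2 ''y'' (int c) = ?y c)"
      proof (rule runs_mv[where X = X])
        have "Be \<le> Gam"
          unfolding Gam_def using power_increasing[of 1 "k * k + k + 3" "2 + Be"] Be_ge by simp
        then have "X * Be \<le> X * (Gam * Gam)" using X(1) G1 mult_mono[of Be Gam 1 Gam] Be_ge by (intro mult_left_mono) auto
        then show "X * Be \<le> int W" using UW[of 0] by simp
        show "wl_is s1 L2" using w(3) fr by (simp add: wl_is_def)
      qed (use m1 w1 w x X fr in auto)
      fix s2 assume sm2: "same (mv_prog ''x'' ''y'') s1 s2" and y2: "\<forall>c<r. iarr s2 ''y'' (int c) = ?y c"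
      have m2: "mst s2" by (rule mst_same[OF m1 sm2]) auto
      show "runs (For ''j'' ''k1'' ?step) s2 ((k + 1) * (step_time (length L) + 2) + 2) (\<lambda>s''. \<forall>c<r. iarr s'' ''x'' (int c) = ?u (Suc k) c)"
        by (rule loop[OF m2]) (use fr sameD[OF sm2, simplified] y2 in auto)
    qed
  qed
  then show ?thesis
  proof (rule runs_time)
    have "mv_time (length L) \<le> mv_time (length L2)" using L(2) by (intro add_mono mult_left_mono) auto
    then have "step_time (length L) + 2 \<le> step_time (length L2) + 2" by linarith
    then have "(k + 1) * (step_time (length L) + 2) \<le> (k + 1) * (step_time (length L2) + 2)" by (rule mult_left_mono) simp
    then show "1 + (mv_time (length L2) + ((k + 1) * (step_time (length L) + 2) + 2)) \<le> mv_time (length L2) + (k + 1) * (step_time (length L2) + 2) + 3"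
      by linarith
  qed
qed

end

subsection \<open>Sweeping over the grid\<close>

definition add_sq :: "string \<Rightarrow> com" where
  "add_sq a = Assign ''S'' (Add (Var ''S'') (Add (Mul (Floor (px a (Var ''u''))) (Floor (px a (Var ''u''))))
     (Mul (Floor (py a (Var ''u''))) (Floor (py a (Var ''u''))))))"

text \<open>Squares are summed because this bounds the absolute values without case distinctions.\<close>

definition bound :: com where
  "bound = Seq (Assign ''S'' (Lit 3)) (Seq (For ''u'' ''k'' (add_sq ''P'')) (For ''u'' ''n'' (add_sq ''G'')))"

definition get_alpha :: com where
  "get_alpha = Seq (Assign ''a'' (Lit 0)) (Seq (Assign ''c'' (Lit 0)) (Seq ask (Assign ''al'' (Var ''q''))))"

text \<open>Arrays are indexed by arbitrary integers and start as zero, so the key of a cell,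
  possibly negative, addresses its bucket directly. Vertices are thus sorted into cells in linear
  time, whatever the extent of the grid. Each bucket owns a segment of length
  \<open>n\<close>.\<close>

definition bucket_step :: com where
  "bucket_step = Seq (Assign ''key'' (Add (Mul (Div (Floor (px ''G'' (Var ''v''))) (Mul (Lit 2) (Var ''k''))) (Var ''K''))
        (Div (Floor (py ''G'' (Var ''v''))) (Mul (Lit 2) (Var ''k'')))))
     (Seq (Store ''kv'' (Var ''v'') (Var ''key''))
     (Seq (Store ''cell'' (Add (Mul (Var ''key'') (Var ''n'')) (Idx ''cnt'' (Var ''key''))) (Var ''v''))
       (Store ''cnt'' (Var ''key'') (Add (Idx ''cnt'' (Var ''key'')) (Lit 1)))))"

definition buckets :: com where
  "buckets = Seq (Assign ''K'' (Add (Mul (Lit 2) (Var ''S'')) (Lit 5))) (For ''v'' ''n'' bucket_step)"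

definition push :: "string \<Rightarrow> com" where
  "push x = Seq (Store ''wl'' (Var ''w'') (Idx ''cell'' (Add (Mul (Var x) (Var ''n'')) (Var ''j''))))
     (Assign ''w'' (Add (Var ''w'') (Lit 1)))"

definition push_cell :: "string \<Rightarrow> com" where
  "push_cell x = Seq (Assign ''cc'' (Idx ''cnt'' (Var x))) (For ''j'' ''cc'' (push x))"

text \<open>The nine directions are the two base 3 digits of \<open>i\<close>, each lowered by 1;
  the remainder is expressed through \<open>Div\<close>, as the language has no operation for
  it.\<close>

definition push_nbr :: com where
  "push_nbr = Seq (Assign ''kk'' (Add (Var ''key'') (Add (Mul (Sub (Div (Var ''i'') (Lit 3)) (Lit 1)) (Var ''K''))
        (Sub (Sub (Var ''i'') (Mul (Lit 3) (Div (Var ''i'') (Lit 3)))) (Lit 1)))))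
     (If (Less (Lit 0) (Idx ''done'' (Var ''kk''))) (push_cell ''kk'') Skip)"

definition gather :: com where
  "gather = Seq (Assign ''w'' (Lit 0)) (Seq (For ''i'' ''nine'' push_nbr)
     (Seq (Assign ''w1'' (Var ''w'')) (Seq (push_cell ''key'') (Seq (Assign ''w2'' (Var ''w''))
       (Store ''done'' (Var ''key'') (Lit 1))))))"

lemma mods_G [simp]:
  "modi (add_sq a) = {''S''}" "moda (add_sq a) = {}" "modr (add_sq a) = {}"
  "modi get_alpha = {''a'', ''c'', ''h'', ''u'', ''q'', ''al''}" "moda get_alpha = {}" "modr get_alpha = {''H''}"
  "modi bucket_step = {''key''}" "moda bucket_step = {''kv'', ''cell'', ''cnt''}" "modr bucket_step = {}"
  "modi buckets = {''key'', ''K'', ''v''}" "moda buckets = {''kv'', ''cell'', ''cnt''}" "modr buckets = {}"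
  "modi (push x) = {''w''}" "moda (push x) = {''wl''}" "modr (push x) = {}"
  "modi (push_cell x) = {''w'', ''cc'', ''j''}" "moda (push_cell x) = {''wl''}" "modr (push_cell x) = {}"
  "modi push_nbr = {''w'', ''cc'', ''j'', ''kk''}" "moda push_nbr = {''wl''}" "modr push_nbr = {}"
  "modi gather = {''w'', ''cc'', ''j'', ''kk'', ''i'', ''w1'', ''w2''}" "moda gather = {''wl'', ''done''}" "modr gather = {}"
  by (auto simp: add_sq_def get_alpha_def bucket_step_def buckets_def push_def push_cell_def push_nbr_def gather_def)

context disk_program
begin

definition base0 :: "state \<Rightarrow> bool" where
  "base0 s \<longleftrightarrow> ivar s ''k'' = int k \<and> ivar s ''n'' = int n \<and> rarr s ''P'' = store_centres xs \<and> rarr s ''G'' = store_centres ys"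

definition sq :: "plane \<Rightarrow> int" where
  "sq z = \<lfloor>fst z\<rfloor> * \<lfloor>fst z\<rfloor> + \<lfloor>snd z\<rfloor> * \<lfloor>snd z\<rfloor>"

lemma sq_nonneg: "0 \<le> sq z"
  by (simp add: sq_def)

lemma abs_le_square: "\<bar>z\<bar> \<le> z * z" for z :: int
proof (cases "z = 0")
  case False
  then have "\<bar>z\<bar> * 1 \<le> \<bar>z\<bar> * \<bar>z\<bar>" by (intro mult_left_mono) auto
  then show ?thesis by (simp add: abs_mult[symmetric])
qed simp

lemma runs_add_sq:
  assumes a: "rarr s a = store_centres zs" and y: "ivar s y = int (length zs)" "y \<notin> {''u'', ''S''}" "length zs \<le> Bd"
    and S: "ivar s ''S'' = S0" "0 \<le> S0" "S0 + (\<Sum>z\<leftarrow>zs. sq z) \<le> int Bd"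
  shows "runs (For ''u'' y (add_sq a)) s (3 * length zs + 2) (\<lambda>s'. ivar s' ''S'' = S0 + (\<Sum>z\<leftarrow>zs. sq z))"
proof -
  have "runs (For ''u'' y (add_sq a)) s (length zs * (1 + 2) + 2) (\<lambda>s'. ivar s' ''S'' = S0 + (\<Sum>z\<leftarrow>zs. sq z))"
  proof (rule runs_For_const[where N = "length zs" and I = "\<lambda>i s'. ivar s' ''S'' = S0 + (\<Sum>z\<leftarrow>take i zs. sq z)"])
    show "length zs \<le> W" using y Bd BW by linarith
    fix i and s' :: state assume i: "i < length zs" "ivar s' ''u'' = int i" and sm: "same (For ''u'' y (add_sq a)) s s'"
      and I: "ivar s' ''S'' = S0 + (\<Sum>z\<leftarrow>take i zs. sq z)"
    let ?z = "zs ! i"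
    have a': "rarr s' a = store_centres zs" using sameD(3)[OF sm] a by simp
    have tk: "(\<Sum>z\<leftarrow>take (Suc i) zs. sq z) = (\<Sum>z\<leftarrow>take i zs. sq z) + sq ?z"
      using i(1) by (simp add: take_Suc_conv_app_nth)
    have all: "(\<Sum>z\<leftarrow>zs. sq z) = (\<Sum>z\<leftarrow>take (Suc i) zs. sq z) + (\<Sum>z\<leftarrow>drop (Suc i) zs. sq z)"
      by (simp flip: sum_list_append map_append)
    have nn: "0 \<le> (\<Sum>z\<leftarrow>drop (Suc i) zs. sq z)" "0 \<le> (\<Sum>z\<leftarrow>take i zs. sq z)"
      by (rule sum_list_nonneg; use sq_nonneg in auto)+
    have b: "S0 + (\<Sum>z\<leftarrow>take i zs. sq z) + sq ?z \<le> int Bd" using S(3) all tk nn by linarith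
    have fl: "\<bar>\<lfloor>fst ?z\<rfloor>\<bar> \<le> sq ?z" "\<bar>\<lfloor>snd ?z\<rfloor>\<bar> \<le> sq ?z" "\<lfloor>fst ?z\<rfloor> * \<lfloor>fst ?z\<rfloor> \<le> sq ?z" "\<lfloor>snd ?z\<rfloor> * \<lfloor>snd ?z\<rfloor> \<le> sq ?z"
      using abs_le_square[of "\<lfloor>fst ?z\<rfloor>"] abs_le_square[of "\<lfloor>snd ?z\<rfloor>"] zero_le_square[of "\<lfloor>fst ?z\<rfloor>"] zero_le_square[of "\<lfloor>snd ?z\<rfloor>"]
      unfolding sq_def by linarith+
    have sB: "sq ?z \<le> int Bd" using b nn S(2) by linarith
    have w: "word W \<lfloor>fst ?z\<rfloor>" "word W \<lfloor>snd ?z\<rfloor>" "word W (\<lfloor>fst ?z\<rfloor> * \<lfloor>fst ?z\<rfloor>)" "word W (\<lfloor>snd ?z\<rfloor> * \<lfloor>snd ?z\<rfloor>)"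
      "word W (S0 + (\<Sum>z\<leftarrow>take i zs. sq z))" "word W (S0 + (\<Sum>z\<leftarrow>take i zs. sq z) + sq ?z)" "word W (sq ?z)"
      using fl b nn S(2) sB sq_nonneg[of ?z] by (auto intro!: word_lin)
    have w': "word W (int i)" "word W (2 * int i)" "word W (2 * int i + 1)" "word W 2" "word W 1"
      by (rule word_lin; use i(1) y(3) Bd(1) in simp)+
    show "runs (add_sq a) s' 1 (\<lambda>s''. same (add_sq a) s' s'' \<longrightarrow>
        ivar (s''\<lparr>ivar := (ivar s'')(''u'' := int i + 1)\<rparr>) ''S'' = S0 + (\<Sum>z\<leftarrow>take (Suc i) zs. sq z))"
      unfolding add_sq_def
      by (rule runs_Assign)
        (use a' i I w w' tk store_centres_nth[OF i(1)] in \<open>simp_all add: sq_def algebra_simps\<close>)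
  qed (use y S in auto)
  then show ?thesis by (rule runs_time) simp
qed

lemma runs_bound:
  assumes s: "base0 s"
  shows "runs bound s (3 * k + 3 * n + 5) base"
proof -
  have tot: "int Sb = 3 + (\<Sum>z\<leftarrow>xs. sq z) + (\<Sum>z\<leftarrow>ys. sq z)" using Sb_eq by (simp add: sq_def)
  have nn: "0 \<le> (\<Sum>z\<leftarrow>xs. sq z)" "0 \<le> (\<Sum>z\<leftarrow>ys. sq z)" by (rule sum_list_nonneg; use sq_nonneg in auto)+
  have SB: "int Sb \<le> int Bd" using Bd(4) by simp
  have "runs bound s (1 + ((3 * k + 2) + (3 * n + 2))) base"
    unfolding bound_def
  proof (rule runs_SeqI)
    have "word W 3" by (rule word_lin) (use Bd in simp)
    then show "runs (Assign ''S'' (Lit 3)) s 1 (\<lambda>s1. ivar s1 ''S'' = 3)" by (intro runs_Assign) auto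
    fix s1 assume sm: "same (Assign ''S'' (Lit 3)) s s1" and S1: "ivar s1 ''S'' = 3"
    have b1: "base0 s1" using s unfolding base0_def by (simp add: sameD[OF sm])
    show "runs (Seq (For ''u'' ''k'' (add_sq ''P'')) (For ''u'' ''n'' (add_sq ''G''))) s1 ((3 * k + 2) + (3 * n + 2)) base"
    proof (rule runs_SeqI)
      show "runs (For ''u'' ''k'' (add_sq ''P'')) s1 (3 * k + 2) (\<lambda>s2. ivar s2 ''S'' = 3 + (\<Sum>z\<leftarrow>xs. sq z))"
        by (rule runs_add_sq) (use b1 S1 Bd tot nn SB in \<open>auto simp: base0_def\<close>)
      fix s2 assume sm2: "same (For ''u'' ''k'' (add_sq ''P'')) s1 s2" and S2: "ivar s2 ''S'' = 3 + (\<Sum>z\<leftarrow>xs. sq z)"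
      have b2: "base0 s2" using b1 unfolding base0_def by (simp add: sameD[OF sm2])
      have "runs (For ''u'' ''n'' (add_sq ''G'')) s2 (3 * n + 2) (\<lambda>s3. ivar s3 ''S'' = (3 + (\<Sum>z\<leftarrow>xs. sq z)) + (\<Sum>z\<leftarrow>ys. sq z))"
        by (rule runs_add_sq) (use b2 S2 Bd tot nn SB in \<open>auto simp: base0_def\<close>)
      then show "runs (For ''u'' ''n'' (add_sq ''G'')) s2 (3 * n + 2) base"
      proof (rule runs_mono)
        fix s3 assume sm3: "same (For ''u'' ''n'' (add_sq ''G'')) s2 s3" and "ivar s3 ''S'' = (3 + (\<Sum>z\<leftarrow>xs. sq z)) + (\<Sum>z\<leftarrow>ys. sq z)"
        then show "base s3" using b2 tot unfolding base0_def base_def by (simp add: sameD[OF sm3])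
      qed simp
    qed
  qed
  then show ?thesis by (rule runs_time) simp
qed

definition key :: "int \<times> int \<Rightarrow> int" where
  "key c = fst c * (2 * int Sb + 5) + snd c"

text \<open>One cell more on each side than vertices can occupy, so that the neighbours of occupied
  cells have valid keys too.\<close>

definition inb :: "int \<times> int \<Rightarrow> bool" where
  "inb c \<longleftrightarrow> \<bar>fst c\<bar> \<le> int Sb + 1 \<and> \<bar>snd c\<bar> \<le> int Sb + 1"

text \<open>The second coordinates differ by at most \<open>2 * Sb + 2\<close>, less than the radix
  \<open>2 * Sb + 5\<close>, so the key determines both digits.\<close>

lemma key_inj: assumes "inb c" "inb c'" "key c = key c'" shows "c = c'"
proof -
  let ?K = "2 * int Sb + 5"
  have e: "(fst c - fst c') * ?K = snd c' - snd c" using assms(3) by (simp add: key_def algebra_simps)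
  have "\<bar>snd c' - snd c\<bar> < ?K" using assms(1,2) unfolding inb_def by linarith
  then have "\<bar>fst c - fst c'\<bar> * ?K < 1 * ?K" using e[symmetric] by (simp add: abs_mult)
  then have "\<bar>fst c - fst c'\<bar> < 1" using mult_less_cancel_right_pos[of ?K] by simp
  then have "fst c = fst c'" by simp
  then show ?thesis using e by (simp add: prod_eq_iff)
qed

lemma key_bound: assumes "inb c" shows "\<bar>key c\<bar> \<le> int Bd"
proof -
  let ?K = "2 * int Sb + 5"
  have "\<bar>key c\<bar> \<le> \<bar>fst c\<bar> * ?K + \<bar>snd c\<bar>"
    using abs_triangle_ineq[of "fst c * ?K" "snd c"] by (simp add: key_def abs_mult)
  also have "\<dots> \<le> (int Sb + 1) * ?K + (int Sb + 1)"
    using assms unfolding inb_def by (intro add_mono mult_right_mono) auto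
  also have "\<dots> = int ((Sb + 1) * (2 * Sb + 6))" by (simp add: algebra_simps)
  also have "\<dots> \<le> int Bd" using key_Bd by (simp only: of_nat_le_iff)
  finally show ?thesis .
qed

lemma abs_div_le: fixes x d :: int assumes "\<bar>x\<bar> \<le> b" "1 \<le> d" shows "\<bar>x div d\<bar> \<le> b"
proof (cases "0 \<le> x")
  case True
  then have "x div d \<le> x" "0 \<le> x div d" using assms(2) zdiv_mono2[of x 1 d] by (auto simp: pos_imp_zdiv_nonneg_iff)
  then show ?thesis using assms(1) True by linarith
next
  case False
  have "x div d \<le> 0" using False assms(2) by (metis div_neg_pos_less0 less_le_not_le linorder_not_le zero_less_one order_less_le_trans nle_le)
  moreover have "x \<le> x div d"
  proof -
    have "x * d \<le> x * 1" using False assms(2) by (intro mult_left_mono_neg) auto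
    then have "(x * d) div d \<le> x div d" using assms(2) by (intro zdiv_mono1) auto
    then show ?thesis using assms(2) by simp
  qed
  ultimately show ?thesis using assms(1) by linarith
qed

lemma floor_bound: assumes "v < n" shows "\<bar>\<lfloor>fst (ys ! v)\<rfloor>\<bar> \<le> int Sb" "\<bar>\<lfloor>snd (ys ! v)\<rfloor>\<bar> \<le> int Sb"
proof -
  have b: "\<bar>fst (ys ! v)\<bar> \<le> real Sb" "\<bar>snd (ys ! v)\<bar> \<le> real Sb" using Sb[of "ys ! v"] assms by auto
  have fl: "\<bar>\<lfloor>x\<rfloor>\<bar> \<le> int m" if "\<bar>x\<bar> \<le> real m" for x m
  proof -
    have "- real m \<le> x" "x \<le> real m" using that by auto
    then have "\<lfloor>x\<rfloor> \<le> int m" "- int m \<le> \<lfloor>x\<rfloor>" by (metis floor_mono floor_of_nat, simp add: le_floor_iff)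
    then show ?thesis by linarith
  qed
  show "\<bar>\<lfloor>fst (ys ! v)\<rfloor>\<bar> \<le> int Sb" "\<bar>\<lfloor>snd (ys ! v)\<rfloor>\<bar> \<le> int Sb" using fl b by auto
qed

lemma cell_bound: assumes "v < n" shows "\<bar>fst (cell v)\<bar> \<le> int Sb" "\<bar>snd (cell v)\<bar> \<le> int Sb"
proof -
  have "1 \<le> 2 * int k" using kpos by linarith
  then show "\<bar>fst (cell v)\<bar> \<le> int Sb" "\<bar>snd (cell v)\<bar> \<le> int Sb"
    unfolding cell_def fst_conv snd_conv using floor_bound[OF assms] abs_div_le by blast+
qed

lemma cell_inb: "v < n \<Longrightarrow> inb (cell v)"
  using cell_bound[of v] by (simp add: inb_def)

definition bucket :: "int \<times> int \<Rightarrow> nat list" where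
  "bucket c = filter (\<lambda>u. cell u = c) [0..<n]"

definition buckets_ok :: "state \<Rightarrow> bool" where
  "buckets_ok s \<longleftrightarrow> ivar s ''K'' = 2 * int Sb + 5 \<and> (\<forall>v<n. iarr s ''kv'' (int v) = key (cell v)) \<and>
     (\<forall>c. inb c \<longrightarrow> iarr s ''cnt'' (key c) = int (length (bucket c)) \<and>
        (\<forall>i<length (bucket c). iarr s ''cell'' (key c * int n + int i) = int (bucket c ! i)))"

lemma cell_index: fixes j j' :: int
  shows "j * int n + int i = j' * int n + int i' \<Longrightarrow> i < n \<Longrightarrow> i' < n \<Longrightarrow> j = j' \<and> i = i'"
proof -
  assume a: "j * int n + int i = j' * int n + int i'" "i < n" "i' < n"
  have "(j * int n + int i) div int n = j" "(j' * int n + int i') div int n = j'"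
  proof -
    have "ys \<noteq> []" using a(2) by auto
    then show "(j * int n + int i) div int n = j" "(j' * int n + int i') div int n = j'"
      using a(2,3) by (simp_all add: div_add1_eq)
  qed
  then have "j = j'" using a(1) by metis
  then show ?thesis using a(1) by simp
qed

lemma runs_buckets:
  assumes s: "base s" "\<And>j. iarr s ''cnt'' j = 0"
  shows "runs buckets s (6 * n + 3) buckets_ok"
proof -
  let ?K = "2 * int Sb + 5"
  \<comment> \<open>The loop invariant sorts by integer keys and not by cells, so it can range over
    all keys without a range condition; \<open>key_inj\<close> translates at the end.\<close>
  let ?b = "\<lambda>m j. filter (\<lambda>u. key (cell u) = j) [0..<m]"
  define inv where "inv m s' \<longleftrightarrow> (\<forall>v<m. iarr s' ''kv'' (int v) = key (cell v)) \<and>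
     (\<forall>j. iarr s' ''cnt'' j = int (length (?b m j)) \<and> (\<forall>i<length (?b m j). iarr s' ''cell'' (j * int n + int i) = int (?b m j ! i)))"
    for m and s' :: state
  have step: "runs bucket_step s' 4 (inv (Suc v))"
    if s': "base s'" "ivar s' ''K'' = ?K" "ivar s' ''v'' = int v" "v < n" "inv v s'" for s' v
  proof -
    let ?j = "key (cell v)" and ?i = "length (?b v (key (cell v)))"
    have G: "rarr s' ''G'' = store_centres ys" "ivar s' ''k'' = int k" "ivar s' ''n'' = int n" using s'(1) by (auto simp: base_def)
    have i: "?i \<le> v" by (rule length_filter_upt_le)
    have j: "\<bar>?j\<bar> \<le> int Bd" by (rule key_bound[OF cell_inb[OF s'(4)]])
    have w: "word W (int v)" "word W (2 * int v)" "word W (2 * int v + 1)" "word W 2" "word W 1" "word W (int k)" "word W (2 * int k)"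
       "word W ?K" "word W (int n)" "word W (int ?i)" "word W (int ?i + 1)"
      by (rule word_lin; use s'(4) Bd i in simp)+
    have w2: "word W \<lfloor>fst (ys ! v)\<rfloor>" "word W \<lfloor>snd (ys ! v)\<rfloor>" "word W (fst (cell v))" "word W (snd (cell v))" "word W ?j"
      using floor_bound[OF s'(4)] cell_bound[OF s'(4)] j Bd by (auto intro!: word_lin)
    have w3: "word W (fst (cell v) * ?K)" by (rule word_mult) (use cell_bound[OF s'(4)] Bd in auto)
    have w4: "word W (?j * int n)" "word W (?j * int n + int ?i)"
      using j Bd i s'(4) by (auto intro!: word_mult word_mult_add)
    let ?e = "Add (Mul (Div (Floor (px ''G'' (Var ''v''))) (Mul (Lit 2) (Var ''k''))) (Var ''K''))
        (Div (Floor (py ''G'' (Var ''v''))) (Mul (Lit 2) (Var ''k'')))"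
    have e: "ival s' ?e = ?j" "iok W s' ?e"
      using s' G w w2 w3 store_centres_nth[OF s'(4)] by (simp_all add: key_def cell_def)
    let ?s1 = "s'\<lparr>ivar := (ivar s')(''key'' := ?j)\<rparr>"
    let ?s2 = "?s1\<lparr>iarr := (iarr s')(''kv'' := (iarr s' ''kv'')(int v := ?j))\<rparr>"
    let ?s3 = "?s2\<lparr>iarr := (iarr ?s2)(''cell'' := (iarr s' ''cell'')(?j * int n + int ?i := int v))\<rparr>"
    let ?s4 = "?s3\<lparr>iarr := (iarr ?s3)(''cnt'' := (iarr s' ''cnt'')(?j := int ?i + 1))\<rparr>"
    have cnt: "iarr s' ''cnt'' ?j = int ?i" using s'(5) by (simp add: inv_def)
    have "inv (Suc v) ?s4"
      unfolding inv_def
    proof (intro conjI allI impI)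
      fix u assume "u < Suc v"
      then show "iarr ?s4 ''kv'' (int u) = key (cell u)" using s'(5) by (auto simp: inv_def less_Suc_eq)
    next
      fix j show "iarr ?s4 ''cnt'' j = int (length (?b (Suc v) j))" using s'(5) by (auto simp: inv_def)
    next
      fix j m assume m: "m < length (?b (Suc v) j)"
      have mn: "m < n" using m length_filter_upt_le[of "\<lambda>u. key (cell u) = j" "Suc v"] s'(4) by linarith
      show "iarr ?s4 ''cell'' (j * int n + int m) = int (?b (Suc v) j ! m)"
      proof (cases "j = ?j \<and> m = ?i")
        case True
        then show ?thesis by (auto simp: nth_append)
      next
        case False
        then have ne: "j * int n + int m \<noteq> ?j * int n + int ?i" using cell_index[of j m ?j ?i] mn i s'(4) by auto
        have m': "m < length (?b v j)"
        proof (cases "j = ?j")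
          case True
          then have "m < Suc ?i" using m by simp
          then show ?thesis using False True by auto
        next
          case False
          then show ?thesis using m by simp
        qed
        then have "?b (Suc v) j ! m = ?b v j ! m" by (simp add: nth_append)
        moreover have "iarr ?s4 ''cell'' (j * int n + int m) = iarr s' ''cell'' (j * int n + int m)" using ne by simp
        ultimately show ?thesis using s'(5) m' unfolding inv_def by metis
      qed
    qed
    have "runs bucket_step s' (1 + (1 + (1 + 1))) (inv (Suc v))"
      unfolding bucket_step_def
    proof (rule runs_SeqI)
      show "runs (Assign ''key'' ?e) s' 1 (\<lambda>s1. s1 = ?s1)" by (rule runs_Assign) (use e in simp_all)
      fix s1 assume s1: "s1 = ?s1"
      show "runs (Seq (Store ''kv'' (Var ''v'') (Var ''key''))
         (Seq (Store ''cell'' (Add (Mul (Var ''key'') (Var ''n'')) (Idx ''cnt'' (Var ''key''))) (Var ''v''))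
         (Store ''cnt'' (Var ''key'') (Add (Idx ''cnt'' (Var ''key'')) (Lit 1))))) s1 (1 + (1 + 1)) (inv (Suc v))"
      proof (rule runs_SeqI)
        show "runs (Store ''kv'' (Var ''v'') (Var ''key'')) s1 1 (\<lambda>s2. s2 = ?s2)"
          by (rule runs_Store) (use s1 s' w w2 in simp_all)
        fix s2 assume s2: "s2 = ?s2"
        show "runs (Seq (Store ''cell'' (Add (Mul (Var ''key'') (Var ''n'')) (Idx ''cnt'' (Var ''key''))) (Var ''v''))
         (Store ''cnt'' (Var ''key'') (Add (Idx ''cnt'' (Var ''key'')) (Lit 1)))) s2 (1 + 1) (inv (Suc v))"
        proof (rule runs_SeqI)
          show "runs (Store ''cell'' (Add (Mul (Var ''key'') (Var ''n'')) (Idx ''cnt'' (Var ''key''))) (Var ''v'')) s2 1 (\<lambda>s3. s3 = ?s3)"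
            by (rule runs_Store) (use s2 s' w w2 w4 cnt G in simp_all)
          fix s3 assume s3: "s3 = ?s3"
          show "runs (Store ''cnt'' (Var ''key'') (Add (Idx ''cnt'' (Var ''key'')) (Lit 1))) s3 1 (inv (Suc v))"
            by (rule runs_Store) (use s3 w w2 cnt \<open>inv (Suc v) ?s4\<close> in \<open>simp_all\<close>)
        qed
      qed
    qed
    then show ?thesis by (simp add: numeral_eq_Suc)
  qed
  have inv_upd: "inv m (s'\<lparr>ivar := z\<rparr>) = inv m s'" for m s' z by (simp add: inv_def)
  have "runs buckets s (1 + (n * (4 + 2) + 2)) buckets_ok"
    unfolding buckets_def
  proof (rule runs_SeqI)
    have "word W (int Sb)" "word W (2 * int Sb)" "word W ?K" "word W 2" "word W 5" by (rule word_lin; use Bd in simp)+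
    then show "runs (Assign ''K'' (Add (Mul (Lit 2) (Var ''S'')) (Lit 5))) s 1 (\<lambda>s1. ivar s1 ''K'' = ?K)"
      using s(1) by (intro runs_Assign) (auto simp: base_def)
    fix s1 assume sm: "same (Assign ''K'' (Add (Mul (Lit 2) (Var ''S'')) (Lit 5))) s s1" and K1: "ivar s1 ''K'' = ?K"
    have b1: "base s1" using base_same[OF s(1) sm] by simp
    show "runs (For ''v'' ''n'' bucket_step) s1 (n * (4 + 2) + 2) buckets_ok"
    proof (rule runs_For_const[where N = n and I = inv])
      show "ivar s1 ''n'' = int n" using b1 by (simp add: base_def)
      show "inv 0 (s1\<lparr>ivar := (ivar s1)(''v'' := 0)\<rparr>)" using s(2) sameD(2)[OF sm] by (simp add: inv_def)
      fix v s2 assume v: "v < n" "ivar s2 ''v'' = int v" and sm2: "same (For ''v'' ''n'' bucket_step) s1 s2" and I: "inv v s2"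
      have "base s2" using base_same[OF b1 sm2] by simp
      moreover have "ivar s2 ''K'' = ?K" using sameD(1)[OF sm2] K1 by simp
      ultimately have "runs bucket_step s2 4 (inv (Suc v))" using v I by (intro step)
      then show "runs bucket_step s2 4 (\<lambda>s3. same bucket_step s2 s3 \<longrightarrow> inv (Suc v) (s3\<lparr>ivar := (ivar s3)(''v'' := int v + 1)\<rparr>))"
        unfolding inv_upd by (rule runs_imp)
    next
      fix s2 assume sm2: "same (For ''v'' ''n'' bucket_step) s1 s2" and I: "inv n s2"
      have "?b n (key c) = bucket c" if "inb c" for c
        unfolding bucket_def
      proof (rule filter_cong)
        fix u assume "u \<in> set [0..<n]"
        then have "inb (cell u)" using cell_inb by simp
        then show "key (cell u) = key c \<longleftrightarrow> cell u = c" using key_inj[OF _ that] by blast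
      qed simp
      then show "buckets_ok s2" using I sameD(1)[OF sm2, of "''K''"] K1 unfolding buckets_ok_def inv_def by simp
    qed (use kW in auto)
  qed
  then show ?thesis by (rule runs_time) simp
qed

end

context disk_program
begin

definition lst :: "state \<Rightarrow> nat list \<Rightarrow> bool" where
  "lst s L \<longleftrightarrow> ivar s ''w'' = int (length L) \<and> (\<forall>i<length L. iarr s ''wl'' (int i) = int (L ! i))"

lemma lst_upd: "x \<noteq> ''w'' \<Longrightarrow> lst (s\<lparr>ivar := (ivar s)(x := z)\<rparr>) L = lst s L"
  by (simp add: lst_def)

lemma runs_push_cell:
  assumes b: "buckets_ok s" "ivar s ''n'' = int n" and c: "inb c" "ivar s x = key c" "x \<notin> {''w'', ''cc'', ''j''}"
    and L: "lst s L" "length L \<le> 8 * n"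
  shows "runs (push_cell x) s (4 * length (bucket c) + 3) (\<lambda>s'. lst s' (L @ bucket c))"
proof -
  let ?B = "bucket c"
  have cnt: "iarr s ''cnt'' (key c) = int (length ?B)" and cellv: "\<And>i. i < length ?B \<Longrightarrow> iarr s ''cell'' (key c * int n + int i) = int (?B ! i)"
    using b(1) c(1) unfolding buckets_ok_def by blast+
  have Bn: "length ?B \<le> n" unfolding bucket_def by (rule length_filter_upt_le)
  have w: "word W (key c)" "word W (int n)" "word W (int (length ?B))" "word W 1"
    using key_bound[OF c(1)] Bd Bn by (auto intro!: word_lin)
  have "runs (push_cell x) s (1 + (length ?B * (1 + 1 + 2) + 2)) (\<lambda>s'. lst s' (L @ ?B))"
    unfolding push_cell_def
  proof (rule runs_SeqI)
    show "runs (Assign ''cc'' (Idx ''cnt'' (Var x))) s 1 (\<lambda>s1. ivar s1 ''cc'' = int (length ?B) \<and> lst s1 L)"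
      by (rule runs_Assign) (use c cnt w L in \<open>auto simp: lst_def\<close>)
    fix s1 assume sm: "same (Assign ''cc'' (Idx ''cnt'' (Var x))) s s1" and s1: "ivar s1 ''cc'' = int (length ?B) \<and> lst s1 L"
    note fr = sameD[OF sm, simplified]
    show "runs (For ''j'' ''cc'' (push x)) s1 (length ?B * (1 + 1 + 2) + 2) (\<lambda>s'. lst s' (L @ ?B))"
    proof (rule runs_For_const[where N = "length ?B" and I = "\<lambda>i s2. lst s2 (L @ take i ?B)"])
      show "length ?B \<le> W" using Bn kW by linarith
      fix i s2 assume i: "i < length ?B" "ivar s2 ''j'' = int i" and sm2: "same (For ''j'' ''cc'' (push x)) s1 s2" and I: "lst s2 (L @ take i ?B)"
      note fr2 = sameD[OF sm2, simplified]
      have x2: "ivar s2 x = key c" "ivar s2 ''n'' = int n" "iarr s2 ''cell'' = iarr s ''cell''"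
        using fr fr2 c b by auto
      have w2: "ivar s2 ''w'' = int (length L + i)" using I i by (simp add: lst_def)
      have Bi: "?B ! i < n" using nth_mem[OF i(1)] unfolding bucket_def by auto
      have ww: "word W (int (length L + i))" "word W (int (length L + i) + 1)" "word W (int i)" "word W (int (?B ! i))"
        by (rule word_lin; use i(1) L(2) Bn Bi Bd in linarith)+
      have wi: "word W (key c * int n)" "word W (key c * int n + int i)"
        using key_bound[OF c(1)] Bd Bn i(1) by (auto intro!: word_mult word_mult_add)
      have "runs (push x) s2 (1 + 1) (\<lambda>s3. lst s3 (L @ take (Suc i) ?B))"
        unfolding push_def
      proof (rule runs_SeqI)
        show "runs (Store ''wl'' (Var ''w'') (Idx ''cell'' (Add (Mul (Var x) (Var ''n'')) (Var ''j'')))) s2 1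
            (\<lambda>s3. ivar s3 = ivar s2 \<and> iarr s3 ''wl'' = (iarr s2 ''wl'')(int (length L + i) := int (?B ! i)))"
          by (rule runs_Store) (use x2 w2 ww wi w i cellv[OF i(1)] in auto)
        fix s3 :: state assume s3: "ivar s3 = ivar s2 \<and> iarr s3 ''wl'' = (iarr s2 ''wl'')(int (length L + i) := int (?B ! i))"
        show "runs (Assign ''w'' (Add (Var ''w'') (Lit 1))) s3 1 (\<lambda>s3. lst s3 (L @ take (Suc i) ?B))"
          by (rule runs_Assign)
            (use s3 w2 ww w I i in \<open>auto simp: lst_def take_Suc_conv_app_nth nth_append less_Suc_eq\<close>)
      qed
      then show "runs (push x) s2 (1 + 1) (\<lambda>s3. same (push x) s2 s3 \<longrightarrow> lst (s3\<lparr>ivar := (ivar s3)(''j'' := int i + 1)\<rparr>) (L @ take (Suc i) ?B))"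
        by (rule runs_mono[OF _ order_refl]) (simp add: lst_upd)
    qed (use s1 in \<open>auto simp: lst_upd\<close>)
  qed
  then show ?thesis by (rule runs_time) simp
qed

text \<open>Index 4 gives \<open>Z\<close> itself, so all nine cells of a block occur. When
  \<open>Z\<close> is gathered it is not yet marked as done, hence only its neighbours are collected
  by the loop.\<close>

definition dir :: "int \<times> int \<Rightarrow> nat \<Rightarrow> int \<times> int" where
  "dir Z i = (fst Z + (int (i div 3) - 1), snd Z + (int (i mod 3) - 1))"

lemma dir_inj: "i < 9 \<Longrightarrow> j < 9 \<Longrightarrow> dir Z i = dir Z j \<Longrightarrow> i = j"
  unfolding dir_def by (metis Pair_inject add_left_cancel diff_add_cancel div_mult_mod_eq of_nat_eq_iff)

lemma dir_nbr: "i < 9 \<Longrightarrow> nbr (dir Z i) Z"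
proof -
  assume "i < 9"
  then have "i div 3 < 3" "i mod 3 < 3" by auto
  then show ?thesis unfolding nbr_def dir_def by auto
qed

lemma nbr_dir: assumes "nbr c Z" shows "\<exists>i<9. c = dir Z i"
proof -
  define a b where "a = nat (fst c - fst Z + 1)" and "b = nat (snd c - snd Z + 1)"
  have ab: "a < 3" "b < 3" "int a = fst c - fst Z + 1" "int b = snd c - snd Z + 1"
    using assms unfolding nbr_def a_def b_def by auto
  have "(3 * a + b) div 3 = a" "(3 * a + b) mod 3 = b" using ab(2) by auto
  then have "c = dir Z (3 * a + b)" unfolding dir_def using ab by (simp add: prod_eq_iff)
  moreover have "3 * a + b < 9" using ab by simp
  ultimately show ?thesis by blast
qed

definition part :: "(int \<times> int) set \<Rightarrow> int \<times> int \<Rightarrow> nat \<Rightarrow> nat list" where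
  "part D Z i = (if dir Z i \<in> D then bucket (dir Z i) else [])"

definition parts :: "(int \<times> int) set \<Rightarrow> int \<times> int \<Rightarrow> nat \<Rightarrow> nat list" where
  "parts D Z i = concat (map (part D Z) [0..<i])"

lemma parts_Suc: "parts D Z (Suc i) = parts D Z i @ part D Z i" and parts_0: "parts D Z 0 = []"
  by (simp_all add: parts_def)

lemma set_bucket: "set (bucket c) = {u. u < n \<and> cell u = c}"
  by (auto simp: bucket_def)

lemma distinct_bucket: "distinct (bucket c)"
  by (simp add: bucket_def)

lemma parts_props: "i \<le> 9 \<Longrightarrow> distinct (parts D Z i) \<and>
    set (parts D Z i) = {u. u < n \<and> cell u \<in> D \<and> (\<exists>j<i. cell u = dir Z j)} \<and> length (parts D Z i) \<le> i * n"
proof (induction i)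
  case (Suc i)
  have s: "set (part D Z i) = {u. u < n \<and> cell u \<in> D \<and> cell u = dir Z i}" by (auto simp: part_def set_bucket)
  have d: "distinct (part D Z i)" by (simp add: part_def distinct_bucket)
  have l: "length (part D Z i) \<le> n" unfolding part_def bucket_def using length_filter_upt_le by auto
  have IH: "distinct (parts D Z i)" "set (parts D Z i) = {u. u < n \<and> cell u \<in> D \<and> (\<exists>j<i. cell u = dir Z j)}" "length (parts D Z i) \<le> i * n"
    using Suc by auto
  have "set (parts D Z i) \<inter> set (part D Z i) = {}"
  proof (rule equals0I)
    fix u assume "u \<in> set (parts D Z i) \<inter> set (part D Z i)"
    then obtain j where "j < i" "dir Z j = dir Z i" unfolding s IH(2) by auto
    then show False using dir_inj[of j i Z] Suc.prems by simp
  qed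
  then show ?case unfolding parts_Suc using s d l IH by (auto simp: less_Suc_eq)
qed (simp add: parts_0)

definition done_ok :: "state \<Rightarrow> (int \<times> int) set \<Rightarrow> bool" where
  "done_ok s D \<longleftrightarrow> (\<forall>c. inb c \<longrightarrow> iarr s ''done'' (key c) = (if c \<in> D then 1 else 0))"

lemma runs_push_nbr:
  assumes s: "buckets_ok s" "ivar s ''n'' = int n" "done_ok s D" and Z: "ivar s ''key'' = key Z" "\<bar>fst Z\<bar> \<le> int Sb" "\<bar>snd Z\<bar> \<le> int Sb"
    and i: "ivar s ''i'' = int i" "i < 9" and L: "lst s L" "length L \<le> 8 * n"
  shows "runs push_nbr s (4 * length (part D Z i) + 5) (\<lambda>s'. lst s' (L @ part D Z i))"
proof -
  let ?c = "dir Z i" and ?K = "2 * int Sb + 5"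
  have c: "inb ?c" using Z(2,3) dir_nbr[OF i(2), of Z] unfolding inb_def nbr_def by auto
  define a b where "a = int (i div 3) - 1" and "b = int (i mod 3) - 1"
  have kc: "key Z + (a * ?K + b) = key ?c" by (simp add: key_def dir_def algebra_simps a_def b_def)
  have ab: "\<bar>a\<bar> \<le> 1" "\<bar>b\<bar> \<le> 1" using i(2) dir_nbr[OF i(2), of Z] by (auto simp: nbr_def dir_def a_def b_def)
  have mod3: "int i - 3 * (int i div 3) = b + 1" by (simp add: minus_mult_div_eq_mod zmod_int b_def)
  have div3: "int i div 3 = a + 1" by (simp add: zdiv_int a_def)
  have aK: "\<bar>a * ?K\<bar> \<le> ?K" using ab(1) by (simp add: abs_mult mult_le_cancel_right1)
  have kb: "\<bar>key ?c\<bar> \<le> int Bd" "\<bar>key Z\<bar> \<le> int Bd" using key_bound[OF c] Z(2,3) by (auto intro!: key_bound simp: inb_def)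
  have SB: "?K \<le> int Bd" using Bd(4) by simp
  have b9: "9 \<le> int Bd" "int i < 9" using Bd(1) i(2) by simp_all
  have w: "word W ?K" "word W (key Z)" "word W (key ?c)" "word W a" "word W b" "word W (a * ?K)" "word W (a * ?K + b)"
    "word W 0" "word W 1" "word W 3" "word W (int i)" "word W (a + 1)" "word W (b + 1)"
    by (rule word_lin; use kb SB aK ab b9 in linarith)+
  have w3: "word W (3 * (a + 1))"
  proof (rule word_lin)
    have "-1 \<le> a" "a \<le> 1" using ab(1) by auto
    then show "\<bar>3 * (a + 1)\<bar> \<le> 9 * int Bd" using b9(1) by simp
  qed
  have K: "ivar s ''K'' = ?K" using s(1) by (simp add: buckets_ok_def)
  let ?e = "Add (Var ''key'') (Add (Mul (Sub (Div (Var ''i'') (Lit 3)) (Lit 1)) (Var ''K''))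
        (Sub (Sub (Var ''i'') (Mul (Lit 3) (Div (Var ''i'') (Lit 3)))) (Lit 1)))"
  have b3: "int i - (3 * a + 3) = b + 1" using mod3 unfolding div3 by simp
  have w4: "word W (int i - (3 * a + 3))" unfolding b3 by (fact w)
  have e: "ival s ?e = key ?c" "iok W s ?e" using Z(1) i K w w3 w4 kc mod3 unfolding div3 ival.simps iok.simps by (simp_all add: div3)
  have "runs push_nbr s (1 + ((4 * length (part D Z i) + 3) + 1)) (\<lambda>s'. lst s' (L @ part D Z i))"
    unfolding push_nbr_def
  proof (rule runs_SeqI)
    show "runs (Assign ''kk'' ?e) s 1 (\<lambda>s1. ivar s1 ''kk'' = key ?c \<and> lst s1 L)"
      by (rule runs_Assign) (use e L in \<open>simp_all add: lst_upd\<close>)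
    fix s1 assume sm: "same (Assign ''kk'' ?e) s s1" and s1: "ivar s1 ''kk'' = key ?c \<and> lst s1 L"
    note fr = sameD[OF sm, simplified]
    have b1: "buckets_ok s1" "ivar s1 ''n'' = int n" using s(1,2) fr by (auto simp: buckets_ok_def)
    have dn: "iarr s1 ''done'' (key ?c) = (if ?c \<in> D then 1 else 0)"
      using s(3) c fr(2) unfolding done_ok_def by metis
    show "runs (If (Less (Lit 0) (Idx ''done'' (Var ''kk''))) (push_cell ''kk'') Skip) s1 ((4 * length (part D Z i) + 3) + 1) (\<lambda>s'. lst s' (L @ part D Z i))"
    proof (rule runs_If)
      show "bok W s1 (Less (Lit 0) (Idx ''done'' (Var ''kk'')))" using s1 dn w by simp
      assume "bval s1 (Less (Lit 0) (Idx ''done'' (Var ''kk'')))"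
      then have "?c \<in> D" using s1 dn by (simp split: if_splits)
      then have p: "part D Z i = bucket ?c" by (simp add: part_def)
      show "runs (push_cell ''kk'') s1 (4 * length (part D Z i) + 3) (\<lambda>s'. lst s' (L @ part D Z i))"
        unfolding p by (rule runs_push_cell) (use b1 c s1 L(2) in auto)
    next
      assume "\<not> bval s1 (Less (Lit 0) (Idx ''done'' (Var ''kk'')))"
      then have "?c \<notin> D" using s1 dn by (simp split: if_splits)
      then have p: "part D Z i = []" by (simp add: part_def)
      show "runs Skip s1 (4 * length (part D Z i) + 3) (\<lambda>s'. lst s' (L @ part D Z i))"
        by (rule runs_time[OF runs_Skip]) (use s1 p in simp_all)
    qed
  qed
  then show ?thesis by (rule runs_time) simp
qed

text \<open>The time is linear in the number of gathered vertices up to a constant for the nine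
  lookups. The loop is therefore analysed with a cost that depends on the round: charging
  \<open>n\<close> to every cell would make the sweep quadratic.\<close>

lemma runs_gather:
  assumes b: "base s" "buckets_ok s" "done_ok s D" "ivar s ''nine'' = 9" and Z: "ivar s ''key'' = key Z" "\<bar>fst Z\<bar> \<le> int Sb" "\<bar>snd Z\<bar> \<le> int Sb"
    and D: "Z \<notin> D"
  defines "L1 \<equiv> parts D Z 9"
  shows "runs gather s (4 * length (L1 @ bucket Z) + 80) (\<lambda>s'. ivar s' ''w1'' = int (length L1) \<and>
     ivar s' ''w2'' = int (length (L1 @ bucket Z)) \<and> (\<forall>i<length (L1 @ bucket Z). iarr s' ''wl'' (int i) = int ((L1 @ bucket Z) ! i)) \<and>
     done_ok s' (insert Z D))" (is "runs _ _ _ ?Q")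
proof -
  have iZ: "inb Z" using Z by (simp add: inb_def)
  have n: "ivar s ''n'' = int n" using b(1) by (simp add: base_def)
  have dL: "distinct L1" "set L1 \<subseteq> {..<n}" using parts_props[of 9 D Z] by (auto simp: L1_def)
  then have L1n: "length L1 \<le> n" by (metis card_lessThan card_mono distinct_card finite_lessThan)
  have Bn: "length (bucket Z) \<le> n" unfolding bucket_def by (rule length_filter_upt_le)
  define st where "st s' \<longleftrightarrow> buckets_ok s' \<and> ivar s' ''n'' = int n \<and> done_ok s' D \<and> ivar s' ''key'' = key Z" for s' :: state
  have st0: "st s" using b n Z by (simp add: st_def)
  have st_same: "st s2" if "st s1" "same c s1 s2" "modi c \<subseteq> {''w'', ''cc'', ''j'', ''kk'', ''i'', ''w1'', ''w2''}" "moda c \<subseteq> {''wl''}" for s1 s2 c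
  proof -
    have "ivar s2 x = ivar s1 x" if "x \<in> {''n'', ''key'', ''K''}" for x by (rule sameD(1)[OF \<open>same c s1 s2\<close>]) (use that \<open>modi c \<subseteq> _\<close> in auto)
    moreover have "iarr s2 x = iarr s1 x" if "x \<in> {''kv'', ''cnt'', ''cell'', ''done''}" for x
      by (rule sameD(2)[OF \<open>same c s1 s2\<close>]) (use that \<open>moda c \<subseteq> _\<close> in auto)
    ultimately show ?thesis using that(1) unfolding st_def buckets_ok_def done_ok_def by simp
  qed
  have w: "word W (int (length L1))" "word W (int (length (L1 @ bucket Z)))" "word W 0" "word W 1" "word W (key Z)"
    using L1n Bn Bd key_bound[OF iZ] by (auto intro!: word_lin)
  have p6: "runs (Store ''done'' (Var ''key'') (Lit 1)) s' 1 ?Q"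
    if "st s'" "ivar s' ''w1'' = int (length L1)" "ivar s' ''w2'' = int (length (L1 @ bucket Z))"
      "\<forall>i<length (L1 @ bucket Z). iarr s' ''wl'' (int i) = int ((L1 @ bucket Z) ! i)" for s'
  proof (rule runs_Store)
    have "done_ok (s'\<lparr>iarr := (iarr s')(''done'' := (iarr s' ''done'')(key Z := 1))\<rparr>) (insert Z D)"
      using that(1) key_inj[OF _ iZ] unfolding st_def done_ok_def by auto
    then show "?Q (s'\<lparr>iarr := (iarr s')(''done'' := (iarr s' ''done'')(ival s' (Var ''key'') := ival s' (Lit 1)))\<rparr>)"
      using that by (simp add: st_def)
  qed (use that w in \<open>auto simp: st_def\<close>)
  let ?r5 = "Seq (Assign ''w2'' (Var ''w'')) (Store ''done'' (Var ''key'') (Lit 1))"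
  have p5: "runs ?r5 s' (1 + 1) ?Q" if st: "st s'" and w1: "ivar s' ''w1'' = int (length L1)" and l: "lst s' (L1 @ bucket Z)" for s'
  proof (rule runs_SeqI)
    show "runs (Assign ''w2'' (Var ''w'')) s' 1 (\<lambda>s1. ivar s1 ''w2'' = int (length (L1 @ bucket Z)))"
      by (rule runs_Assign) (use l w in \<open>auto simp: lst_def\<close>)
    fix s1 assume sm: "same (Assign ''w2'' (Var ''w'')) s' s1" and w2: "ivar s1 ''w2'' = int (length (L1 @ bucket Z))"
    have "st s1" by (rule st_same[OF st sm]) auto
    moreover have "\<forall>i<length (L1 @ bucket Z). iarr s1 ''wl'' (int i) = int ((L1 @ bucket Z) ! i)"
      using l sameD(2)[OF sm, of "''wl''"] unfolding lst_def by simp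
    ultimately show "runs (Store ''done'' (Var ''key'') (Lit 1)) s1 1 ?Q"
      using w1 w2 sameD(1)[OF sm] by (intro p6) auto
  qed
  let ?r4 = "Seq (push_cell ''key'') ?r5"
  have p4: "runs ?r4 s' ((4 * length (bucket Z) + 3) + (1 + 1)) ?Q" if st: "st s'" and w1: "ivar s' ''w1'' = int (length L1)" and l: "lst s' L1" for s'
  proof (rule runs_SeqI)
    show "runs (push_cell ''key'') s' (4 * length (bucket Z) + 3) (\<lambda>s1. lst s1 (L1 @ bucket Z))"
      by (rule runs_push_cell) (use st iZ l L1n in \<open>auto simp: st_def\<close>)
    fix s1 assume sm: "same (push_cell ''key'') s' s1" and l1: "lst s1 (L1 @ bucket Z)"
    have "st s1" by (rule st_same[OF st sm]) auto
    then show "runs ?r5 s1 (1 + 1) ?Q" using w1 l1 sameD(1)[OF sm] by (intro p5) auto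
  qed
  let ?r3 = "Seq (Assign ''w1'' (Var ''w'')) ?r4"
  have p3: "runs ?r3 s' (1 + ((4 * length (bucket Z) + 3) + (1 + 1))) ?Q" if st: "st s'" and l: "lst s' L1" for s'
  proof (rule runs_SeqI)
    show "runs (Assign ''w1'' (Var ''w'')) s' 1 (\<lambda>s1. ivar s1 ''w1'' = int (length L1) \<and> lst s1 L1)"
      by (rule runs_Assign) (use l w in \<open>auto simp: lst_def\<close>)
    fix s1 assume sm: "same (Assign ''w1'' (Var ''w'')) s' s1" and l1: "ivar s1 ''w1'' = int (length L1) \<and> lst s1 L1"
    have "st s1" by (rule st_same[OF st sm]) auto
    then show "runs ?r4 s1 ((4 * length (bucket Z) + 3) + (1 + 1)) ?Q" using l1 by (intro p4) auto
  qed
  have sumlen: "(\<Sum>i<m. 4 * length (part D Z i) + 5) = 4 * length (parts D Z m) + 5 * m" for m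
    by (induction m) (simp_all add: parts_0 parts_Suc)
  have loop: "runs (For ''i'' ''nine'' push_nbr) s' ((\<Sum>i<9. 4 * length (part D Z i) + 5) + 2 * 9 + 2) (\<lambda>s1. lst s1 L1)"
    if st: "st s'" and l: "lst s' []" and ni: "ivar s' ''nine'' = 9" for s'
  proof (rule runs_For[where N = 9 and I = "\<lambda>i s1. lst s1 (parts D Z i)"])
    show "ivar s' ''nine'' = int 9" using ni by simp
    show "9 \<le> W" using Bd(1) BW by linarith
    fix i s2 assume i: "i < 9" "ivar s2 ''i'' = int i" and sm: "same (For ''i'' ''nine'' push_nbr) s' s2" and I: "lst s2 (parts D Z i)"
    have st2: "st s2" by (rule st_same[OF st sm]) auto
    have "length (parts D Z i) \<le> 8 * n"
    proof -
      have "length (parts D Z i) \<le> i * n" using parts_props[of i D Z] i(1) by simp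
      also have "\<dots> \<le> 8 * n" using i(1) by (intro mult_right_mono) auto
      finally show ?thesis .
    qed
    then have "runs push_nbr s2 (4 * length (part D Z i) + 5) (\<lambda>s3. lst s3 (parts D Z i @ part D Z i))"
      using st2 Z i I by (intro runs_push_nbr) (auto simp: st_def)
    then show "runs push_nbr s2 (4 * length (part D Z i) + 5) (\<lambda>s3. same push_nbr s2 s3 \<longrightarrow> lst (s3\<lparr>ivar := (ivar s3)(''i'' := int i + 1)\<rparr>) (parts D Z (Suc i)))"
      unfolding parts_Suc by (rule runs_mono[OF _ order_refl]) (simp add: lst_upd)
  qed (use l in \<open>auto simp: parts_0 lst_upd L1_def\<close>)
  have "runs gather s (1 + (((\<Sum>i<9. 4 * length (part D Z i) + 5) + 2 * 9 + 2) + (1 + ((4 * length (bucket Z) + 3) + (1 + 1))))) ?Q"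
    unfolding gather_def
  proof (rule runs_SeqI)
    show "runs (Assign ''w'' (Lit 0)) s 1 (\<lambda>s1. lst s1 [])" by (rule runs_Assign) (use w in \<open>auto simp: lst_def\<close>)
    fix s1 assume sm: "same (Assign ''w'' (Lit 0)) s s1" and l: "lst s1 []"
    have st1: "st s1" by (rule st_same[OF st0 sm]) auto
    have ni: "ivar s1 ''nine'' = 9" using sameD(1)[OF sm, of "''nine''"] b(4) by simp
    show "runs (Seq (For ''i'' ''nine'' push_nbr) ?r3) s1 (((\<Sum>i<9. 4 * length (part D Z i) + 5) + 2 * 9 + 2) + (1 + ((4 * length (bucket Z) + 3) + (1 + 1)))) ?Q"
    proof (rule runs_SeqI[OF loop[OF st1 l ni]])
      fix s2 assume sm2: "same (For ''i'' ''nine'' push_nbr) s1 s2" and l2: "lst s2 L1"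
      have "st s2" by (rule st_same[OF st1 sm2]) auto
      then show "runs ?r3 s2 (1 + ((4 * length (bucket Z) + 3) + (1 + 1))) ?Q" using l2 by (rule p3)
    qed
  qed
  then show ?thesis by (rule runs_time) (simp add: sumlen L1_def)
qed

text \<open>These facts feed the exchange: \<open>L1\<close> consists of all processed vertices in
  cells adjacent to \<open>Z\<close>, the new cell is disjoint from what was processed, and the
  block is small enough for a query.\<close>

lemma gather_props:
  assumes "Z \<notin> D" "D \<subseteq> cell ` {..<n}"
  defines "L1 \<equiv> parts D Z 9" and "U \<equiv> {u. u < n \<and> cell u \<in> D}"
  shows "distinct (L1 @ bucket Z)" "set (L1 @ bucket Z) \<subseteq> {..<n}" "set L1 = {u\<in>U. nbr (cell u) Z}"
    "set L1 \<subseteq> U" "set (bucket Z) \<inter> U = {}" "length (L1 @ bucket Z) \<le> card {u \<in> {..<n}. nbr (cell u) Z}"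
    "length (L1 @ bucket Z) \<le> 36 * k\<^sup>2 * p"
proof -
  have p: "distinct L1" "set L1 = {u. u < n \<and> cell u \<in> D \<and> (\<exists>j<9. cell u = dir Z j)}"
    using parts_props[of 9 D Z] by (auto simp: L1_def)
  show s1: "set L1 = {u\<in>U. nbr (cell u) Z}"   proof -
    have "(\<exists>j<9. c = dir Z j) \<longleftrightarrow> nbr c Z" for c using dir_nbr nbr_dir by metis
    then show ?thesis unfolding p(2) U_def by blast
  qed
  then show "set L1 \<subseteq> U" by blast
  show dU: "set (bucket Z) \<inter> U = {}" using assms(1) by (auto simp: set_bucket U_def)
  show dist: "distinct (L1 @ bucket Z)" using p(1) distinct_bucket dU s1 by auto
  show sub: "set (L1 @ bucket Z) \<subseteq> {..<n}" using s1 by (auto simp: set_bucket U_def)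
  have "set (L1 @ bucket Z) \<subseteq> {u \<in> {..<n}. nbr (cell u) Z}" using s1 sub by (auto simp: set_bucket nbr_def)
  then have "card (set (L1 @ bucket Z)) \<le> card {u \<in> {..<n}. nbr (cell u) Z}" by (intro card_mono) auto
  then show l: "length (L1 @ bucket Z) \<le> card {u \<in> {..<n}. nbr (cell u) Z}" unfolding distinct_card[OF dist] .
  then show "length (L1 @ bucket Z) \<le> 36 * k\<^sup>2 * p" using card_block[of Z] by (rule order_trans)
qed

text \<open>Each vertex lies in the neighbourhood of at most nine nonempty cells.\<close>

lemma sum_blocks:
  assumes New: "New \<subseteq> {..<n}" "inj_on cell New"
  shows "(\<Sum>v\<in>New. card {u \<in> {..<n}. nbr (cell u) (cell v)}) \<le> 9 * n"
proof -
  have fin: "finite New" using New(1) finite_subset by blast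
  have "(\<Sum>v\<in>New. card {u \<in> {..<n}. nbr (cell u) (cell v)}) = (\<Sum>v\<in>New. \<Sum>u<n. if nbr (cell u) (cell v) then 1 else 0)"
    by (intro sum.cong refl) (simp add: sum.If_cases Int_def)
  also have "\<dots> = (\<Sum>u<n. \<Sum>v\<in>New. if nbr (cell u) (cell v) then 1 else 0)" by (rule sum.swap)
  also have "\<dots> = (\<Sum>u<n. card {v\<in>New. nbr (cell u) (cell v)})"
    using fin by (intro sum.cong refl) (simp add: sum.If_cases Int_def)
  also have "\<dots> \<le> (\<Sum>u<n. 9)"
  proof (rule sum_mono)
    fix u
    have "card {v\<in>New. nbr (cell u) (cell v)} \<le> card (dir (cell u) ` {..<9})"
    proof (rule card_inj_on_le)
      show "inj_on cell {v\<in>New. nbr (cell u) (cell v)}" using New(2) by (rule inj_on_subset) auto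
      show "cell ` {v\<in>New. nbr (cell u) (cell v)} \<subseteq> dir (cell u) ` {..<9}"
      proof
        fix c assume "c \<in> cell ` {v\<in>New. nbr (cell u) (cell v)}"
        then have "nbr c (cell u)" by (auto simp: nbr_def abs_minus_commute)
        then show "c \<in> dir (cell u) ` {..<9}" using nbr_dir by blast
      qed
    qed simp
    also have "\<dots> \<le> 9" using card_image_le[of "{..<9}" "dir (cell u)"] by simp
    finally show "card {v\<in>New. nbr (cell u) (cell v)} \<le> 9" .
  qed
  finally show ?thesis by simp
qed

end

text \<open>The sweep runs over vertices and not over cells: the first vertex of a cell triggers its
  processing, and later ones find it marked in \<open>done\<close>. Empty cells are never
  processed.\<close>

definition visit :: com where
  "visit = Seq (Assign ''key'' (Idx ''kv'' (Var ''v'')))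
     (If (Less (Idx ''done'' (Var ''key'')) (Lit 1)) (Seq gather update_prog) Skip)"

text \<open>The empty host is \<open>P[{}]\<close>, row 0 of the table, so the sweep starts with the
  first unit vector.\<close>

definition initialise :: com where
  "initialise = Seq (Store ''x'' (Lit 0) (Lit 1)) (Seq (Assign ''K0'' (Add (Add (Mul (Var ''k'') (Var ''k'')) (Var ''k'')) (Lit 1)))
     (Seq (Assign ''k1'' (Add (Var ''k'') (Lit 1))) (Assign ''nine'' (Lit 9))))"

text \<open>Row \<open>r\<close> is filled with all of \<open>V\<close>, so that the third part of
  the host becomes empty and the query counts the maps into the set of row \<open>a\<close> alone.
  The combination of these counts is the value at \<open>V\<close> of the function for
  \<open>G\<close>.\<close>

definition result :: com where
  "result = Seq (For ''u'' ''k'' (Store ''m'' (Add (Mul (Var ''r'') (Var ''k'')) (Var ''u'')) (Lit 1)))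
     (Seq (Assign ''c'' (Var ''r'')) (Seq (Assign ''w'' (Lit 0)) (Seq (Assign ''result'' (Lit 0))
       (For ''a'' ''r'' (Seq ask (Assign ''result'' (Add (Var ''result'') (Mul (Idx ''x'' (Var ''a'')) (Var ''q'')))))))))"

definition count_prog :: com where
  "count_prog = Seq bound (Seq labels (Seq enum (Seq get_alpha (Seq buckets (Seq initialise (Seq (For ''v'' ''n'' visit) result))))))"

lemma mods_I [simp]:
  "modi visit = {''key'', ''w'', ''cc'', ''j'', ''kk'', ''i'', ''w1'', ''w2'', ''c'', ''a'', ''h'', ''u'', ''q''}"
  "moda visit = {''wl'', ''done'', ''y'', ''b'', ''d'', ''e'', ''x''}" "modr visit = {''H''}"
  "modi initialise = {''K0'', ''k1'', ''nine''}" "moda initialise = {''x''}" "modr initialise = {}"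
  "modi bound = {''S'', ''u''}" "moda bound = {}" "modr bound = {}"
  "modi labels = {''u'', ''v'', ''l'', ''l2'', ''t''}" "moda labels = {''lab''}" "modr labels = {}"
  "modi enum = {''r'', ''w'', ''v'', ''r0'', ''i'', ''u'', ''new'', ''t'', ''a'', ''c'', ''h'', ''q''}" "moda enum = {''m''}" "modr enum = {''H''}"
  by (auto simp: visit_def initialise_def bound_def labels_def enum_def)

context disk_reps
begin

text \<open>With the empty set for both rows and no vertices of \<open>G\<close> the queried host is
  a translate of \<open>P\<close>, so the answer is the number of automorphisms.\<close>

lemma runs_get_alpha:
  assumes s: "base s" "m_ok s" "table s Rs" "ivar s ''w'' = 0"
  shows "runs get_alpha s (12 * k + 11) mst"
proof -
  have r0: "0 < r" "Rs ! 0 = {}" using irredundantD(6,7)[OF irr] by auto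
  have w: "word W 0" by (rule word_lin) simp
  have val: "pairing {} [] {} = alpha" using conv_g_self[of "{}"] by (simp add: pairing_Nil)
  define st where "st s' \<longleftrightarrow> base s' \<and> m_ok s' \<and> table s' Rs \<and> ivar s' ''w'' = 0" for s' :: state
  have st_same: "st s2" if "st s1" "same c s1 s2" "modi c \<subseteq> {''a'', ''c'', ''h'', ''u'', ''q''}" "moda c = {}" "modr c \<subseteq> {''H''}" for s1 s2 c
  proof -
    have "base s2" by (rule base_same[OF _ that(2)]) (use that in \<open>auto simp: st_def\<close>)
    moreover have "iarr s2 ''m'' = iarr s1 ''m''" by (rule sameD(2)[OF that(2)]) (use that in auto)
    moreover have "ivar s2 ''r'' = ivar s1 ''r''" "ivar s2 ''w'' = ivar s1 ''w''" by (rule sameD(1)[OF that(2)]; use that in auto)+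
    ultimately show ?thesis using that(1) unfolding st_def m_ok_def table_def row_def by simp
  qed
  have "runs get_alpha s (1 + (1 + ((12 * (k + length ([]::nat list)) + 8) + 1))) mst"
    unfolding get_alpha_def
  proof (rule runs_SeqI)
    show "runs (Assign ''a'' (Lit 0)) s 1 (\<lambda>s1. ivar s1 ''a'' = 0)" by (rule runs_Assign) (use w in auto)
    fix s1 assume sm1: "same (Assign ''a'' (Lit 0)) s s1" and a: "ivar s1 ''a'' = 0"
    have st1: "st s1" by (rule st_same[OF _ sm1]) (use s in \<open>auto simp: st_def\<close>)
    show "runs (Seq (Assign ''c'' (Lit 0)) (Seq ask (Assign ''al'' (Var ''q'')))) s1 (1 + ((12 * (k + length ([]::nat list)) + 8) + 1)) mst"
    proof (rule runs_SeqI)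
      show "runs (Assign ''c'' (Lit 0)) s1 1 (\<lambda>s2. ivar s2 ''c'' = 0)" by (rule runs_Assign) (use w in auto)
      fix s2 assume sm2: "same (Assign ''c'' (Lit 0)) s1 s2" and c: "ivar s2 ''c'' = 0"
      have st2: "st s2" by (rule st_same[OF st1 sm2]) auto
      have a2: "ivar s2 ''a'' = 0" using sameD(1)[OF sm2, of "''a''"] a by simp
      have row0: "row s2 0 = {}" using st2 r0 by (auto simp: st_def table_def)
      show "runs (Seq ask (Assign ''al'' (Var ''q''))) s2 ((12 * (k + length ([]::nat list)) + 8) + 1) mst"
      proof (rule runs_SeqI)
        show "runs ask s2 (12 * (k + length ([]::nat list)) + 8) (\<lambda>s3. ivar s3 ''q'' = pairing (row s2 0) [] (row s2 0) \<and>
            0 \<le> ivar s3 ''q'' \<and> ivar s3 ''q'' \<le> int Qb)"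
          by (rule runs_pairing) (use st2 a2 c in \<open>auto simp: st_def wl_is_def\<close>)
        fix s3 assume sm3: "same ask s2 s3" and q: "ivar s3 ''q'' = pairing (row s2 0) [] (row s2 0) \<and> 0 \<le> ivar s3 ''q'' \<and> ivar s3 ''q'' \<le> int Qb"
        have st3: "st s3" by (rule st_same[OF st2 sm3]) auto
        have q3: "ivar s3 ''q'' = alpha" using q row0 val by simp
        have "word W (ivar s3 ''q'')" using q QW by (simp add: word_def)
        moreover have "mst (s3\<lparr>ivar := (ivar s3)(''al'' := alpha)\<rparr>)"
          using st3 unfolding st_def mst_def base_def m_ok_def table_def row_def by simp
        ultimately show "runs (Assign ''al'' (Var ''q'')) s3 1 mst" using q3 by (intro runs_Assign) simp_all
      qed
    qed
  qed
  then show ?thesis by (rule runs_time) simp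
qed

text \<open>The pairings of \<open>x\<close> count maps of \<open>P\<close> into an actual host with
  at most \<open>2 * k + n\<close> vertices, up to division by \<open>alpha\<close>, so
  \<open>x_bound\<close> applies afresh to every processed region. Otherwise the growth during an
  update would accumulate over the cells.\<close>

lemma coefficient_bound:
  assumes x: "xi x = S U (close ys)" and U: "finite U" "card U \<le> n" and c: "c < r"
  shows "\<bar>x c\<bar> \<le> X0"
proof -
  have mv: "\<bar>mv (S {} adj) x c\<bar> \<le> int Qb" for c
  proof -
    have fin: "finite (V - Rs ! c)" by simp
    obtain R where R: "\<And>A. conv (S U (close ys)) (S (V - Rs ! c) adj) A = S (U <+> (V - Rs ! c)) R A" "finite (U <+> (V - Rs ! c))"
      by (rule conv_S_is_S[OF U(1) fin, of "close ys" adj]) blast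
    have "card (V - Rs ! c) \<le> k" using card_mono[of V "V - Rs ! c"] by auto
    then have card: "card (U <+> (V - Rs ! c)) \<le> 2 * k + n" using U by (simp add: card_Plus)
    have "alpha * mv (S {} adj) x c = conv (conv (xi x) (S {} adj)) (g (V - Rs ! c)) V" by (rule alpha_mv) simp
    also have "\<dots> = conv (xi x) (g (V - Rs ! c)) V"
      by (intro conv_cong conv_S_empty_host) (auto intro: finite_subset)
    also have "\<dots> = S (U <+> (V - Rs ! c)) R V" unfolding x g_def R(1) ..
    finally have e: "alpha * mv (S {} adj) x c = S (U <+> (V - Rs ! c)) R V" .
    have "S (U <+> (V - Rs ! c)) R V \<le> int (2 * k + n) ^ k"
      using R(2) card kpos by (intro S_le) auto
    then have le: "alpha * mv (S {} adj) x c \<le> int Qb" unfolding e Qb_def by simp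
    have "0 \<le> alpha * mv (S {} adj) x c" unfolding e by (rule S_nonneg)
    then have nn: "0 \<le> mv (S {} adj) x c" using alpha_pos by (simp add: zero_le_mult_iff)
    then have "1 * mv (S {} adj) x c \<le> alpha * mv (S {} adj) x c" using alpha_pos by (intro mult_right_mono) auto
    then show ?thesis using nn le by linarith
  qed
  have H: "\<bar>H a c\<bar> \<le> int Qb" if "a < r" "c < r" for a c
    using Q_bound[of "[]" a c] that unfolding empty_series by simp
  have "\<bar>x c\<bar> \<le> int Qb * (1 + int r * int Qb) ^ (k + k * k)" by (rule x_bound[OF mv H c])
  also have "\<dots> \<le> int Qb * (1 + 2 ^ k * int Qb) ^ (k + k * k)"
    using r_le by (intro mult_left_mono power_mono add_left_mono mult_right_mono) auto
  finally show ?thesis by (simp add: X0_def)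
qed

lemma X0_pos: "1 \<le> X0"
proof -
  have "1 \<le> (1 + 2 ^ k * int Qb) ^ (k + k * k)" by (rule one_le_power) simp
  then have "1 * 1 \<le> int Qb * (1 + 2 ^ k * int Qb) ^ (k + k * k)" using Qb_pos by (intro mult_mono) auto
  then show ?thesis by (simp add: X0_def)
qed

text \<open>\<open>D\<close> is the set of processed cells. The array \<open>x\<close> is specified
  through the function that it represents and not by the updates that produced it, which is what
  makes \<open>coefficient_bound\<close> applicable.\<close>

definition sw :: "(int \<times> int) set \<Rightarrow> state \<Rightarrow> bool" where
  "sw D s \<longleftrightarrow> mst s \<and> buckets_ok s \<and> done_ok s D \<and> ivar s ''nine'' = 9 \<and> ivar s ''K0'' = int (k * k + k + 1) \<and>
     ivar s ''k1'' = int (k + 1) \<and>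
     (\<exists>x. (\<forall>c<r. iarr s ''x'' (int c) = x c) \<and> xi x = S {u. u < n \<and> cell u \<in> D} (close ys))"

abbreviation cell_time :: "nat \<Rightarrow> nat" where
  "cell_time m \<equiv> (4 * m + 80) + (mv_time m + (k + 1) * (step_time m + 2) + 3)"

text \<open>A walk with fewer than \<open>k\<close> steps out of the new cell stays in adjacent
  cells (\<open>walk_nbr\<close>); this is the locality that the exchange asks for. The resulting
  equation of convolutions is the one that \<open>xi_update\<close> solves for the enlarged
  region.\<close>

lemma runs_cell_step:
  assumes s: "sw D s" "ivar s ''key'' = key Z" and Z: "Z = cell v" "v < n" "Z \<notin> D" and D: "D \<subseteq> cell ` {..<n}"
  shows "runs (Seq gather update_prog) s (cell_time (card {u \<in> {..<n}. nbr (cell u) Z})) (sw (insert Z D))"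
proof -
  let ?m = "card {u \<in> {..<n}. nbr (cell u) Z}"
  let ?L1 = "parts D Z 9"
  let ?L2 = "?L1 @ bucket Z"
  let ?U = "{u. u < n \<and> cell u \<in> D}"
  note gp = gather_props[OF Z(3) D]
  have Zb: "\<bar>fst Z\<bar> \<le> int Sb" "\<bar>snd Z\<bar> \<le> int Sb" using cell_bound[OF Z(2)] Z(1) by auto
  have base: "base s" using s(1) by (simp add: sw_def mst_def)
  obtain x where x: "\<forall>c<r. iarr s ''x'' (int c) = x c" "xi x = S ?U (close ys)" using s(1) unfolding sw_def by blast
  have finU: "finite ?U" and cU: "card ?U \<le> n" using card_mono[of "{..<n}" ?U] by auto
  have xb: "\<bar>x c\<bar> \<le> X0" if "c < r" for c by (rule coefficient_bound[OF x(2) finU cU that])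
  have new: "{u. u < n \<and> cell u \<in> insert Z D} = ?U \<union> set (bucket Z)" by (auto simp: set_bucket)
  have ex: "conv (S (?U \<union> set (bucket Z)) (close ys)) (S (set ?L1) (close ys)) A = conv (S ?U (close ys)) (S (set ?L2) (close ys)) A" for A
    unfolding set_append
  proof (rule S_exchange[OF finU finite_set])
    show "?U \<inter> set (bucket Z) = {}" "set ?L1 \<subseteq> ?U" using gp(4,5) by auto
    fix z v j assume z: "z \<in> set (bucket Z)" "v \<in> ?U \<union> set (bucket Z)" "j < k" "(z, v) \<in> {(a, b). close ys a b \<or> a = b} ^^ j"
    have "cell z = Z" using z(1) by (simp add: set_bucket)
    then have "nbr (cell v) Z" using walk_nbr[OF z(4,3)] by simp
    then show "v \<in> set ?L1 \<union> set (bucket Z)" using z(2) gp(3) by blast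
  qed
  let ?x' = "update (host_series ?L1) (mv (host_series ?L2) x) x (Suc k)"
  have xi': "xi ?x' = S {u. u < n \<and> cell u \<in> insert Z D} (close ys)"
    unfolding new
  proof (rule xi_update)
    show "inv (S (?U \<union> set (bucket Z)) (close ys))" using finU by (intro inv_S) auto
    show "conv (S (?U \<union> set (bucket Z)) (close ys)) (host_series ?L1) A = conv (xi x) (host_series ?L2) A" for A
      using ex[of A] unfolding x(2) .
  qed auto
  have "runs (Seq gather update_prog) s ((4 * length ?L2 + 80) + (mv_time (length ?L2) + (k + 1) * (step_time (length ?L2) + 2) + 3)) (sw (insert Z D))"
  proof (rule runs_SeqI)
    show "runs gather s (4 * length ?L2 + 80) (\<lambda>s'. ivar s' ''w1'' = int (length ?L1) \<and>
     ivar s' ''w2'' = int (length ?L2) \<and> (\<forall>i<length ?L2. iarr s' ''wl'' (int i) = int (?L2 ! i)) \<and> done_ok s' (insert Z D))"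
      by (rule runs_gather) (use s base Zb Z(3) in \<open>auto simp: sw_def\<close>)
    fix s1 assume sm: "same gather s s1" and g: "ivar s1 ''w1'' = int (length ?L1) \<and>
     ivar s1 ''w2'' = int (length ?L2) \<and> (\<forall>i<length ?L2. iarr s1 ''wl'' (int i) = int (?L2 ! i)) \<and> done_ok s1 (insert Z D)"
    note fr = sameD[OF sm, simplified]
    have m1: "mst s1" by (rule mst_same[OF _ sm]) (use s(1) in \<open>auto simp: sw_def\<close>)
    have "runs update_prog s1 (mv_time (length ?L2) + (k + 1) * (step_time (length ?L2) + 2) + 3)
       (\<lambda>s'. \<forall>c<r. iarr s' ''x'' (int c) = ?x' c)"
    proof (rule runs_update[where X = X0, OF m1])
      show "wl_is s1 ?L2" using g gp(2) unfolding wl_is_def by blast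
      show "iarr s1 ''x'' (int c) = x c" if "c < r" for c using x(1) fr(2) that by simp
    qed (use g gp fr s(1) K_Bd xb X0_pos XW in \<open>auto simp: sw_def\<close>)
    then show "runs update_prog s1 (mv_time (length ?L2) + (k + 1) * (step_time (length ?L2) + 2) + 3) (sw (insert Z D))"
    proof (rule runs_mono)
      fix s2 assume sm2: "same update_prog s1 s2" and x2: "\<forall>c<r. iarr s2 ''x'' (int c) = ?x' c"
      note fr2 = sameD[OF sm2, simplified]
      have "mst s2" by (rule mst_same[OF m1 sm2]) auto
      moreover have "buckets_ok s2" using s(1) fr fr2 unfolding sw_def buckets_ok_def by simp
      moreover have "done_ok s2 (insert Z D)" using g fr2(2)[of "''done''"] unfolding done_ok_def by simp
      moreover have "ivar s2 ''nine'' = 9" "ivar s2 ''K0'' = int (k * k + k + 1)" "ivar s2 ''k1'' = int (k + 1)"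
        using s(1) fr(1) fr2(1) unfolding sw_def by simp_all
      ultimately show "sw (insert Z D) s2" using x2 xi' unfolding sw_def by blast
    qed simp
  qed
  then show ?thesis
  proof (rule runs_time)
    have l: "length ?L2 \<le> ?m" by (rule gp(6))
    have mvl: "mv_time (length ?L2) \<le> mv_time ?m" using l by (intro add_mono mult_left_mono) auto
    then have "(k + 1) * (step_time (length ?L2) + 2) \<le> (k + 1) * (step_time ?m + 2)" by (intro mult_left_mono) linarith+
    then show "(4 * length ?L2 + 80) + (mv_time (length ?L2) + (k + 1) * (step_time (length ?L2) + 2) + 3) \<le> cell_time ?m"
      using l mvl by linarith
  qed
qed

definition Gk :: nat where
  "Gk = 87 + (12 * k + 18) + (k + 1) * ((12 * k + 18) + (k * k + k + 1) * (12 * k + 25) + 21)"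

text \<open>The form \<open>m + 1\<close> times a common factor makes the times summable over the
  cells. The factor \<open>r * r\<close> stems from the matrix products, which query every
  entry.\<close>

lemma cell_time_le: "cell_time m \<le> (m + 1) * (r * r * Gk)"
proof -
  let ?A = "12 * k + 18" and ?K = "k * k + k + 1" and ?q = "(m + 1) * (r * r)"
  have r1: "1 \<le> r" using irredundantD(6)[OF irr] by (cases Rs) auto
  have rr: "r \<le> r * r" "1 \<le> r * r" using r1 by auto
  have q: "r * r \<le> ?q" "1 \<le> ?q" "r \<le> ?q" "m \<le> ?q"
  proof -
    show q1: "r * r \<le> ?q" using mult_le_mono[of 1 "m + 1" "r * r" "r * r"] by simp
    show "1 \<le> ?q" "r \<le> ?q" using q1 rr by linarith+
    show "m \<le> ?q" using mult_le_mono[of m "m + 1" 1 "r * r"] rr(2) by simp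
  qed
  have mvt: "mv_time m' \<le> (m' + 1) * (r * r) * ?A" for m'
  proof -
    have "mv_time m' = r * r * (12 * (k + m') + 11) + 5 * r + 2" by (simp add: algebra_simps)
    also have "\<dots> \<le> r * r * (12 * (k + m') + 11) + 5 * (r * r) + 2 * (r * r)" using rr by linarith
    also have "\<dots> = r * r * (12 * (k + m') + 18)" by (simp add: algebra_simps)
    also have "\<dots> \<le> r * r * ((m' + 1) * ?A)" by (intro mult_left_mono) (simp_all add: algebra_simps)
    also have "\<dots> = (m' + 1) * (r * r) * ?A" by (simp only: mult_ac)
    finally show ?thesis .
  qed
  have m0: "mv_time 0 + 3 * r + 4 \<le> ?q * (12 * k + 25)"
  proof -
    have "mv_time 0 \<le> r * r * ?A" using mvt[of 0] by (simp only: add_0 mult_1)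
    then have "mv_time 0 + 3 * r + 4 \<le> r * r * ?A + 7 * (r * r)" using rr by linarith
    also have "\<dots> = r * r * (12 * k + 25)" by (simp add: algebra_simps)
    also have "\<dots> \<le> ?q * (12 * k + 25)" using q(1) by (rule mult_le_mono1)
    finally show ?thesis .
  qed
  have st: "step_time m + 2 \<le> ?q * (?A + ?K * (12 * k + 25) + 21)"
  proof -
    have "?K * (mv_time 0 + 3 * r + 4) \<le> ?K * (?q * (12 * k + 25))" using m0 by (rule mult_le_mono2)
    then have "step_time m + 2 \<le> ?q * ?A + ?K * (?q * (12 * k + 25)) + 21 * ?q" using mvt[of m] q by linarith
    also have "\<dots> = ?q * (?A + ?K * (12 * k + 25) + 21)" by (simp only: distrib_left ac_simps)
    finally show ?thesis .
  qed
  have "(k + 1) * (step_time m + 2) \<le> (k + 1) * (?q * (?A + ?K * (12 * k + 25) + 21))" using st by (rule mult_le_mono2)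
  then have "cell_time m \<le> 87 * ?q + ?q * ?A + (k + 1) * (?q * (?A + ?K * (12 * k + 25) + 21))" using mvt[of m] q by linarith
  also have "\<dots> = ?q * Gk" unfolding Gk_def by (simp only: distrib_left distrib_right mult_ac add_ac)
  finally show ?thesis by (simp only: mult.assoc)
qed

lemma runs_sweep:
  assumes s: "sw {} s"
  shows "runs (For ''v'' ''n'' visit) s (5 * n + 10 * n * (r * r * Gk) + 2) (sw (cell ` {..<n}))"
proof -
  let ?D = "\<lambda>v. cell ` {..<v}"
  let ?m = "\<lambda>v. card {u \<in> {..<n}. nbr (cell u) (cell v)}"
  let ?t = "\<lambda>v. if cell v \<in> ?D v then 0 else cell_time (?m v)"
  have upd: "sw D (s'\<lparr>ivar := (ivar s')(x := z)\<rparr>) = sw D s'" if "x \<in> {''v'', ''key''}" for D s' x z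
  proof -
    have "x = ''v'' \<or> x = ''key''" using that by simp
    then show ?thesis
      by (elim disjE) (simp_all add: sw_def mst_def base_def m_ok_def table_def row_def buckets_ok_def done_ok_def)
  qed
  have step: "runs visit s' (?t v + 3) (sw (?D (Suc v)))" if s': "sw (?D v) s'" "ivar s' ''v'' = int v" "v < n" for s' v
  proof -
    have kv: "iarr s' ''kv'' (int v) = key (cell v)" using s' by (simp add: sw_def buckets_ok_def)
    have Suc: "?D (Suc v) = insert (cell v) (?D v)" by (auto simp: lessThan_Suc)
    have w: "word W (int v)" "word W (key (cell v))" "word W 0" "word W 1"
      using s'(3) key_bound[OF cell_inb[OF s'(3)]] Bd by (auto intro!: word_lin)
    have "runs visit s' (1 + ((?t v + 1) + 1)) (sw (?D (Suc v)))"
      unfolding visit_def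
    proof (rule runs_SeqI)
      show "runs (Assign ''key'' (Idx ''kv'' (Var ''v''))) s' 1 (\<lambda>s1. sw (?D v) s1 \<and> ivar s1 ''key'' = key (cell v))"
        by (rule runs_Assign) (use s' kv w upd in simp_all)
      fix s1 assume s1: "sw (?D v) s1 \<and> ivar s1 ''key'' = key (cell v)"
      have dn: "iarr s1 ''done'' (key (cell v)) = (if cell v \<in> ?D v then 1 else 0)"
        using s1 cell_inb[OF s'(3)] unfolding sw_def done_ok_def by blast
      show "runs (If (Less (Idx ''done'' (Var ''key'')) (Lit 1)) (Seq gather update_prog) Skip) s1 ((?t v + 1) + 1) (sw (?D (Suc v)))"
      proof (rule runs_If)
        show "bok W s1 (Less (Idx ''done'' (Var ''key'')) (Lit 1))" using s1 dn w by simp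
        assume "bval s1 (Less (Idx ''done'' (Var ''key'')) (Lit 1))"
        then have nd: "cell v \<notin> ?D v" using s1 dn by (simp split: if_splits)
        have "runs (Seq gather update_prog) s1 (cell_time (?m v)) (sw (insert (cell v) (?D v)))"
          using s1 nd s'(3) by (intro runs_cell_step) auto
        then show "runs (Seq gather update_prog) s1 (?t v + 1) (sw (?D (Suc v)))"
          unfolding Suc by (rule runs_time) (use nd in simp)
      next
        assume "\<not> bval s1 (Less (Idx ''done'' (Var ''key'')) (Lit 1))"
        then have "cell v \<in> ?D v" using s1 dn by (simp split: if_splits)
        then have "?D (Suc v) = ?D v" unfolding Suc by blast
        then show "runs Skip s1 (?t v + 1) (sw (?D (Suc v)))" using s1 by (intro runs_time[OF runs_Skip]) auto
      qed
    qed
    then show ?thesis by (rule runs_time) simp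
  qed
  have loop: "runs (For ''v'' ''n'' visit) s ((\<Sum>v<n. ?t v + 3) + 2 * n + 2) (sw (?D n))"
  proof (rule runs_For[where N = n and I = "\<lambda>v. sw (?D v)"])
    show "ivar s ''n'' = int n" using s by (simp add: sw_def mst_def base_def)
    fix v s' assume v: "v < n" "ivar s' ''v'' = int v" and I: "sw (?D v) s'"
    show "runs visit s' (?t v + 3) (\<lambda>s''. same visit s' s'' \<longrightarrow> sw (?D (Suc v)) (s''\<lparr>ivar := (ivar s'')(''v'' := int v + 1)\<rparr>))"
      by (rule runs_mono[OF step[OF I v(2,1)] order_refl]) (use upd in simp)
  qed (use s upd kW in auto)
  \<comment> \<open>The first vertices of their cells carry the whole cost of the updates, and
    \<open>cell\<close> is injective on them. Their blocks have at most \<open>9 * n\<close>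
    vertices in total, and there are at most \<open>n\<close> of them, whence the factor 10.\<close>
  let ?New = "{v. v < n \<and> cell v \<notin> ?D v}"
  have inj: "inj_on cell ?New"
  proof (rule linorder_inj_onI')
    fix i j assume "i \<in> ?New" "j \<in> ?New" "i < j"
    then have "cell i \<in> cell ` {..<j}" "cell j \<notin> cell ` {..<j}" by auto
    then show "cell i \<noteq> cell j" by metis
  qed
  have "(\<Sum>v<n. ?t v) = (\<Sum>v\<in>?New. cell_time (?m v))"
    by (rule sum.mono_neutral_cong_right) auto
  also have "\<dots> \<le> (\<Sum>v\<in>?New. (?m v + 1) * (r * r * Gk))" by (rule sum_mono) (rule cell_time_le)
  also have "\<dots> = ((\<Sum>v\<in>?New. ?m v) + card ?New) * (r * r * Gk)" by (simp only: distrib_right sum_distrib_right sum.distrib) simp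
  also have "\<dots> \<le> (9 * n + n) * (r * r * Gk)"
  proof (rule mult_le_mono1, rule add_mono)
    show "(\<Sum>v\<in>?New. ?m v) \<le> 9 * n" by (rule sum_blocks[OF _ inj]) auto
    show "card ?New \<le> n" using card_mono[of "{..<n}" ?New] by auto
  qed
  finally have "(\<Sum>v<n. ?t v) \<le> 10 * n * (r * r * Gk)" by simp
  moreover have "(\<Sum>v<n. ?t v + 3) = (\<Sum>v<n. ?t v) + 3 * n" by (simp add: sum.distrib)
  ultimately show ?thesis by (intro runs_time[OF loop]) linarith
qed

lemma runs_initialise:
  assumes s: "mst s" "buckets_ok s" "\<And>j. iarr s ''x'' j = 0" "\<And>j. iarr s ''done'' j = 0"
  shows "runs initialise s 4 (sw {})"
proof -
  let ?K = "int (k * k + k + 1)"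
  have k: "ivar s ''k'' = int k" using s(1) by (simp add: mst_def base_def)
  have "int (k * k + k + 1) \<le> int Bd" using K_Bd by linarith
  then have KB: "int k * int k + int k + 1 \<le> int Bd" by simp
  have kk: "0 \<le> int k * int k" "9 \<le> int Bd" using Bd(1) by simp_all
  have w: "word W 0" "word W 1" "word W 9" "word W (int k)" "word W (int k * int k)" "word W (int k * int k + int k)"
    "word W (int k * int k + int k + 1)" "word W (int k + 1)"
    by (rule word_lin; use KB kk in linarith)+
  let ?s1 = "s\<lparr>iarr := (iarr s)(''x'' := (iarr s ''x'')(0 := 1))\<rparr>"
  let ?s4 = "?s1\<lparr>ivar := (ivar s)(''K0'' := ?K, ''k1'' := int (k + 1), ''nine'' := 9)\<rparr>"
  have r0: "0 < r" "Rs ! 0 = {}" using irredundantD(6,7)[OF irr] by auto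
  have sw4: "sw {} ?s4"
  proof -
    define x :: "nat \<Rightarrow> int" where "x c = (if c = 0 then 1 else 0)" for c
    have "xi x A = S {u. u < n \<and> cell u \<in> {}} (close ys) A" for A
    proof -
      have "xi x A = (\<Sum>a<r. if a = 0 then g (Rs ! 0) A else 0)" unfolding xi_def x_def by (rule sum.cong) auto
      then show ?thesis using r0 by (simp add: sum.delta g_def S_empty_host)
    qed
    then have "xi x = S {u. u < n \<and> cell u \<in> {}} (close ys)" by (rule ext)
    moreover have "\<forall>c<r. iarr ?s4 ''x'' (int c) = x c" using s(3) by (simp add: x_def)
    moreover have "mst ?s4" using s(1) unfolding mst_def base_def m_ok_def table_def row_def by simp
    moreover have "buckets_ok ?s4" using s(2) unfolding buckets_ok_def by simp
    moreover have "done_ok ?s4 {}" using s(4) unfolding done_ok_def by simp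
    ultimately show ?thesis unfolding sw_def by auto
  qed
  have "runs initialise s (1 + (1 + (1 + 1))) (sw {})"
    unfolding initialise_def
  proof (rule runs_SeqI)
    show "runs (Store ''x'' (Lit 0) (Lit 1)) s 1 (\<lambda>s1. s1 = ?s1)" by (rule runs_Store) (use w in auto)
    fix s1 assume s1: "s1 = ?s1"
    show "runs (Seq (Assign ''K0'' (Add (Add (Mul (Var ''k'') (Var ''k'')) (Var ''k'')) (Lit 1)))
     (Seq (Assign ''k1'' (Add (Var ''k'') (Lit 1))) (Assign ''nine'' (Lit 9)))) s1 (1 + (1 + 1)) (sw {})"
    proof (rule runs_SeqI)
      show "runs (Assign ''K0'' (Add (Add (Mul (Var ''k'') (Var ''k'')) (Var ''k'')) (Lit 1))) s1 1 (\<lambda>s2. s2 = ?s1\<lparr>ivar := (ivar s)(''K0'' := ?K)\<rparr>)"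
        by (rule runs_Assign) (use s1 w k in \<open>simp_all add: add.commute add.left_commute\<close>)
      fix s2 assume s2: "s2 = ?s1\<lparr>ivar := (ivar s)(''K0'' := ?K)\<rparr>"
      show "runs (Seq (Assign ''k1'' (Add (Var ''k'') (Lit 1))) (Assign ''nine'' (Lit 9))) s2 (1 + 1) (sw {})"
      proof (rule runs_SeqI)
        show "runs (Assign ''k1'' (Add (Var ''k'') (Lit 1))) s2 1 (\<lambda>s3. s3 = ?s1\<lparr>ivar := (ivar s)(''K0'' := ?K, ''k1'' := int (k + 1))\<rparr>)"
          by (rule runs_Assign) (use s2 w k in \<open>simp_all add: add.commute\<close>)
        fix s3 assume s3: "s3 = ?s1\<lparr>ivar := (ivar s)(''K0'' := ?K, ''k1'' := int (k + 1))\<rparr>"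
        show "runs (Assign ''nine'' (Lit 9)) s3 1 (sw {})" by (rule runs_Assign) (use s3 w sw4 in simp_all)
      qed
    qed
  qed
  then show ?thesis by (rule runs_time) simp
qed

lemma runs_result:
  assumes s: "sw (cell ` {..<n}) s"
  shows "runs result s (3 * k + r * (12 * k + 11) + 7) (\<lambda>s'. ivar s' ''result'' = int (card (sub (disk_graph xs) (disk_graph ys))))"
    (is "runs _ _ _ ?Q")
proof -
  have m: "mst s" using s by (simp add: sw_def)
  have U: "{u. u < n \<and> cell u \<in> cell ` {..<n}} = {..<n}" by auto
  obtain x where x: "\<forall>c<r. iarr s ''x'' (int c) = x c" "xi x = S {..<n} (close ys)" using s unfolding sw_def U by blast
  have xb: "\<bar>x c\<bar> \<le> X0" if "c < r" for c by (rule coefficient_bound[OF x(2)]) (use that in auto)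
  have fin: "xi x V = int (card (sub (disk_graph xs) (disk_graph ys)))" unfolding x(2) card_sub Sl_def ..
  have r: "ivar s ''r'' = int r" "ivar s ''k'' = int k" using m by (simp_all add: mst_r) (simp add: mst_def base_def)
  have mok: "m_ok s" and rows: "\<And>i. i < r \<Longrightarrow> row s i = Rs ! i" and base: "base s" using m mst_r(2)[OF m] by (auto simp: mst_def)
  have rB: "r \<le> Bd" using r_Bd by simp
  have w01: "word W 0" "word W 1" "word W (int r)" by (rule word_lin; use Bd(1) rB in simp)+
  let ?st = "Store ''m'' (Add (Mul (Var ''r'') (Var ''k'')) (Var ''u'')) (Lit 1)"
  have fill: "runs (For ''u'' ''k'' ?st) s (k * (1 + 2) + 2) (\<lambda>s1. m_ok s1 \<and> (\<forall>i<r. row s1 i = Rs ! i) \<and> row s1 r = V)"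
  proof (rule runs_For_const[where N = k and I = "\<lambda>u s1. m_ok s1 \<and> (\<forall>i<r. row s1 i = Rs ! i) \<and> {..<u} \<subseteq> row s1 r"])
    fix u s1 assume u: "u < k" "ivar s1 ''u'' = int u" and sm: "same (For ''u'' ''k'' ?st) s s1"
      and I: "m_ok s1 \<and> (\<forall>i<r. row s1 i = Rs ! i) \<and> {..<u} \<subseteq> row s1 r"
    have v: "ivar s1 ''r'' = int r" "ivar s1 ''k'' = int k" using sameD(1)[OF sm] r by simp_all
    have w: "word W (int r * int k)" "word W (int r * int k + int u)" "word W (int u)" "word W (int k)"
      by (rule word_mult_add word_mult word_lin; use u(1) rB Bd in simp)+
    let ?s2 = "s1\<lparr>iarr := (iarr s1)(''m'' := (iarr s1 ''m'')(int r * int k + int u := 1))\<rparr>"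
    have "m_ok ?s2" using I by (simp add: m_ok_def)
    moreover have "row ?s2 i = Rs ! i" if "i < r" for i
    proof -
      have "row ?s2 i = row s1 i" unfolding row_def using m_index[of i _ r u] that u(1) by force
      then show ?thesis using I that by blast
    qed
    moreover have "{..<Suc u} \<subseteq> row ?s2 r" using I u(1) unfolding row_def by (auto simp: less_Suc_eq)
    ultimately show "runs ?st s1 1 (\<lambda>s''. same ?st s1 s'' \<longrightarrow> m_ok (s''\<lparr>ivar := (ivar s'')(''u'' := int u + 1)\<rparr>) \<and>
        (\<forall>i<r. row (s''\<lparr>ivar := (ivar s'')(''u'' := int u + 1)\<rparr>) i = Rs ! i) \<and>
        {..<Suc u} \<subseteq> row (s''\<lparr>ivar := (ivar s'')(''u'' := int u + 1)\<rparr>) r)"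
      unfolding row_upd by (intro runs_Store) (use v u w w01 in simp_all)
  next
    fix s1 assume "m_ok s1 \<and> (\<forall>i<r. row s1 i = Rs ! i) \<and> {..<k} \<subseteq> row s1 r"
    then show "m_ok s1 \<and> (\<forall>i<r. row s1 i = Rs ! i) \<and> row s1 r = V" using row_subset[of s1 r] by blast
  qed (use r kW mok rows in \<open>auto simp: row_upd\<close>)
  define st where "st s' \<longleftrightarrow> base s' \<and> m_ok s' \<and> (\<forall>i<r. row s' i = Rs ! i) \<and> row s' r = V \<and> ivar s' ''r'' = int r \<and>
     (\<forall>c<r. iarr s' ''x'' (int c) = x c)" for s' :: state
  have st_same: "st s2" if "st s1" "same c s1 s2" "modi c \<subseteq> {''a'', ''c'', ''h'', ''u'', ''q'', ''w'', ''result''}" "moda c = {}" "modr c \<subseteq> {''H''}" for s1 s2 c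
  proof -
    have "base s2" by (rule base_same[OF _ that(2)]) (use that in \<open>auto simp: st_def\<close>)
    moreover have "iarr s2 ''m'' = iarr s1 ''m''" "iarr s2 ''x'' = iarr s1 ''x''" by (rule sameD(2)[OF that(2)]; use that in auto)+
    moreover have "ivar s2 ''r'' = ivar s1 ''r''" by (rule sameD(1)[OF that(2)]) (use that in auto)
    ultimately show ?thesis using that(1) unfolding st_def m_ok_def row_def by simp
  qed
  let ?body = "Seq ask (Assign ''result'' (Add (Var ''result'') (Mul (Idx ''x'' (Var ''a'')) (Var ''q''))))"
  let ?P = "\<lambda>i. \<Sum>a<i. x a * g (Rs ! a) V"
  let ?Ta = "12 * (k + length ([]::nat list)) + 8"
  have gq: "pairing (Rs ! a) [] V = g (Rs ! a) V" if "a < r" for a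
  proof -
    have "pairing (Rs ! a) [] V = conv (g (Rs ! a)) (S {} adj) V" unfolding pairing_Nil by (simp add: g_def)
    then show ?thesis by (simp add: conv_S_empty_host)
  qed
  have gb: "0 \<le> g (Rs ! a) V" "g (Rs ! a) V \<le> int Qb" if "a < r" for a
    using pairing_le[of "[]" "Rs ! a" V] gq[OF that] sep[OF that] sepset_subset by (auto simp: g_nonneg)
  have XBe: "X0 * (2 ^ k * int Qb) \<le> int W" "X0 \<le> int W"
  proof -
    have "Be \<le> Gam" unfolding Gam_def using power_increasing[of 1 "k * k + k + 3" "2 + Be"] Be_ge by simp
    also have "Gam \<le> Gam ^ (k + 4)" using power_increasing[of 1 "k + 4" Gam] Gam_facts(1) by simp
    finally have "X0 * Be \<le> X0 * Gam ^ (k + 4)" using X0_pos by (intro mult_left_mono) auto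
    then have XB: "X0 * Be \<le> int W" using XW by linarith
    have "X0 * (2 ^ k * int Qb) \<le> X0 * Be" using X0_pos by (intro mult_left_mono) (auto simp: Be_def)
    then show "X0 * (2 ^ k * int Qb) \<le> int W" using XB by linarith
    have "X0 * 1 \<le> X0 * Be" using X0_pos Be_ge by (intro mult_left_mono) auto
    then show "X0 \<le> int W" using XB by linarith
  qed
  have xg: "\<bar>x a * g (Rs ! a) V\<bar> \<le> X0 * int Qb" if "a < r" for a
    unfolding abs_mult using xb[OF that] gb[OF that] X0_pos by (intro mult_mono) auto
  have Pb: "\<bar>?P i\<bar> \<le> int W" if "i \<le> r" for i
  proof -
    have "\<bar>?P i\<bar> \<le> (\<Sum>a<i. \<bar>x a * g (Rs ! a) V\<bar>)" by (rule sum_abs)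
    also have "\<dots> \<le> (\<Sum>a<i. X0 * int Qb)" using xg that by (intro sum_mono) auto
    also have "\<dots> = int i * (X0 * int Qb)" by simp
    also have "\<dots> \<le> 2 ^ k * (X0 * int Qb)" using that r_le X0_pos by (intro mult_right_mono) auto
    also have "\<dots> = X0 * (2 ^ k * int Qb)" by simp
    finally show ?thesis using XBe(1) by linarith
  qed
  have body: "runs ?body s' (?Ta + 1) (\<lambda>s2. ivar s2 ''result'' = ?P (Suc a))"
    if s': "st s'" "ivar s' ''c'' = int r" "ivar s' ''w'' = 0" "ivar s' ''a'' = int a" "a < r" "ivar s' ''result'' = ?P a" for s' a
  proof (rule runs_SeqI)
    show "runs ask s' ?Ta (\<lambda>s1. ivar s1 ''q'' = pairing (row s' a) [] (row s' r) \<and> 0 \<le> ivar s1 ''q'' \<and> ivar s1 ''q'' \<le> int Qb)"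
      by (rule runs_pairing) (use s' rB in \<open>auto simp: st_def wl_is_def\<close>)
    fix s1 assume sm: "same ask s' s1" and q: "ivar s1 ''q'' = pairing (row s' a) [] (row s' r) \<and> 0 \<le> ivar s1 ''q'' \<and> ivar s1 ''q'' \<le> int Qb"
    have "row s' a = Rs ! a" "row s' r = V" using s'(1,5) by (auto simp: st_def)
    then have q': "ivar s1 ''q'' = g (Rs ! a) V" using q gq[OF s'(5)] by simp
    have f: "ivar s1 ''result'' = ?P a" "ivar s1 ''a'' = int a" "iarr s1 ''x'' (int a) = x a"
      using sameD[OF sm] s' by (auto simp: st_def)
    have "int Qb \<le> int W" using QW by simp
    then have w: "word W (?P a)" "word W (?P (Suc a))" "word W (x a)" "word W (g (Rs ! a) V)"
      using Pb[of a] Pb[of "Suc a"] s'(5) xb[OF s'(5)] XBe(2) gb[OF s'(5)]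
      by (auto simp: word_def simp del: sum.lessThan_Suc)
    have wp: "word W (x a * g (Rs ! a) V)"
    proof -
      have "X0 * (1 * int Qb) \<le> X0 * (2 ^ k * int Qb)" using X0_pos by (intro mult_left_mono mult_right_mono) auto
      then show ?thesis using xg[OF s'(5)] XBe(1) unfolding word_def by linarith
    qed
    show "runs (Assign ''result'' (Add (Var ''result'') (Mul (Idx ''x'' (Var ''a'')) (Var ''q'')))) s1 1 (\<lambda>s2. ivar s2 ''result'' = ?P (Suc a))"
      by (rule runs_Assign) (use f q' w wp rW(2)[OF s'(5)] in simp_all)
  qed
  have loop: "runs (For ''a'' ''r'' ?body) s' (r * (?Ta + 1 + 2) + 2) ?Q"
    if s': "st s'" "ivar s' ''c'' = int r" "ivar s' ''w'' = 0" "ivar s' ''result'' = 0" for s'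
  proof (rule runs_For_const[where N = r and I = "\<lambda>a s2. ivar s2 ''result'' = ?P a"])
    show "ivar s' ''r'' = int r" using s' by (simp add: st_def)
    fix a s2 assume a: "a < r" "ivar s2 ''a'' = int a" and sm: "same (For ''a'' ''r'' ?body) s' s2" and I: "ivar s2 ''result'' = ?P a"
    have "st s2" by (rule st_same[OF s'(1) sm]) auto
    then have "runs ?body s2 (?Ta + 1) (\<lambda>s3. ivar s3 ''result'' = ?P (Suc a))"
      using a I s' sameD(1)[OF sm] by (intro body) auto
    then show "runs ?body s2 (?Ta + 1) (\<lambda>s3. same ?body s2 s3 \<longrightarrow> ivar (s3\<lparr>ivar := (ivar s3)(''a'' := int a + 1)\<rparr>) ''result'' = ?P (Suc a))"
      by (rule runs_mono[OF _ order_refl]) simp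
  next
    fix s2 :: state assume "ivar s2 ''result'' = ?P r"
    then show "?Q s2" using fin by (simp add: xi_def)
  qed (use s' rW in auto)
  have "runs result s ((k * (1 + 2) + 2) + (1 + (1 + (1 + (r * (?Ta + 1 + 2) + 2))))) ?Q"
    unfolding result_def
  proof (rule runs_SeqI[OF fill])
    fix s1 assume sm1: "same (For ''u'' ''k'' ?st) s s1" and q1: "m_ok s1 \<and> (\<forall>i<r. row s1 i = Rs ! i) \<and> row s1 r = V"
    have st1: "st s1" using q1 base_same[OF base sm1] sameD[OF sm1] r x(1) by (simp add: st_def)
    show "runs (Seq (Assign ''c'' (Var ''r'')) (Seq (Assign ''w'' (Lit 0)) (Seq (Assign ''result'' (Lit 0)) (For ''a'' ''r'' ?body)))) s1
       (1 + (1 + (1 + (r * (?Ta + 1 + 2) + 2)))) ?Q"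
    proof (rule runs_SeqI)
      show "runs (Assign ''c'' (Var ''r'')) s1 1 (\<lambda>s2. ivar s2 ''c'' = int r)"
        by (rule runs_Assign) (use st1 w01 in \<open>auto simp: st_def\<close>)
      fix s2 assume sm2: "same (Assign ''c'' (Var ''r'')) s1 s2" and c2: "ivar s2 ''c'' = int r"
      have st2: "st s2" by (rule st_same[OF st1 sm2]) auto
      show "runs (Seq (Assign ''w'' (Lit 0)) (Seq (Assign ''result'' (Lit 0)) (For ''a'' ''r'' ?body))) s2 (1 + (1 + (r * (?Ta + 1 + 2) + 2))) ?Q"
      proof (rule runs_SeqI)
        show "runs (Assign ''w'' (Lit 0)) s2 1 (\<lambda>s3. ivar s3 ''c'' = int r \<and> ivar s3 ''w'' = 0)"
          by (rule runs_Assign) (use c2 w01 in auto)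
        fix s3 assume sm3: "same (Assign ''w'' (Lit 0)) s2 s3" and c3: "ivar s3 ''c'' = int r \<and> ivar s3 ''w'' = 0"
        have st3: "st s3" by (rule st_same[OF st2 sm3]) auto
        show "runs (Seq (Assign ''result'' (Lit 0)) (For ''a'' ''r'' ?body)) s3 (1 + (r * (?Ta + 1 + 2) + 2)) ?Q"
        proof (rule runs_SeqI)
          show "runs (Assign ''result'' (Lit 0)) s3 1 (\<lambda>s4. ivar s4 ''c'' = int r \<and> ivar s4 ''w'' = 0 \<and> ivar s4 ''result'' = 0)"
            by (rule runs_Assign) (use c3 w01 in auto)
          fix s4 assume sm4: "same (Assign ''result'' (Lit 0)) s3 s4" and c4: "ivar s4 ''c'' = int r \<and> ivar s4 ''w'' = 0 \<and> ivar s4 ''result'' = 0"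
          have "st s4" by (rule st_same[OF st3 sm4]) auto
          then show "runs (For ''a'' ''r'' ?body) s4 (r * (?Ta + 1 + 2) + 2) ?Q" using c4 by (intro loop) auto
        qed
      qed
    qed
  qed
  then show ?thesis by (rule runs_time) simp
qed

end

lemma sigma0_pos:
  assumes "finite (verts P)"
  shows "1 \<le> sigma0 P"
proof -
  have "separations0 P \<subseteq> Pow (verts P) \<times> Pow (verts P)" by (auto simp: separations0_def)
  then have "finite (separations0 P)" by (rule finite_subset) (simp add: assms(1))
  then have "finite (separations0 P // separation_iso P)" by (rule finite_quotient) (auto simp: separation_iso_def)
  moreover have "({}, verts P) \<in> separations0 P" by (simp add: separations0_def)
  then have "separations0 P // separation_iso P \<noteq> {}" unfolding quotient_def by blast
  ultimately show ?thesis unfolding sigma0_def by (simp add: Suc_le_eq card_gt_0_iff)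
qed

text \<open>The summands bound the phases of \<open>count_prog\<close>, in their order, in units of
  \<open>\<sigma>\<^sup>2 * max 1 n\<close>; the maximum is there because the work on
  \<open>P\<close> remains when \<open>G\<close> is empty.\<close>

definition count_cost :: "nat \<Rightarrow> nat" where
  "count_cost k = (3 * k + 8) + (k * (k * (4 * k + 7) + 4) + 3 * k + 4) + (k * (28 * k + 39) + 4) + (12 * k + 11) + 9 + 4 +
     (7 + 10 * (87 + (12 * k + 18) + (k + 1) * ((12 * k + 18) + (k * k + k + 1) * (12 * k + 25) + 21))) + (3 * k + 7 + 12 * k + 11)"

context disk_program
begin

lemma runs_count_prog:
  assumes s: "base0 s" "\<And>a j. iarr s a j = 0"
  defines "\<sigma> \<equiv> sigma0 (disk_graph xs)"
  shows "runs count_prog s (\<sigma>\<^sup>2 * max 1 n * count_cost k)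
    (\<lambda>s'. ivar s' ''result'' = int (card (sub (disk_graph xs) (disk_graph ys))))" (is "runs _ _ _ ?Q")
proof -
  let ?N = "max 1 n"
  let ?G = "87 + (12 * k + 18) + (k + 1) * ((12 * k + 18) + (k * k + k + 1) * (12 * k + 25) + 21)"
  let ?t1 = "3 * k + 3 * n + 5"
  let ?t2 = "k * (k * (4 * k + 7) + 4) + 3 * k + 4"
  let ?t3 = "k * (\<sigma> * (\<sigma> * (24 * k + 26) + 4 * k + 8) + 5) + 4"
  let ?t4 = "12 * k + 11"
  let ?t5 = "6 * n + 3"
  let ?t7 = "5 * n + 10 * n * (\<sigma> * \<sigma> * ?G) + 2"
  let ?t8 = "3 * k + \<sigma> * (12 * k + 11) + 7"
  have run: "runs count_prog s (?t1 + (?t2 + (?t3 + (?t4 + (?t5 + (4 + (?t7 + ?t8))))))) ?Q"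
    unfolding count_prog_def
  proof (rule runs_SeqI)
    show "runs bound s ?t1 base" by (rule runs_bound[OF s(1)])
    fix s1 assume sm1: "same bound s s1" and b1: "base s1"
    have z1: "iarr s1 a j = 0" for a j using sameD(2)[OF sm1] s(2) by simp
    show "runs (Seq labels (Seq enum (Seq get_alpha (Seq buckets (Seq initialise (Seq (For ''v'' ''n'' visit) result)))))) s1
      (?t2 + (?t3 + (?t4 + (?t5 + (4 + (?t7 + ?t8)))))) ?Q"
    proof (rule runs_SeqI)
      show "runs labels s1 ?t2 (\<lambda>s'. \<exists>l. good_lab s' l)" by (rule runs_labels[OF b1])
      fix s2 assume sm2: "same labels s1 s2" and "\<exists>l. good_lab s2 l"
      then obtain l where l: "good_lab s2 l" by blast
      have b2: "base s2" by (rule base_same[OF b1 sm2]) auto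
      have z2: "iarr s2 a j = 0" if "a \<noteq> ''lab''" for a j using sameD(2)[OF sm2] z1 that by simp
      \<comment> \<open>The rows depend on the labelling that the run has found, so the analysis of
        the update becomes available only at this point.\<close>
      interpret R: disk_reps \<Omega> W xs ys Sb Bd p "outer l k"
        by (intro disk_reps.intro disk_program_axioms disk_reps_axioms.intro outer_reps[OF l])
      have r: "R.r \<le> \<sigma>" unfolding \<sigma>_def by (rule irredundantD(1)[OF R.irr])
      show "runs (Seq enum (Seq get_alpha (Seq buckets (Seq initialise (Seq (For ''v'' ''n'' visit) result))))) s2
        (?t3 + (?t4 + (?t5 + (4 + (?t7 + ?t8))))) ?Q"
      proof (rule runs_SeqI)
        show "runs enum s2 ?t3 (\<lambda>s'. enum_state s' l \<and> table s' (outer l k))"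
          unfolding \<sigma>_def by (rule runs_enum[OF b2 l]) (rule z2, simp)
        fix s3 assume sm3: "same enum s2 s3" and e3: "enum_state s3 l \<and> table s3 (outer l k)"
        have z3: "iarr s3 a j = 0" if "a \<noteq> ''lab''" "a \<noteq> ''m''" for a j using sameD(2)[OF sm3] z2 that by simp
        show "runs (Seq get_alpha (Seq buckets (Seq initialise (Seq (For ''v'' ''n'' visit) result)))) s3
          (?t4 + (?t5 + (4 + (?t7 + ?t8)))) ?Q"
        proof (rule runs_SeqI)
          show "runs get_alpha s3 ?t4 R.mst"
            by (rule R.runs_get_alpha) (use e3 in \<open>auto simp: enum_state_def\<close>)
          fix s4 assume sm4: "same get_alpha s3 s4" and m4: "R.mst s4"
          have z4: "iarr s4 a j = 0" if "a \<noteq> ''lab''" "a \<noteq> ''m''" for a j using sameD(2)[OF sm4] z3 that by simp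
          show "runs (Seq buckets (Seq initialise (Seq (For ''v'' ''n'' visit) result))) s4 (?t5 + (4 + (?t7 + ?t8))) ?Q"
          proof (rule runs_SeqI)
            show "runs buckets s4 ?t5 buckets_ok"
              by (rule runs_buckets) (use m4 z4 in \<open>auto simp: R.mst_def\<close>)
            fix s5 assume sm5: "same buckets s4 s5" and k5: "buckets_ok s5"
            have m5: "R.mst s5" by (rule R.mst_same[OF m4 sm5]) auto
            have z5: "iarr s5 ''x'' j = 0" "iarr s5 ''done'' j = 0" for j
              using sameD(2)[OF sm5, of "''x''"] sameD(2)[OF sm5, of "''done''"] z4[of "''x''" j] z4[of "''done''" j] by simp_all
            show "runs (Seq initialise (Seq (For ''v'' ''n'' visit) result)) s5 (4 + (?t7 + ?t8)) ?Q"
            proof (rule runs_SeqI)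
              show "runs initialise s5 4 (R.sw {})" by (rule R.runs_initialise[OF m5 k5 z5])
              fix s6 assume w6: "R.sw {} s6"
              show "runs (Seq (For ''v'' ''n'' visit) result) s6 (?t7 + ?t8) ?Q"
              proof (rule runs_SeqI)
                show "runs (For ''v'' ''n'' visit) s6 ?t7 (R.sw (cell ` {..<n}))"
                proof (rule runs_time[OF R.runs_sweep[OF w6]])
                  show "5 * n + 10 * n * (R.r * R.r * R.Gk) + 2 \<le> ?t7"
                    unfolding R.Gk_def by (intro add_mono mult_mono r order_refl) simp_all
                qed
                fix s7 assume w7: "R.sw (cell ` {..<n}) s7"
                show "runs result s7 ?t8 ?Q"
                proof (rule runs_time[OF R.runs_result[OF w7]])
                  show "3 * k + R.r * (12 * k + 11) + 7 \<le> ?t8" by (intro add_mono mult_mono r order_refl) simp_all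
                qed
              qed
            qed
          qed
        qed
      qed
    qed
  qed
  let ?q = "\<sigma> * \<sigma> * ?N"
  have "1 \<le> \<sigma>" unfolding \<sigma>_def by (rule sigma0_pos) (simp add: disk_graph_def)
  then have ss: "\<sigma> \<le> \<sigma> * \<sigma>" "1 \<le> \<sigma> * \<sigma>" by simp_all
  have q: "\<sigma> * \<sigma> \<le> ?q" "n \<le> ?q" using mult_le_mono[OF order_refl, of 1 ?N "\<sigma> * \<sigma>"] mult_le_mono[OF ss(2), of n ?N] by simp_all
  have q1: "1 \<le> ?q" "\<sigma> \<le> ?q" using q(1) ss by linarith+
  have M: "c \<le> ?q * c" for c using mult_le_mono1[OF q1(1), of c] by simp
  have t1: "?t1 \<le> ?q * (3 * k + 8)"
  proof -
    have "?t1 \<le> ?q * (3 * k) + 3 * ?q + 5 * ?q" using M[of "3 * k"] q q1 by linarith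
    then show ?thesis by (simp add: algebra_simps)
  qed
  have t3: "?t3 \<le> ?q * (k * (28 * k + 39) + 4)"
  proof -
    have "\<sigma> * (\<sigma> * (24 * k + 26) + 4 * k + 8) + 5 = \<sigma> * \<sigma> * (24 * k + 26) + \<sigma> * (4 * k + 8) + 5" by (simp add: algebra_simps)
    also have "\<dots> \<le> ?q * (24 * k + 26) + ?q * (4 * k + 8) + ?q * 5"
      using q q1 by (intro add_mono mult_le_mono1) simp_all
    also have "\<dots> = ?q * (28 * k + 39)" by (simp add: algebra_simps)
    finally have "k * (\<sigma> * (\<sigma> * (24 * k + 26) + 4 * k + 8) + 5) \<le> k * (?q * (28 * k + 39))" by (rule mult_le_mono2)
    then have "?t3 \<le> k * (?q * (28 * k + 39)) + ?q * 4" using q1 by linarith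
    then show ?thesis by (simp only: distrib_left mult_ac)
  qed
  have t7: "?t7 \<le> ?q * (7 + 10 * ?G)"
  proof -
    have "n \<le> ?N" by simp
    then have "10 * n * (\<sigma> * \<sigma> * ?G) \<le> 10 * ?N * (\<sigma> * \<sigma> * ?G)" by (intro mult_le_mono order_refl)
    also have "\<dots> = ?q * (10 * ?G)" by (simp only: mult_ac)
    finally have "?t7 \<le> 5 * ?q + ?q * (10 * ?G) + 2 * ?q" using q q1 by linarith
    also have "\<dots> = ?q * (7 + 10 * ?G)" by (simp only: distrib_left mult.commute)
    finally show ?thesis .
  qed
  have t8: "?t8 \<le> ?q * (3 * k + 7 + 12 * k + 11)"
  proof -
    have "?t8 \<le> ?q * (3 * k) + ?q * (12 * k + 11) + ?q * 7"
      using M[of "3 * k"] M[of 7] mult_le_mono1[OF q1(2), of "12 * k + 11"] by linarith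
    then show ?thesis by (simp add: algebra_simps)
  qed
  have t5: "?t5 \<le> ?q * 9" using q q1 by linarith
  have "?t1 + (?t2 + (?t3 + (?t4 + (?t5 + (4 + (?t7 + ?t8)))))) \<le>
      ?q * (3 * k + 8) + (?q * ?t2 + (?q * (k * (28 * k + 39) + 4) + (?q * ?t4 + (?q * 9 + (?q * 4 + (?q * (7 + 10 * ?G) + ?q * (3 * k + 7 + 12 * k + 11)))))))"
    by (intro add_mono t1 t3 t5 t7 t8 M)
  also have "\<dots> = \<sigma>\<^sup>2 * ?N * count_cost k"
    unfolding count_cost_def power2_eq_square distrib_left[symmetric] by (simp only: add.assoc)
  finally show ?thesis by (rule runs_time[OF run])
qed

end

subsection \<open>Word sizes and the main theorem\<close>

lemma add_le_power:
  fixes b :: int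
  assumes "2 \<le> b" "x \<le> b ^ i" "y \<le> b ^ i"
  shows "x + y \<le> b ^ Suc i"
proof -
  have "x + y \<le> 2 * b ^ i" using assms(2,3) by simp
  also have "\<dots> \<le> b * b ^ i" using assms(1) by (intro mult_right_mono) auto
  finally show ?thesis by simp
qed

lemma mult_le_power:
  fixes b :: int
  assumes "0 \<le> b" "0 \<le> x" "0 \<le> y" "x \<le> b ^ i" "y \<le> b ^ j"
  shows "x * y \<le> b ^ (i + j)"
  unfolding power_add using assms by (intro mult_mono) auto

lemma power_le_power:
  fixes b :: int
  assumes "0 \<le> x" "x \<le> b ^ i"
  shows "x ^ m \<le> b ^ (i * m)"
  unfolding power_mult using assms by (intro power_mono) auto

text \<open>All magnitudes become powers of the single base \<open>b\<close>, an addition costing at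
  most one factor: \<open>2 * k + n\<close> is at most \<open>b ^ 2\<close>, hence \<open>Q\<close>
  at most \<open>b ^ (2 * k)\<close> and \<open>2 ^ k * Q\<close> at most
  \<open>b ^ (3 * k)\<close>. The exponents are polynomials in \<open>k\<close>, as the word size
  requires.\<close>

lemma coefficient_sizes:
  fixes b k n :: nat
  assumes b: "2 \<le> b" "k + n \<le> b"
  defines "Q \<equiv> int ((2 * k + n) ^ k)"
  shows "Q \<le> int b ^ (2 * k)"
    "Q * (1 + 2 ^ k * Q) ^ (k + k * k) * ((2 + (2 + 2 ^ k * Q)) ^ (k * k + k + 3)) ^ (k + 4)
       \<le> int b ^ (2 * k + (3 * k + 1) * (k + k * k) + (3 * k + 3) * (k * k + k + 3) * (k + 4))"
proof -
  let ?b = "int b"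
  have b2: "2 \<le> ?b" "0 \<le> ?b" "1 \<le> ?b" using b(1) by simp_all
  have one: "1 \<le> ?b ^ i" for i using b2(3) by simp
  have two: "2 \<le> ?b ^ Suc i" for i using add_le_power[OF b2(1) one one, of i] by simp
  have Q0: "0 \<le> Q" by (simp add: Q_def)
  show Q: "Q \<le> ?b ^ (2 * k)"
  proof -
    have "int k + int (k + n) \<le> ?b ^ Suc 1" using b by (intro add_le_power) auto
    then have "int (2 * k + n) \<le> ?b ^ 2" by (simp add: power2_eq_square)
    then show ?thesis unfolding Q_def of_nat_power by (rule power_le_power[rotated]) simp
  qed
  have "(2::int) ^ k \<le> ?b ^ k" using b2 by (intro power_mono) auto
  then have "2 ^ k * Q \<le> ?b ^ (k + 2 * k)" using Q0 Q b2 by (intro mult_le_power) auto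
  then have kQ: "2 ^ k * Q \<le> ?b ^ (3 * k)" by simp
  have f1: "1 + 2 ^ k * Q \<le> ?b ^ Suc (3 * k)" by (rule add_le_power[OF b2(1) one kQ])
  have f2: "2 + (2 + 2 ^ k * Q) \<le> ?b ^ Suc (Suc (Suc (3 * k)))"
  proof -
    have "2 ^ k * Q \<le> ?b ^ Suc (3 * k)" by (rule order_trans[OF kQ]) (rule power_increasing[OF _ b2(3)], simp)
    then show ?thesis by (intro add_le_power b2(1) two)
  qed
  have m1: "Q * (1 + 2 ^ k * Q) ^ (k + k * k) \<le> ?b ^ (2 * k + Suc (3 * k) * (k + k * k))"
    using Q0 Q f1 b2 by (intro mult_le_power power_le_power) auto
  have m2: "((2 + (2 + 2 ^ k * Q)) ^ (k * k + k + 3)) ^ (k + 4) \<le> ?b ^ (Suc (Suc (Suc (3 * k))) * (k * k + k + 3) * (k + 4))"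
    using Q0 f2 b2 by (intro power_le_power) auto
  have e: "Suc (3 * k) = 3 * k + 1" "Suc (Suc (3 * k + 1)) = 3 * k + 3" by simp_all
  show "Q * (1 + 2 ^ k * Q) ^ (k + k * k) * ((2 + (2 + 2 ^ k * Q)) ^ (k * k + k + 3)) ^ (k + 4)
       \<le> int b ^ (2 * k + (3 * k + 1) * (k + k * k) + (3 * k + 3) * (k * k + k + 3) * (k + 4))"
    by (rule mult_le_power[OF b2(2) _ _ m1[unfolded e] m2[unfolded e]]) (use Q0 in simp_all)
qed

lemma sum_sq_floor_le:
  assumes "coords_at_most zs M" "length zs \<le> b" "M \<le> b" "2 \<le> b"
  shows "(\<Sum>z\<leftarrow>zs. \<lfloor>fst z\<rfloor> * \<lfloor>fst z\<rfloor> + \<lfloor>snd z\<rfloor> * \<lfloor>snd z\<rfloor>) \<le> int b ^ 4"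
proof -
  have fl: "\<lfloor>c\<rfloor> * \<lfloor>c\<rfloor> \<le> int b * int b" if "\<bar>c\<bar> \<le> real M" for c
  proof -
    have "- int M \<le> \<lfloor>c\<rfloor>" "\<lfloor>c\<rfloor> \<le> int M" using that by (simp_all add: le_floor_iff floor_le_iff)
    then have "\<bar>\<lfloor>c\<rfloor>\<bar> \<le> int b" using assms(3) by linarith
    then have "\<bar>\<lfloor>c\<rfloor>\<bar> * \<bar>\<lfloor>c\<rfloor>\<bar> \<le> int b * int b" by (intro mult_mono) auto
    then show ?thesis by simp
  qed
  have "(\<Sum>z\<leftarrow>zs. \<lfloor>fst z\<rfloor> * \<lfloor>fst z\<rfloor> + \<lfloor>snd z\<rfloor> * \<lfloor>snd z\<rfloor>) \<le> (\<Sum>z\<leftarrow>zs. 2 * (int b * int b))"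
  proof (rule sum_list_mono)
    fix z assume "z \<in> set zs"
    then have "\<bar>fst z\<bar> \<le> real M" "\<bar>snd z\<bar> \<le> real M" using assms(1) unfolding coords_at_most_def by auto
    then show "\<lfloor>fst z\<rfloor> * \<lfloor>fst z\<rfloor> + \<lfloor>snd z\<rfloor> * \<lfloor>snd z\<rfloor> \<le> 2 * (int b * int b)" using fl[of "fst z"] fl[of "snd z"] by linarith
  qed
  also have "\<dots> = int (length zs) * 2 * (int b * int b)" by (simp add: sum_list_triv)
  also have "\<dots> \<le> int b * int b * (int b * int b)" using assms(2,4) by (intro mult_right_mono mult_mono) auto
  also have "\<dots> = int b ^ 4" by (simp add: power4_eq_xxxx)
  finally show ?thesis .
qed

text \<open>The square of an integer dominates its absolute value, and rounding loses less than 1.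
  Hence the sum of squares that the program computes, plus its initial value 3, bounds all
  coordinates.\<close>

lemma abs_le_floor_sq: "\<bar>c\<bar> \<le> real_of_int (\<lfloor>c\<rfloor> * \<lfloor>c\<rfloor> + 1)"
proof -
  have "1 * \<bar>\<lfloor>c\<rfloor>\<bar> \<le> \<bar>\<lfloor>c\<rfloor>\<bar> * \<bar>\<lfloor>c\<rfloor>\<bar>" by (cases "\<lfloor>c\<rfloor> = 0") (simp, intro mult_right_mono, simp_all)
  then have "\<bar>\<lfloor>c\<rfloor>\<bar> \<le> \<lfloor>c\<rfloor> * \<lfloor>c\<rfloor>" by simp
  then have "\<bar>\<lfloor>c\<rfloor>\<bar> + 1 \<le> \<lfloor>c\<rfloor> * \<lfloor>c\<rfloor> + 1" by linarith
  moreover have "\<bar>c\<bar> \<le> real_of_int (\<bar>\<lfloor>c\<rfloor>\<bar> + 1)" by linarith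
  ultimately show ?thesis using of_int_le_iff[where 'a = real] order_trans by blast
qed

text \<open>The empty pattern is treated apart because its cells would have width 0; exactly one map
  starts from it.\<close>

definition main_prog :: com where
  "main_prog = If (Less (Var ''k'') (Lit 1)) (Assign ''result'' (Lit 1)) count_prog"

text \<open>Both polynomials are mere expansions: \<open>time_poly\<close> of
  \<open>count_cost k + 2\<close>, where the 2 pays for the case distinction, and
  \<open>word_poly\<close> of the exponent in \<open>coefficient_sizes\<close> plus
  \<open>2 * k + 40\<close>, which accommodates the product of two numbers up to
  \<open>b ^ (k + 16)\<close>.\<close>

definition time_poly :: "nat poly" where "time_poly = [:1757, 1326, 895, 494, 120:]"
definition word_poly :: "nat poly" where "word_poly = [:76, 62, 40, 21, 3:]"

lemma poly_time_poly: "poly time_poly k = count_cost k + 2"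
  by (simp add: time_poly_def count_cost_def algebra_simps)

lemma poly_word_poly:
  "poly word_poly k = 2 * k + (3 * k + 1) * (k + k * k) + (3 * k + 3) * (k * k + k + 3) * (k + 4) + (2 * k + 40)"
  by (simp add: word_poly_def algebra_simps)

lemma card_sub_empty: "card (sub (disk_graph []) G) = 1"
proof -
  have "sub (disk_graph []) G = {\<lambda>_. undefined}" by (auto simp: sub_def disk_graph_def)
  then show ?thesis by simp
qed

lemma main_prog_correct:
  assumes M: "coords_at_most (xs @ ys) M" and ply: "has_ply xs p" "has_ply ys p"
    and answers: "\<And>zs. length zs \<le> 38 * (length xs)\<^sup>2 * p \<Longrightarrow> has_ply zs p \<Longrightarrow>
      \<Omega> xs zs = Some (card (sub (disk_graph xs) (disk_graph zs)))"
  shows "computes_within \<Omega> ((length xs + length ys + M + 2) ^ poly word_poly (length xs)) main_prog xs ys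
    ((sigma0 (disk_graph xs))\<^sup>2 * max 1 (length ys) * poly time_poly (length xs)) (card (sub (disk_graph xs) (disk_graph ys)))"
proof -
  let ?k = "length xs" and ?n = "length ys"
  define b where "b = ?k + ?n + M + 2"
  define W where "W = b ^ poly word_poly ?k"
  let ?c = "2 * ?k + (3 * ?k + 1) * (?k + ?k * ?k) + (3 * ?k + 3) * (?k * ?k + ?k + 3) * (?k + 4)"
  have b: "2 \<le> b" "?k + ?n \<le> b" "M \<le> b" by (simp_all add: b_def)
  then have b1: "1 \<le> int b" "2 \<le> int b" by simp_all
  have le_W: "x \<le> int W" if "x \<le> int b ^ i" "i \<le> ?c + (2 * ?k + 40)" for x i
  proof -
    have "int b ^ i \<le> int b ^ poly word_poly ?k" unfolding poly_word_poly by (rule power_increasing[OF that(2) b1(1)])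
    then show ?thesis using that(1) unfolding W_def by simp
  qed
  have W1: "1 \<le> W" using b(1) by (simp add: W_def)
  interpret machine \<Omega> W by unfold_locales (rule W1)
  let ?s = "init_state xs ys"
  let ?R = "\<lambda>s'. ivar s' ''result'' = int (card (sub (disk_graph xs) (disk_graph ys)))"
  let ?T = "(sigma0 (disk_graph xs))\<^sup>2 * max 1 ?n"
  have w01: "word W 0" "word W 1" "word W (int ?k)"
    using W1 le_W[of "int ?k" 1] b by (auto simp: word_def)
  have T1: "1 \<le> ?T"
  proof -
    have "1 \<le> sigma0 (disk_graph xs)" by (rule sigma0_pos) (simp add: disk_graph_def)
    then show ?thesis by simp
  qed
  have "runs main_prog ?s (?T * (count_cost ?k + 1) + 1) ?R"
    unfolding main_prog_def
  proof (rule runs_If)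
    show "bok W ?s (Less (Var ''k'') (Lit 1))" using w01 by (simp add: init_state_def)
    assume "bval ?s (Less (Var ''k'') (Lit 1))"
    then have xs: "xs = []" by (simp add: init_state_def)
    have "runs (Assign ''result'' (Lit 1)) ?s 1 ?R" by (rule runs_Assign) (simp_all add: w01 xs card_sub_empty)
    then show "runs (Assign ''result'' (Lit 1)) ?s (?T * (count_cost ?k + 1)) ?R"
      by (rule runs_time) (use mult_le_mono[OF T1, of 1 "count_cost ?k + 1"] in \<open>simp only: mult_1\<close>)
  next
    assume "\<not> bval ?s (Less (Var ''k'') (Lit 1))"
    then have k: "1 \<le> ?k" by (simp add: init_state_def Suc_le_eq)
    define \<Sigma> where "\<Sigma> = (\<Sum>z\<leftarrow>xs @ ys. \<lfloor>fst z\<rfloor> * \<lfloor>fst z\<rfloor> + \<lfloor>snd z\<rfloor> * \<lfloor>snd z\<rfloor>)"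
    define Sb where "Sb = nat (3 + \<Sigma>)"
    \<comment> \<open>In the exponent, \<open>k\<close> accommodates the \<open>2 ^ k\<close> rows
      and 16 the cell keys, whose range is at most \<open>b ^ 13\<close> because \<open>Sb\<close>
      is at most \<open>b ^ 5\<close>.\<close>
    define Bd where "Bd = b ^ (?k + 16)"
    have "0 \<le> \<Sigma>" unfolding \<Sigma>_def by (rule sum_list_nonneg) auto
    then have Sb_eq: "int Sb = 3 + \<Sigma>" by (simp add: Sb_def)
    have p3: "3 \<le> int b ^ 4" using power_mono[of 2 "int b" 4] b1 by simp
    have S5: "int Sb \<le> int b ^ 5"
    proof -
      have "\<Sigma> \<le> int b ^ 4" unfolding \<Sigma>_def by (rule sum_sq_floor_le[OF M]) (use b in auto)
      then show ?thesis using add_le_power[OF b1(2) p3] Sb_eq by (simp add: eval_nat_numeral)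
    qed
    have le_Bd: "x \<le> Bd" if "int x \<le> int b ^ i" "i \<le> ?k + 16" for x i
    proof -
      have "int b ^ i \<le> int Bd" unfolding Bd_def of_nat_power by (rule power_increasing[OF that(2) b1(1)])
      then show ?thesis using that(1) by simp
    qed
    have p6: "6 \<le> int b ^ 5" "1 \<le> int b ^ 5" "9 \<le> int b ^ 4" 
      using power_mono[of 2 "int b" 5] power_mono[of 2 "int b" 4] b1 by simp_all
    have S6: "int Sb + 1 \<le> int b ^ 6" "2 * int Sb \<le> int b ^ 6" 
      using add_le_power[OF b1(2) S5 p6(2)] add_le_power[OF b1(2) S5 S5] by (simp_all add: eval_nat_numeral)
    have p66: "6 \<le> int b ^ 6" using power_mono[of 2 "int b" 6] b1 by simp
    have S7: "2 * int Sb + 6 \<le> int b ^ 7" using add_le_power[OF b1(2) S6(2) p66] by (simp add: eval_nat_numeral)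
    have kb: "int ?k + 1 \<le> int b" "int ?n \<le> int b" by (simp_all add: b_def)
    interpret disk_instance \<Omega> W xs ys Sb Bd p
    proof unfold_locales
      show "9 \<le> Bd" by (rule le_Bd[of _ 4]) (use p6 in simp_all)
      show "?k \<le> Bd" "?n \<le> Bd" by (rule le_Bd[of _ 1]; use kb in simp)+
      show "4 * Sb + 6 \<le> Bd"
        by (rule le_Bd[of _ 8]) (use add_le_power[OF b1(2) S7, of "int b ^ 7"] S7 in \<open>simp_all add: eval_nat_numeral\<close>)
      have "int Bd * int Bd + int Bd \<le> int b ^ Suc (2 * ?k + 32)"
      proof (rule add_le_power[OF b1(2)])
        have "(?k + 16) + (?k + 16) = 2 * ?k + 32" by simp
        then show "int Bd * int Bd \<le> int b ^ (2 * ?k + 32)" unfolding Bd_def of_nat_power power_add[symmetric] by (metis order_refl)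
        show "int Bd \<le> int b ^ (2 * ?k + 32)" unfolding Bd_def of_nat_power by (rule power_increasing[OF _ b1(1)]) simp
      qed
      then have "int Bd * int Bd + int Bd \<le> int W" by (rule le_W) simp
      then show "Bd * Bd + Bd \<le> W" by (metis of_nat_add of_nat_le_iff of_nat_mult)
      show "\<bar>fst z\<bar> \<le> real Sb \<and> \<bar>snd z\<bar> \<le> real Sb" if "z \<in> set xs \<union> set ys" for z
      proof -
        have "\<lfloor>fst z\<rfloor> * \<lfloor>fst z\<rfloor> + \<lfloor>snd z\<rfloor> * \<lfloor>snd z\<rfloor> \<le> \<Sigma>"
          unfolding \<Sigma>_def by (rule member_le_sum_list) (use that in auto)
        moreover have "0 \<le> \<lfloor>fst z\<rfloor> * \<lfloor>fst z\<rfloor>" "0 \<le> \<lfloor>snd z\<rfloor> * \<lfloor>snd z\<rfloor>" by simp_all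
        ultimately have "\<lfloor>fst z\<rfloor> * \<lfloor>fst z\<rfloor> + 1 \<le> int Sb" "\<lfloor>snd z\<rfloor> * \<lfloor>snd z\<rfloor> + 1 \<le> int Sb"
          using Sb_eq by linarith+
        then show ?thesis using abs_le_floor_sq[of "fst z"] abs_le_floor_sq[of "snd z"]
          by (metis of_int_le_iff of_int_of_nat_eq order_trans)
      qed
    qed (use k ply answers in auto)
    have sizes: "int Qb \<le> int b ^ (2 * ?k)" "X0 * Gam ^ (?k + 4) \<le> int b ^ ?c"
      unfolding X0_def Gam_def Be_def Qb_def by (rule coefficient_sizes[OF b(1,2)])+
    interpret disk_program \<Omega> W xs ys Sb Bd p
    proof unfold_locales
      have "int Qb \<le> int W" by (rule le_W[OF sizes(1)]) simp
      then show "Qb \<le> W" by simp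
      have "(2::int) ^ ?k \<le> int b ^ ?k" using b1 by (intro power_mono) auto
      moreover have "1 \<le> int b ^ ?k" using b1 by simp
      ultimately have "2 ^ ?k + 1 \<le> int b ^ Suc ?k" by (rule add_le_power[OF b1(2)])
      then show "2 ^ ?k + 1 \<le> Bd" by (intro le_Bd[of _ "Suc ?k"]) simp_all
      show "X0 * Gam ^ (?k + 4) \<le> int W" by (rule le_W[OF sizes(2)]) simp
      have "(int Sb + 1) * (2 * int Sb + 6) \<le> int b ^ (6 + 7)" using S6 S7 by (intro mult_le_power) auto
      then show "(Sb + 1) * (2 * Sb + 6) \<le> Bd" by (intro le_Bd[of _ 13]) (simp_all add: algebra_simps)
      have "(int ?k + 1) * (int ?k + 1) \<le> int b ^ (1 + 1)" using kb by (intro mult_le_power) auto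
      then have "int ?k * int ?k + int ?k + 1 \<le> int b ^ 2" by (simp add: algebra_simps power2_eq_square)
      then show "?k * ?k + ?k + 1 \<le> Bd" by (intro le_Bd[of _ 2]) simp_all
      show "int Sb = 3 + (\<Sum>z\<leftarrow>xs @ ys. \<lfloor>fst z\<rfloor> * \<lfloor>fst z\<rfloor> + \<lfloor>snd z\<rfloor> * \<lfloor>snd z\<rfloor>)" using Sb_eq unfolding \<Sigma>_def .
    qed
    have "runs count_prog ?s (?T * count_cost ?k) ?R"
      by (rule runs_count_prog) (simp_all add: base0_def init_state_def)
    then show "runs count_prog ?s (?T * (count_cost ?k + 1)) ?R" by (rule runs_time) simp
  qed
  then have "runs main_prog ?s (?T * poly time_poly ?k) ?R"
  proof (rule runs_time)
    show "?T * (count_cost ?k + 1) + 1 \<le> ?T * poly time_poly ?k" using T1 unfolding poly_time_poly by (simp add: algebra_simps)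
  qed
  then show ?thesis unfolding runs_def computes_within_def W_def[symmetric, unfolded b_def] .
qed

lemma poly_nat_mono: "x \<le> y \<Longrightarrow> poly (p :: nat poly) x \<le> poly p y"
  by (induction p) (auto intro!: add_mono mult_mono)

lemma computes_within_mono:
  assumes "computes_within \<Omega> W c xs ys T N" "W \<le> W'" "T \<le> T'"
  shows "computes_within \<Omega> W' c xs ys T' N"
  using assms exec_mono unfolding computes_within_def by (meson order_trans)

text \<open>Every query combines the given pattern with a host of ply at most \<open>p\<close>, so
  it is again a bounded instance. The kernel size counts the \<open>k\<close> vertices of the
  pattern besides those of the host, and the factor \<open>[:1, 1:]\<close> in the time absorbs
  \<open>max 1 n\<close>.\<close>

lemma turing_kernel_bounded_instances:
  fixes r :: "nat poly"
  shows "turing_kernel (bounded_instances r) (poly ([:0, 1:] + [:0, 0, 38:] * r))"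
  unfolding turing_kernel_def
proof (rule exI[of _ main_prog], rule exI[of _ "r * r * [:1, 1:] * time_poly"], rule exI[of _ word_poly], intro ballI allI impI)
  fix I M
  let ?h = "poly ([:0, 1:] + [:0, 0, 38:] * r)"
  assume I: "I \<in> bounded_instances r" and M: "coords_at_most (fst I @ snd I) M"
  obtain xs ys where xy: "I = (xs, ys)" by (cases I)
  let ?k = "length xs" and ?n = "length ys"
  obtain p where p: "p \<le> poly r ?k" "ply_at_most (disk_graph xs) ((!) xs) p" "ply_at_most (disk_graph ys) ((!) ys) p"
    and \<sigma>: "sigma0 (disk_graph xs) \<le> poly r ?k"
    using I unfolding bounded_instances_def xy by blast
  let ?\<Omega> = "instance_oracle (bounded_instances r) (?h ?k)"
  have "computes_within ?\<Omega> ((?k + ?n + M + 2) ^ poly word_poly ?k) main_prog xs ys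
     ((sigma0 (disk_graph xs))\<^sup>2 * max 1 ?n * poly time_poly ?k) (card (sub (disk_graph xs) (disk_graph ys)))"
  proof (rule main_prog_correct[where p = p])
    show "coords_at_most (xs @ ys) M" using M xy by simp
    show "has_ply xs p" "has_ply ys p" using p ply_disk_graph by blast+
    fix zs assume len: "length zs \<le> 38 * ?k\<^sup>2 * p" and zs: "has_ply zs p"
    have "(xs, zs) \<in> bounded_instances r"
      using p(1,2) \<sigma> zs unfolding bounded_instances_def ply_disk_graph[symmetric] by blast
    moreover have "inst_size (xs, zs) \<le> ?h ?k"
    proof -
      have "38 * ?k\<^sup>2 * p \<le> 38 * ?k\<^sup>2 * poly r ?k" using p(1) by (rule mult_le_mono2)
      moreover have "?h ?k = ?k + 38 * ?k\<^sup>2 * poly r ?k" by (simp add: power2_eq_square mult_ac)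
      ultimately show ?thesis using len unfolding inst_size_def fst_conv snd_conv by linarith
    qed
    ultimately show "?\<Omega> xs zs = Some (card (sub (disk_graph xs) (disk_graph zs)))"
      unfolding instance_oracle_def solution_def by simp
  qed
  then show "computes_within (instance_oracle (bounded_instances r) (?h (inst_param I)))
     ((inst_size I + M + 2) ^ poly word_poly (inst_size I)) main_prog (fst I) (snd I)
     (poly (r * r * [:1, 1:] * time_poly) (inst_size I)) (solution I)"
    unfolding xy inst_size_def inst_param_def solution_def fst_conv snd_conv
  proof (rule computes_within_mono)
    show "(?k + ?n + M + 2) ^ poly word_poly ?k \<le> (?k + ?n + M + 2) ^ poly word_poly (?k + ?n)"
      by (intro power_increasing poly_nat_mono) auto
    have "sigma0 (disk_graph xs) \<le> poly r (?k + ?n)" using \<sigma> poly_nat_mono[of ?k "?k + ?n" r] by simp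
    moreover have "max 1 ?n \<le> poly [:1, 1:] (?k + ?n)" by simp
    moreover have "poly time_poly ?k \<le> poly time_poly (?k + ?n)" by (rule poly_nat_mono) simp
    ultimately show "(sigma0 (disk_graph xs))\<^sup>2 * max 1 ?n * poly time_poly ?k \<le> poly (r * r * [:1, 1:] * time_poly) (?k + ?n)"
      unfolding poly_mult power2_eq_square by (intro mult_le_mono)
  qed
qed

theorem theorem4:
  shows
    "(\<exists>(c :: com) (C :: nat) (q :: nat poly) (w :: nat poly).
        \<forall>(P :: nat graph) (G :: nat graph) (f :: nat \<Rightarrow> plane) (g :: nat \<Rightarrow> plane)
          (k :: nat) (n :: nat) (p :: nat) (M :: nat).
          simple_graph P \<and> verts P = {..<k} \<and> embedding P f \<and> ply_at_most P f p \<and>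
          simple_graph G \<and> verts G = {..<n} \<and> embedding G g \<and> ply_at_most G g p \<and>
          coords_at_most (map f [0..<k] @ map g [0..<n]) M \<longrightarrow>
          computes_within
            (pattern_oracle (map f [0..<k]) (C * k\<^sup>2 * p))
            ((k + n + M + 2) ^ poly w k)
            c (map f [0..<k]) (map g [0..<n])
            ((sigma0 P)\<^sup>2 * max 1 n * poly q k)
            (card (sub P G)))
     \<and> (\<forall>r :: nat poly. \<exists>h :: nat poly. turing_kernel (bounded_instances r) (poly h))"
proof (rule conjI, rule exI[of _ main_prog], rule exI[of _ "38::nat"], rule exI[of _ time_poly], rule exI[of _ word_poly], intro allI impI)
  fix P G :: "nat graph" and f g :: "nat \<Rightarrow> plane" and k n p M :: nat
  assume A: "simple_graph P \<and> verts P = {..<k} \<and> embedding P f \<and> ply_at_most P f p \<and>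
    simple_graph G \<and> verts G = {..<n} \<and> embedding G g \<and> ply_at_most G g p \<and>
    coords_at_most (map f [0..<k] @ map g [0..<n]) M"
  let ?xs = "map f [0..<k]" and ?ys = "map g [0..<n]"
  from A have vert: "verts P = {..<k}" "verts G = {..<n}" and pl: "ply_at_most P f p" "ply_at_most G g p"
    and M: "coords_at_most (?xs @ ?ys) M" by - (elim conjE, assumption)+
  \<comment> \<open>Vertex set and embedding determine a simple graph, so the counts for the given
    graphs are those of the disk graphs on which the program works.\<close>
  have P: "disk_graph ?xs = P" and G: "disk_graph ?ys = G" using A disk_graph_unique by blast+
  have ply: "has_ply (map e [0..<m]) p" if "verts H = {..<m}" "ply_at_most H e p" for H :: "nat graph" and e m
  proof -
    have eq: "{i. i < length (map e [0..<m]) \<and> dist (map e [0..<m] ! i) z \<le> 1} = {v \<in> verts H. z \<in> cball (e v) 1}" for z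
      unfolding that(1) by (rule Collect_cong, rule conj_cong) simp_all
    show ?thesis using that(2) unfolding has_ply_def ply_at_most_def eq .
  qed
  have "computes_within (pattern_oracle ?xs (38 * k\<^sup>2 * p)) ((length ?xs + length ?ys + M + 2) ^ poly word_poly (length ?xs))
    main_prog ?xs ?ys ((sigma0 (disk_graph ?xs))\<^sup>2 * max 1 (length ?ys) * poly time_poly (length ?xs))
    (card (sub (disk_graph ?xs) (disk_graph ?ys)))"
  proof (rule main_prog_correct[where p = p])
    show "has_ply ?xs p" by (rule ply[OF vert(1) pl(1)])
    show "has_ply ?ys p" by (rule ply[OF vert(2) pl(2)])
    fix zs :: "plane list" assume "length zs \<le> 38 * (length ?xs)\<^sup>2 * p"
    then show "pattern_oracle ?xs (38 * k\<^sup>2 * p) ?xs zs = Some (card (sub (disk_graph ?xs) (disk_graph zs)))"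
      unfolding pattern_oracle_def length_map length_upt diff_zero by simp
  qed (fact M)
  then show "computes_within (pattern_oracle ?xs (38 * k\<^sup>2 * p)) ((k + n + M + 2) ^ poly word_poly k) main_prog ?xs ?ys
    ((sigma0 P)\<^sup>2 * max 1 n * poly time_poly k) (card (sub P G))"
    unfolding P G length_map length_upt diff_zero .
next
  show "\<forall>r :: nat poly. \<exists>h :: nat poly. turing_kernel (bounded_instances r) (poly h)"
    using turing_kernel_bounded_instances by blast
qed

end
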